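(* Let $\alpha\in(\frac13,\frac12]$, let $\mathbf X=(X,\mathbb X)$ be a geometric rough path in $\mathscr C^{0,\alpha}_g([0,T];V)$, and let $b:\Omega\times[0,T]\to W$, $\sigma:\Omega\times[0,T]\to\mathcal L(\bar V,W)$ be bounded and progressively measurable. Let $\gamma\in(\frac1\alpha,3]$. Suppose that $\sup_{t\in[0,T]}\|Y'_t\|_n<\infty$ and that $(Y',Y'')\in\bar{\mathbf D}_X^{\beta,\beta'}L_{4,n}([0,T];\mathcal L(V,W))$ for some parameters $n>4$, $0<\beta'\le\beta\le\alpha$ such that, with $\beta''=\min\{\alpha(\gamma-2),\alpha(\frac n4-1),\beta'\}$, $\alpha+\beta>\frac12$ and $\alpha+\beta+\beta''>1$. Let $Y$ be a rough Itô process with $$dY_t=b_t\,dt+\sigma_t\,dB_t+(Y',Y'')_t\,d\mathbf X_t.$$ Then the flow of (deterministic) probability measures $\mu_t=\mathrm{Law}(Y_t;\mathbf X)$ satisfies the measure-valued rough partial differential (forward) equation $$d\mu_t=\bar{\mathcal L}_t^\star\mu_t\,dt+\bar{\mathcal T}_t^\star\mu_t\,d\mathbf X_t,\qquad\mu_0=\mathrm{Law}(Y_0;\mathbf X),$$ in the analytically weak and integral sense: for all $\varphi\in\mathcal C_b^\gamma(W;\mathbb R)$ and $t\in[0,T]$, $$\langle\mu_t,\varphi\rangle=\langle\mu_0,\varphi\rangle+\int_0^t\langle\mu_s,\bar{\mathcal L}_s\varphi\rangle\,ds+\int_0^t\big(\langle\mu_s,\bar{\mathcal T}_s\varphi\rangle,\langle\mu_s,\bar{\mathcal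 T}'_s\varphi\rangle\big)\,d\mathbf X_s.$$
   Context: **Probability and norms.** Fix $T>0$ and a complete probability space $(\Omega,\mathcal G,\mathbb P)$ with a filtration $\{\mathcal F_t\}_{t\in[0,T]}$ such that $\mathcal F_0$ contains all $\mathbb P$-null sets; $\mathbb E_s=\mathbb E(\cdot\mid\mathcal F_s)$; $B$ is a standard $\{\mathcal F_t\}$-Brownian motion in $\bar V$. $V,\bar V,W$ are real finite-dimensional Banach spaces; $\mathcal L(V,\mathcal L(V,W))$ is identified with $\mathcal L(V\otimes V,W)$ via $K(v_1\otimes v_2)=(Kv_1)v_2$. $\|\xi\|_m=(\mathbb E|\xi|^m)^{1/m}$, $\|\xi|\mathcal F\|_m=(\mathbb E(|\xi|^m|\mathcal F))^{1/m}$ (essential supremum when the index is $\infty$). $\delta Y_{s,t}=Y_t-Y_s$. For a two-parameter process $A$: $\|A\|_{\kappa;m,n}=\sup_{s<t}\|\|A_{s,t}|\mathcal F_s\|_m\|_n/(t-s)^\kappa$, $\|A\|_{\kappa;n}=\sup_{s<t}\|A_{s,t}\|_n/(t-s)^\kappa$, $(\mathbb E_\bullet A)_{s,t}=\mathbb E_sA_{s,t}$. **Function spaces.** For $\kappa=N+a$, $N\ge0$ integer, $0<a\le1$, $\mathcal C_b^\kappa$ is the space of bounded functions with bounded Fréchet derivatives up to order $N$ and $D^Ng$ globally $a$-Hölder. **Rough paths.** $\mathbf X=(X,\mathbb X)\in\mathscr C^\alpha([0,T];V)$ means: $X$ is $\alpha$-Hölder, $\sup_{s<t}|\mathbb X_{s,t}|/(t-s)^{2\alpha}<\infty$,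 and $\mathbb X_{s,t}-\mathbb X_{s,u}-\mathbb X_{u,t}=\delta X_{s,u}\otimes\delta X_{u,t}$ for $s\le u\le t$. $\mathscr C_g^{0,\alpha}$ is the closure in $\mathscr C^\alpha$ (for the distance $\sup_{s<t}\frac{|\delta X_{s,t}-\delta\bar X_{s,t}|}{(t-s)^\alpha}+\sup_{s<t}\frac{|\mathbb X_{s,t}-\bar{\mathbb X}_{s,t}|}{(t-s)^{2\alpha}}$) of the canonical lifts $(X,\int\delta X\otimes dX)$ of smooth paths. **Extended stochastic controlled rough paths.** $\bar{\mathbf D}_X^{\beta,\beta'}L_{m,n}([0,T];E)$ ($E$ finite-dimensional) is the set of pairs of progressively measurable processes $(Z,Z')$ with values in $E$ and $\mathcal L(V,E)$ such that, with $R^Z_{s,t}=\delta Z_{s,t}-Z'_s\delta X_{s,t}$, the quantities $\|\delta Z\|_{\beta;m,n}$, $\|\mathbb E_\bullet R^Z\|_{\beta+\beta';n}$, $\sup_t\|Z'_t\|_n$ and $\|\mathbb E_\bullet\delta Z'\|_{\beta';n}$ are finite. **Rough (stochastic) integral.** For $(Z,Z')$ with $E=\mathcal L(V,\cdot)$, $\int_0^\cdot(Z,Z')\,d\mathbf X$ is the continuous process that is the limit in probability, uniformly in $t\in[0,T]$, of $\sum_{[u,v]\in\mathcal P,\,u<t}(Z_u\delta X_{u,v\wedge t}+Z'_u\mathbb X_{u,v\wedge t})$ as the mesh of the partition $\mathcal P$ tends to $0$; for deterministic $(Z,Z')$ it is the limit of these sums. **Rough Itô process.** A continuous adapted process $Y$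 in $W$ with $Y_t=Y_0+\int_0^tb_s\,ds+\int_0^t\sigma_s\,dB_s+\int_0^t(Y',Y'')_s\,d\mathbf X_s$. **Effective operators.** Put $a_{t,\omega}=(\sigma\sigma^\dagger)_{t,\omega}$, $(\mathcal T_{t,\omega}\varphi)(y)=D\varphi(y)Y'_t(\omega)$, $(\mathcal T'_{t,\omega}\varphi)(y)=D^2\varphi(y)(Y'_t(\omega),Y'_t(\omega))+D\varphi(y)Y''_t(\omega)$. Define $\bar b_t(y)=\mathbb E(b_{t,\omega}|Y_t=y)$ and $\bar a_t(y)=\mathbb E(a_{t,\omega}|Y_t=y)$ (jointly measurable versions), $(\bar{\mathcal L}_t\varphi)(y)=\bar b_t(y)\cdot D\varphi(y)+\frac12\bar a_t(y):D^2\varphi(y)$, $(\bar{\mathcal T}_t\varphi)(y)=\mathbb E((\mathcal T_{t,\omega}\varphi)(y)|Y_t=y)$, $(\bar{\mathcal T}'_t\varphi)(y)=\mathbb E((\mathcal T'_{t,\omega}\varphi)(y)|Y_t=y)$. $\mathrm{Law}(Y_t;\mathbf X)$ is the law of $Y_t$ under $\mathbb P$ (for the given deterministic $\mathbf X$), and $\langle\mu,g\rangle=\int g\,d\mu$. *)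

theory Defs
  imports "HOL-Probability.Probability"
begin

section \<open>Finite-dimensional Banach spaces\<close>

class fin_dim_banach = banach +
  assumes finitely_spanned: "\<exists>B. finite B \<and> (\<forall>x. \<exists>r. x = (\<Sum>b\<in>B. r b *\<^sub>R b))"

lemma finite_dimensional: "\<exists>B::'a::fin_dim_banach set. finite B \<and> span B = UNIV"
proof -
  obtain B :: "'a set" where B: "finite B" "\<And>x. \<exists>r. x = (\<Sum>b\<in>B. r b *\<^sub>R b)"
    using finitely_spanned by blast
  then have "span B = UNIV" by (auto simp: span_finite)
  then show ?thesis using B by blast
qed

lemma finitely_spannedI:
  assumes "finite B" "span B = (UNIV :: 'a::real_vector set)"
  shows "\<exists>B::'a set. finite B \<and> (\<forall>x. \<exists>r. x = (\<Sum>b\<in>B. r b *\<^sub>R b))"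
  using assms by (intro exI[of _ B]) (auto simp: span_finite[OF assms(1)] image_iff set_eq_iff)

instance euclidean_space \<subseteq> fin_dim_banach
  by standard (rule finitely_spannedI[OF finite_Basis span_Basis])

lemma finite_span_imp_countable_basis:
  fixes B :: "'a::real_normed_vector set"
  assumes fin: "finite B" and sp: "span B = UNIV"
  shows "\<exists>\<B>::'a set set. countable \<B> \<and> open = generate_topology \<B>"
proof -
  define D where "D = (\<lambda>q. \<Sum>b\<in>B. of_rat (q b) *\<^sub>R b) ` (B \<rightarrow>\<^sub>E (UNIV::rat set))"
  have cD: "countable D"
    unfolding D_def using fin by (intro countable_image countable_PiE) auto
  have dense: "\<exists>d\<in>D. dist x d < e" if e: "e > 0" for x e
  proof -
    have "x \<in> span B" using sp by simp
    then obtain r where r: "x = (\<Sum>b\<in>B. r b *\<^sub>R b)"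
      unfolding span_finite[OF fin] by auto
    define S where "S = (\<Sum>b\<in>B. norm b) + 1"
    have S: "S > 0" unfolding S_def by (smt (verit) norm_ge_zero sum_nonneg)
    have "\<exists>q. \<bar>r b - of_rat q\<bar> < e / S" for b
    proof -
      obtain y where y: "y \<in> \<rat>" "r b < y" "y < r b + e / S"
        using Rats_dense_in_real[of "r b" "r b + e / S"] S e by auto
      then obtain q where "y = of_rat q" by (auto elim: Rats_cases)
      with y show ?thesis by (intro exI[of _ q]) auto
    qed
    then obtain q where q: "\<And>b. \<bar>r b - of_rat (q b)\<bar> < e / S" by metis
    define d where "d = (\<Sum>b\<in>B. of_rat (restrict q B b) *\<^sub>R b)"
    have "d \<in> D" unfolding D_def d_def by (intro image_eqI[of _ _ "restrict q B"]) auto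
    moreover have "dist x d < e"
    proof -
      have "x - d = (\<Sum>b\<in>B. (r b - of_rat (q b)) *\<^sub>R b)"
        by (simp add: r d_def sum_subtractf scaleR_diff_left)
      then have "norm (x - d) \<le> (\<Sum>b\<in>B. \<bar>r b - of_rat (q b)\<bar> * norm b)"
        by (metis (mono_tags, lifting) norm_scaleR norm_sum sum.cong)
      also have "\<dots> \<le> (\<Sum>b\<in>B. e / S * norm b)"
        using q by (intro sum_mono mult_right_mono) (auto intro: less_imp_le)
      also have "\<dots> = e / S * (S - 1)" by (simp add: S_def sum_distrib_left)
      also have "\<dots> < e / S * S" using S e by (intro mult_strict_left_mono) auto
      finally show ?thesis using S by (simp add: dist_norm)
    qed
    ultimately show ?thesis by blast
  qed
  define \<B> where "\<B> = (\<lambda>(d, n). ball d (inverse (real (Suc n)))) ` (D \<times> UNIV)"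
  have "countable \<B>" unfolding \<B>_def using cD by auto
  moreover have "topological_basis \<B>"
  proof (rule topological_basisI)
    show "open V" if "V \<in> \<B>" for V using that by (auto simp: \<B>_def)
  next
    fix U :: "'a set" and x assume U: "open U" "x \<in> U"
    then obtain e where e: "e > 0" "ball x e \<subseteq> U" by (meson openE)
    obtain n where n: "inverse (real (Suc n)) < e / 2"
      using reals_Archimedean[of "e/2"] e by auto
    obtain d where d: "d \<in> D" "dist x d < inverse (real (Suc n))"
      using dense[of "inverse (real (Suc n))" x] by auto
    have "ball d (inverse (real (Suc n))) \<subseteq> ball x e"
    proof
      fix z assume "z \<in> ball d (inverse (real (Suc n)))"
      then have "dist d z < inverse (real (Suc n))" by simp
      then show "z \<in> ball x e" using d n dist_triangle[of x z d] by simp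
    qed
    then show "\<exists>V\<in>\<B>. x \<in> V \<and> V \<subseteq> U"
      using d e by (intro bexI[of _ "ball d (inverse (real (Suc n)))"])
        (auto simp: \<B>_def dist_commute)
  qed
  ultimately show ?thesis using topological_basis_imp_subbasis by blast
qed

instance fin_dim_banach \<subseteq> second_countable_topology
proof
  show "\<exists>\<B>::'a set set. countable \<B> \<and> open = generate_topology \<B>"
    using finite_dimensional finite_span_imp_countable_basis by blast
qed

lemma separated_by_functionals_imp_finite_span:
  fixes S :: "'a::real_vector set" and G :: "('a \<Rightarrow> real) set"
  assumes "finite G" "\<And>g. g \<in> G \<Longrightarrow> linear g" "subspace S"
    "\<And>x. x \<in> S \<Longrightarrow> (\<forall>g\<in>G. g x = 0) \<Longrightarrow> x = 0"
  shows "\<exists>A. finite A \<and> S \<subseteq> span A"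
  using assms
proof (induction G arbitrary: S rule: finite_induct)
  case empty
  then have "S \<subseteq> {0}" by auto
  then show ?case by (intro exI[of _ "{}"]) auto
next
  case (insert g G)
  have lg: "linear g" using insert.prems by auto
  define S' where "S' = {x \<in> S. g x = 0}"
  have "subspace S'"
    using insert.prems(2) lg unfolding S'_def subspace_def
    by (auto simp: linear_add linear_scale linear_0)
  moreover have "x = 0" if "x \<in> S'" "\<forall>h\<in>G. h x = 0" for x
    using that insert.prems(3)[of x] by (auto simp: S'_def)
  ultimately obtain A where A: "finite A" "S' \<subseteq> span A"
    using insert.IH[of S'] insert.prems(1) by auto
  show ?case
  proof (cases "S' = S")
    case True
    then show ?thesis using A by auto
  next
    case False
    then obtain x0 where x0: "x0 \<in> S" "g x0 \<noteq> 0" by (auto simp: S'_def)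
    have "x \<in> span (insert x0 A)" if x: "x \<in> S" for x
    proof -
      let ?c = "g x / g x0"
      have "x - ?c *\<^sub>R x0 \<in> S'"
        using x x0 insert.prems(2) lg unfolding S'_def
        by (auto simp: linear_diff linear_scale subspace_diff subspace_scale)
      then show ?thesis using A(2) by (auto simp: span_breakdown_eq)
    qed
    then show ?thesis using A(1) by (intro exI[of _ "insert x0 A"]) auto
  qed
qed

instance blinfun :: (fin_dim_banach, fin_dim_banach) fin_dim_banach
proof
  obtain B0 :: "'a set" where B0: "finite B0" "span B0 = UNIV" using finite_dimensional by blast
  obtain C0 :: "'b set" where C0: "finite C0" "span C0 = UNIV" using finite_dimensional by blast
  obtain C where C: "C \<subseteq> C0" "independent C" "span C = UNIV"
    using maximal_independent_subset[of C0] C0 by (metis span_span span_mono top.extremum_uniqueI)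
  define G where "G = (\<lambda>(b, c) (f::'a \<Rightarrow>\<^sub>L 'b). representation C (blinfun_apply f b) c) ` (B0 \<times> C)"
  have fC: "finite C" using C C0 finite_subset by blast
  have lin: "linear g" if "g \<in> G" for g
    using that C unfolding G_def
    by (auto intro!: linearI simp: blinfun.add_left blinfun.scaleR_left
        representation_add representation_scale)
  have sep: "f = 0" if f: "\<forall>g\<in>G. g f = 0" for f :: "'a \<Rightarrow>\<^sub>L 'b"
  proof (rule blinfun_eqI)
    fix v
    have z: "blinfun_apply f b = 0" if b: "b \<in> B0" for b
    proof -
      have "blinfun_apply f b = (\<Sum>c\<in>C. representation C (blinfun_apply f b) c *\<^sub>R c)"
        using sum_representation_eq[OF C(2), of "blinfun_apply f b" C] C fC by simp
      also have "\<dots> = 0" using f b by (intro sum.neutral) (auto simp: G_def)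
      finally show ?thesis .
    qed
    have "v \<in> span B0" using B0 by simp
    then show "blinfun_apply f v = blinfun_apply 0 v"
      by (induction rule: span_induct_alt) (auto simp: blinfun.add_right blinfun.scaleR_right z)
  qed
  obtain A where "finite A" "(UNIV :: ('a \<Rightarrow>\<^sub>L 'b) set) \<subseteq> span A"
    using separated_by_functionals_imp_finite_span[of G UNIV] lin sep fC B0(1)
    by (auto simp: G_def)
  then show "\<exists>A::('a \<Rightarrow>\<^sub>L 'b) set. finite A \<and> (\<forall>x. \<exists>r. x = (\<Sum>a\<in>A. r a *\<^sub>R a))"
    by (intro finitely_spannedI[of A]) auto
qed

lemma independent_norm_bound:
  fixes A :: "'a::real_normed_vector set"
  assumes "finite A" "independent A"
  shows "\<exists>c. \<forall>r. (\<Sum>a\<in>A. \<bar>r a\<bar>) \<le> c * norm (\<Sum>a\<in>A. r a *\<^sub>R a)"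
  using assms
proof (induction A rule: finite_induct)
  case empty
  show ?case by auto
next
  case (insert x A)
  have xA: "x \<notin> span A" and iA: "independent A"
    using insert.prems insert.hyps by (auto simp: independent_insert)
  obtain c0 where c0': "\<forall>r. (\<Sum>a\<in>A. \<bar>r a\<bar>) \<le> c0 * norm (\<Sum>a\<in>A. r a *\<^sub>R a)"
    using insert.IH iA by blast
  define c where "c = max c0 0"
  have c: "(\<Sum>a\<in>A. \<bar>r a\<bar>) \<le> c * norm (\<Sum>a\<in>A. r a *\<^sub>R a)" "c \<ge> 0" for r
    using c0'[rule_format, of r] mult_right_mono[of c0 c "norm (\<Sum>a\<in>A. r a *\<^sub>R a)"]
    by (auto simp: c_def)
  have "closed (span A)"
  proof (rule closed_sequential_limits[THEN iffD2], intro allI impI, elim conjE)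
    fix s l assume s: "\<forall>n. s n \<in> span A" and sl: "s \<longlonglongrightarrow> l"
    have "\<exists>r. s n = (\<Sum>a\<in>A. r a *\<^sub>R a)" for n
      using s[rule_format, of n] unfolding span_finite[OF insert.hyps(1)] by auto
    then obtain r where r: "\<And>n. s n = (\<Sum>a\<in>A. r n a *\<^sub>R a)" by metis
    have "Cauchy (\<lambda>n. r n a)" if a: "a \<in> A" for a
    proof (rule metric_CauchyI)
      fix e :: real assume e: "e > 0"
      have "Cauchy s" using sl convergent_Cauchy convergent_def by blast
      then obtain N where N: "\<And>m n. m \<ge> N \<Longrightarrow> n \<ge> N \<Longrightarrow> dist (s m) (s n) < e / (c + 1)"
        using metric_CauchyD[of s "e / (c+1)"] e c(2) by (metis add_nonneg_pos divide_pos_pos zero_less_one)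
      have "dist (r m a) (r n a) < e" if "m \<ge> N" "n \<ge> N" for m n
      proof -
        have "\<bar>r m a - r n a\<bar> \<le> (\<Sum>a\<in>A. \<bar>r m a - r n a\<bar>)"
          using a insert.hyps(1) by (intro member_le_sum) auto
        also have "\<dots> \<le> c * norm (s m - s n)"
          using c(1)[of "\<lambda>a. r m a - r n a"]
          by (simp add: r sum_subtractf scaleR_diff_left)
        also have "\<dots> \<le> c * (e / (c + 1))"
          using N[OF that] c(2) by (intro mult_left_mono) (auto simp: dist_norm)
        also have "\<dots> < e" using e c(2) by (simp add: field_simps)
        finally show ?thesis by (simp add: dist_real_def)
      qed
      then show "\<exists>M. \<forall>m\<ge>M. \<forall>n\<ge>M. dist (r m a) (r n a) < e" by blast
    qed
    then have "\<forall>a\<in>A. \<exists>L. (\<lambda>n. r n a) \<longlonglongrightarrow> L"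
      using real_Cauchy_convergent convergent_def by blast
    then obtain R where R: "\<And>a. a \<in> A \<Longrightarrow> (\<lambda>n. r n a) \<longlonglongrightarrow> R a" by metis
    have "s \<longlonglongrightarrow> (\<Sum>a\<in>A. R a *\<^sub>R a)"
      using R unfolding r by (intro tendsto_sum tendsto_scaleR tendsto_const)
    then have "l = (\<Sum>a\<in>A. R a *\<^sub>R a)" using sl LIMSEQ_unique by blast
    then show "l \<in> span A" by (simp add: span_base span_scale span_sum)
  qed
  moreover have "span A \<noteq> {}" using span_zero by blast
  ultimately have d: "infdist x (span A) > 0"
    using xA infdist_pos_not_in_closed by blast
  define d where "d = infdist x (span A)"
  have d0: "d > 0" using d d_def by simp
  have key: "\<bar>t\<bar> * d \<le> norm (t *\<^sub>R x + y)" if y: "y \<in> span A" for t y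
  proof (cases "t = 0")
    case False
    have "- (1/t) *\<^sub>R y \<in> span A" using y by (intro span_scale)
    then have "d \<le> dist x (- (1/t) *\<^sub>R y)" unfolding d_def by (rule infdist_le)
    then have "\<bar>t\<bar> * d \<le> \<bar>t\<bar> * norm (x + (1/t) *\<^sub>R y)"
      by (intro mult_left_mono) (auto simp: dist_norm)
    also have "\<dots> = norm (t *\<^sub>R (x + (1/t) *\<^sub>R y))" by simp
    also have "t *\<^sub>R (x + (1/t) *\<^sub>R y) = t *\<^sub>R x + y" using False by (simp add: scaleR_add_right)
    finally show ?thesis .
  qed auto
  show ?case
  proof (intro exI allI)
    fix r
    let ?y = "\<Sum>a\<in>A. r a *\<^sub>R a" and ?z = "\<Sum>a\<in>insert x A. r a *\<^sub>R a"
    have z: "?z = r x *\<^sub>R x + ?y" using insert.hyps by simp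
    have y: "?y \<in> span A" by (simp add: span_base span_scale span_sum)
    have rx: "\<bar>r x\<bar> \<le> norm ?z / d"
      using key[OF y, of "r x"] d0 by (simp add: z field_simps)
    have "norm ?y \<le> norm ?z + \<bar>r x\<bar> * norm x"
      using norm_triangle_ineq4[of ?z "r x *\<^sub>R x"] by (simp add: z)
    also have "\<dots> \<le> norm ?z + norm ?z / d * norm x"
      using mult_right_mono[OF rx norm_ge_zero[of x]] by simp
    finally have "c * norm ?y \<le> c * (norm ?z + norm ?z / d * norm x)"
      using c(2) by (rule mult_left_mono)
    then have "(\<Sum>a\<in>insert x A. \<bar>r a\<bar>) \<le> norm ?z / d + c * (norm ?z + norm ?z / d * norm x)"
      using c(1)[of r] rx insert.hyps by simp
    also have "\<dots> = (1 / d + c * (1 + norm x / d)) * norm ?z" by (simp add: field_simps)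
    finally show "(\<Sum>a\<in>insert x A. \<bar>r a\<bar>) \<le> (1 / d + c * (1 + norm x / d)) * norm ?z" .
  qed
qed

lemma bounded_linear_fin_dim:
  fixes f :: "'a::fin_dim_banach \<Rightarrow> 'b::real_normed_vector"
  assumes f: "linear f"
  shows "bounded_linear f"
proof -
  obtain B0 :: "'a set" where B0: "finite B0" "span B0 = UNIV" using finite_dimensional by blast
  obtain B where B: "B \<subseteq> B0" "independent B" "span B = UNIV"
    using maximal_independent_subset[of B0] B0 by (metis span_span span_mono top.extremum_uniqueI)
  have fB: "finite B" using B B0 finite_subset by blast
  obtain c where c: "\<And>r. (\<Sum>a\<in>B. \<bar>r a\<bar>) \<le> c * norm (\<Sum>a\<in>B. r a *\<^sub>R a)"
    using independent_norm_bound[OF fB B(2)] by blast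
  define S where "S = (\<Sum>a\<in>B. norm (f a))"
  show ?thesis
  proof (rule bounded_linear_intro)
    fix x
    let ?r = "representation B x"
    have x: "x = (\<Sum>b\<in>B. ?r b *\<^sub>R b)"
      using sum_representation_eq[OF B(2), of x B] B fB by simp
    have "norm (f x) = norm (\<Sum>b\<in>B. ?r b *\<^sub>R f b)"
      by (subst x) (simp add: linear_sum[OF f] linear_scale[OF f])
    also have "\<dots> \<le> (\<Sum>b\<in>B. \<bar>?r b\<bar> * norm (f b))"
      by (rule order_trans[OF norm_sum]) simp
    also have "\<dots> \<le> (\<Sum>b\<in>B. \<bar>?r b\<bar> * S)"
      unfolding S_def using fB by (intro sum_mono mult_left_mono member_le_sum) auto
    also have "\<dots> = (\<Sum>b\<in>B. \<bar>?r b\<bar>) * S" by (simp add: sum_distrib_right)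
    also have "\<dots> \<le> c * norm x * S"
      using c[of ?r] x by (intro mult_right_mono) (auto simp: S_def sum_nonneg)
    finally show "norm (f x) \<le> norm x * (c * S)" by (simp add: mult.commute mult.left_commute)
  qed (use f in \<open>auto simp: linear_add linear_scale\<close>)
qed


section \<open>Tensor products\<close>

text \<open>For a finite-dimensional space \<open>E\<close>, \<open>E \<otimes> E\<close> is realised as \<open>L(E\<^sup>*, E)\<close>,
  with \<open>u \<otimes> v\<close> the operator \<open>l \<mapsto> l(u) v\<close>.\<close>

type_synonym 'a tensor2 = "('a \<Rightarrow>\<^sub>L real) \<Rightarrow>\<^sub>L 'a"

definition tensor :: "'a::fin_dim_banach \<Rightarrow> 'a \<Rightarrow> 'a tensor2" (infixr "\<otimes>" 70)
  where "u \<otimes> v = Blinfun (\<lambda>l. blinfun_apply l u *\<^sub>R v)"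

text \<open>The identification of \<open>L(E, L(E, F))\<close> with \<open>L(E \<otimes> E, F)\<close>: the linear map on
  \<open>E \<otimes> E\<close> determined by \<open>K (u \<otimes> v) = (K u) v\<close>, see \<open>tensor_lift_unique\<close>
  and \<open>tensor_lift_tensor\<close>.\<close>

definition tensor_lift ::
    "('a::fin_dim_banach \<Rightarrow>\<^sub>L ('a \<Rightarrow>\<^sub>L 'e::real_normed_vector)) \<Rightarrow> 'a tensor2 \<Rightarrow> 'e"
  where "tensor_lift K = (THE f. linear f \<and> (\<forall>u v. f (u \<otimes> v) = blinfun_apply (blinfun_apply K u) v))"

lemma tensor_apply: "blinfun_apply (u \<otimes> v) l = blinfun_apply l u *\<^sub>R v"
proof -
  have "bounded_linear (\<lambda>l. blinfun_apply l u *\<^sub>R v)"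
    by (intro bounded_linear_intros)
  then show ?thesis unfolding tensor_def by (simp add: bounded_linear_Blinfun_apply)
qed

lemma tensor_lift_unique:
  fixes K :: "'a::fin_dim_banach \<Rightarrow>\<^sub>L ('a \<Rightarrow>\<^sub>L 'e::real_normed_vector)"
  shows "\<exists>!f. linear f \<and> (\<forall>u v. f (u \<otimes> v) = blinfun_apply (blinfun_apply K u) v)"
proof -
  obtain B0 :: "'a set" where B0: "finite B0" "span B0 = UNIV" using finite_dimensional by blast
  obtain B where B: "B \<subseteq> B0" "independent B" "span B = UNIV"
    using maximal_independent_subset[of B0] B0 by (metis span_span span_mono top.extremum_uniqueI)
  have fB: "finite B" using B B0 finite_subset by blast
  define co where "co b = Blinfun (\<lambda>x. representation B x b)" for b
  have "bounded_linear (\<lambda>x. representation B x b)" for b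
    using B by (intro bounded_linear_fin_dim linearI) (auto simp: representation_add representation_scale)
  then have co: "blinfun_apply (co b) x = representation B x b" for b x
    unfolding co_def by (simp add: bounded_linear_Blinfun_apply)
  have x: "x = (\<Sum>b\<in>B. representation B x b *\<^sub>R b)" for x
    using sum_representation_eq[OF B(2), of x B] B fB by simp
  have decomp: "A = (\<Sum>b\<in>B. b \<otimes> blinfun_apply A (co b))" for A :: "'a tensor2"
  proof (rule blinfun_eqI)
    fix l
    have "l = (\<Sum>b\<in>B. blinfun_apply l b *\<^sub>R co b)"
    proof (rule blinfun_eqI)
      fix y
      have "blinfun_apply l y = (\<Sum>b\<in>B. representation B y b *\<^sub>R blinfun_apply l b)"
        by (subst x[of y]) (simp add: blinfun.sum_right blinfun.scaleR_right)
      then show "blinfun_apply l y = blinfun_apply (\<Sum>b\<in>B. blinfun_apply l b *\<^sub>R co b) y"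
        by (simp add: blinfun.sum_left blinfun.scaleR_left co mult.commute)
    qed
    then have "blinfun_apply A l = blinfun_apply A (\<Sum>b\<in>B. blinfun_apply l b *\<^sub>R co b)" by simp
    then show "blinfun_apply A l = blinfun_apply (\<Sum>b\<in>B. b \<otimes> blinfun_apply A (co b)) l"
      by (simp add: blinfun.sum_right blinfun.sum_left blinfun.scaleR_right tensor_apply)
  qed
  define f where "f A = (\<Sum>b\<in>B. blinfun_apply (blinfun_apply K b) (blinfun_apply A (co b)))"
    for A :: "'a tensor2"
  have "linear f"
    by (rule linearI) (auto simp: f_def blinfun.add_left blinfun.add_right blinfun.scaleR_left
        blinfun.scaleR_right sum.distrib scaleR_sum_right)
  moreover have "f (u \<otimes> v) = blinfun_apply (blinfun_apply K u) v" for u v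
  proof -
    have "blinfun_apply (blinfun_apply K u) v
        = (\<Sum>b\<in>B. representation B u b *\<^sub>R blinfun_apply (blinfun_apply K b) v)"
      by (subst x[of u]) (simp add: blinfun.sum_right blinfun.sum_left blinfun.scaleR_right blinfun.scaleR_left)
    then show ?thesis by (simp add: f_def tensor_apply co blinfun.scaleR_right)
  qed
  moreover have "g = h" if "linear g" "\<forall>u v. g (u \<otimes> v) = blinfun_apply (blinfun_apply K u) v"
    "linear h" "\<forall>u v. h (u \<otimes> v) = blinfun_apply (blinfun_apply K u) v" for g h
  proof
    fix A
    show "g A = h A"
      using that by (subst (1 2) decomp) (simp add: linear_sum)
  qed
  ultimately show ?thesis by blast
qed

lemma linear_tensor_lift: "linear (tensor_lift K)"
  and tensor_lift_tensor: "tensor_lift K (u \<otimes> v) = blinfun_apply (blinfun_apply K u) v"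
  using theI'[OF tensor_lift_unique[of K]] unfolding tensor_lift_def by blast+


section \<open>Functions of class \<open>C\<^sub>b\<^sup>\<gamma>\<close>\<close>

definition Dfun :: "('a::real_normed_vector \<Rightarrow> 'b::real_normed_vector) \<Rightarrow> 'a \<Rightarrow> ('a \<Rightarrow>\<^sub>L 'b)"
  where "Dfun f y = Blinfun (frechet_derivative f (at y))"

lemma has_derivative_Dfun:
  assumes "f differentiable (at y)"
  shows "(f has_derivative blinfun_apply (Dfun f y)) (at y)"
proof -
  have "(f has_derivative frechet_derivative f (at y)) (at y)"
    using assms frechet_derivative_works by blast
  then show ?thesis
    by (simp add: Dfun_def bounded_linear_Blinfun_apply[OF has_derivative_bounded_linear])
qed

text \<open>The space \<open>C\<^sub>b\<^sup>\<gamma>\<close> for \<open>2 < \<gamma> \<le> 3\<close>, i.e. \<open>\<gamma> = N + a\<close> with \<open>N = 2\<close> and \<open>a = \<gamma> - 2 \<in> (0,1]\<close>;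
  no other values of \<open>\<gamma>\<close> are used.\<close>

definition Cb :: "real \<Rightarrow> ('a::real_normed_vector \<Rightarrow> real) set"
  where "Cb \<gamma> = {f.
     bounded (range f) \<and>
     (\<forall>y. f differentiable (at y)) \<and> bounded (range (Dfun f)) \<and>
     (\<forall>y. Dfun f differentiable (at y)) \<and> bounded (range (Dfun (Dfun f))) \<and>
     (\<exists>C. \<forall>x y. norm (Dfun (Dfun f) x - Dfun (Dfun f) y) \<le> C * norm (x - y) powr (\<gamma> - 2))}"


section \<open>Rough paths on \<open>[0,T]\<close>\<close>

definition time_pairs :: "real \<Rightarrow> (real \<times> real) set"
  where "time_pairs T = {(s, t). 0 \<le> s \<and> s < t \<and> t \<le> T}"

definition rough_path ::
    "real \<Rightarrow> real \<Rightarrow> (real \<Rightarrow> 'v::fin_dim_banach) \<Rightarrow> (real \<Rightarrow> real \<Rightarrow> 'v tensor2) \<Rightarrow> bool"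
  where "rough_path T \<alpha> X XX \<longleftrightarrow>
     (\<exists>C. \<forall>(s, t)\<in>time_pairs T. norm (X t - X s) \<le> C * (t - s) powr \<alpha>) \<and>
     (\<exists>C. \<forall>(s, t)\<in>time_pairs T. norm (XX s t) \<le> C * (t - s) powr (2 * \<alpha>)) \<and>
     (\<forall>s u t. 0 \<le> s \<and> s \<le> u \<and> u \<le> t \<and> t \<le> T \<longrightarrow>
        XX s t - XX s u - XX u t = (X u - X s) \<otimes> (X t - X u))"

definition rough_dist ::
    "real \<Rightarrow> real \<Rightarrow> (real \<Rightarrow> 'v::fin_dim_banach) \<Rightarrow> (real \<Rightarrow> real \<Rightarrow> 'v tensor2) \<Rightarrow>
     (real \<Rightarrow> 'v) \<Rightarrow> (real \<Rightarrow> real \<Rightarrow> 'v tensor2) \<Rightarrow> ennreal"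
  where "rough_dist T \<alpha> X XX Y YY =
     (SUP (s, t)\<in>time_pairs T. ennreal (norm ((X t - X s) - (Y t - Y s)) / (t - s) powr \<alpha>)) +
     (SUP (s, t)\<in>time_pairs T. ennreal (norm (XX s t - YY s t) / (t - s) powr (2 * \<alpha>)))"

definition smooth_path :: "real \<Rightarrow> (real \<Rightarrow> 'v::real_normed_vector) \<Rightarrow> bool"
  where "smooth_path T X \<longleftrightarrow> (\<exists>d. d 0 = X \<and>
     (\<forall>k. \<forall>t\<in>{0..T}. (d k has_vector_derivative d (Suc k) t) (at t within {0..T})))"

definition canonical_lift :: "real \<Rightarrow> (real \<Rightarrow> 'v::fin_dim_banach) \<Rightarrow> real \<Rightarrow> real \<Rightarrow> 'v tensor2"
  where "canonical_lift T X s t =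
     integral {s..t} (\<lambda>r. (X r - X s) \<otimes> vector_derivative X (at r within {0..T}))"

definition geometric_rough_path ::
    "real \<Rightarrow> real \<Rightarrow> (real \<Rightarrow> 'v::fin_dim_banach) \<Rightarrow> (real \<Rightarrow> real \<Rightarrow> 'v tensor2) \<Rightarrow> bool"
  where "geometric_rough_path T \<alpha> X XX \<longleftrightarrow> rough_path T \<alpha> X XX \<and>
     (\<forall>\<epsilon>>0. \<exists>Z. smooth_path T Z \<and> rough_dist T \<alpha> X XX Z (canonical_lift T Z) < \<epsilon>)"


section \<open>Filtered probability spaces and processes\<close>

definition filtered_prob_space :: "'o measure \<Rightarrow> (real \<Rightarrow> 'o measure) \<Rightarrow> real \<Rightarrow> bool"
  where "filtered_prob_space M F T \<longleftrightarrow>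
     prob_space M \<and> complete_measure M \<and>
     (\<forall>t\<in>{0..T}. subalgebra M (F t)) \<and>
     (\<forall>s\<in>{0..T}. \<forall>t\<in>{0..T}. s \<le> t \<longrightarrow> sets (F s) \<subseteq> sets (F t)) \<and>
     null_sets M \<subseteq> sets (F 0)"

definition adapted :: "(real \<Rightarrow> 'o measure) \<Rightarrow> real \<Rightarrow> (real \<Rightarrow> 'o \<Rightarrow> 'e::topological_space) \<Rightarrow> bool"
  where "adapted F T Z \<longleftrightarrow> (\<forall>t\<in>{0..T}. Z t \<in> borel_measurable (F t))"

definition progressive :: "(real \<Rightarrow> 'o measure) \<Rightarrow> real \<Rightarrow> (real \<Rightarrow> 'o \<Rightarrow> 'e::topological_space) \<Rightarrow> bool"
  where "progressive F T Z \<longleftrightarrow>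
     (\<forall>t\<in>{0..T}. (\<lambda>(s, \<omega>). Z s \<omega>) \<in> borel_measurable (restrict_space borel {0..t} \<Otimes>\<^sub>M F t))"

definition bounded_process :: "'o measure \<Rightarrow> real \<Rightarrow> (real \<Rightarrow> 'o \<Rightarrow> 'e::real_normed_vector) \<Rightarrow> bool"
  where "bounded_process M T Z \<longleftrightarrow> (\<exists>C. \<forall>t\<in>{0..T}. \<forall>\<omega>\<in>space M. norm (Z t \<omega>) \<le> C)"

definition continuous_process :: "'o measure \<Rightarrow> real \<Rightarrow> (real \<Rightarrow> 'o \<Rightarrow> 'e::topological_space) \<Rightarrow> bool"
  where "continuous_process M T Z \<longleftrightarrow> (AE \<omega> in M. continuous_on {0..T} (\<lambda>t. Z t \<omega>))"

definition standard_brownian_motion ::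
    "'o measure \<Rightarrow> (real \<Rightarrow> 'o measure) \<Rightarrow> real \<Rightarrow> (real \<Rightarrow> 'o \<Rightarrow> 'u::euclidean_space) \<Rightarrow> bool"
  where "standard_brownian_motion M F T B \<longleftrightarrow>
     adapted F T B \<and> continuous_process M T B \<and> (AE \<omega> in M. B 0 \<omega> = 0) \<and>
     (\<forall>(s, t)\<in>time_pairs T.
        prob_space.indep_set M (sets (F s))
          (sets (vimage_algebra (space M) (\<lambda>\<omega>. B t \<omega> - B s \<omega>) borel)) \<and>
        prob_space.indep_vars M (\<lambda>_. borel) (\<lambda>e \<omega>. (B t \<omega> - B s \<omega>) \<bullet> e) Basis \<and>
        (\<forall>e\<in>Basis. distributed M lborel (\<lambda>\<omega>. (B t \<omega> - B s \<omega>) \<bullet> e)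
           (\<lambda>x. ennreal (normal_density 0 (sqrt (t - s)) x))))"

text \<open>Convergence in probability, uniformly in \<open>t \<in> [0,T]\<close>, along a filter; exceptional sets are
  covered by measurable ones so that no measurability of the supremum is presupposed.\<close>

definition ucp_tendsto ::
    "'o measure \<Rightarrow> real \<Rightarrow> ('p \<Rightarrow> real \<Rightarrow> 'o \<Rightarrow> 'e::real_normed_vector) \<Rightarrow>
     (real \<Rightarrow> 'o \<Rightarrow> 'e) \<Rightarrow> 'p filter \<Rightarrow> bool"
  where "ucp_tendsto M T S I \<F> \<longleftrightarrow>
     (\<forall>\<epsilon>>0. \<forall>\<eta>>0. \<forall>\<^sub>F p in \<F>. \<exists>A\<in>sets M. measure M A < \<eta> \<and>
        (\<forall>\<omega>\<in>space M - A. \<forall>t\<in>{0..T}. norm (S p t \<omega> - I t \<omega>) \<le> \<epsilon>))"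


section \<open>Mixed moment norms and conditional expectations\<close>

definition ennreal_powr :: "ennreal \<Rightarrow> real \<Rightarrow> ennreal"
  where "ennreal_powr x p = (if x = \<infinity> then \<infinity> else ennreal (enn2real x powr p))"

definition Lnorm :: "'o measure \<Rightarrow> ereal \<Rightarrow> ('o \<Rightarrow> ennreal) \<Rightarrow> ennreal"
  where "Lnorm M p f =
     (if p = \<infinity> then esssup M f
      else ennreal_powr (\<integral>\<^sup>+\<omega>. ennreal_powr (f \<omega>) (real_of_ereal p) \<partial>M) (1 / real_of_ereal p))"

definition cond_Lnorm :: "'o measure \<Rightarrow> 'o measure \<Rightarrow> real \<Rightarrow> ('o \<Rightarrow> ennreal) \<Rightarrow> 'o \<Rightarrow> ennreal"
  where "cond_Lnorm M G m f \<omega> =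
     ennreal_powr (nn_cond_exp M G (\<lambda>\<omega>. ennreal_powr (f \<omega>) m) \<omega>) (1 / m)"

definition holder_Lnorm ::
    "'o measure \<Rightarrow> real \<Rightarrow> real \<Rightarrow> ereal \<Rightarrow> (real \<Rightarrow> real \<Rightarrow> 'o \<Rightarrow> 'e::real_normed_vector) \<Rightarrow> ennreal"
  where "holder_Lnorm M T \<kappa> n A = (SUP (s, t)\<in>time_pairs T.
     Lnorm M n (\<lambda>\<omega>. ennreal (norm (A s t \<omega>))) / ennreal ((t - s) powr \<kappa>))"

definition holder_cond_Lnorm ::
    "'o measure \<Rightarrow> (real \<Rightarrow> 'o measure) \<Rightarrow> real \<Rightarrow> real \<Rightarrow> real \<Rightarrow> ereal \<Rightarrow>
     (real \<Rightarrow> real \<Rightarrow> 'o \<Rightarrow> 'e::real_normed_vector) \<Rightarrow> ennreal"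
  where "holder_cond_Lnorm M F T \<kappa> m n A = (SUP (s, t)\<in>time_pairs T.
     Lnorm M n (cond_Lnorm M (F s) m (\<lambda>\<omega>. ennreal (norm (A s t \<omega>)))) / ennreal ((t - s) powr \<kappa>))"

text \<open>The library's \<open>real_cond_exp\<close> is real-valued only.\<close>

definition has_cond_exp ::
    "'o measure \<Rightarrow> 'o measure \<Rightarrow> ('o \<Rightarrow> 'e::{banach, second_countable_topology}) \<Rightarrow> ('o \<Rightarrow> 'e) \<Rightarrow> bool"
  where "has_cond_exp M G f g \<longleftrightarrow>
     integrable M f \<and> integrable M g \<and> g \<in> borel_measurable G \<and>
     (\<forall>A\<in>sets G. (LINT \<omega>:A|M. f \<omega>) = (LINT \<omega>:A|M. g \<omega>))"

definition vcond_exp ::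
    "'o measure \<Rightarrow> 'o measure \<Rightarrow> ('o \<Rightarrow> 'e::{banach, second_countable_topology}) \<Rightarrow> 'o \<Rightarrow> 'e"
  where "vcond_exp M G f = (SOME g. has_cond_exp M G f g)"

text \<open>\<open>h\<close> is a version of \<open>y \<mapsto> E(\<xi> | \<eta> = y)\<close>.\<close>

definition cond_exp_given ::
    "'o measure \<Rightarrow> ('o \<Rightarrow> 'e::{banach, second_countable_topology}) \<Rightarrow>
     ('o \<Rightarrow> 'w::topological_space) \<Rightarrow> ('w \<Rightarrow> 'e) \<Rightarrow> bool"
  where "cond_exp_given M \<xi> \<eta> h \<longleftrightarrow> h \<in> borel_measurable borel \<and>
     has_cond_exp M (vimage_algebra (space M) \<eta> borel) \<xi> (\<lambda>\<omega>. h (\<eta> \<omega>))"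

definition ext_stoch_controlled ::
    "'o measure \<Rightarrow> (real \<Rightarrow> 'o measure) \<Rightarrow> real \<Rightarrow> (real \<Rightarrow> 'v::fin_dim_banach) \<Rightarrow>
     real \<Rightarrow> real \<Rightarrow> real \<Rightarrow> ereal \<Rightarrow>
     (real \<Rightarrow> 'o \<Rightarrow> 'e::fin_dim_banach) \<Rightarrow> (real \<Rightarrow> 'o \<Rightarrow> ('v \<Rightarrow>\<^sub>L 'e)) \<Rightarrow> bool"
  where "ext_stoch_controlled M F T X \<beta> \<beta>' m n Z Z' \<longleftrightarrow>
     progressive F T Z \<and> progressive F T Z' \<and>
     holder_cond_Lnorm M F T \<beta> m n (\<lambda>s t \<omega>. Z t \<omega> - Z s \<omega>) < \<infinity> \<and>
     holder_Lnorm M T (\<beta> + \<beta>') n (\<lambda>s t. vcond_exp M (F s)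
        (\<lambda>\<omega>. Z t \<omega> - Z s \<omega> - blinfun_apply (Z' s \<omega>) (X t - X s))) < \<infinity> \<and>
     (SUP t\<in>{0..T}. Lnorm M n (\<lambda>\<omega>. ennreal (norm (Z' t \<omega>)))) < \<infinity> \<and>
     holder_Lnorm M T \<beta>' n (\<lambda>s t. vcond_exp M (F s) (\<lambda>\<omega>. Z' t \<omega> - Z' s \<omega>)) < \<infinity>"


section \<open>Rough, stochastic and rough stochastic integrals\<close>

text \<open>A partition of \<open>[0,T]\<close> is given by its finite set of nodes; \<open>steps P\<close> are its intervals.\<close>

definition partitions :: "real \<Rightarrow> real set set"
  where "partitions T = {P. finite P \<and> {0, T} \<subseteq> P \<and> P \<subseteq> {0..T}}"

definition steps :: "real set \<Rightarrow> (real \<times> real) set"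
  where "steps P = {(u, v). u \<in> P \<and> v \<in> P \<and> u < v \<and> P \<inter> {u<..<v} = {}}"

definition mesh_to_zero :: "real \<Rightarrow> real set filter"
  where "mesh_to_zero T =
     (INF \<delta>\<in>{0<..}. principal {P \<in> partitions T. \<forall>(u, v)\<in>steps P. v - u < \<delta>})"

definition rough_sum ::
    "(real \<Rightarrow> 'v::fin_dim_banach) \<Rightarrow> (real \<Rightarrow> real \<Rightarrow> 'v tensor2) \<Rightarrow>
     (real \<Rightarrow> ('v \<Rightarrow>\<^sub>L 'e::real_normed_vector)) \<Rightarrow> (real \<Rightarrow> ('v \<Rightarrow>\<^sub>L ('v \<Rightarrow>\<^sub>L 'e))) \<Rightarrow>
     real set \<Rightarrow> real \<Rightarrow> 'e"
  where "rough_sum X XX Z Z' P t =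
     (\<Sum>(u, v)\<in>{(u, v) \<in> steps P. u < t}.
        blinfun_apply (Z u) (X (min v t) - X u) + tensor_lift (Z' u) (XX u (min v t)))"

definition has_stoch_rough_integral ::
    "'o measure \<Rightarrow> real \<Rightarrow> (real \<Rightarrow> 'v::fin_dim_banach) \<Rightarrow> (real \<Rightarrow> real \<Rightarrow> 'v tensor2) \<Rightarrow>
     (real \<Rightarrow> 'o \<Rightarrow> ('v \<Rightarrow>\<^sub>L 'e::real_normed_vector)) \<Rightarrow> (real \<Rightarrow> 'o \<Rightarrow> ('v \<Rightarrow>\<^sub>L ('v \<Rightarrow>\<^sub>L 'e))) \<Rightarrow>
     (real \<Rightarrow> 'o \<Rightarrow> 'e) \<Rightarrow> bool"
  where "has_stoch_rough_integral M T X XX Z Z' J \<longleftrightarrow> continuous_process M T J \<and>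
     ucp_tendsto M T (\<lambda>P t \<omega>. rough_sum X XX (\<lambda>s. Z s \<omega>) (\<lambda>s. Z' s \<omega>) P t) J (mesh_to_zero T)"

definition has_rough_integral ::
    "real \<Rightarrow> (real \<Rightarrow> 'v::fin_dim_banach) \<Rightarrow> (real \<Rightarrow> real \<Rightarrow> 'v tensor2) \<Rightarrow>
     (real \<Rightarrow> ('v \<Rightarrow>\<^sub>L 'e::real_normed_vector)) \<Rightarrow> (real \<Rightarrow> ('v \<Rightarrow>\<^sub>L ('v \<Rightarrow>\<^sub>L 'e))) \<Rightarrow>
     (real \<Rightarrow> 'e) \<Rightarrow> bool"
  where "has_rough_integral T X XX Z Z' J \<longleftrightarrow> continuous_on {0..T} J \<and>
     uniform_limit {0..T} (rough_sum X XX Z Z') J (mesh_to_zero T)"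

text \<open>Elementary integrands \<open>\<Sum> h\<^sub>u 1\<^bsub>(u,v]\<^esub>\<close> with \<open>h\<^sub>u\<close> bounded and \<open>F\<^sub>u\<close>-measurable, and the
  Ito integral as the continuous adapted limit of their integrals along an \<open>L\<^sup>2\<close>-approximation.\<close>

definition elementary_integrand ::
    "'o measure \<Rightarrow> (real \<Rightarrow> 'o measure) \<Rightarrow> real \<Rightarrow> real set \<Rightarrow>
     (real \<Rightarrow> 'o \<Rightarrow> 'e::real_normed_vector) \<Rightarrow> bool"
  where "elementary_integrand M F T P h \<longleftrightarrow> P \<in> partitions T \<and>
     (\<forall>u\<in>P. h u \<in> borel_measurable (F u) \<and> (\<exists>C. \<forall>\<omega>\<in>space M. norm (h u \<omega>) \<le> C))"

definition elementary_process :: "real set \<Rightarrow> (real \<Rightarrow> 'o \<Rightarrow> 'e::real_vector) \<Rightarrow> real \<Rightarrow> 'o \<Rightarrow> 'e"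
  where "elementary_process P h s \<omega> = (\<Sum>(u, v)\<in>steps P. indicator {u<..v} s *\<^sub>R h u \<omega>)"

definition elementary_integral ::
    "real set \<Rightarrow> (real \<Rightarrow> 'o \<Rightarrow> ('u::real_normed_vector \<Rightarrow>\<^sub>L 'w::real_normed_vector)) \<Rightarrow>
     (real \<Rightarrow> 'o \<Rightarrow> 'u) \<Rightarrow> real \<Rightarrow> 'o \<Rightarrow> 'w"
  where "elementary_integral P h B t \<omega> =
     (\<Sum>(u, v)\<in>steps P. blinfun_apply (h u \<omega>) (B (min v t) \<omega> - B (min u t) \<omega>))"

definition has_ito_integral ::
    "'o measure \<Rightarrow> (real \<Rightarrow> 'o measure) \<Rightarrow> real \<Rightarrow> (real \<Rightarrow> 'o \<Rightarrow> 'u::euclidean_space) \<Rightarrow>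
     (real \<Rightarrow> 'o \<Rightarrow> ('u \<Rightarrow>\<^sub>L 'w::fin_dim_banach)) \<Rightarrow> (real \<Rightarrow> 'o \<Rightarrow> 'w) \<Rightarrow> bool"
  where "has_ito_integral M F T B \<sigma> I \<longleftrightarrow>
     continuous_process M T I \<and> adapted F T I \<and>
     (\<exists>P h. (\<forall>k::nat. elementary_integrand M F T (P k) (h k)) \<and>
        (\<lambda>k. \<integral>\<^sup>+\<omega>. (\<integral>\<^sup>+s\<in>{0..T}.
            ennreal ((norm (elementary_process (P k) (h k) s \<omega> - \<sigma> s \<omega>))\<^sup>2) \<partial>lborel) \<partial>M)
          \<longlonglongrightarrow> 0 \<and>
        ucp_tendsto M T (\<lambda>k. elementary_integral (P k) (h k) B) I sequentially)"

definition rough_ito_process ::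
    "'o measure \<Rightarrow> (real \<Rightarrow> 'o measure) \<Rightarrow> real \<Rightarrow> (real \<Rightarrow> 'o \<Rightarrow> 'u::euclidean_space) \<Rightarrow>
     (real \<Rightarrow> 'v::fin_dim_banach) \<Rightarrow> (real \<Rightarrow> real \<Rightarrow> 'v tensor2) \<Rightarrow>
     (real \<Rightarrow> 'o \<Rightarrow> 'w::fin_dim_banach) \<Rightarrow> (real \<Rightarrow> 'o \<Rightarrow> ('u \<Rightarrow>\<^sub>L 'w)) \<Rightarrow>
     (real \<Rightarrow> 'o \<Rightarrow> ('v \<Rightarrow>\<^sub>L 'w)) \<Rightarrow> (real \<Rightarrow> 'o \<Rightarrow> ('v \<Rightarrow>\<^sub>L ('v \<Rightarrow>\<^sub>L 'w))) \<Rightarrow>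
     (real \<Rightarrow> 'o \<Rightarrow> 'w) \<Rightarrow> bool"
  where "rough_ito_process M F T B X XX b \<sigma> Y' Y'' Y \<longleftrightarrow>
     continuous_process M T Y \<and> adapted F T Y \<and>
     (\<exists>I J. has_ito_integral M F T B \<sigma> I \<and> has_stoch_rough_integral M T X XX Y' Y'' J \<and>
        (AE \<omega> in M. \<forall>t\<in>{0..T}.
           Y t \<omega> = Y 0 \<omega> + (LINT s:{0..t}|lborel. b s \<omega>) + I t \<omega> + J t \<omega>))"


section \<open>Effective operators and the forward equation\<close>

text \<open>\<open>\<sigma>\<^sup>\<dagger> l\<close> is the vector with \<open>\<sigma>\<^sup>\<dagger> l \<bullet> u = l (\<sigma> u)\<close> for all \<open>u\<close>, so \<open>\<sigma> \<sigma>\<^sup>\<dagger>\<close> maps the dual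
  of \<open>W\<close> to \<open>W\<close>, i.e. it is the element \<open>\<Sum>\<^sub>e \<sigma> e \<otimes> \<sigma> e\<close> of \<open>W \<otimes> W\<close>.\<close>

definition dagger :: "('u::euclidean_space \<Rightarrow>\<^sub>L 'w::real_normed_vector) \<Rightarrow> ('w \<Rightarrow>\<^sub>L real) \<Rightarrow> 'u"
  where "dagger \<sigma> l = (\<Sum>e\<in>Basis. blinfun_apply l (blinfun_apply \<sigma> e) *\<^sub>R e)"

definition diffusion :: "('u::euclidean_space \<Rightarrow>\<^sub>L 'w::fin_dim_banach) \<Rightarrow> 'w tensor2"
  where "diffusion \<sigma> = Blinfun (\<lambda>l. blinfun_apply \<sigma> (dagger \<sigma> l))"

lemma inner_dagger: "dagger \<sigma> l \<bullet> u = blinfun_apply l (blinfun_apply \<sigma> u)"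
proof -
  have "blinfun_apply l (blinfun_apply \<sigma> u)
      = blinfun_apply l (blinfun_apply \<sigma> (\<Sum>e\<in>Basis. (u \<bullet> e) *\<^sub>R e))"
    by (simp add: euclidean_representation)
  then show ?thesis
    by (simp only: dagger_def inner_sum_left blinfun.sum_right blinfun.scaleR_right
        inner_scaleR_left real_scaleR_def inner_commute[of u] mult.commute)
qed

lemma diffusion_eq: "diffusion \<sigma> = (\<Sum>e\<in>Basis. blinfun_apply \<sigma> e \<otimes> blinfun_apply \<sigma> e)"
proof -
  have "(\<lambda>l. blinfun_apply \<sigma> (dagger \<sigma> l))
      = blinfun_apply (\<Sum>e\<in>Basis. blinfun_apply \<sigma> e \<otimes> blinfun_apply \<sigma> e)"
    by (auto simp: fun_eq_iff dagger_def tensor_apply blinfun.sum_left blinfun.sum_right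
        blinfun.scaleR_right)
  then show ?thesis by (simp add: diffusion_def blinfun_apply_inverse)
qed

text \<open>The contraction \<open>a : D\<^sup>2\<phi>\<close> is the value at \<open>a \<in> W \<otimes> W\<close> of the linear form given by \<open>D\<^sup>2\<phi>\<close>.\<close>

definition generator ::
    "(real \<Rightarrow> 'w \<Rightarrow> 'w::fin_dim_banach) \<Rightarrow> (real \<Rightarrow> 'w \<Rightarrow> 'w tensor2) \<Rightarrow>
     real \<Rightarrow> ('w \<Rightarrow> real) \<Rightarrow> 'w \<Rightarrow> real"
  where "generator b a t \<phi> y =
     blinfun_apply (Dfun \<phi> y) (b t y) + 1 / 2 * tensor_lift (Dfun (Dfun \<phi>) y) (a t y)"

definition transport_op ::
    "('v::real_normed_vector \<Rightarrow>\<^sub>L 'w::real_normed_vector) \<Rightarrow> ('w \<Rightarrow> real) \<Rightarrow> 'w \<Rightarrow> ('v \<Rightarrow>\<^sub>L real)"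
  where "transport_op Y' \<phi> y = Dfun \<phi> y o\<^sub>L Y'"

definition transport_op' ::
    "('v::real_normed_vector \<Rightarrow>\<^sub>L 'w::real_normed_vector) \<Rightarrow> ('v \<Rightarrow>\<^sub>L ('v \<Rightarrow>\<^sub>L 'w)) \<Rightarrow>
     ('w \<Rightarrow> real) \<Rightarrow> 'w \<Rightarrow> ('v \<Rightarrow>\<^sub>L ('v \<Rightarrow>\<^sub>L real))"
  where "transport_op' Y' Y'' \<phi> y = Blinfun (\<lambda>u. Blinfun (\<lambda>v.
     blinfun_apply (blinfun_apply (Dfun (Dfun \<phi>) y) (blinfun_apply Y' u)) (blinfun_apply Y' v)
     + blinfun_apply (Dfun \<phi> y) (blinfun_apply (blinfun_apply Y'' u) v)))"

lemma transport_op'_apply: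
  "blinfun_apply (blinfun_apply (transport_op' Y' Y'' \<phi> y) u) v =
     blinfun_apply (blinfun_apply (Dfun (Dfun \<phi>) y) (blinfun_apply Y' u)) (blinfun_apply Y' v)
     + blinfun_apply (Dfun \<phi> y) (blinfun_apply (blinfun_apply Y'' u) v)"
proof -
  let ?D = "Dfun \<phi> y" and ?D2 = "Dfun (Dfun \<phi>) y"
  have 1: "Blinfun (\<lambda>v. blinfun_apply (blinfun_apply ?D2 (blinfun_apply Y' u)) (blinfun_apply Y' v)
     + blinfun_apply ?D (blinfun_apply (blinfun_apply Y'' u) v))
     = (blinfun_apply ?D2 (blinfun_apply Y' u) o\<^sub>L Y') + (?D o\<^sub>L blinfun_apply Y'' u)" for u
    by (rule blinfun_eqI, subst bounded_linear_Blinfun_apply)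
      (auto intro!: bounded_linear_intros simp: blinfun.add_left)
  have "bounded_linear (\<lambda>u. (blinfun_apply ?D2 (blinfun_apply Y' u) o\<^sub>L Y') + (?D o\<^sub>L blinfun_apply Y'' u))"
    by (intro bounded_linear_add
        bounded_linear_compose[OF bounded_bilinear.bounded_linear_left[OF bounded_bilinear_blinfun_compose]]
        bounded_linear_compose[OF bounded_bilinear.bounded_linear_right[OF bounded_bilinear_blinfun_compose]]
        bounded_linear_intros)
  then show ?thesis
    unfolding transport_op'_def 1 by (simp add: bounded_linear_Blinfun_apply blinfun.add_left)
qed

text \<open>Analytically weak, integral solutions of
  \<open>d\<mu> = L\<^sup>\<star> \<mu> dt + \<Gamma>\<^sup>\<star> \<mu> dX\<close>, \<open>\<mu>\<^sub>0 = \<nu>\<close>; existence of all the integrals is part of the notion.\<close>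

definition weak_rough_forward_solution ::
    "real \<Rightarrow> real \<Rightarrow> (real \<Rightarrow> 'v::fin_dim_banach) \<Rightarrow> (real \<Rightarrow> real \<Rightarrow> 'v tensor2) \<Rightarrow>
     (real \<Rightarrow> ('w::fin_dim_banach \<Rightarrow> real) \<Rightarrow> 'w \<Rightarrow> real) \<Rightarrow>
     (real \<Rightarrow> ('w \<Rightarrow> real) \<Rightarrow> 'w \<Rightarrow> ('v \<Rightarrow>\<^sub>L real)) \<Rightarrow>
     (real \<Rightarrow> ('w \<Rightarrow> real) \<Rightarrow> 'w \<Rightarrow> ('v \<Rightarrow>\<^sub>L ('v \<Rightarrow>\<^sub>L real))) \<Rightarrow>
     (real \<Rightarrow> 'w measure) \<Rightarrow> 'w measure \<Rightarrow> bool"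
  where "weak_rough_forward_solution T \<gamma> X XX L \<Gamma> \<Gamma>' \<mu> \<nu> \<longleftrightarrow>
     (\<forall>t\<in>{0..T}. prob_space (\<mu> t) \<and> sets (\<mu> t) = sets borel) \<and> \<mu> 0 = \<nu> \<and>
     (\<forall>\<phi>\<in>Cb \<gamma>.
        (\<forall>s\<in>{0..T}. integrable (\<mu> s) \<phi> \<and> integrable (\<mu> s) (L s \<phi>) \<and>
           integrable (\<mu> s) (\<Gamma> s \<phi>) \<and> integrable (\<mu> s) (\<Gamma>' s \<phi>)) \<and>
        set_integrable lborel {0..T} (\<lambda>s. \<integral>y. L s \<phi> y \<partial>\<mu> s) \<and>
        (\<exists>J. has_rough_integral T X XX
               (\<lambda>s. \<integral>y. \<Gamma> s \<phi> y \<partial>\<mu> s) (\<lambda>s. \<integral>y. \<Gamma>' s \<phi> y \<partial>\<mu> s) J \<and>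
             (\<forall>t\<in>{0..T}. (\<integral>y. \<phi> y \<partial>\<mu> t) =
                (\<integral>y. \<phi> y \<partial>\<mu> 0) + (LINT s:{0..t}|lborel. (\<integral>y. L s \<phi> y \<partial>\<mu> s)) + J t)))"

end

theory Submission
  imports Defs
begin

text \<open>Fix a test function \<open>\<phi>\<close> and put \<open>m(t) = E \<phi>(Y\<^sub>t)\<close>. The equation states that \<open>m\<close> is the sum of the time
  integral of \<open>E (D\<phi>(Y\<^sub>r) b\<^sub>r + 1/2 D\<^sup>2\<phi>(Y\<^sub>r) : a\<^sub>r)\<close> and of a deterministic rough integral whose integrand
  is \<open>g\<^sub>s = E (D\<phi>(Y\<^sub>s) Y'\<^sub>s)\<close> with derivative \<open>g'\<^sub>s = E (D\<^sup>2\<phi>(Y\<^sub>s)(Y'\<^sub>s, Y'\<^sub>s) + D\<phi>(Y\<^sub>s) Y''\<^sub>s)\<close>.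
  A deterministic rough integral is recognised by its local expansion: a continuous path started at
  \<open>0\<close> whose increments are \<open>g\<^sub>s \<delta>X\<^sub>s\<^sub>,\<^sub>t + g'\<^sub>s XX\<^sub>s\<^sub>,\<^sub>t\<close> up to an error of order \<open>\<theta> > 1\<close> in \<open>t - s\<close> is the
  limit of the compensated sums, because the errors add up to a power of the mesh
  (\<open>has_rough_integral_germ\<close>). Hence it suffices to expand \<open>m\<close> over a single interval \<open>[s,t]\<close>
  of length \<open>h\<close>, which is \<open>local_expansion\<close>; taking expectations first replaces the pathwise Ito formula.

  Write the increment of \<open>Y\<close> as \<open>p + q\<close>, where \<open>p\<close> is the Ito increment plus \<open>Y'\<^sub>s \<delta>X\<close>, of order
  \<open>h\<^sup>\<alpha>\<close> in \<open>L\<^sup>4\<close>, and \<open>q\<close> is the drift plus \<open>Y''\<^sub>s XX\<close> plus the remainder \<open>W\<close> of the rough stochastic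
  integral, of order \<open>h\<^bsup>\<alpha>+\<beta>\<^esup>\<close> in \<open>L\<^sup>2\<close>. The second order Taylor expansion with only \<open>p\<close> in the quadratic
  term has an error of order \<open>h\<^bsup>\<alpha>\<gamma>\<^esup> + h\<^bsup>2\<alpha>+\<beta>\<^esup>\<close> in expectation (\<open>taylor_expectation\<close>). In expectation
  the Ito increment is orthogonal to everything known at time \<open>s\<close> and its square is the integral of
  \<open>\<sigma>\<sigma>\<^sup>\<dagger>\<close>; \<open>W\<close> paired with \<open>D\<phi>(Y\<^sub>s)\<close> is of order \<open>h\<^bsup>\<alpha>+\<beta>+\<beta>'\<^esup>\<close>; and since \<open>X\<close> is geometric, half of
  \<open>D\<^sup>2\<phi>(Y\<^sub>s)(Y'\<^sub>s \<delta>X, Y'\<^sub>s \<delta>X)\<close> is the contraction of \<open>D\<^sup>2\<phi>(Y\<^sub>s)(Y'\<^sub>s, Y'\<^sub>s)\<close> with \<open>XX\<close>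
  (\<open>tensor_lift_transport_op'\<close>). Replacing \<open>Y\<^sub>s\<close> by \<open>Y\<^sub>r\<close> under the time integral costs
  \<open>h\<^bsup>1+\<alpha>(\<gamma>-2)\<^esup>\<close> (\<open>time_regularity\<close>). All these exponents exceed \<open>1\<close>.

  Two probabilistic facts carry this. The moments of Ito increments come from discrete martingales
  and a truncation that keeps fourth moments bounded along the approximation (\<open>ito_increment\<close>). The
  two bounds on \<open>W\<close>, in \<open>L\<^sup>2\<close> and after conditioning, come from stochastic sewing along dyadic
  partitions (\<open>stochastic_sewing_dyadic\<close>, \<open>rough_remainder\<close>). Finally, \<open>D\<phi>(Y\<^sub>t)\<close> and \<open>D\<^sup>2\<phi>(Y\<^sub>t)\<close> are
  functions of \<open>Y\<^sub>t\<close>, so conditioning on \<open>Y\<^sub>t\<close> replaces the coefficients by the effective ones and the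
  expectations by integrals against the law of \<open>Y\<^sub>t\<close> (\<open>cond_exp_given_blinfun\<close>).\<close>

section \<open>Coordinates and tensors\<close>

lemma finite_coordinates:
  "\<exists>(B :: 'a::fin_dim_banach set) co. finite B \<and>
     (\<forall>x. x = (\<Sum>b\<in>B. (co b :: 'a \<Rightarrow>\<^sub>L real) x *\<^sub>R b))"
proof -
  obtain B0 :: "'a set" where B0: "finite B0" "span B0 = UNIV" using finite_dimensional by blast
  obtain B where B: "B \<subseteq> B0" "independent B" "span B = UNIV"
    using maximal_independent_subset[of B0] B0 by (metis span_span span_mono top.extremum_uniqueI)
  have fB: "finite B" using B B0 finite_subset by blast
  have "bounded_linear (\<lambda>x. representation B x b)" for b
    using B by (intro bounded_linear_fin_dim linearI)
      (auto simp: representation_add representation_scale)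
  then have "Blinfun (\<lambda>x. representation B x b) x = representation B x b" for b x
    by (simp add: bounded_linear_Blinfun_apply)
  moreover have "x = (\<Sum>b\<in>B. representation B x b *\<^sub>R b)" for x
    using sum_representation_eq[OF B(2), of x B] B fB by simp
  ultimately show ?thesis
    using fB by (intro exI[of _ B] exI[of _ "\<lambda>b. Blinfun (\<lambda>x. representation B x b)"]) simp
qed

lemma tensor_lift_coordinates:
  "\<exists>(B :: 'a::fin_dim_banach set) co. finite B \<and>
     (\<forall>(K :: 'a \<Rightarrow>\<^sub>L 'a \<Rightarrow>\<^sub>L 'e::real_normed_vector) A. tensor_lift K A =
        (\<Sum>b\<in>B. K b (A (co b))))"
proof -
  obtain B :: "'a set" and co :: "'a => ('a \<Rightarrow>\<^sub>L real)" where fB: "finite B"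
    and x: "\<And>x. x = (\<Sum>b\<in>B. co b x *\<^sub>R b)"
    using finite_coordinates by blast
  have decomp: "A = (\<Sum>b\<in>B. b \<otimes> A (co b))" for A :: "'a tensor2"
  proof (rule blinfun_eqI)
    fix l :: "'a \<Rightarrow>\<^sub>L real"
    have "l = (\<Sum>b\<in>B. l b *\<^sub>R co b)"
    proof (rule blinfun_eqI)
      fix y
      have "l y = (\<Sum>b\<in>B. co b y *\<^sub>R l b)"
        by (subst x[of y]) (simp add: blinfun.sum_right blinfun.scaleR_right)
      then show "l y = (\<Sum>b\<in>B. l b *\<^sub>R co b) y"
        by (simp add: blinfun.sum_left blinfun.scaleR_left mult.commute)
    qed
    then have "A l = A (\<Sum>b\<in>B. l b *\<^sub>R co b)" by simp
    then show "A l = (\<Sum>b\<in>B. b \<otimes> A (co b)) l"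
      by (simp add: blinfun.sum_right blinfun.sum_left blinfun.scaleR_right tensor_apply)
  qed
  have "tensor_lift K A = (\<Sum>b\<in>B. K b (A (co b)))"
    for K :: "'a \<Rightarrow>\<^sub>L 'a \<Rightarrow>\<^sub>L 'e" and A
    by (subst decomp[of A]) (simp add: linear_sum[OF linear_tensor_lift] tensor_lift_tensor)
  then show ?thesis using fB by blast
qed

lemma bounded_bilinear_tensor_lift:
  "bounded_bilinear (tensor_lift :: ('a::fin_dim_banach \<Rightarrow>\<^sub>L 'a \<Rightarrow>\<^sub>L 'e::real_normed_vector) => _)"
proof -
  obtain B :: "'a set" and co :: "'a => ('a \<Rightarrow>\<^sub>L real)" where fB: "finite B"
    and *: "\<And>(K :: 'a \<Rightarrow>\<^sub>L 'a \<Rightarrow>\<^sub>L 'e) A. tensor_lift K A =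
        (\<Sum>b\<in>B. K b (A (co b)))"
    using tensor_lift_coordinates[where ?'a='a and ?'e='e] by blast
  show ?thesis
  proof
    fix K K' :: "'a \<Rightarrow>\<^sub>L 'a \<Rightarrow>\<^sub>L 'e" and A A' :: "'a tensor2" and r
    show "tensor_lift (K + K') A = tensor_lift K A + tensor_lift K' A"
      "tensor_lift K (A + A') = tensor_lift K A + tensor_lift K A'"
      "tensor_lift (r *\<^sub>R K) A = r *\<^sub>R tensor_lift K A"
      "tensor_lift K (r *\<^sub>R A) = r *\<^sub>R tensor_lift K A"
      by (simp_all add: * blinfun.add_left blinfun.add_right blinfun.scaleR_left
          blinfun.scaleR_right sum.distrib scaleR_sum_right)
  next
    show "\<exists>C. \<forall>(K :: 'a \<Rightarrow>\<^sub>L 'a \<Rightarrow>\<^sub>L 'e) A. norm (tensor_lift K A) \<le> norm K * norm A * C"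
    proof (intro exI allI)
      fix K :: "'a \<Rightarrow>\<^sub>L 'a \<Rightarrow>\<^sub>L 'e" and A
      have "norm (tensor_lift K A)
          \<le> (\<Sum>b\<in>B. norm (K b (A (co b))))"
        unfolding * by (rule norm_sum)
      also have "\<dots> \<le> (\<Sum>b\<in>B. (norm K * norm b) * (norm A * norm (co b)))"
        by (intro sum_mono order_trans[OF norm_blinfun] mult_mono norm_blinfun) auto
      also have "\<dots> = norm K * norm A * (\<Sum>b\<in>B. norm b * norm (co b))"
        by (simp add: sum_distrib_left mult_ac)
      finally show "norm (tensor_lift K A) \<le> norm K * norm A * (\<Sum>b\<in>B. norm b * norm (co b))" .
    qed
  qed
qed

interpretation tensor_lift: bounded_bilinear
  "tensor_lift :: ('a::fin_dim_banach \<Rightarrow>\<^sub>L 'a \<Rightarrow>\<^sub>L 'e::real_normed_vector) => _"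
  by (rule bounded_bilinear_tensor_lift)

lemma bounded_bilinear_tensor: "bounded_bilinear (tensor :: 'a::fin_dim_banach => _)"
proof
  fix u u' v v' :: 'a and r
  show "(u + u') \<otimes> v = u \<otimes> v + u' \<otimes> v" "u \<otimes> (v + v') = u \<otimes> v + u \<otimes> v'"
    "(r *\<^sub>R u) \<otimes> v = r *\<^sub>R (u \<otimes> v)" "u \<otimes> (r *\<^sub>R v) = r *\<^sub>R (u \<otimes> v)"
    by (auto intro!: blinfun_eqI simp: tensor_apply blinfun.add_left blinfun.add_right
        blinfun.scaleR_left blinfun.scaleR_right algebra_simps)
next
  show "\<exists>C. \<forall>u v :: 'a. norm (u \<otimes> v) \<le> norm u * norm v * C"
  proof (intro exI allI)
    fix u v :: 'a
    have "norm ((u \<otimes> v) l) \<le> norm u * norm v * norm l" for l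
      using mult_right_mono[OF norm_blinfun[of l u] norm_ge_zero[of v]]
      by (simp add: tensor_apply mult_ac)
    then show "norm (u \<otimes> v) \<le> norm u * norm v * 1"
      by (intro norm_blinfun_bound) auto
  qed
qed

interpretation tensor: bounded_bilinear "tensor :: 'a::fin_dim_banach => _"
  by (rule bounded_bilinear_tensor)

definition symmetric_form :: "('a::real_normed_vector \<Rightarrow>\<^sub>L 'a \<Rightarrow>\<^sub>L 'e::real_normed_vector) => bool"
  where "symmetric_form K \<longleftrightarrow>
    (\<forall>u v. K u v = K v u)"

text \<open>For symmetric \<open>S\<close> the function \<open>r \<mapsto> 1/2 S(X\<^sub>r - X\<^sub>s, X\<^sub>r - X\<^sub>s)\<close> has the derivative
  \<open>S(X\<^sub>r - X\<^sub>s, X'\<^sub>r)\<close>, so the iterated integral of a smooth path is computed by the fundamental theorem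
  of calculus.\<close>

lemma tensor_lift_canonical_lift:
  fixes K :: "'v::fin_dim_banach \<Rightarrow>\<^sub>L 'v \<Rightarrow>\<^sub>L 'e::banach"
  assumes Z: "smooth_path T Z" and st: "0 \<le> s" "s \<le> t" "t \<le> T" and K: "symmetric_form K"
  shows "tensor_lift K (canonical_lift T Z s t) =
    (1 / 2) *\<^sub>R K (Z t - Z s) (Z t - Z s)"
proof (cases "s = t")
  case True
  then show ?thesis by (simp add: canonical_lift_def tensor_lift.zero_right)
next
  case False
  then have st': "s < t" using st by simp
  obtain d where d0: "d 0 = Z" and
    d: "\<And>k t. t \<in> {0..T} ==> (d k has_vector_derivative d (Suc k) t) (at t within {0..T})"
    using Z unfolding smooth_path_def by blast
  have dZ: "(Z has_vector_derivative d 1 r) (at r within {0..T})" if "r \<in> {0..T}" for r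
    using d[OF that, of 0] d0 by simp
  have vd: "vector_derivative Z (at r within {0..T}) = d 1 r" if r: "r \<in> {s..t}" for r
    using dZ[of r] r st st' by (intro vector_derivative_within_cbox[of 0 T r, simplified]) auto
  have cont: "continuous_on {s..t} (d k)" for k
  proof (rule continuous_on_subset)
    show "continuous_on {0..T} (d k)"
      by (rule continuous_on_vector_derivative) (rule d)
  qed (use st in auto)
  have int: "(\<lambda>r. (Z r - Z s) \<otimes> d 1 r) integrable_on {s..t}"
    using cont[of 0] cont[of 1] unfolding d0
    by (intro integrable_continuous_real tensor.continuous_on continuous_intros) auto
  have "canonical_lift T Z s t = integral {s..t} (\<lambda>r. (Z r - Z s) \<otimes> d 1 r)"
    unfolding canonical_lift_def by (rule integral_cong) (simp add: vd)
  then have "tensor_lift K (canonical_lift T Z s t) =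
      integral {s..t} (tensor_lift K \<circ> (\<lambda>r. (Z r - Z s) \<otimes> d 1 r))"
    using integral_linear[OF int tensor_lift.bounded_linear_right[of K]] by simp
  also have "\<dots> = integral {s..t} (\<lambda>r. K (Z r - Z s) (d 1 r))"
    by (simp add: tensor_lift_tensor o_def)
  also have "\<dots> = (1 / 2) *\<^sub>R K (Z t - Z s) (Z t - Z s)"
  proof (rule integral_unique)
    let ?G = "\<lambda>r. (1 / 2) *\<^sub>R K (Z r - Z s) (Z r - Z s)"
    have "((\<lambda>r. K (Z r - Z s) (d 1 r)) has_integral (?G t - ?G s)) {s..t}"
    proof (rule fundamental_theorem_of_calculus)
      fix r assume r: "r \<in> {s..t}"
      have 1: "((\<lambda>r. Z r - Z s) has_vector_derivative d 1 r) (at r within {s..t})"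
        using has_vector_derivative_within_subset[OF dZ, of r "{s..t}"] r st
        by (auto intro!: derivative_eq_intros)
      have "((\<lambda>r. K (Z r - Z s) (Z r - Z s)) has_vector_derivative
          K (Z r - Z s) (d 1 r) + K (d 1 r) (Z r - Z s))
          (at r within {s..t})"
        by (intro bounded_bilinear.has_vector_derivative[OF bounded_bilinear_blinfun_apply] 1
            bounded_linear.has_vector_derivative[OF blinfun.bounded_linear_right])
      then have "(?G has_vector_derivative (1/2) *\<^sub>R (K (Z r - Z s) (d 1 r)
          + K (d 1 r) (Z r - Z s))) (at r within {s..t})"
        by (rule bounded_linear.has_vector_derivative[OF bounded_linear_scaleR_right])
      moreover have "(1/2) *\<^sub>R (K (Z r - Z s) (d 1 r)
          + K (d 1 r) (Z r - Z s)) = K (Z r - Z s) (d 1 r)"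
        using K[unfolded symmetric_form_def, rule_format, of "d 1 r" "Z r - Z s"]
        by (simp add: scaleR_add_left[symmetric] scaleR_add_right)
      ultimately show "(?G has_vector_derivative K (Z r - Z s) (d 1 r)) (at r within {s..t})"
        by simp
    qed (use st in simp)
    then show "((\<lambda>r. K (Z r - Z s) (d 1 r)) has_integral ?G t) {s..t}"
      by simp
  qed
  finally show ?thesis .
qed

text \<open>Both sides of the identity for smooth paths are continuous in the rough path distance, so it passes
  to the closure. This is where geometricity enters: the symmetric part of \<open>XX\<close> carries no
  information beyond \<open>X\<close>.\<close>

lemma tensor_lift_geometric:
  fixes K :: "'v::fin_dim_banach \<Rightarrow>\<^sub>L 'v \<Rightarrow>\<^sub>L 'e::banach"
  assumes X: "geometric_rough_path T \<alpha> X XX" and st: "0 \<le> s" "s < t" "t \<le> T"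
    and K: "symmetric_form K"
  shows "tensor_lift K (XX s t) = (1 / 2) *\<^sub>R K (X t - X s) (X t - X s)"
proof -
  define q where "q v = (1 / 2) *\<^sub>R K v v" for v
  have ex: "\<exists>Z. smooth_path T Z \<and> norm ((X t - X s) - (Z t - Z s)) \<le> (t - s) powr \<alpha> / Suc n \<and>
     norm (XX s t - canonical_lift T Z s t) \<le> (t - s) powr (2 * \<alpha>) / Suc n" for n
  proof -
    obtain Z where Z: "smooth_path T Z"
      "rough_dist T \<alpha> X XX Z (canonical_lift T Z) < ennreal (1 / Suc n)"
      using X unfolding geometric_rough_path_def by (metis ennreal_less_zero_iff of_nat_0_less_iff zero_less_Suc zero_less_divide_1_iff)
    have mem: "(s, t) \<in> time_pairs T" using st by (simp add: time_pairs_def)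
    have 1: "ennreal (norm ((X t - X s) - (Z t - Z s)) / (t - s) powr \<alpha>)
        \<le> rough_dist T \<alpha> X XX Z (canonical_lift T Z)"
      unfolding rough_dist_def by (rule add_increasing2) (use mem in \<open>auto intro!: SUP_upper2[of "(s,t)"]\<close>)
    have 2: "ennreal (norm (XX s t - canonical_lift T Z s t) / (t - s) powr (2 * \<alpha>))
        \<le> rough_dist T \<alpha> X XX Z (canonical_lift T Z)"
      unfolding rough_dist_def by (rule add_increasing) (use mem in \<open>auto intro!: SUP_upper2[of "(s,t)"]\<close>)
    have "norm ((X t - X s) - (Z t - Z s)) / (t - s) powr \<alpha> \<le> 1 / Suc n"
      "norm (XX s t - canonical_lift T Z s t) / (t - s) powr (2 * \<alpha>) \<le> 1 / Suc n"
      using order.strict_implies_order[OF order_le_less_trans[OF 1 Z(2)]]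
        order.strict_implies_order[OF order_le_less_trans[OF 2 Z(2)]] by simp_all
    then show ?thesis using Z(1) st by (intro exI[of _ Z]) (simp add: field_simps)
  qed
  then obtain Z where Z: "\<And>n. smooth_path T (Z n)"
    "\<And>n. norm ((X t - X s) - (Z n t - Z n s)) \<le> (t - s) powr \<alpha> / Suc n"
    "\<And>n. norm (XX s t - canonical_lift T (Z n) s t) \<le> (t - s) powr (2 * \<alpha>) / Suc n"
    by metis
  have lim0: "(\<lambda>n. c / Suc n) \<longlonglongrightarrow> 0" for c :: real
    using LIMSEQ_Suc[OF lim_const_over_n[of c]] by simp
  have "(\<lambda>n. (X t - X s) - (Z n t - Z n s)) \<longlonglongrightarrow> 0"
    by (rule Lim_null_comparison[OF always_eventually lim0]) (use Z(2) in blast)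
  from tendsto_diff[OF tendsto_const[of "X t - X s"] this]
  have l1: "(\<lambda>n. Z n t - Z n s) \<longlonglongrightarrow> X t - X s" by simp
  have "(\<lambda>n. XX s t - canonical_lift T (Z n) s t) \<longlonglongrightarrow> 0"
    by (rule Lim_null_comparison[OF always_eventually lim0]) (use Z(3) in blast)
  from tendsto_diff[OF tendsto_const[of "XX s t"] this]
  have l2: "(\<lambda>n. canonical_lift T (Z n) s t) \<longlonglongrightarrow> XX s t" by simp
  have "(\<lambda>n. tensor_lift K (canonical_lift T (Z n) s t)) \<longlonglongrightarrow> tensor_lift K (XX s t)"
    by (intro tensor_lift.tendsto tendsto_const l2)
  moreover have "(\<lambda>n. q (Z n t - Z n s)) \<longlonglongrightarrow> q (X t - X s)"
    unfolding q_def by (intro tendsto_intros blinfun.tendsto tendsto_const l1)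
  moreover have "tensor_lift K (canonical_lift T (Z n) s t) = q (Z n t - Z n s)" for n
    unfolding q_def using st by (intro tensor_lift_canonical_lift Z(1) K) auto
  ultimately show ?thesis unfolding q_def using LIMSEQ_unique by simp
qed


section \<open>Functions of class \<open>C\<^sub>b\<^sup>\<gamma>\<close>\<close>

lemma Cb_has_derivative:
  assumes "\<phi> \<in> Cb \<gamma>"
  shows "(\<phi> has_derivative blinfun_apply (Dfun \<phi> y)) (at y)"
    and "(Dfun \<phi> has_derivative blinfun_apply (Dfun (Dfun \<phi>) y)) (at y)"
  using assms by (auto simp: Cb_def intro: has_derivative_Dfun)

lemma Cb_bounds:
  fixes \<phi> :: "'a::real_normed_vector => real"
  assumes "\<phi> \<in> Cb \<gamma>"
  obtains C where "C > 0" "\<And>y. \<bar>\<phi> y\<bar> \<le> C" "\<And>y. norm (Dfun \<phi> y) \<le> C"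
    "\<And>y. norm (Dfun (Dfun \<phi>) y) \<le> C"
    "\<And>x y. norm (Dfun (Dfun \<phi>) x - Dfun (Dfun \<phi>) y) \<le> C * norm (x - y) powr (\<gamma> - 2)"
    "\<And>x y. norm (Dfun \<phi> x - Dfun \<phi> y) \<le> C * norm (x - y)"
proof -
  obtain C0 where C0: "\<And>y. \<bar>\<phi> y\<bar> \<le> C0"
    using assms unfolding Cb_def bounded_iff by auto
  obtain C1 where C1: "\<And>y. norm (Dfun \<phi> y) \<le> C1"
    using assms unfolding Cb_def bounded_iff by blast
  obtain C2 where C2: "\<And>y. norm (Dfun (Dfun \<phi>) y) \<le> C2"
    using assms unfolding Cb_def bounded_iff by blast
  obtain C3 where C3: "\<And>x y. norm (Dfun (Dfun \<phi>) x - Dfun (Dfun \<phi>) y) \<le> C3 * norm (x - y) powr (\<gamma> - 2)"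
    using assms unfolding Cb_def by blast
  define C where "C = 1 + \<bar>C0\<bar> + \<bar>C1\<bar> + \<bar>C2\<bar> + \<bar>C3\<bar>"
  have C4: "norm (Dfun \<phi> x - Dfun \<phi> y) \<le> C2 * norm (x - y)" for x y
    using Cb_has_derivative(2)[OF assms] C2
    by (intro differentiable_bound[of UNIV "Dfun \<phi>" "\<lambda>y. blinfun_apply (Dfun (Dfun \<phi>) y)"])
      (auto simp: norm_blinfun.rep_eq[symmetric])
  show thesis
  proof (rule that[of C])
    fix x y :: 'a
    have "C3 * norm (x - y) powr (\<gamma> - 2) \<le> C * norm (x - y) powr (\<gamma> - 2)"
      by (intro mult_right_mono) (auto simp: C_def)
    then show "norm (Dfun (Dfun \<phi>) x - Dfun (Dfun \<phi>) y) \<le> C * norm (x - y) powr (\<gamma> - 2)"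
      using C3[of x y] by linarith
    have "C2 * norm (x - y) \<le> C * norm (x - y)"
      by (intro mult_right_mono) (auto simp: C_def)
    then show "norm (Dfun \<phi> x - Dfun \<phi> y) \<le> C * norm (x - y)" using C4[of x y] by linarith
    show "\<bar>\<phi> y\<bar> \<le> C" "norm (Dfun \<phi> y) \<le> C" "norm (Dfun (Dfun \<phi>) y) \<le> C"
      using C0[of y] C1[of y] C2[of y] by (auto simp: C_def)
  qed (auto simp: C_def)
qed

lemma Cb_continuous:
  fixes \<phi> :: "'a::real_normed_vector => real"
  assumes "\<phi> \<in> Cb \<gamma>" "\<gamma> > 2"
  shows "continuous_on UNIV \<phi>" "continuous_on UNIV (Dfun \<phi>)" "continuous_on UNIV (Dfun (Dfun \<phi>))"
proof -
  show "continuous_on UNIV \<phi>" "continuous_on UNIV (Dfun \<phi>)"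
    using Cb_has_derivative[OF assms(1)]
    by (auto intro!: continuous_at_imp_continuous_on has_derivative_continuous)
  obtain C where C: "\<And>x y. norm (Dfun (Dfun \<phi>) x - Dfun (Dfun \<phi>) y) \<le> C * norm (x - y) powr (\<gamma> - 2)"
    by (rule Cb_bounds[OF assms(1)]) (rule that)
  show "continuous_on UNIV (Dfun (Dfun \<phi>))"
    unfolding continuous_on_def
  proof
    fix y :: 'a
    have "((\<lambda>x. C * norm (x - y) powr (\<gamma> - 2)) \<longlongrightarrow> C * norm (y - y) powr (\<gamma> - 2)) (at y)"
      using assms(2) by (intro tendsto_intros) auto
    then have "((\<lambda>x. C * norm (x - y) powr (\<gamma> - 2)) \<longlongrightarrow> 0) (at y)"
      using assms(2) by simp
    from Lim_null_comparison[OF always_eventually[OF allI[OF C]] this]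
    have "((\<lambda>x. Dfun (Dfun \<phi>) x - Dfun (Dfun \<phi>) y) \<longlongrightarrow> 0) (at y)" .
    then show "(Dfun (Dfun \<phi>) \<longlongrightarrow> Dfun (Dfun \<phi>) y) (at y)" by (simp add: LIM_zero_iff)
  qed
qed

lemma Cb_line_derivatives:
  fixes \<phi> :: "'a::real_normed_vector => real"
  assumes "\<phi> \<in> Cb \<gamma>"
  shows "((\<lambda>r. \<phi> (y + r *\<^sub>R x)) has_field_derivative Dfun \<phi> (y + r *\<^sub>R x) x) (at r)"
    and "((\<lambda>r. Dfun \<phi> (y + r *\<^sub>R x) z) has_field_derivative
       Dfun (Dfun \<phi>) (y + r *\<^sub>R x) x z) (at r)"
proof -
  have line: "((\<lambda>r. y + r *\<^sub>R x) has_derivative (\<lambda>t. t *\<^sub>R x)) (at r)"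
    by (auto intro!: derivative_eq_intros)
  from has_derivative_compose[OF line Cb_has_derivative(1)[OF assms]]
  show "((\<lambda>r. \<phi> (y + r *\<^sub>R x)) has_field_derivative Dfun \<phi> (y + r *\<^sub>R x) x) (at r)"
    by (simp add: has_field_derivative_def blinfun.scaleR_right mult_commute_abs)
  from has_derivative_compose[OF line Cb_has_derivative(2)[OF assms]]
  have "((\<lambda>r. Dfun \<phi> (y + r *\<^sub>R x)) has_derivative
      (\<lambda>t. t *\<^sub>R Dfun (Dfun \<phi>) (y + r *\<^sub>R x) x)) (at r)"
    by (simp add: blinfun.scaleR_right)
  from bounded_linear.has_derivative[OF blinfun.bounded_linear_left[of z] this]
  show "((\<lambda>r. Dfun \<phi> (y + r *\<^sub>R x) z) has_field_derivative
       Dfun (Dfun \<phi>) (y + r *\<^sub>R x) x z) (at r)"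
    by (simp add: has_field_derivative_def blinfun.scaleR_left mult_commute_abs)
qed

text \<open>The same remainder is bounded in two ways: boundedness of \<open>D\<^sup>2\<phi>\<close> gives the better bound for large
  \<open>x\<close>, its Hoelder continuity the better one for small \<open>x\<close>.\<close>

lemma Cb_taylor:
  fixes \<phi> :: "'a::real_normed_vector => real"
  assumes \<phi>: "\<phi> \<in> Cb \<gamma>" and \<gamma>: "2 < \<gamma>"
  obtains C where "C > 0"
    "\<And>y x. \<bar>\<phi> (y + x) - \<phi> y - Dfun \<phi> y x
       - 1/2 * Dfun (Dfun \<phi>) y x x\<bar> \<le> C * norm x ^ 2"
    "\<And>y x. \<bar>\<phi> (y + x) - \<phi> y - Dfun \<phi> y x
       - 1/2 * Dfun (Dfun \<phi>) y x x\<bar> \<le> C * norm x powr \<gamma>"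
proof -
  obtain C where C: "C > 0" "\<And>y. norm (Dfun (Dfun \<phi>) y) \<le> C"
    "\<And>x y. norm (Dfun (Dfun \<phi>) x - Dfun (Dfun \<phi>) y) \<le> C * norm (x - y) powr (\<gamma> - 2)"
    by (rule Cb_bounds[OF \<phi>]) (rule that)
  have key: "\<bar>\<phi> (y + x) - \<phi> y - Dfun \<phi> y x
       - 1/2 * Dfun (Dfun \<phi>) y x x\<bar> \<le> C * norm x ^ 2 \<and>
     \<bar>\<phi> (y + x) - \<phi> y - Dfun \<phi> y x
       - 1/2 * Dfun (Dfun \<phi>) y x x\<bar> \<le> C * norm x powr \<gamma>" for x y
  proof -
    define D where "D m r = (if m = 0 then \<phi> (y + r *\<^sub>R x) else if m = 1 then Dfun \<phi> (y + r *\<^sub>R x) x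
      else Dfun (Dfun \<phi>) (y + r *\<^sub>R x) x x)" for m :: nat and r
    have "\<exists>t. 0 < t \<and> t < 1 \<and>
        D 0 1 = (\<Sum>m<2. (D m 0 / fact m) * 1 ^ m) + (D 2 t / fact 2) * 1 ^ 2"
    proof (rule Maclaurin)
      show "\<forall>m t. m < 2 \<and> 0 \<le> t \<and> t \<le> 1 \<longrightarrow> (D m has_real_derivative D (Suc m) t) (at t)"
      proof (intro allI impI)
        fix m :: nat and t :: real
        assume "m < 2 \<and> 0 \<le> t \<and> t \<le> 1"
        then consider "m = 0" | "m = 1" by linarith
        then show "(D m has_real_derivative D (Suc m) t) (at t)"
        proof cases
          case 1
          then show ?thesis using Cb_line_derivatives(1)[OF \<phi>, of y x t] by (simp add: D_def[abs_def])
        next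
          case 2
          then show ?thesis using Cb_line_derivatives(2)[OF \<phi>, of y x x t] by (simp add: D_def[abs_def])
        qed
      qed
    qed auto
    then obtain t where t: "0 < t" "t < 1" "D 0 1 = D 0 0 + D 1 0 + D 2 t / 2"
      by (auto simp: numeral_2_eq_2)
    define E where "E = Dfun (Dfun \<phi>) (y + t *\<^sub>R x) - Dfun (Dfun \<phi>) y"
    have eq: "\<phi> (y + x) - \<phi> y - Dfun \<phi> y x
       - 1/2 * Dfun (Dfun \<phi>) y x x = 1/2 * E x x"
      using t(3) by (simp add: D_def E_def blinfun.diff_left)
    have "\<bar>E x x\<bar> \<le> norm E * norm x * norm x"
      using norm_blinfun[of "E x" x] mult_right_mono[OF norm_blinfun[of E x] norm_ge_zero[of x]] by simp
    then have b: "\<bar>1/2 * E x x\<bar> \<le> 1/2 * (norm E * norm x ^ 2)"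
      by (simp add: power2_eq_square mult.assoc)
    have "norm E \<le> 2 * C"
      unfolding E_def using norm_triangle_ineq4[of "Dfun (Dfun \<phi>) (y + t *\<^sub>R x)" "Dfun (Dfun \<phi>) y"]
        C(2)[of "y + t *\<^sub>R x"] C(2)[of y] by linarith
    then have "norm E * norm x ^ 2 \<le> 2 * C * norm x ^ 2" by (intro mult_right_mono) auto
    then have 1: "\<bar>1/2 * E x x\<bar> \<le> C * norm x ^ 2" using b by simp
    have "norm E \<le> C * (t * norm x) powr (\<gamma> - 2)"
      unfolding E_def using C(3)[of "y + t *\<^sub>R x" y] t by simp
    also have "\<dots> \<le> C * norm x powr (\<gamma> - 2)"
      using t C \<gamma> by (intro mult_left_mono powr_mono2) (auto simp: mult_left_le_one_le)
    finally have "norm E * norm x ^ 2 \<le> (C * norm x powr (\<gamma> - 2)) * norm x ^ 2"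
      by (rule mult_right_mono) auto
    also have "\<dots> = C * norm x powr \<gamma>"
    proof (cases "x = 0")
      case False
      then have "norm x ^ 2 = norm x powr 2" by simp
      then show ?thesis by (simp add: mult.assoc powr_add[symmetric] del: powr_numeral)
    qed (use \<gamma> in auto)
    finally have "\<bar>1/2 * E x x\<bar> \<le> 1/2 * (C * norm x powr \<gamma>)"
      using b by linarith
    also have "\<dots> \<le> C * norm x powr \<gamma>" using C(1) by simp
    finally show ?thesis unfolding eq using 1 by blast
  qed
  show thesis by (rule that[of C]) (use key C in auto)
qed

text \<open>The second difference is the increment of \<open>x \<mapsto> \<phi>(x + e v) - \<phi>(x)\<close> along \<open>e u\<close>, and the derivative of
  that function is controlled by the differentiability of \<open>D\<phi>\<close> at \<open>y\<close>.\<close>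

lemma Cb_second_difference:
  fixes \<phi> :: "'a::real_normed_vector => real"
  assumes \<phi>: "\<phi> \<in> Cb \<gamma>" and \<eta>: "\<eta> > 0"
  shows "\<exists>e0>0. \<forall>e. 0 < e \<and> e < e0 \<longrightarrow>
    \<bar>\<phi> (y + e *\<^sub>R u + e *\<^sub>R v) - \<phi> (y + e *\<^sub>R u) - \<phi> (y + e *\<^sub>R v) + \<phi> y
      - e\<^sup>2 * Dfun (Dfun \<phi>) y v u\<bar> \<le> \<eta> * e\<^sup>2"
proof -
  define c where "c = (2 * norm u + norm v + 1) * (norm u + 1)"
  have c: "c > 0" unfolding c_def by (intro mult_pos_pos) (auto intro: add_nonneg_pos)
  obtain d where d: "d > 0" "\<And>w. norm w < d ==>
    norm (Dfun \<phi> (y + w) - Dfun \<phi> y - Dfun (Dfun \<phi>) y w) \<le> (\<eta> / c) * norm w"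
  proof -
    have "\<exists>d>0. \<forall>z. norm (z - y) < d \<longrightarrow>
      norm (Dfun \<phi> z - Dfun \<phi> y - Dfun (Dfun \<phi>) y (z - y)) \<le> (\<eta> / c) * norm (z - y)"
      using Cb_has_derivative(2)[OF \<phi>, of y] \<eta> c unfolding has_derivative_at_alt by (meson divide_pos_pos)
    then obtain d where "d > 0" "\<And>z. norm (z - y) < d ==>
      norm (Dfun \<phi> z - Dfun \<phi> y - Dfun (Dfun \<phi>) y (z - y)) \<le> (\<eta> / c) * norm (z - y)"
      by blast
    from this(1) this(2)[of "y + _"] show ?thesis by (intro that[of d]) simp_all
  qed
  define e0 where "e0 = d / (norm u + norm v + 1)"
  have nn: "norm u + norm v + 1 > 0" by (intro add_nonneg_pos) auto
  then have e0: "e0 > 0" unfolding e0_def using d by simp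
  show ?thesis
  proof (intro exI[of _ e0] conjI e0 allI impI)
    fix e assume e: "0 < e \<and> e < e0"
    then have ed: "e * (norm u + norm v + 1) < d" using nn by (simp add: e0_def field_simps)
    define \<psi> where "\<psi> r = \<phi> ((y + e *\<^sub>R v) + r *\<^sub>R (e *\<^sub>R u)) - \<phi> (y + r *\<^sub>R (e *\<^sub>R u))" for r
    define \<psi>' where "\<psi>' r = Dfun \<phi> ((y + e *\<^sub>R v) + r *\<^sub>R (e *\<^sub>R u)) (e *\<^sub>R u)
       - Dfun \<phi> (y + r *\<^sub>R (e *\<^sub>R u)) (e *\<^sub>R u)" for r
    have "(\<psi> has_real_derivative \<psi>' r) (at r)" for r
      unfolding \<psi>_def \<psi>'_def by (intro DERIV_diff Cb_line_derivatives[OF \<phi>])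
    then obtain r where r: "0 < r" "r < 1" "\<psi> 1 - \<psi> 0 = \<psi>' r"
      using MVT2[of 0 1 \<psi> \<psi>'] by auto
    define w1 where "w1 = e *\<^sub>R v + r *\<^sub>R (e *\<^sub>R u)"
    define w2 where "w2 = r *\<^sub>R (e *\<^sub>R u)"
    have re: "r * e \<le> e" using r e by (simp add: mult_left_le_one_le)
    have "norm w2 = (r * e) * norm u" using r e by (simp add: w2_def)
    also have "\<dots> \<le> e * norm u" using re by (intro mult_right_mono) auto
    finally have n2: "norm w2 \<le> e * norm u" .
    have "norm w1 \<le> norm (e *\<^sub>R v) + norm w2" unfolding w1_def w2_def by (rule norm_triangle_ineq)
    then have n1: "norm w1 \<le> e * (norm u + norm v)" using n2 e by (simp add: algebra_simps)
    have le: "e * norm u \<le> e * (norm u + norm v + 1)" "e * (norm u + norm v) \<le> e * (norm u + norm v + 1)"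
      using e by (auto intro!: mult_left_mono)
    define r1 where "r1 = Dfun \<phi> (y + w1) - Dfun \<phi> y - Dfun (Dfun \<phi>) y w1"
    define r2 where "r2 = Dfun \<phi> (y + w2) - Dfun \<phi> y - Dfun (Dfun \<phi>) y w2"
    have "norm r1 \<le> (\<eta> / c) * norm w1" "norm r2 \<le> (\<eta> / c) * norm w2"
      unfolding r1_def r2_def using n1 n2 le ed by (intro d(2), linarith)+
    then have "norm r1 + norm r2 \<le> (\<eta> / c) * (norm w1 + norm w2)" by (simp add: distrib_left)
    also have "\<dots> \<le> (\<eta> / c) * (e * (2 * norm u + norm v))"
      using n1 n2 \<eta> c by (intro mult_left_mono) (auto simp: algebra_simps)
    finally have rr: "norm (r1 - r2) \<le> (\<eta> / c) * (e * (2 * norm u + norm v))"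
      using norm_triangle_ineq4[of r1 r2] by linarith
    have w: "w1 - w2 = e *\<^sub>R v" by (simp add: w1_def w2_def)
    have diff: "Dfun \<phi> (y + w1) - Dfun \<phi> (y + w2) = e *\<^sub>R Dfun (Dfun \<phi>) y v + (r1 - r2)"
      using arg_cong[OF w, of "blinfun_apply (Dfun (Dfun \<phi>) y)"]
      by (simp add: r1_def r2_def blinfun.diff_right blinfun.scaleR_right algebra_simps)
    have "\<psi>' r = (Dfun \<phi> (y + w1) - Dfun \<phi> (y + w2)) (e *\<^sub>R u)"
      by (simp add: \<psi>'_def w1_def w2_def blinfun.diff_left add.assoc)
    also have "\<dots> = e\<^sup>2 * Dfun (Dfun \<phi>) y v u + e * (r1 - r2) u"
      unfolding diff by (simp only: blinfun.add_left blinfun.scaleR_left blinfun.scaleR_right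
          real_scaleR_def power2_eq_square distrib_left mult.assoc)
    finally have "\<psi>' r - e\<^sup>2 * Dfun (Dfun \<phi>) y v u = e * (r1 - r2) u"
      by linarith
    then have "\<bar>\<psi>' r - e\<^sup>2 * Dfun (Dfun \<phi>) y v u\<bar> = e * \<bar>(r1 - r2) u\<bar>"
      using e by (simp only: abs_mult) simp
    also have "\<dots> \<le> e * (norm (r1 - r2) * norm u)"
      using e norm_blinfun[of "r1 - r2" u] by (intro mult_left_mono) auto
    finally have f1: "\<bar>\<psi>' r - e\<^sup>2 * Dfun (Dfun \<phi>) y v u\<bar>
      \<le> e * (norm (r1 - r2) * norm u)" .
    have f2: "e * (norm (r1 - r2) * norm u) \<le> e * ((\<eta> / c) * (e * (2 * norm u + norm v)) * norm u)"
      using e rr by (intro mult_left_mono mult_right_mono) auto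
    have f3: "e * ((\<eta> / c) * (e * (2 * norm u + norm v)) * norm u)
      = (\<eta> * e\<^sup>2) * ((2 * norm u + norm v) * norm u / c)" by (simp add: power2_eq_square)
    have "(2 * norm u + norm v) * norm u \<le> c" unfolding c_def by (intro mult_mono) auto
    then have "(2 * norm u + norm v) * norm u / c \<le> 1" using c by simp
    then have "(\<eta> * e\<^sup>2) * ((2 * norm u + norm v) * norm u / c) \<le> (\<eta> * e\<^sup>2) * 1"
      using \<eta> by (intro mult_left_mono) auto
    with order_trans[OF f1 f2]
    have fin: "\<bar>\<psi>' r - e\<^sup>2 * Dfun (Dfun \<phi>) y v u\<bar> \<le> \<eta> * e\<^sup>2"
      unfolding f3 mult_1_right by (rule order_trans)
    have "y + e *\<^sub>R v + 1 *\<^sub>R (e *\<^sub>R u) = y + e *\<^sub>R u + e *\<^sub>R v" by (simp only: scaleR_one add_ac)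
    then have "\<psi> 1 - \<psi> 0 = \<phi> (y + e *\<^sub>R u + e *\<^sub>R v) - \<phi> (y + e *\<^sub>R u) - \<phi> (y + e *\<^sub>R v) + \<phi> y"
      unfolding \<psi>_def by (simp only: scaleR_one scaleR_zero_left add_0_right)
    with fin r(3) show "\<bar>\<phi> (y + e *\<^sub>R u + e *\<^sub>R v) - \<phi> (y + e *\<^sub>R u) - \<phi> (y + e *\<^sub>R v) + \<phi> y
      - e\<^sup>2 * Dfun (Dfun \<phi>) y v u\<bar> \<le> \<eta> * e\<^sup>2"
      by (simp only:)
  qed
qed

text \<open>The second difference does not change when \<open>u\<close> and \<open>v\<close> are exchanged, so its limit is symmetric.
  Symmetry merges the mixed second order terms of the expansion of \<open>\<phi>(Y)\<close> and makes \<open>D\<^sup>2\<phi>\<close> composed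
  with \<open>Y'\<close> a symmetric form to which geometricity of the rough path applies.\<close>

lemma Cb_second_derivative_symmetric:
  assumes \<phi>: "\<phi> \<in> Cb \<gamma>"
  shows "Dfun (Dfun \<phi>) y u v =
    Dfun (Dfun \<phi>) y v u"
proof -
  let ?a = "Dfun (Dfun \<phi>) y u v"
  let ?b = "Dfun (Dfun \<phi>) y v u"
  have "\<bar>?a - ?b\<bar> \<le> 0 + \<eta>" if \<eta>: "\<eta> > 0" for \<eta>
  proof -
    let ?\<Delta> = "\<lambda>e. \<phi> (y + e *\<^sub>R u + e *\<^sub>R v) - \<phi> (y + e *\<^sub>R u) - \<phi> (y + e *\<^sub>R v) + \<phi> y"
    have \<eta>2: "\<eta> / 2 > 0" using \<eta> by simp
    from Cb_second_difference[OF \<phi> \<eta>2, of y u v]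
    obtain e1 where e1: "e1 > 0"
      "\<forall>e. 0 < e \<and> e < e1 \<longrightarrow> \<bar>?\<Delta> e - e\<^sup>2 * ?b\<bar> \<le> \<eta> / 2 * e\<^sup>2"
      by (elim exE conjE) (rule that)
    from Cb_second_difference[OF \<phi> \<eta>2, of y v u]
    obtain e2 where e2: "e2 > 0" "\<forall>e. 0 < e \<and> e < e2 \<longrightarrow>
        \<bar>\<phi> (y + e *\<^sub>R v + e *\<^sub>R u) - \<phi> (y + e *\<^sub>R v) - \<phi> (y + e *\<^sub>R u) + \<phi> y - e\<^sup>2 * ?a\<bar> \<le> \<eta> / 2 * e\<^sup>2"
      by (elim exE conjE) (rule that)
    define e where "e = min e1 e2 / 2"
    have e: "0 < e" "e < e1" "e < e2" using e1(1) e2(1) by (auto simp: e_def)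
    have "y + e *\<^sub>R v + e *\<^sub>R u = y + e *\<^sub>R u + e *\<^sub>R v" by (simp only: add_ac)
    with e2(2)[rule_format, OF conjI[OF e(1,3)]] have "\<bar>?\<Delta> e - e\<^sup>2 * ?a\<bar> \<le> \<eta> / 2 * e\<^sup>2" by (simp only:)
    with e1(2)[rule_format, OF conjI[OF e(1,2)]] have "\<bar>e\<^sup>2 * ?a - e\<^sup>2 * ?b\<bar> \<le> \<eta> * e\<^sup>2" by linarith
    then have "e\<^sup>2 * \<bar>?a - ?b\<bar> \<le> e\<^sup>2 * \<eta>"
      by (simp only: right_diff_distrib[symmetric] abs_mult) (simp add: mult.commute)
    then show ?thesis using e by simp
  qed
  then have "\<bar>?a - ?b\<bar> \<le> 0" using field_le_epsilon by blast
  then show ?thesis by simp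
qed


section \<open>Partitions and rough sums\<close>

lemma steps_image:
  fixes p :: "nat => real"
  assumes p: "\<And>i j. i < j ==> j \<le> m ==> p i < p j"
  shows "steps (p ` {..m}) = (\<lambda>i. (p i, p (Suc i))) ` {..<m}"
proof (intro set_eqI iffI; clarify)
  fix u v assume uv: "(u, v) \<in> steps (p ` {..m})"
  then obtain i j where ij: "i \<le> m" "j \<le> m" "u = p i" "v = p j" "p i < p j"
    "p ` {..m} \<inter> {u<..<v} = {}" by (auto simp: steps_def)
  have "i < j" using ij p by (metis less_asym linorder_less_linear)
  moreover have "\<not> Suc i < j"
  proof
    assume "Suc i < j"
    then have "p i < p (Suc i)" "p (Suc i) < p j" "Suc i \<le> m"
      using ij p[of i "Suc i"] p[of "Suc i" j] by auto
    then have "p (Suc i) \<in> p ` {..m} \<inter> {u<..<v}" using ij by auto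
    then show False using ij by blast
  qed
  ultimately have "j = Suc i" by simp
  then show "(u, v) \<in> (\<lambda>i. (p i, p (Suc i))) ` {..<m}" using ij by auto
next
  fix u v i assume i: "i < m"
  have "p j \<le> p i \<or> p (Suc i) \<le> p j" if "j \<le> m" for j
  proof -
    consider "j < i" | "j = i" | "j = Suc i" | "Suc i < j" by linarith
    then show ?thesis
      by cases (use p[of j i] p[of "Suc i" j] that i in auto)
  qed
  then show "(p i, p (Suc i)) \<in> steps (p ` {..m})"
    using i p[of i "Suc i"] unfolding steps_def by (auto simp: not_less[symmetric])
qed

lemma sum_steps_image:
  fixes p :: "nat => real"
  assumes p: "\<And>i j. i < j ==> j \<le> m ==> p i < p j"
  shows "(\<Sum>(u, v)\<in>steps (p ` {..m}). f u v) = (\<Sum>i<m. f (p i) (p (Suc i)))"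
proof -
  have "inj_on (\<lambda>i. (p i, p (Suc i))) {..<m}"
    using p by (intro inj_onI) (metis fst_conv lessThan_iff less_irrefl less_imp_le linorder_neqE_nat)
  then show ?thesis using steps_image[of m p, OF p] by (simp add: sum.reindex)
qed

lemma partition_enumeration:
  fixes P :: "real set"
  assumes "finite P" "P \<noteq> {}"
  obtains p and m :: nat where "\<And>i j. i < j ==> j \<le> m ==> p i < p j" "P = p ` {..m}"
proof -
  let ?l = "sorted_list_of_set P"
  define m where "m = card P - 1"
  have len: "length ?l = Suc m" using assms by (simp add: m_def card_gt_0_iff)
  show thesis
  proof (rule that[of m "\<lambda>i. ?l ! i"])
    show "?l ! i < ?l ! j" if "i < j" "j \<le> m" for i j
      using that len strict_sorted_list_of_set[of P] by (simp add: sorted_wrt_nth_less)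
    have "P = set ?l" using assms by simp
    also have "\<dots> = (!) ?l ` {..m}"
      using len by (auto simp: set_conv_nth less_Suc_eq_le)
    finally show "P = (!) ?l ` {..m}" .
  qed
qed

lemma finite_steps:
  assumes "finite P"
  shows "finite (steps P)"
  by (rule finite_subset[of _ "P \<times> P"]) (use assms in \<open>auto simp: steps_def\<close>)

lemma sum_steps_telescope:
  fixes f :: "real => 'b::ab_group_add"
  assumes P: "P \<in> partitions T" and t: "0 \<le> t" "t \<le> T"
  shows "(\<Sum>(u, v)\<in>{(u, v) \<in> steps P. u < t}. f (min v t) - f u) = f t - f 0"
proof -
  have fin: "finite P" and ne: "P \<noteq> {}" and P0: "0 \<in> P" "T \<in> P" and PT: "P \<subseteq> {0..T}"
    using P by (auto simp: partitions_def)
  obtain p and m :: nat where p: "\<And>i j. i < j ==> j \<le> m ==> p i < p j" and Pp: "P = p ` {..m}"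
    by (rule partition_enumeration[OF fin ne]) (rule that)
  have le: "p i \<le> p j" if "i \<le> j" "j \<le> m" for i j using p[of i j] that by (cases "i = j") auto
  obtain i0 where i0: "i0 \<le> m" "p i0 = 0" using P0 Pp by auto
  obtain iT where iT: "iT \<le> m" "p iT = T" using P0 Pp by auto
  have "p 0 \<in> P" "p m \<in> P" using Pp by auto
  then have p0: "p 0 = 0" and pm: "p m = T"
    using le[of 0 i0] le[of iT m] i0 iT PT by (auto intro: antisym)
  have "(\<Sum>(u, v)\<in>{(u, v) \<in> steps P. u < t}. f (min v t) - f u)
      = (\<Sum>(u, v)\<in>steps P. if u < t then f (min v t) - f u else 0)"
  proof -
    have "{(u, v) \<in> steps P. u < t} = steps P \<inter> {x. fst x < t}" by auto
    then show ?thesis using finite_steps[OF fin]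
      by (simp add: sum.inter_restrict split_beta)
  qed
  also have "\<dots> = (\<Sum>(u, v)\<in>steps P. f (min v t) - f (min u t))"
    by (intro sum.cong) (auto simp: steps_def min_def)
  also have "\<dots> = (\<Sum>i<m. f (min (p (Suc i)) t) - f (min (p i) t))"
    unfolding Pp by (rule sum_steps_image[OF p])
  also have "\<dots> = f (min (p m) t) - f (min (p 0) t)"
    by (rule sum_lessThan_telescope)
  finally show ?thesis using p0 pm t by simp
qed

lemma eventually_mesh_to_zero:
  assumes "\<delta> > 0" "\<And>P. P \<in> partitions T ==> (\<And>u v. (u, v) \<in> steps P ==> v - u < \<delta>) ==> Q P"
  shows "eventually Q (mesh_to_zero T)"
  unfolding mesh_to_zero_def
  by (rule eventually_INF1[of \<delta>]) (use assms in \<open>auto simp: eventually_principal\<close>)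

lemma filterlim_mesh_to_zero:
  assumes "\<And>k. P k \<in> partitions T" "\<And>k u v. (u, v) \<in> steps (P k) ==> v - u \<le> m k" "(m \<longlongrightarrow> 0) F"
  shows "filterlim P (mesh_to_zero T) F"
  unfolding mesh_to_zero_def filterlim_INF filterlim_principal
proof (intro ballI)
  fix \<delta> :: real assume "\<delta> \<in> {0<..}"
  then have "eventually (\<lambda>k. m k < \<delta>) F" using assms(3) order_tendstoD(2) by fastforce
  then show "\<forall>\<^sub>F k in F. P k \<in> {P \<in> partitions T. \<forall>(u, v)\<in>steps P. v - u < \<delta>}"
    by eventually_elim (use assms(1,2) in \<open>fastforce intro: order_le_less_trans\<close>)
qed

text \<open>Summing a local error of order \<open>\<theta> > 1\<close> over a partition leaves at most \<open>mesh\<^sup>\<theta>\<^sup>-\<^sup>1\<close> times the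
  total length, so a path whose increments are known up to such an error is the limit of the rough
  sums.\<close>

lemma has_rough_integral_germ:
  fixes Z :: "real => ('v::fin_dim_banach \<Rightarrow>\<^sub>L 'e::real_normed_vector)"
  assumes T: "0 < T" and J: "continuous_on {0..T} J" "J 0 = 0" and \<theta>: "1 < \<theta>" and C: "0 \<le> C"
    and germ: "\<And>u v. 0 \<le> u ==> u < v ==> v \<le> T ==>
      norm (J v - J u - (Z u (X v - X u) + tensor_lift (Z' u) (XX u v))) \<le> C * (v - u) powr \<theta>"
  shows "has_rough_integral T X XX Z Z' J"
  unfolding has_rough_integral_def
proof
  show "uniform_limit {0..T} (rough_sum X XX Z Z') J (mesh_to_zero T)"
    unfolding uniform_limit_iff
  proof (intro allI impI)
    fix e :: real assume e: "e > 0"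
    define \<delta> where "\<delta> = (e / (2 * (C + 1) * T)) powr (1 / (\<theta> - 1))"
    have d0: "\<delta> > 0" using e C T by (simp add: \<delta>_def)
    have dp: "\<delta> powr (\<theta> - 1) = e / (2 * (C + 1) * T)"
      using e C T \<theta> by (simp add: \<delta>_def powr_powr)
    show "\<forall>\<^sub>F P in mesh_to_zero T. \<forall>t\<in>{0..T}. dist (rough_sum X XX Z Z' P t) (J t) < e"
    proof (rule eventually_mesh_to_zero[OF d0], intro ballI)
      fix P t assume P: "P \<in> partitions T" and mesh: "\<And>u v. (u, v) \<in> steps P ==> v - u < \<delta>"
        and t: "t \<in> {0..T}"
      let ?S = "{(u, v) \<in> steps P. u < t}"
      let ?A = "\<lambda>u v. Z u (X v - X u) + tensor_lift (Z' u) (XX u v)"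
      have "J t = (\<Sum>(u, v)\<in>?S. J (min v t) - J u)"
        using sum_steps_telescope[OF P, of t J] t J(2) by simp
      then have eq: "rough_sum X XX Z Z' P t - J t = (\<Sum>(u, v)\<in>?S. ?A u (min v t) - (J (min v t) - J u))"
        unfolding rough_sum_def by (simp add: sum_subtractf[symmetric] split_beta)
      have bound: "norm (?A u (min v t) - (J (min v t) - J u)) \<le> C * \<delta> powr (\<theta> - 1) * (min v t - u)"
        if uv: "(u, v) \<in> steps P" "u < t" for u v
      proof -
        let ?w = "min v t"
        have u: "0 \<le> u" "u < ?w" "?w \<le> T" "?w - u < \<delta>"
          using uv P t mesh[of u v] by (auto simp: steps_def partitions_def)
        have pw: "(?w - u) powr \<theta> = (?w - u) powr (\<theta> - 1) * (?w - u)"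
          using u powr_add[of "?w - u" "\<theta> - 1" 1] by simp
        have "norm (?A u ?w - (J ?w - J u)) \<le> C * ((?w - u) powr (\<theta> - 1) * (?w - u))"
          using germ[OF u(1-3)] unfolding pw by (simp add: norm_minus_commute)
        moreover have "C * ((?w - u) powr (\<theta> - 1) * (?w - u)) \<le> C * (\<delta> powr (\<theta> - 1) * (?w - u))"
          using u \<theta> C by (intro mult_left_mono mult_right_mono powr_mono2) auto
        ultimately show ?thesis by (simp only: mult.assoc)
      qed
      have "norm (rough_sum X XX Z Z' P t - J t) \<le> (\<Sum>x\<in>?S. C * \<delta> powr (\<theta> - 1) * (min (snd x) t - fst x))"
        unfolding eq by (rule sum_norm_le) (use bound in auto)
      also have "\<dots> = C * \<delta> powr (\<theta> - 1) * (\<Sum>(u, v)\<in>?S. min v t - u)"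
        by (simp only: sum_distrib_left case_prod_unfold)
      also have "(\<Sum>(u, v)\<in>?S. min v t - u) = t"
        using sum_steps_telescope[OF P, of t "\<lambda>x. x"] t by simp
      also have "C * \<delta> powr (\<theta> - 1) * t \<le> (C + 1) * \<delta> powr (\<theta> - 1) * T"
        using t C by (intro mult_mono) auto
      also have "\<dots> = e / 2"
      proof -
        have "c \<noteq> 0 ==> c * (e / (2 * c * T)) * T = e / 2" for c using T by simp
        then show ?thesis unfolding dp using C by (metis add_nonneg_pos less_irrefl zero_less_one)
      qed
      finally show "dist (rough_sum X XX Z Z' P t) (J t) < e" using e by (simp add: dist_norm)
    qed
  qed
qed (rule J)

definition grid :: "real => real => nat => real set"
  where "grid a b N = (\<lambda>i. a + real i * (b - a) / real N) ` {..N}"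

lemma grid_subset: "a \<le> b ==> grid a b N \<subseteq> {a..b}"
proof
  fix x assume "a \<le> b" "x \<in> grid a b N"
  then obtain i where i: "i \<le> N" "x = a + real i * (b - a) / real N" by (auto simp: grid_def)
  have "real i / real N \<le> 1" using i by (cases "N = 0") auto
  then have "real i / real N * (b - a) \<le> 1 * (b - a)" using \<open>a \<le> b\<close> by (intro mult_right_mono) auto
  then show "x \<in> {a..b}" using i \<open>a \<le> b\<close> by auto
qed

lemma grid_ends:
  assumes "N > 0"
  shows "a \<in> grid a b N" "b \<in> grid a b N"
proof -
  have "a = a + real 0 * (b - a) / real N" "b = a + real N * (b - a) / real N" using assms by auto
  then show "a \<in> grid a b N" "b \<in> grid a b N" unfolding grid_def by (blast intro: image_eqI)+
qed

lemma grid_next: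
  assumes "a \<le> u" "u < b" "N > 0"
  shows "\<exists>p\<in>grid a b N. u < p \<and> p \<le> u + (b - a) / real N"
proof -
  define h where "h = (b - a) / real N"
  have h: "h > 0" using assms by (simp add: h_def)
  define i where "i = nat \<lfloor>(u - a) / h\<rfloor>"
  have q: "0 \<le> (u - a) / h" using assms h by simp
  have i: "real i \<le> (u - a) / h" "(u - a) / h < real i + 1"
    using q unfolding i_def by linarith+
  have "(u - a) / h < real N" using assms h by (simp add: h_def field_simps)
  then have iN: "Suc i \<le> N" using i by linarith
  have "a + real (Suc i) * h \<in> grid a b N"
    using iN unfolding grid_def h_def by (intro image_eqI[of _ _ "Suc i"]) auto
  moreover have "u < a + real (Suc i) * h" "a + real (Suc i) * h \<le> u + h"
    using i h by (auto simp: field_simps)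
  ultimately show ?thesis unfolding h_def by blast
qed

definition dyadic_partition :: "real => real => real => nat => real set"
  where "dyadic_partition T s t k = grid 0 s (2 ^ k) \<union> grid s t (2 ^ k) \<union> grid t T (2 ^ k)"

lemma dyadic_partition:
  assumes "0 \<le> s" "s < t" "t \<le> T"
  shows "dyadic_partition T s t k \<in> partitions T"
    and "(u, v) \<in> steps (dyadic_partition T s t k) ==> v - u \<le> T / 2 ^ k"
    and "dyadic_partition T s t k \<inter> {s..t} = grid s t (2 ^ k)"
    and "s \<in> dyadic_partition T s t k" "t \<in> dyadic_partition T s t k"
proof -
  let ?P = "dyadic_partition T s t k"
  have sub: "grid 0 s (2 ^ k) \<subseteq> {0..s}" "grid s t (2 ^ k) \<subseteq> {s..t}" "grid t T (2 ^ k) \<subseteq> {t..T}"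
    using assms by (auto intro!: grid_subset)
  have ends: "0 \<in> grid 0 s (2 ^ k)" "s \<in> grid s t (2 ^ k)" "t \<in> grid s t (2 ^ k)" "T \<in> grid t T (2 ^ k)"
    by (auto intro!: grid_ends)
  show "s \<in> ?P" "t \<in> ?P" using ends by (auto simp: dyadic_partition_def)
  show "?P \<inter> {s..t} = grid s t (2 ^ k)"
    unfolding dyadic_partition_def using sub ends by fastforce
  show PT: "?P \<in> partitions T"
  proof -
    have "finite ?P" by (simp add: dyadic_partition_def grid_def)
    moreover have "?P \<subseteq> {0..T}"
    proof -
      have "{0..s} \<subseteq> {0..T}" "{s..t} \<subseteq> {0..T}" "{t..T} \<subseteq> {0..T}" using assms by auto
      then show ?thesis unfolding dyadic_partition_def using sub by blast
    qed
    ultimately show ?thesis using ends by (auto simp: partitions_def dyadic_partition_def)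
  qed
  assume uv: "(u, v) \<in> steps ?P"
  then have u: "0 \<le> u" "u < v" "v \<le> T" and e: "?P \<inter> {u<..<v} = {}"
    using PT by (auto simp: steps_def partitions_def)
  have "\<exists>p\<in>?P. u < p \<and> p \<le> u + T / 2 ^ k"
  proof -
    have next_point: "\<exists>p\<in>?P. u < p \<and> p \<le> u + T / 2 ^ k"
      if ab: "a \<le> u" "u < b" "0 \<le> a" "b \<le> T" "grid a b (2 ^ k) \<subseteq> ?P" for a b
    proof -
      have "(b - a) / 2 ^ k \<le> T / 2 ^ k" using ab by (intro divide_right_mono) auto
      moreover obtain p where "p \<in> grid a b (2 ^ k)" "u < p" "p \<le> u + (b - a) / 2 ^ k"
        using grid_next[OF ab(1,2), of "2 ^ k"] by auto
      ultimately show ?thesis using ab(5) by (intro bexI[of _ p]) auto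
    qed
    have "0 \<le> s" "s \<le> T" "0 \<le> t" using assms by auto
    moreover have "grid 0 s (2 ^ k) \<subseteq> ?P" "grid s t (2 ^ k) \<subseteq> ?P" "grid t T (2 ^ k) \<subseteq> ?P"
      by (auto simp: dyadic_partition_def)
    moreover consider "u < s" | "s \<le> u" "u < t" | "t \<le> u" "u < T" using u by linarith
    ultimately show ?thesis
      using next_point[of 0 s] next_point[of s t] next_point[of t T] u(1) assms by cases blast+
  qed
  then obtain p where p: "p \<in> ?P" "u < p" "p \<le> u + T / 2 ^ k" by blast
  have "v \<le> p" using e p by force
  then show "v - u \<le> T / 2 ^ k" using p by simp
qed

text \<open>Along partitions whose nodes in \<open>[s,t]\<close> are the dyadic points of that interval, the increment over
  \<open>[s,t]\<close> of a rough sum is a dyadic sum of the germ.\<close>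

lemma dyadic_sum_difference:
  fixes A :: "real => real => 'b::ab_group_add" and k :: nat
  assumes st: "0 \<le> s" "s < t" "t \<le> T"
  defines "P \<equiv> dyadic_partition T s t k"
  shows "(\<Sum>(u, v)\<in>{(u, v) \<in> steps P. u < t}. A u (min v t))
      - (\<Sum>(u, v)\<in>{(u, v) \<in> steps P. u < s}. A u (min v s))
    = (\<Sum>i<2 ^ k. A (s + real i * (t - s) / 2 ^ k) (s + real (Suc i) * (t - s) / 2 ^ k))"
proof -
  note dp = dyadic_partition[OF st, of k, folded P_def]
  have fin: "finite (steps P)" using dp(1) by (intro finite_steps) (auto simp: partitions_def)
  have le: "min v r = v" if "(u, v) \<in> steps P" "u < r" "r \<in> P" for u v r
  proof -
    have "r \<notin> {u<..<v}" using that by (auto simp: steps_def)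
    then show ?thesis using that by (auto simp: min_def)
  qed
  have "(\<Sum>(u, v)\<in>{(u, v) \<in> steps P. u < t}. A u (min v t)) = (\<Sum>(u, v)\<in>{(u, v) \<in> steps P. u < t}. A u v)"
    by (intro sum.cong refl) (use le[OF _ _ dp(5)] in auto)
  moreover have "(\<Sum>(u, v)\<in>{(u, v) \<in> steps P. u < s}. A u (min v s)) = (\<Sum>(u, v)\<in>{(u, v) \<in> steps P. u < s}. A u v)"
    by (intro sum.cong refl) (use le[OF _ _ dp(4)] in auto)
  moreover have "(\<Sum>(u, v)\<in>{(u, v) \<in> steps P. u < t}. A u v)
      = (\<Sum>(u, v)\<in>{(u, v) \<in> steps P. u < s}. A u v) + (\<Sum>(u, v)\<in>{(u, v) \<in> steps P. s \<le> u \<and> u < t}. A u v)"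
  proof -
    have "{(u, v) \<in> steps P. u < t} = {(u, v) \<in> steps P. u < s} \<union> {(u, v) \<in> steps P. s \<le> u \<and> u < t}"
      using st by auto
    then show ?thesis
      by (simp only:) (intro sum.union_disjoint finite_subset[OF _ fin]; auto)
  qed
  moreover have "{(u, v) \<in> steps P. s \<le> u \<and> u < t} = steps (grid s t (2 ^ k))"
  proof -
    have "{(u, v) \<in> steps P. s \<le> u \<and> u < t} = steps (P \<inter> {s..t})"
    proof (intro set_eqI iffI; clarify)
      fix u v assume "(u, v) \<in> steps P" "s \<le> u" "u < t"
      then show "(u, v) \<in> steps (P \<inter> {s..t})"
        using le[OF _ _ dp(5), of u v] by (auto simp: steps_def)
    next
      fix u v assume uv: "(u, v) \<in> steps (P \<inter> {s..t})"
      then have "P \<inter> {u<..<v} = {}" by (force simp: steps_def)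
      then show "(u, v) \<in> steps P \<and> s \<le> u \<and> u < t" using uv by (auto simp: steps_def)
    qed
    then show ?thesis unfolding dp(3) .
  qed
  moreover have "(\<Sum>(u, v)\<in>steps (grid s t (2 ^ k)). A u v)
      = (\<Sum>i<2 ^ k. A (s + real i * (t - s) / 2 ^ k) (s + real (Suc i) * (t - s) / 2 ^ k))"
  proof -
    have "s + real i * (t - s) / real (2 ^ k) < s + real j * (t - s) / real (2 ^ k)" if "i < j" for i j
      using that st by (intro add_strict_left_mono divide_strict_right_mono mult_strict_right_mono) auto
    then show ?thesis
      unfolding grid_def by (subst sum_steps_image) auto
  qed
  ultimately show ?thesis by simp
qed


section \<open>Square integrable functions\<close>

definition sq_int :: "'o measure => ('o => 'b::{real_normed_vector,second_countable_topology}) => bool"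
  where "sq_int M f \<longleftrightarrow> f \<in> borel_measurable M \<and> integrable M (\<lambda>w. (norm (f w))\<^sup>2)"

definition l2 :: "'o measure => ('o => 'b::{real_normed_vector,second_countable_topology}) => real"
  where "l2 M f = sqrt (\<integral>w. (norm (f w))\<^sup>2 \<partial>M)"

lemma sq_int_measurable: "sq_int M f ==> f \<in> borel_measurable M"
  by (simp add: sq_int_def)

lemma l2_nonneg: "0 \<le> l2 M f"
  by (simp add: l2_def)

lemma l2_square: "(l2 M f)\<^sup>2 = (\<integral>w. (norm (f w))\<^sup>2 \<partial>M)"
  by (simp add: l2_def)

lemma sq_int_mult:
  assumes f: "sq_int M f" and g: "sq_int M g"
  shows "integrable M (\<lambda>w. norm (f w) * norm (g w))"
    and "(\<integral>w. norm (f w) * norm (g w) \<partial>M) \<le> l2 M f * l2 M g"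
proof -
  note [measurable] = sq_int_measurable[OF f] sq_int_measurable[OF g]
  have F: "integrable M (\<lambda>w. (norm (f w))\<^sup>2)" and G: "integrable M (\<lambda>w. (norm (g w))\<^sup>2)"
    using f g by (simp_all add: sq_int_def)
  show I: "integrable M (\<lambda>w. norm (f w) * norm (g w))"
  proof (rule Bochner_Integration.integrable_bound)
    show "integrable M (\<lambda>w. (norm (f w))\<^sup>2 + (norm (g w))\<^sup>2)" using F G by simp
    have "a * b \<le> a\<^sup>2 + b\<^sup>2" if "0 \<le> a" "0 \<le> b" for a b :: real
      using sum_squares_bound[of a b] that mult_nonneg_nonneg[OF that] by linarith
    then show "AE w in M. norm (norm (f w) * norm (g w)) \<le> norm ((norm (f w))\<^sup>2 + (norm (g w))\<^sup>2)"
      by (intro AE_I2) (simp add: abs_mult)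
  qed measurable
  define a where "a = (\<integral>w. (norm (f w))\<^sup>2 \<partial>M)"
  define b where "b = (\<integral>w. (norm (g w))\<^sup>2 \<partial>M)"
  define c where "c = (\<integral>w. norm (f w) * norm (g w) \<partial>M)"
  have nn: "0 \<le> a" "0 \<le> b" "0 \<le> c" unfolding a_def b_def c_def by (auto intro!: integral_nonneg_AE)
  have q: "0 \<le> a - 2 * r * c + r\<^sup>2 * b" for r
  proof -
    have "0 \<le> (\<integral>w. (norm (f w) - r * norm (g w))\<^sup>2 \<partial>M)" by simp
    also have "\<dots> = (\<integral>w. (norm (f w))\<^sup>2 - 2 * r * (norm (f w) * norm (g w)) + r\<^sup>2 * (norm (g w))\<^sup>2 \<partial>M)"
      by (intro Bochner_Integration.integral_cong refl) (simp add: power2_eq_square algebra_simps)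
    also have "\<dots> = a - 2 * r * c + r\<^sup>2 * b"
      unfolding a_def b_def c_def using F G I by simp
    finally show ?thesis .
  qed
  have "c\<^sup>2 \<le> a * b"
  proof (cases "b = 0")
    case True
    have "c = 0"
    proof (rule ccontr)
      assume "c \<noteq> 0"
      then show False using q[of "(a + 1) / c"] True nn(1) by simp
    qed
    then show ?thesis using True by simp
  next
    case False
    then have "0 \<le> (a - 2 * (c / b) * c + (c / b)\<^sup>2 * b) * b" using q[of "c / b"] nn by simp
    also have "\<dots> = a * b - c\<^sup>2" using False by (simp add: power2_eq_square field_simps)
    finally show ?thesis by simp
  qed
  then have "c \<le> sqrt (a * b)" by (rule real_le_rsqrt)
  then show "(\<integral>w. norm (f w) * norm (g w) \<partial>M) \<le> l2 M f * l2 M g"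
    unfolding l2_def a_def b_def c_def by (simp add: real_sqrt_mult)
qed

lemma sq_int_inner:
  fixes f g :: "'o => real"
  assumes f: "sq_int M f" and g: "sq_int M g"
  shows "integrable M (\<lambda>w. f w * g w)" and "\<bar>\<integral>w. f w * g w \<partial>M\<bar> \<le> l2 M f * l2 M g"
proof -
  note [measurable] = sq_int_measurable[OF f] sq_int_measurable[OF g]
  show "integrable M (\<lambda>w. f w * g w)"
    by (rule Bochner_Integration.integrable_bound[OF sq_int_mult(1)[OF f g]]) (auto simp: abs_mult)
  have "\<bar>\<integral>w. f w * g w \<partial>M\<bar> \<le> (\<integral>w. norm (f w) * norm (g w) \<partial>M)"
    using integral_norm_bound[of M "\<lambda>w. f w * g w"] by (simp add: abs_mult)
  then show "\<bar>\<integral>w. f w * g w \<partial>M\<bar> \<le> l2 M f * l2 M g" using sq_int_mult(2)[OF f g] by simp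
qed

lemma sq_int_mono:
  assumes "f \<in> borel_measurable M" "sq_int M g" "AE w in M. norm (f w) \<le> norm (g w)"
  shows "sq_int M f" "l2 M f \<le> l2 M g"
proof -
  have ae: "AE w in M. (norm (f w))\<^sup>2 \<le> (norm (g w))\<^sup>2"
    using assms(3) by eventually_elim (auto intro: power_mono)
  have G: "integrable M (\<lambda>w. (norm (g w))\<^sup>2)" using assms by (simp add: sq_int_def)
  have I: "integrable M (\<lambda>w. (norm (f w))\<^sup>2)"
    by (rule Bochner_Integration.integrable_bound[OF G]) (use assms(1) ae in auto)
  then show "sq_int M f" using assms by (simp add: sq_int_def)
  show "l2 M f \<le> l2 M g" unfolding l2_def
    by (intro real_sqrt_le_mono integral_mono_AE I G ae)
qed

lemma sq_int_add:
  assumes f: "sq_int M f" and g: "sq_int M g"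
  shows "sq_int M (\<lambda>w. f w + g w)" "l2 M (\<lambda>w. f w + g w) \<le> l2 M f + l2 M g"
proof -
  note [measurable] = sq_int_measurable[OF f] sq_int_measurable[OF g]
  let ?h = "\<lambda>w. norm (f w) + norm (g w)"
  have F: "integrable M (\<lambda>w. (norm (f w))\<^sup>2)" and G: "integrable M (\<lambda>w. (norm (g w))\<^sup>2)"
    using f g by (simp_all add: sq_int_def)
  note I = sq_int_mult[OF f g]
  have sq: "(norm (?h w))\<^sup>2 = (norm (f w))\<^sup>2 + 2 * (norm (f w) * norm (g w)) + (norm (g w))\<^sup>2" for w
    by (simp add: power2_eq_square algebra_simps)
  have H: "sq_int M ?h" unfolding sq_int_def sq using F G I(1) by simp
  have "(\<integral>w. (norm (?h w))\<^sup>2 \<partial>M) = (l2 M f)\<^sup>2 + 2 * (\<integral>w. norm (f w) * norm (g w) \<partial>M) + (l2 M g)\<^sup>2"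
    unfolding sq l2_square using F G I(1) by simp
  also have "\<dots> \<le> (l2 M f + l2 M g)\<^sup>2" using I(2) by (simp add: power2_sum)
  finally have h: "l2 M ?h \<le> l2 M f + l2 M g"
    unfolding l2_def[of M ?h] by (intro real_le_lsqrt) (auto simp: l2_nonneg)
  have "f \<in> borel_measurable M" "g \<in> borel_measurable M" by measurable
  then have m: "(\<lambda>w. f w + g w) \<in> borel_measurable M" by measurable
  show "sq_int M (\<lambda>w. f w + g w)"
    by (rule sq_int_mono(1)[OF m H]) (auto intro: norm_triangle_ineq)
  have "l2 M (\<lambda>w. f w + g w) \<le> l2 M ?h"
    by (rule sq_int_mono(2)[OF m H]) (auto intro: norm_triangle_ineq)
  then show "l2 M (\<lambda>w. f w + g w) \<le> l2 M f + l2 M g" using h by simp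
qed

lemma sq_int_minus: "sq_int M f ==> sq_int M (\<lambda>w. - f w)" "l2 M (\<lambda>w. - f w) = l2 M f"
  by (auto simp: sq_int_def l2_def)

lemma sq_int_diff:
  assumes "sq_int M f" "sq_int M g"
  shows "sq_int M (\<lambda>w. f w - g w)" "l2 M (\<lambda>w. f w - g w) \<le> l2 M f + l2 M g"
  using sq_int_add[OF assms(1) sq_int_minus(1)[OF assms(2)]] by (simp_all add: sq_int_minus(2))

lemma sq_int_scaleR:
  assumes "sq_int M f"
  shows "sq_int M (\<lambda>w. c *\<^sub>R f w)" "l2 M (\<lambda>w. c *\<^sub>R f w) = \<bar>c\<bar> * l2 M f"
  using assms by (auto simp: sq_int_def l2_def power_mult_distrib real_sqrt_mult)

lemma sq_int_zero: "sq_int M (\<lambda>w. 0)" "l2 M (\<lambda>w. 0) = 0"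
  by (auto simp: sq_int_def l2_def)

lemma sq_int_sum:
  assumes "\<And>i. i \<in> I ==> sq_int M (f i)"
  shows "sq_int M (\<lambda>w. \<Sum>i\<in>I. f i w)" "l2 M (\<lambda>w. \<Sum>i\<in>I. f i w) \<le> (\<Sum>i\<in>I. l2 M (f i))"
proof -
  have "sq_int M (\<lambda>w. \<Sum>i\<in>I. f i w) \<and> l2 M (\<lambda>w. \<Sum>i\<in>I. f i w) \<le> (\<Sum>i\<in>I. l2 M (f i))"
    using assms
  proof (induction I rule: infinite_finite_induct)
    case (insert i I)
    then have 1: "sq_int M (f i)" "sq_int M (\<lambda>w. \<Sum>i\<in>I. f i w)"
      "l2 M (\<lambda>w. \<Sum>i\<in>I. f i w) \<le> (\<Sum>i\<in>I. l2 M (f i))" by auto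
    show ?case using sq_int_add[OF 1(1,2)] 1(3) insert.hyps by simp
  qed (auto simp: sq_int_zero)
  then show "sq_int M (\<lambda>w. \<Sum>i\<in>I. f i w)" "l2 M (\<lambda>w. \<Sum>i\<in>I. f i w) \<le> (\<Sum>i\<in>I. l2 M (f i))"
    by auto
qed

lemma l2_leI: "(\<integral>w. (norm (f w))\<^sup>2 \<partial>M) \<le> c\<^sup>2 ==> 0 \<le> c ==> l2 M f \<le> c"
  unfolding l2_def by (rule real_le_lsqrt)

lemma (in prob_space) sq_int_integrable:
  fixes f :: "'a => 'b::{banach,second_countable_topology}"
  assumes f: "sq_int M f"
  shows "integrable M f" "(\<integral>w. norm (f w) \<partial>M) \<le> l2 M f"
proof -
  have one: "sq_int M (\<lambda>_. 1 :: real)" "l2 M (\<lambda>_. 1 :: real) = 1"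
    by (auto simp: sq_int_def l2_def prob_space)
  from sq_int_mult[OF f one(1)] one(2)
  show "(\<integral>w. norm (f w) \<partial>M) \<le> l2 M f" by simp
  from sq_int_mult(1)[OF f one(1)] have "integrable M (\<lambda>w. norm (f w))" by simp
  then show "integrable M f" using sq_int_measurable[OF f] by (simp add: integrable_norm_iff)
qed

lemma sq_int_bounded_mult:
  fixes f :: "'o => real"
  assumes f: "sq_int M f" and \<xi>: "\<xi> \<in> borel_measurable M" "AE w in M. \<bar>\<xi> w\<bar> \<le> C"
  shows "sq_int M (\<lambda>w. \<xi> w * f w)" "0 \<le> C ==> l2 M (\<lambda>w. \<xi> w * f w) \<le> C * l2 M f"
proof -
  note [measurable] = sq_int_measurable[OF f] \<xi>(1)
  have ae: "AE w in M. norm (\<xi> w * f w) \<le> norm (C *\<^sub>R f w)"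
    using \<xi>(2) by eventually_elim (auto simp: abs_mult intro!: mult_right_mono)
  have m: "(\<lambda>w. \<xi> w * f w) \<in> borel_measurable M" by measurable
  show "sq_int M (\<lambda>w. \<xi> w * f w)" "0 \<le> C ==> l2 M (\<lambda>w. \<xi> w * f w) \<le> C * l2 M f"
    using sq_int_mono[OF m sq_int_scaleR(1)[OF f] ae] sq_int_scaleR(2)[OF f, of C] by auto
qed


section \<open>Passage to the limit\<close>

text \<open>Second moments make the sequence uniformly integrable: clipping at level \<open>m\<close> changes each expectation
  by at most \<open>K\<^sup>2 / m\<close>, and the clipped variables converge by dominated convergence. The bound on the
  limit is Fatou's lemma.\<close>

lemma (in prob_space) expectation_tendsto_of_bounded_second_moment:
  fixes Z :: "nat => 'a => real"
  assumes Z: "\<And>k. sq_int M (Z k)" "\<And>k. l2 M (Z k) \<le> K"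
    and meas: "Z' \<in> borel_measurable M" and lim: "AE w in M. (\<lambda>k. Z k w) \<longlonglongrightarrow> Z' w"
  shows "sq_int M Z'" "l2 M Z' \<le> K" "(\<lambda>k. \<integral>w. Z k w \<partial>M) \<longlonglongrightarrow> (\<integral>w. Z' w \<partial>M)"
proof -
  note [measurable] = sq_int_measurable[OF Z(1)] meas
  have K: "0 \<le> K" using Z(2)[of 0] l2_nonneg[of M "Z 0"] by linarith
  have m2: "(\<integral>w. (Z k w)\<^sup>2 \<partial>M) \<le> K\<^sup>2" for k
    using power_mono[OF Z(2)[of k] l2_nonneg, of 2] l2_square[of M "Z k"] by simp
  have I2: "integrable M (\<lambda>w. (Z k w)\<^sup>2)" for k using Z(1)[of k] by (simp add: sq_int_def)
  have "(\<integral>\<^sup>+w. ennreal ((Z' w)\<^sup>2) \<partial>M) = (\<integral>\<^sup>+w. liminf (\<lambda>k. ennreal ((Z k w)\<^sup>2)) \<partial>M)"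
  proof (rule nn_integral_cong_AE)
    show "AE w in M. ennreal ((Z' w)\<^sup>2) = liminf (\<lambda>k. ennreal ((Z k w)\<^sup>2))"
      using lim
    proof eventually_elim
      case (elim w)
      then have "(\<lambda>k. ennreal ((Z k w)\<^sup>2)) \<longlonglongrightarrow> ennreal ((Z' w)\<^sup>2)" by (intro tendsto_intros) auto
      then show ?case by (rule lim_imp_Liminf[OF trivial_limit_sequentially, symmetric])
    qed
  qed
  also have "\<dots> \<le> liminf (\<lambda>k. \<integral>\<^sup>+w. ennreal ((Z k w)\<^sup>2) \<partial>M)"
    by (rule nn_integral_liminf) measurable
  also have "\<dots> \<le> ennreal (K\<^sup>2)"
  proof -
    have "(\<integral>\<^sup>+w. ennreal ((Z k w)\<^sup>2) \<partial>M) \<le> ennreal (K\<^sup>2)" for k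
      using nn_integral_eq_integral[OF I2, of k] m2[of k] by (simp add: ennreal_leI)
    then have "liminf (\<lambda>k. \<integral>\<^sup>+w. ennreal ((Z k w)\<^sup>2) \<partial>M) \<le> liminf (\<lambda>k. ennreal (K\<^sup>2))"
      by (intro Liminf_mono) auto
    then show ?thesis by (simp add: Liminf_const)
  qed
  finally have nn: "(\<integral>\<^sup>+w. ennreal ((Z' w)\<^sup>2) \<partial>M) \<le> ennreal (K\<^sup>2)" .
  then have I2': "integrable M (\<lambda>w. (Z' w)\<^sup>2)"
    by (intro integrableI_bounded) (auto intro: order_le_less_trans)
  then show sq': "sq_int M Z'" by (simp add: sq_int_def)
  have m2': "(\<integral>w. (Z' w)\<^sup>2 \<partial>M) \<le> K\<^sup>2"
    using nn nn_integral_eq_integral[OF I2'] by simp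
  then show "l2 M Z' \<le> K" using K by (intro l2_leI) auto
  \<comment> \<open>the clipping error \<open>\<bar>x - clip x\<bar>\<close> at level \<open>m\<close> is at most \<open>x\<^sup>2 / m\<close>\<close>
  define c where "c m x = max (- m) (min m x)" for m x :: real
  have c_err: "\<bar>x - c m x\<bar> \<le> x\<^sup>2 / m" if m: "m > 0" for m x
  proof (cases "\<bar>x\<bar> \<le> m")
    case True
    then show ?thesis using m by (auto simp: c_def)
  next
    case False
    have "\<bar>x - c m x\<bar> \<le> \<bar>x\<bar>" using m by (auto simp: c_def)
    also have "\<dots> \<le> \<bar>x\<bar> * \<bar>x\<bar> / m" using False m mult_left_mono[of m "\<bar>x\<bar>" "\<bar>x\<bar>"]
      by (simp add: pos_le_divide_eq mult.commute)
    finally show ?thesis by (simp add: power2_eq_square abs_mult[symmetric])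
  qed
  have c_m[measurable]: "(\<lambda>w. c m (f w)) \<in> borel_measurable M" if [measurable]: "f \<in> borel_measurable M" for m f
    unfolding c_def by measurable
  have c_b: "\<bar>c m x\<bar> \<le> m" if "m > 0" for m x using that by (auto simp: c_def)
  have c_i: "integrable M (\<lambda>w. c m (f w))" if "m > 0" "f \<in> borel_measurable M" for m f
    using that c_b by (intro integrable_const_bound[of _ m]) auto
  have err: "\<bar>(\<integral>w. f w \<partial>M) - (\<integral>w. c m (f w) \<partial>M)\<bar> \<le> K\<^sup>2 / m"
    if m: "m > 0" and f: "sq_int M f" "(\<integral>w. (f w)\<^sup>2 \<partial>M) \<le> K\<^sup>2" for m f
  proof -
    note [measurable] = sq_int_measurable[OF f(1)]
    have If: "integrable M f" "integrable M (\<lambda>w. (f w)\<^sup>2)"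
      using sq_int_integrable(1)[OF f(1)] f(1) by (auto simp: sq_int_def)
    have "(\<integral>w. f w \<partial>M) - (\<integral>w. c m (f w) \<partial>M) = (\<integral>w. f w - c m (f w) \<partial>M)"
      using If c_i[OF m] by simp
    also have "\<bar>\<dots>\<bar> \<le> (\<integral>w. (f w)\<^sup>2 / m \<partial>M)"
      using If c_i[OF m] c_err[OF m]
      by (intro order_trans[OF integral_abs_bound] integral_mono) auto
    also have "\<dots> \<le> K\<^sup>2 / m" using f(2) m by (simp add: divide_right_mono)
    finally show ?thesis .
  qed
  show "(\<lambda>k. \<integral>w. Z k w \<partial>M) \<longlonglongrightarrow> (\<integral>w. Z' w \<partial>M)"
  proof (rule LIMSEQ_I)
    fix r :: real assume r: "r > 0"
    define m where "m = 4 * (K\<^sup>2 + 1) / r"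
    have m: "m > 0" using r by (simp add: m_def add_nonneg_pos)
    have K1: "K\<^sup>2 + 1 > 0" by (simp add: add_nonneg_pos)
    have "K\<^sup>2 / m = (K\<^sup>2 / (K\<^sup>2 + 1)) * (r / 4)" using r K1 by (simp add: m_def)
    also have "\<dots> \<le> 1 * (r / 4)" using r K1 by (intro mult_right_mono) auto
    finally have Km: "K\<^sup>2 / m < r / 3" using r by simp
    have "(\<lambda>k. \<integral>w. c m (Z k w) \<partial>M) \<longlonglongrightarrow> (\<integral>w. c m (Z' w) \<partial>M)"
    proof (rule integral_dominated_convergence[where w="\<lambda>_. m"])
      show "AE w in M. (\<lambda>k. c m (Z k w)) \<longlonglongrightarrow> c m (Z' w)"
        using lim unfolding c_def by eventually_elim (intro tendsto_max tendsto_min tendsto_const)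
    qed (use c_b[OF m] in auto)
    then obtain N where N: "\<And>k. k \<ge> N ==> \<bar>(\<integral>w. c m (Z k w) \<partial>M) - (\<integral>w. c m (Z' w) \<partial>M)\<bar> < r / 3"
      using LIMSEQ_D[of "\<lambda>k. \<integral>w. c m (Z k w) \<partial>M" _ "r / 3"] r
      by (metis divide_pos_pos real_norm_def zero_less_numeral)
    show "\<exists>no. \<forall>k\<ge>no. norm ((\<integral>w. Z k w \<partial>M) - (\<integral>w. Z' w \<partial>M)) < r"
    proof (intro exI[of _ N] allI impI)
      fix k assume k: "N \<le> k"
      show "norm ((\<integral>w. Z k w \<partial>M) - (\<integral>w. Z' w \<partial>M)) < r"
        using N[OF k] err[OF m Z(1) m2, of k] err[OF m sq' m2'] Km unfolding real_norm_def by linarith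
    qed
  qed
qed

text \<open>Exceptional sets are covered by measurable ones, as in the uniform notion, so that the limit need not
  be measurable.\<close>

definition tends_in_prob :: "'o measure => (nat => 'o => 'e::real_normed_vector) => ('o => 'e) => bool"
  where "tends_in_prob M S Z \<longleftrightarrow> (\<forall>\<epsilon>>0. \<forall>\<eta>>0. \<forall>\<^sub>F k in sequentially. \<exists>A\<in>sets M. measure M A < \<eta> \<and>
     (\<forall>w\<in>space M - A. norm (S k w - Z w) \<le> \<epsilon>))"

lemma (in finite_measure) tends_in_prob_AE_subseq:
  assumes "tends_in_prob M S Z"
  obtains r where "strict_mono r" "AE w in M. (\<lambda>k. S (r k) w) \<longlonglongrightarrow> Z w"
proof -
  define Q where "Q n k \<longleftrightarrow> (\<exists>A\<in>sets M. measure M A < (1/2) ^ n \<and>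
     (\<forall>w\<in>space M - A. norm (S k w - Z w) \<le> (1/2) ^ n))" for n k
  have "\<forall>\<^sub>F k in sequentially. Q n k" for n
    using assms[unfolded tends_in_prob_def, rule_format, of "(1/2)^n" "(1/2)^n"] by (simp add: Q_def)
  then have "\<exists>N. \<forall>k\<ge>N. Q n k" for n by (simp add: eventually_sequentially)
  then obtain N where N: "\<And>n k. k \<ge> N n ==> Q n k" by metis
  define r where "r = rec_nat (N 0) (\<lambda>n m. max (Suc m) (N (Suc n)))"
  have rS: "r (Suc n) = max (Suc (r n)) (N (Suc n))" for n by (simp add: r_def)
  have mono: "strict_mono r" by (rule strict_monoI_Suc) (simp add: rS)
  have "r n \<ge> N n" for n by (cases n) (simp add: r_def, simp add: rS)
  then have "\<exists>A\<in>sets M. measure M A < (1/2) ^ n \<and>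
     (\<forall>w\<in>space M - A. norm (S (r n) w - Z w) \<le> (1/2) ^ n)" for n using N[of n "r n"] by (simp add: Q_def)
  then obtain A where A: "\<And>n. A n \<in> sets M" "\<And>n. measure M (A n) < (1/2) ^ n"
    "\<And>n w. w \<in> space M - A n ==> norm (S (r n) w - Z w) \<le> (1/2) ^ n" by metis
  have "AE w in M. eventually (\<lambda>n. w \<in> space M - A n) sequentially"
  proof (rule borel_cantelli_AE1)
    show "summable (\<lambda>n. measure M (A n))"
      by (rule summable_comparison_test'[of "\<lambda>n. (1/2) ^ n" 0])
        (use A(2) in \<open>auto simp: summable_geometric less_imp_le\<close>)
  qed (use A(1) in \<open>auto simp: emeasure_eq_measure\<close>)
  then have "AE w in M. (\<lambda>k. S (r k) w) \<longlonglongrightarrow> Z w"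
  proof eventually_elim
    case (elim w)
    then have "\<forall>\<^sub>F n in sequentially. norm (S (r n) w - Z w) \<le> (1/2) ^ n"
      by eventually_elim (rule A(3))
    then have "(\<lambda>n. S (r n) w - Z w) \<longlonglongrightarrow> 0"
      by (rule Lim_null_comparison) (intro LIMSEQ_realpow_zero, auto)
    then show ?case by (simp add: LIM_zero_iff)
  qed
  with mono show thesis by (rule that)
qed

lemma (in finite_measure) tends_in_prob_add:
  assumes S: "tends_in_prob M S Z" and S': "tends_in_prob M S' Z'"
  shows "tends_in_prob M (\<lambda>k w. S k w + S' k w) (\<lambda>w. Z w + Z' w)"
  unfolding tends_in_prob_def
proof (intro allI impI)
  fix \<epsilon> \<eta> :: real assume e: "0 < \<epsilon>" "0 < \<eta>"
  then have e2: "0 < \<epsilon> / 2" "0 < \<eta> / 2" by auto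
  from S[unfolded tends_in_prob_def, rule_format, OF e2] S'[unfolded tends_in_prob_def, rule_format, OF e2]
  show "\<forall>\<^sub>F k in sequentially. \<exists>A\<in>sets M. measure M A < \<eta> \<and>
     (\<forall>w\<in>space M - A. norm (S k w + S' k w - (Z w + Z' w)) \<le> \<epsilon>)"
  proof eventually_elim
    case (elim k)
    then obtain A A' where A: "A \<in> sets M" "measure M A < \<eta> / 2"
        "\<And>w. w \<in> space M - A ==> norm (S k w - Z w) \<le> \<epsilon> / 2"
      and A': "A' \<in> sets M" "measure M A' < \<eta> / 2"
        "\<And>w. w \<in> space M - A' ==> norm (S' k w - Z' w) \<le> \<epsilon> / 2" by blast
    show ?case
    proof (intro bexI[of _ "A \<union> A'"] conjI ballI)
      show "measure M (A \<union> A') < \<eta>"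
        using measure_Un_le[OF A(1) A'(1)] A(2) A'(2) by simp
      fix w assume "w \<in> space M - (A \<union> A')"
      then have "norm (S k w - Z w) \<le> \<epsilon> / 2" "norm (S' k w - Z' w) \<le> \<epsilon> / 2" using A(3) A'(3) by auto
      then show "norm (S k w + S' k w - (Z w + Z' w)) \<le> \<epsilon>"
        using norm_triangle_ineq[of "S k w - Z w" "S' k w - Z' w"] by (simp add: algebra_simps)
    qed (use A A' in auto)
  qed
qed

lemma tends_in_prob_bounded_linear:
  assumes S: "tends_in_prob M S Z" and f: "bounded_linear f"
  shows "tends_in_prob M (\<lambda>k w. f (S k w)) (\<lambda>w. f (Z w))"
  unfolding tends_in_prob_def
proof (intro allI impI)
  fix \<epsilon> \<eta> :: real assume e: "0 < \<epsilon>" "0 < \<eta>"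
  obtain K where K: "K > 0" "\<And>x. norm (f x) \<le> norm x * K" using bounded_linear.pos_bounded[OF f] by blast
  have e': "0 < \<epsilon> / K" using e K by simp
  from S[unfolded tends_in_prob_def, rule_format, OF e' e(2)]
  show "\<forall>\<^sub>F k in sequentially. \<exists>A\<in>sets M. measure M A < \<eta> \<and>
     (\<forall>w\<in>space M - A. norm (f (S k w) - f (Z w)) \<le> \<epsilon>)"
  proof eventually_elim
    case (elim k)
    then obtain A where A: "A \<in> sets M" "measure M A < \<eta>"
        "\<And>w. w \<in> space M - A ==> norm (S k w - Z w) \<le> \<epsilon> / K" by blast
    have "norm (f (S k w) - f (Z w)) \<le> \<epsilon>" if "w \<in> space M - A" for w
    proof -
      have "norm (f (S k w) - f (Z w)) \<le> norm (S k w - Z w) * K"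
        using K(2)[of "S k w - Z w"] by (simp add: linear_diff[OF bounded_linear.linear[OF f]])
      also have "\<dots> \<le> \<epsilon> / K * K" using A(3)[OF that] K(1) by (intro mult_right_mono) auto
      finally show ?thesis using K by simp
    qed
    then show ?case using A by blast
  qed
qed

lemma (in finite_measure) tends_in_prob_of_l2:
  fixes S :: "nat => 'a => real"
  assumes S: "\<And>k. sq_int M (S k)" "(\<lambda>k. l2 M (S k)) \<longlonglongrightarrow> 0"
  shows "tends_in_prob M S (\<lambda>w. 0)"
  unfolding tends_in_prob_def
proof (intro allI impI)
  fix \<epsilon> \<eta> :: real assume e: "0 < \<epsilon>" "0 < \<eta>"
  have "(\<lambda>k. (l2 M (S k))\<^sup>2 / \<epsilon>\<^sup>2) \<longlonglongrightarrow> 0\<^sup>2 / \<epsilon>\<^sup>2" using S(2) e by (intro tendsto_intros) auto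
  then have "\<forall>\<^sub>F k in sequentially. (l2 M (S k))\<^sup>2 / \<epsilon>\<^sup>2 < \<eta>" using e(2) by (auto dest: order_tendstoD(2))
  then show "\<forall>\<^sub>F k in sequentially. \<exists>A\<in>sets M. measure M A < \<eta> \<and>
     (\<forall>w\<in>space M - A. norm (S k w - 0) \<le> \<epsilon>)"
  proof eventually_elim
    case (elim k)
    note [measurable] = sq_int_measurable[OF S(1)]
    let ?A = "{w \<in> space M. \<epsilon>\<^sup>2 \<le> (norm (S k w))\<^sup>2}"
    have "measure M ?A \<le> (\<integral>w. (norm (S k w))\<^sup>2 \<partial>M) / \<epsilon>\<^sup>2"
      using S(1)[of k] e by (intro integral_Markov_inequality_measure[where A="space M"]) (auto simp: sq_int_def)
    also have "\<dots> < \<eta>" using elim by (simp add: l2_square)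
    finally have "measure M ?A < \<eta>" .
    moreover have "norm (S k w) \<le> \<epsilon>" if "w \<in> space M - ?A" for w
      using that e by (auto simp: not_le intro!: less_imp_le power_less_imp_less_base[of "\<bar>S k w\<bar>" 2 \<epsilon>])
    ultimately show ?case by (intro bexI[of _ ?A]) auto
  qed
qed

lemma ucp_tendsto_imp_tends_in_prob:
  assumes S: "ucp_tendsto M T S I \<F>" and P: "filterlim P \<F> sequentially" and t: "t \<in> {0..T}"
  shows "tends_in_prob M (\<lambda>k. S (P k) t) (I t)"
  unfolding tends_in_prob_def
proof (intro allI impI)
  fix \<epsilon> \<eta> :: real assume e: "0 < \<epsilon>" "0 < \<eta>"
  from S[unfolded ucp_tendsto_def, rule_format, OF e]
  have "\<forall>\<^sub>F k in sequentially. \<exists>A\<in>sets M. measure M A < \<eta> \<and>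
     (\<forall>w\<in>space M - A. \<forall>t\<in>{0..T}. norm (S (P k) t w - I t w) \<le> \<epsilon>)"
    using P by (rule eventually_compose_filterlim)
  then show "\<forall>\<^sub>F k in sequentially. \<exists>A\<in>sets M. measure M A < \<eta> \<and>
     (\<forall>w\<in>space M - A. norm (S (P k) t w - I t w) \<le> \<epsilon>)"
    by eventually_elim (use t in blast)
qed


section \<open>Mixed norms and conditional expectations\<close>

lemma borel_measurable_bilinear:
  fixes h :: "'a::{second_countable_topology,real_normed_vector} =>
    'b::{second_countable_topology,real_normed_vector} => 'c::real_normed_vector"
  assumes "bounded_bilinear h" "f \<in> borel_measurable M" "g \<in> borel_measurable M"
  shows "(\<lambda>x. h (f x) (g x)) \<in> borel_measurable M"
  by (rule borel_measurable_continuous_Pair[OF assms(2,3)])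
    (intro bounded_bilinear.continuous_on[OF assms(1)] continuous_intros)

lemma borel_measurable_blinfun_apply [measurable]:
  fixes f :: "'o => 'a::fin_dim_banach \<Rightarrow>\<^sub>L 'b::fin_dim_banach"
  assumes "f \<in> borel_measurable M" "g \<in> borel_measurable M"
  shows "(\<lambda>x. f x (g x)) \<in> borel_measurable M"
  by (rule borel_measurable_bilinear[OF bounded_bilinear_blinfun_apply assms])

lemma borel_measurable_bounded_linear:
  assumes "bounded_linear h" "f \<in> borel_measurable M"
  shows "(\<lambda>x. h (f x)) \<in> borel_measurable M"
  using measurable_compose[OF assms(2) borel_measurable_continuous_onI[OF
    linear_continuous_on[OF assms(1)]]] .

lemma measurable_ennreal_powr [measurable]: "(\<lambda>x. ennreal_powr x p) \<in> borel_measurable borel"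
  unfolding ennreal_powr_def by measurable

text \<open>Pointwise \<open>x\<^sup>4 \<le> c\<^sup>4 + c\<^bsup>4-n\<^esup> x\<^sup>n\<close>, the first term being enough where \<open>x \<le> c\<close> and the second where
  \<open>x \<ge> c\<close>; hence the factor \<open>2\<close>.\<close>

lemma (in prob_space) fourth_moment_of_Lnorm:
  assumes f[measurable]: "f \<in> borel_measurable M" and n: "4 < n" and c: "0 < c"
    and le: "Lnorm M n f \<le> ennreal c"
  shows "(\<integral>\<^sup>+w. (f w) ^ 4 \<partial>M) \<le> ennreal (2 * c ^ 4)"
proof (cases n)
  case PInf
  have es: "esssup M f \<le> ennreal c" using le PInf by (simp add: Lnorm_def)
  have "AE w in M. f w \<le> ennreal c"
    using esssup_AE[of f M] by eventually_elim (rule order_trans[OF _ es])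
  then have "AE w in M. (f w) ^ 4 \<le> ennreal (c ^ 4)"
  proof eventually_elim
    case (elim w)
    then have "(f w) ^ 4 \<le> (ennreal c) ^ 4" by (intro power_mono) auto
    then show ?case using c by (simp add: ennreal_power)
  qed
  then have "(\<integral>\<^sup>+w. (f w) ^ 4 \<partial>M) \<le> (\<integral>\<^sup>+w. ennreal (c ^ 4) \<partial>M)" by (rule nn_integral_mono_AE)
  also have "\<dots> = ennreal (c ^ 4)" by (simp add: emeasure_space_1)
  also have "\<dots> \<le> ennreal (2 * c ^ 4)" using c by (intro ennreal_leI) simp
  finally show ?thesis .
next
  case MInf
  then show ?thesis using n by simp
next
  case (real r)
  then have r: "4 < r" using n by (metis ereal_less_eq(3) not_less numeral_eq_ereal)
  define I where "I = (\<integral>\<^sup>+w. ennreal_powr (f w) r \<partial>M)"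
  have I1: "ennreal_powr I (1 / r) \<le> ennreal c"
    using le real by (simp add: Lnorm_def I_def)
  then have Ifin: "I \<noteq> \<infinity>" by (auto simp: ennreal_powr_def top_unique)
  then have "enn2real I powr (1 / r) \<le> c" using I1 c by (simp add: ennreal_powr_def)
  then have "(enn2real I powr (1 / r)) powr r \<le> c powr r" using r by (intro powr_mono2) auto
  then have "enn2real I \<le> c powr r" using r by (simp add: powr_powr)
  then have I: "I \<le> ennreal (c powr r)" using Ifin
    by (metis ennreal_enn2real ennreal_leI infinity_ennreal_def less_top)
  have pw: "(f w) ^ 4 \<le> ennreal (c ^ 4) + ennreal (c powr (4 - r)) * ennreal_powr (f w) r" for w
  proof (cases "f w")
    case (real x)
    have "x ^ 4 \<le> c ^ 4 + c powr (4 - r) * x powr r"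
    proof (cases "x \<le> c")
      case True
      then show ?thesis using real by (intro add_increasing2) (auto intro: power_mono)
    next
      case False
      then have x: "x > 0" using c by simp
      have "x ^ 4 = x powr (4 - r) * x powr r" using x by (simp add: powr_add[symmetric])
      also have "\<dots> \<le> c powr (4 - r) * x powr r"
        using False c r by (intro mult_right_mono powr_mono2') auto
      finally show ?thesis using c by (simp add: add_increasing)
    qed
    then show ?thesis using real c
      by (simp add: ennreal_powr_def ennreal_power ennreal_mult[symmetric] ennreal_plus[symmetric]
          ennreal_leI del: ennreal_plus)
  next
    case top
    then show ?thesis using c by (simp add: ennreal_powr_def ennreal_mult_top)
  qed
  have "(\<integral>\<^sup>+w. (f w) ^ 4 \<partial>M)
      \<le> (\<integral>\<^sup>+w. ennreal (c ^ 4) + ennreal (c powr (4 - r)) * ennreal_powr (f w) r \<partial>M)"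
    by (intro nn_integral_mono pw)
  also have "\<dots> = ennreal (c ^ 4) + ennreal (c powr (4 - r)) * I"
    unfolding I_def by (subst nn_integral_add) (auto simp: nn_integral_cmult emeasure_space_1)
  also have "\<dots> \<le> ennreal (c ^ 4) + ennreal (c powr (4 - r)) * ennreal (c powr r)"
    using I by (intro add_left_mono mult_left_mono) auto
  also have "\<dots> = ennreal (2 * c ^ 4)"
    using c by (simp add: ennreal_mult[symmetric] powr_add[symmetric] ennreal_plus[symmetric] del: ennreal_plus)
  finally show ?thesis .
qed

lemma (in prob_space) moments_of_nn_fourth_moment:
  fixes Z :: "'a => 'b::{real_normed_vector,second_countable_topology}"
  assumes Z[measurable]: "Z \<in> borel_measurable M" and c: "0 < c"
    and le: "(\<integral>\<^sup>+w. ennreal (norm (Z w)) ^ 4 \<partial>M) \<le> ennreal (2 * c ^ 4)"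
  shows "integrable M (\<lambda>w. (norm (Z w)) ^ 4)" "(\<integral>w. (norm (Z w)) ^ 4 \<partial>M) \<le> 2 * c ^ 4"
    "sq_int M Z" "l2 M Z \<le> 2 * c"
proof -
  have nn: "(\<integral>\<^sup>+w. ennreal ((norm (Z w)) ^ 4) \<partial>M) \<le> ennreal (2 * c ^ 4)"
    using le by (simp add: ennreal_power)
  then show I: "integrable M (\<lambda>w. (norm (Z w)) ^ 4)"
    by (intro integrableI_bounded) (auto intro: order_le_less_trans)
  show m: "(\<integral>w. (norm (Z w)) ^ 4 \<partial>M) \<le> 2 * c ^ 4"
    using nn nn_integral_eq_integral[OF I] c by simp
  have pw: "x\<^sup>2 \<le> c\<^sup>2 + x ^ 4 / c\<^sup>2" for x :: real
  proof -
    have "2 * x\<^sup>2 * c\<^sup>2 \<le> (x\<^sup>2)\<^sup>2 + (c\<^sup>2)\<^sup>2" by (rule sum_squares_bound)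
    then have "x\<^sup>2 * c\<^sup>2 \<le> c\<^sup>2 * c\<^sup>2 + x ^ 4"
      by (simp add: power2_eq_square power4_eq_xxxx mult.assoc) (smt (verit) mult_nonneg_nonneg zero_le_square mult.assoc)
    then show ?thesis using c by (simp add: field_simps power2_eq_square)
  qed
  have J: "integrable M (\<lambda>w. c\<^sup>2 + (norm (Z w)) ^ 4 / c\<^sup>2)" using I by simp
  have I2: "integrable M (\<lambda>w. (norm (Z w))\<^sup>2)"
    by (rule Bochner_Integration.integrable_bound[OF J]) (use pw in auto)
  then show "sq_int M Z" by (simp add: sq_int_def)
  have "(\<integral>w. (norm (Z w))\<^sup>2 \<partial>M) \<le> (\<integral>w. c\<^sup>2 + (norm (Z w)) ^ 4 / c\<^sup>2 \<partial>M)"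
    by (intro integral_mono I2 J pw)
  also have "\<dots> = c\<^sup>2 + (\<integral>w. (norm (Z w)) ^ 4 \<partial>M) / c\<^sup>2" using I by (simp add: prob_space)
  also have "\<dots> \<le> c\<^sup>2 + (2 * c ^ 4) / c\<^sup>2" using m by (intro add_left_mono divide_right_mono) auto
  also have "\<dots> \<le> (2 * c)\<^sup>2" using c by (simp add: power2_eq_square power4_eq_xxxx)
  finally show "l2 M Z \<le> 2 * c" using c by (intro l2_leI) auto
qed

lemmas (in prob_space) moments_of_Lnorm =
  moments_of_nn_fourth_moment[OF _ _ fourth_moment_of_Lnorm]

text \<open>The fourth power of the conditional norm is the conditional expectation of \<open>f\<^sup>4\<close>, which has the same
  mean as \<open>f\<^sup>4\<close>.\<close>

lemma (in prob_space) fourth_moment_of_cond_Lnorm: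
  assumes G: "subalgebra M G" and f[measurable]: "f \<in> borel_measurable M" and n: "4 < n" and c: "0 < c"
    and le: "Lnorm M n (cond_Lnorm M G 4 f) \<le> ennreal c"
  shows "(\<integral>\<^sup>+w. (f w) ^ 4 \<partial>M) \<le> ennreal (2 * c ^ 4)"
proof -
  interpret finite_measure_subalgebra M G by unfold_locales (rule G)
  have p4: "ennreal_powr x 4 = x ^ 4" for x
    by (cases x) (auto simp: ennreal_powr_def ennreal_power power_eq_top_ennreal)
  have "(r powr (1 / 4)) ^ 4 = r" if "0 \<le> r" for r :: real
    using that by (cases "r = 0") (simp_all add: powr_realpow[symmetric] powr_powr)
  then have q4: "(ennreal_powr x (1/4)) ^ 4 = x" for x
    by (cases x) (auto simp: ennreal_powr_def ennreal_power powr_power power_eq_top_ennreal)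
  have "(\<integral>\<^sup>+w. (cond_Lnorm M G 4 f w) ^ 4 \<partial>M) \<le> ennreal (2 * c ^ 4)"
    by (rule fourth_moment_of_Lnorm[OF _ n c le]) (simp add: cond_Lnorm_def[abs_def])
  also have "(\<integral>\<^sup>+w. (cond_Lnorm M G 4 f w) ^ 4 \<partial>M) = (\<integral>\<^sup>+w. nn_cond_exp M G (\<lambda>w. (f w) ^ 4) w \<partial>M)"
    unfolding cond_Lnorm_def q4 p4 ..
  also have "\<dots> = (\<integral>\<^sup>+w. (f w) ^ 4 \<partial>M)"
    using nn_cond_exp_intg[of "\<lambda>_. 1" "\<lambda>w. (f w) ^ 4"] by simp
  finally show ?thesis .
qed

lemma SUP_Lnorm_bound:
  fixes f :: "'i => ennreal"
  assumes "(SUP i\<in>I. f i) < \<infinity>"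
  obtains c where "c > 0" "\<And>i. i \<in> I ==> f i \<le> ennreal c"
proof -
  define c where "c = enn2real (SUP i\<in>I. f i) + 1"
  have "f i \<le> ennreal c" if "i \<in> I" for i
  proof -
    have "f i \<le> (SUP i\<in>I. f i)" using that by (rule SUP_upper)
    also have "\<dots> = ennreal (enn2real (SUP i\<in>I. f i))" using assms by simp
    also have "\<dots> \<le> ennreal c" unfolding c_def by (intro ennreal_leI) simp
    finally show ?thesis .
  qed
  moreover have "c > 0" unfolding c_def by (simp add: add_nonneg_pos)
  ultimately show thesis by (rule that[rotated])
qed

lemma SUP_quotient_bound:
  assumes "(SUP (s, t)\<in>time_pairs T. L s t / ennreal ((t - s) powr \<kappa>)) < \<infinity>"
  obtains c where "c > 0" "\<And>s t. (s, t) \<in> time_pairs T ==> L s t \<le> ennreal (c * (t - s) powr \<kappa>)"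
proof -
  obtain c where c: "c > 0"
    "\<And>i. i \<in> time_pairs T ==> (case i of (s, t) => L s t / ennreal ((t - s) powr \<kappa>)) \<le> ennreal c"
    using SUP_Lnorm_bound[OF assms] by blast
  show thesis
  proof (rule that[OF c(1)])
    fix s t assume st: "(s, t) \<in> time_pairs T"
    let ?y = "ennreal ((t - s) powr \<kappa>)"
    have y: "?y \<noteq> 0" "?y \<noteq> top" using st by (auto simp: time_pairs_def)
    have "L s t = ?y * L s t / ?y" using y by (metis mult.commute mult_divide_eq_ennreal)
    also have "\<dots> = ?y * (L s t / ?y)" by (simp add: ennreal_times_divide)
    also have "\<dots> \<le> ?y * ennreal c" using c(2)[OF st] by (intro mult_left_mono) auto
    also have "\<dots> = ennreal (c * (t - s) powr \<kappa>)" using c(1) by (simp add: ennreal_mult[symmetric] mult.commute)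
    finally show "L s t \<le> ennreal (c * (t - s) powr \<kappa>)" .
  qed
qed

lemma set_lebesgue_integral_bounded_linear:
  fixes f :: "'o => 'a::{banach,second_countable_topology}"
    and h :: "'a => 'b::{banach,second_countable_topology}"
  assumes "bounded_linear h" "integrable M f" "A \<in> sets M"
  shows "(LINT w:A|M. h (f w)) = h (LINT w:A|M. f w)"
proof -
  interpret h: bounded_linear h by fact
  have "(LINT w:A|M. h (f w)) = (\<integral>w. h (indicator A w *\<^sub>R f w) \<partial>M)"
    unfolding set_lebesgue_integral_def by (simp add: h.scaleR)
  also have "\<dots> = h (LINT w:A|M. f w)"
    unfolding set_lebesgue_integral_def
    by (rule integral_bounded_linear[OF assms(1) integrable_mult_indicator[OF assms(3,2)]])
  finally show ?thesis .
qed

lemma has_cond_exp_bounded_linear: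
  fixes f :: "'o => 'a::{banach,second_countable_topology}"
    and h :: "'a => 'b::{banach,second_countable_topology}"
  assumes h: "bounded_linear h" and f: "has_cond_exp M G f g" and G: "subalgebra M G"
  shows "has_cond_exp M G (\<lambda>w. h (f w)) (\<lambda>w. h (g w))"
proof -
  have A: "A \<in> sets M" if "A \<in> sets G" for A using that G by (auto simp: subalgebra_def)
  show ?thesis
    using f unfolding has_cond_exp_def
    by (auto simp: set_lebesgue_integral_bounded_linear[OF h _ A]
        intro: integrable_bounded_linear[OF h] borel_measurable_bounded_linear[OF h])
qed

lemma has_cond_exp_add:
  assumes "has_cond_exp M G f g" "has_cond_exp M G f' g'" and G: "subalgebra M G"
  shows "has_cond_exp M G (\<lambda>w. f w + f' w) (\<lambda>w. g w + g' w)"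
proof -
  have A: "A \<in> sets M" if "A \<in> sets G" for A using that G by (auto simp: subalgebra_def)
  have "(LINT w:A|M. f w + f' w) = (LINT w:A|M. g w + g' w)" if "A \<in> sets G" for A
    using assms that A[OF that]
    by (subst (1 2) set_integral_add) (auto simp: has_cond_exp_def set_integrable_def intro!: integrable_mult_indicator)
  then show ?thesis using assms unfolding has_cond_exp_def by auto
qed

lemma (in finite_measure_subalgebra) has_cond_exp_real_cond_exp:
  fixes f :: "'a => real"
  assumes "integrable M f"
  shows "has_cond_exp M F f (real_cond_exp M F f)"
  using assms real_cond_exp_int(1)[OF assms] real_cond_exp_intA[OF assms] unfolding has_cond_exp_def by simp

text \<open>A version exists because it can be assembled from the real conditional expectations of the
  coordinates; the choice operator then yields one.\<close>

lemma (in finite_measure_subalgebra) has_cond_exp_vcond_exp: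
  fixes f :: "'a => 'e::fin_dim_banach"
  assumes f: "integrable M f"
  shows "has_cond_exp M F f (vcond_exp M F f)"
proof -
  obtain B :: "'e set" and co :: "'e => ('e \<Rightarrow>\<^sub>L real)" where fB: "finite B"
    and x: "\<And>x. x = (\<Sum>b\<in>B. co b x *\<^sub>R b)"
    using finite_coordinates by blast
  have 1: "has_cond_exp M F (\<lambda>w. co b (f w) *\<^sub>R b)
      (\<lambda>w. real_cond_exp M F (\<lambda>w. co b (f w)) w *\<^sub>R b)" for b
    by (rule has_cond_exp_bounded_linear[OF bounded_linear_scaleR_left has_cond_exp_real_cond_exp subalg])
      (rule integrable_bounded_linear[OF blinfun.bounded_linear_right f])
  have "has_cond_exp M F (\<lambda>w. \<Sum>b\<in>B'. co b (f w) *\<^sub>R b)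
      (\<lambda>w. \<Sum>b\<in>B'. real_cond_exp M F (\<lambda>w. co b (f w)) w *\<^sub>R b)" if "B' \<subseteq> B" for B'
    using finite_subset[OF that fB] that
  proof (induction B' rule: finite_induct)
    case empty
    then show ?case by (simp add: has_cond_exp_def)
  next
    case (insert b B')
    then show ?case using has_cond_exp_add[OF 1[of b] insert.IH subalg] by simp
  qed
  from this[of B] have "\<exists>g. has_cond_exp M F f g" using x by auto
  then show ?thesis unfolding vcond_exp_def by (rule someI_ex)
qed

lemma (in finite_measure_subalgebra) has_cond_exp_mult:
  fixes f :: "'a => real"
  assumes fg: "has_cond_exp M F f g" and \<xi>: "\<xi> \<in> borel_measurable F" "integrable M (\<lambda>w. \<xi> w * f w)"
  shows "integrable M (\<lambda>w. \<xi> w * g w)" "(\<integral>w. \<xi> w * g w \<partial>M) = (\<integral>w. \<xi> w * f w \<partial>M)"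
proof -
  have f: "integrable M f" "integrable M g" "g \<in> borel_measurable F"
    using fg by (auto simp: has_cond_exp_def)
  note [measurable] = measurable_from_subalg[OF subalg \<xi>(1)] borel_measurable_integrable[OF f(2)]
  have ae: "AE w in M. real_cond_exp M F f w = g w"
    using fg by (intro real_cond_exp_charact) (auto simp: has_cond_exp_def)
  note r = real_cond_exp_intg[OF \<xi>(2,1) borel_measurable_integrable[OF f(1)]]
  have ae': "AE w in M. \<xi> w * real_cond_exp M F f w = \<xi> w * g w" using ae by eventually_elim simp
  show "integrable M (\<lambda>w. \<xi> w * g w)"
    by (rule integrable_cong_AE_imp[OF r(1)]) (use ae' in auto)
  have "(\<integral>w. \<xi> w * g w \<partial>M) = (\<integral>w. \<xi> w * real_cond_exp M F f w \<partial>M)"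
    using ae' by (intro integral_cong_AE) (auto elim: AE_mp)
  then show "(\<integral>w. \<xi> w * g w \<partial>M) = (\<integral>w. \<xi> w * f w \<partial>M)" using r(2) by simp
qed

lemma integrable_blinfun_bounded:
  fixes f :: "'o => 'e::fin_dim_banach" and \<Lambda> :: "'o => 'e \<Rightarrow>\<^sub>L 'b::fin_dim_banach"
  assumes f: "integrable M f" and \<Lambda>: "\<Lambda> \<in> borel_measurable M" "\<And>w. norm (\<Lambda> w) \<le> C"
  shows "integrable M (\<lambda>w. \<Lambda> w (f w))"
proof (rule Bochner_Integration.integrable_bound)
  show "integrable M (\<lambda>w. C * norm (f w))" using f by simp
  have "norm (\<Lambda> w (f w)) \<le> C * norm (f w)" for w
    using order_trans[OF norm_blinfun mult_right_mono[OF \<Lambda>(2)]] by simp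
  then show "AE w in M. norm (\<Lambda> w (f w)) \<le> norm (C * norm (f w))"
    by (intro AE_I2) (metis abs_ge_self order_trans real_norm_def)
qed (use f \<Lambda> in measurable)

lemma (in finite_measure_subalgebra) has_cond_exp_blinfun:
  fixes f :: "'a => 'e::fin_dim_banach" and \<Lambda> :: "'a => 'e \<Rightarrow>\<^sub>L real"
  assumes fg: "has_cond_exp M F f g" and \<Lambda>: "\<Lambda> \<in> borel_measurable F" "\<And>w. norm (\<Lambda> w) \<le> C"
  shows "(\<integral>w. \<Lambda> w (g w) \<partial>M) = (\<integral>w. \<Lambda> w (f w) \<partial>M)"
proof -
  obtain B :: "'e set" and co :: "'e => ('e \<Rightarrow>\<^sub>L real)" where fB: "finite B"
    and x: "\<And>x. x = (\<Sum>b\<in>B. co b x *\<^sub>R b)"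
    using finite_coordinates by blast
  have fgi: "integrable M f" "integrable M g" using fg by (auto simp: has_cond_exp_def)
  note [measurable] = measurable_from_subalg[OF subalg \<Lambda>(1)] borel_measurable_integrable[OF fgi(1)]
  have ex: "\<Lambda> w y = (\<Sum>b\<in>B. \<Lambda> w b * co b y)" for y w
    by (subst x[of y]) (simp add: blinfun.sum_right blinfun.scaleR_right mult.commute)
  have i: "integrable M (\<lambda>w. \<Lambda> w b * co b (f w))" for b
  proof (rule Bochner_Integration.integrable_bound)
    show "integrable M (\<lambda>w. (C * norm b) * co b (f w))"
      by (intro integrable_mult_right integrable_bounded_linear[OF blinfun.bounded_linear_right fgi(1)])
    have "\<bar>\<Lambda> w b\<bar> \<le> C * norm b" for w
      using order_trans[OF norm_blinfun[of "\<Lambda> w" b] mult_right_mono[OF \<Lambda>(2)]] by simp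
    then have "\<bar>\<Lambda> w b\<bar> \<le> \<bar>C * norm b\<bar>" for w using abs_ge_self order_trans by blast
    then show "AE w in M. norm (\<Lambda> w b * co b (f w))
        \<le> norm ((C * norm b) * co b (f w))"
      by (intro AE_I2) (simp only: norm_mult real_norm_def abs_mult mult_right_mono abs_ge_zero)
  qed measurable
  have m: "(\<lambda>w. \<Lambda> w b) \<in> borel_measurable F" for b using \<Lambda>(1) by measurable
  note r = has_cond_exp_mult[OF has_cond_exp_bounded_linear[OF blinfun.bounded_linear_right fg subalg] m i]
  have "(\<integral>w. \<Lambda> w (g w) \<partial>M) = (\<integral>w. (\<Sum>b\<in>B. \<Lambda> w b * co b (g w)) \<partial>M)"
    by (intro Bochner_Integration.integral_cong refl ex)
  also have "\<dots> = (\<Sum>b\<in>B. \<integral>w. \<Lambda> w b * co b (g w) \<partial>M)"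
    by (intro Bochner_Integration.integral_sum r(1))
  also have "\<dots> = (\<Sum>b\<in>B. \<integral>w. \<Lambda> w b * co b (f w) \<partial>M)"
    by (intro sum.cong refl r(2))
  also have "\<dots> = (\<integral>w. (\<Sum>b\<in>B. \<Lambda> w b * co b (f w)) \<partial>M)"
    by (intro Bochner_Integration.integral_sum[symmetric] i)
  also have "\<dots> = (\<integral>w. \<Lambda> w (f w) \<partial>M)"
    by (intro Bochner_Integration.integral_cong refl ex[symmetric])
  finally show ?thesis .
qed


section \<open>Stochastic sewing along dyadic partitions\<close>

lemma l2_orthogonal_sum:
  fixes e :: "nat => 'o => real"
  assumes sq: "\<And>i. i < N ==> sq_int M (e i)"
    and orth: "\<And>i j. i < j ==> j < N ==> (\<integral>w. e i w * e j w \<partial>M) = 0"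
  shows "(l2 M (\<lambda>w. \<Sum>i<N. e i w))\<^sup>2 = (\<Sum>i<N. (l2 M (e i))\<^sup>2)"
  using assms
proof (induction N)
  case 0
  then show ?case by (simp add: sq_int_zero)
next
  case (Suc N)
  let ?S = "\<lambda>w. \<Sum>i<N. e i w"
  have S: "sq_int M ?S" using Suc.prems by (intro sq_int_sum) auto
  have eN: "sq_int M (e N)" using Suc.prems by auto
  have cross: "(\<integral>w. ?S w * e N w \<partial>M) = 0"
  proof -
    have "(\<integral>w. ?S w * e N w \<partial>M) = (\<integral>w. (\<Sum>i<N. e i w * e N w) \<partial>M)"
      by (simp add: sum_distrib_right)
    also have "\<dots> = (\<Sum>i<N. \<integral>w. e i w * e N w \<partial>M)"
      using Suc.prems eN by (intro Bochner_Integration.integral_sum sq_int_inner) auto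
    also have "\<dots> = 0" using Suc.prems by (intro sum.neutral) auto
    finally show ?thesis .
  qed
  have "(l2 M (\<lambda>w. ?S w + e N w))\<^sup>2 = (\<integral>w. (?S w)\<^sup>2 + 2 * (?S w * e N w) + (e N w)\<^sup>2 \<partial>M)"
    unfolding l2_square
    by (intro Bochner_Integration.integral_cong refl) (simp add: power2_sum)
  also have "\<dots> = (l2 M ?S)\<^sup>2 + 2 * (\<integral>w. ?S w * e N w \<partial>M) + (l2 M (e N))\<^sup>2"
    using S eN sq_int_inner(1)[OF S eN] unfolding l2_square by (simp add: sq_int_def)
  finally show ?case using cross Suc by simp
qed

lemma sum_lessThan_double:
  "(\<Sum>i<2 * n. f i) = (\<Sum>i<n. f (2 * i) + f (2 * i + 1))" for f :: "nat => 'b::comm_monoid_add"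
  by (induction n) (simp_all add: add.assoc)

text \<open>The dyadic sums of \<open>A\<close> over \<open>[s,t]\<close> change from one level to the next by a sum of defects
  \<open>D\<close>.  After subtraction of the conditional expectations \<open>g\<close> the summands are orthogonal, so that
  only the square root of their number is lost and \<open>\<kappa> > 1/2\<close> suffices; the conditional expectations
  themselves are summed by the triangle inequality, which needs \<open>\<theta> > 1\<close>.\<close>

lemma (in prob_space) stochastic_sewing_dyadic:
  fixes A D g :: "real => real => 'a => real" and T \<kappa> \<theta> a c :: real
  assumes F: "\<And>t. t \<in> {0..T} ==> subalgebra M (F t)"
    "\<And>s t. 0 \<le> s ==> s \<le> t ==> t \<le> T ==> sets (F s) \<subseteq> sets (F t)"
    and exps: "1 / 2 < \<kappa>" "1 < \<theta>" "0 \<le> a" "0 \<le> c"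
    and A: "\<And>s t. 0 \<le> s ==> s < t ==> t \<le> T ==> sq_int M (A s t)"
    and D: "\<And>s t w. 0 \<le> s ==> s < t ==> t \<le> T ==>
      D s t w = A s ((s + t) / 2) w + A ((s + t) / 2) t w - A s t w"
    and D_meas: "\<And>s t. 0 \<le> s ==> s < t ==> t \<le> T ==> D s t \<in> borel_measurable (F t)"
    and D_bound: "\<And>s t. 0 \<le> s ==> s < t ==> t \<le> T ==> l2 M (D s t) \<le> a * (t - s) powr \<kappa>"
    and g: "\<And>s t. 0 \<le> s ==> s < t ==> t \<le> T ==> has_cond_exp M (F s) (D s t) (g s t)"
    "\<And>s t. 0 \<le> s ==> s < t ==> t \<le> T ==> sq_int M (g s t)"
    "\<And>s t. 0 \<le> s ==> s < t ==> t \<le> T ==> l2 M (g s t) \<le> c * (t - s) powr \<theta>"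
    and st: "0 \<le> s" "s < t" "t \<le> T"
    and Z: "Z \<in> borel_measurable M"
    "tends_in_prob M (\<lambda>k w. \<Sum>i<2 ^ k. A (s + real i * (t - s) / 2 ^ k) (s + real (Suc i) * (t - s) / 2 ^ k) w) Z"
  shows "sq_int M (\<lambda>w. Z w - A s t w)"
    and "l2 M (\<lambda>w. Z w - A s t w)
      \<le> a / (1 - 2 powr (1 / 2 - \<kappa>)) * (t - s) powr \<kappa> + c / (1 - 2 powr (1 - \<theta>)) * (t - s) powr \<theta>"
    and "\<And>\<xi> C. \<xi> \<in> borel_measurable (F s) ==> (\<And>w. \<bar>\<xi> w\<bar> \<le> C) ==>
      \<bar>\<integral>w. \<xi> w * (Z w - A s t w) \<partial>M\<bar> \<le> C * (c / (1 - 2 powr (1 - \<theta>)) * (t - s) powr \<theta>)"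
proof -
  define h where "h = t - s"
  have h: "h > 0" using st by (simp add: h_def)
  define x where "x k i = s + real i * h / 2 ^ k" for k i :: nat
  define S where "S k w = (\<Sum>i<2 ^ k. A (x k i) (x k (Suc i)) w)" for k w
  define q1 where "q1 = (2::real) powr (1 / 2 - \<kappa>)"
  define q2 where "q2 = (2::real) powr (1 - \<theta>)"
  have q: "0 < q1" "q1 < 1" "0 < q2" "q2 < 1"
    using exps powr_less_mono[of "1/2 - \<kappa>" 0 "2::real"] powr_less_mono[of "1 - \<theta>" 0 "2::real"]
    by (auto simp: q1_def q2_def)
  have x_diff: "x k (Suc i) - x k i = h / 2 ^ k" for k i
    by (simp add: x_def field_simps)
  have x_mono: "x k i \<le> x k j" if "i \<le> j" for k i j
    using that h by (simp add: x_def divide_right_mono)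
  have x0: "x k 0 = s" and xN: "x k (2 ^ k) = t" for k
    by (simp_all add: x_def h_def)
  have x_range: "0 \<le> x k i" "x k i < x k (Suc i)" "x k (Suc i) \<le> T" "s \<le> x k i" if "i < 2 ^ k" for k i
    using x_mono[of 0 i k] x_mono[of "Suc i" "2 ^ k" k] x0 xN x_diff[of k i] that st h
    by (auto simp: Suc_le_eq) (smt (verit) divide_pos_pos zero_less_numeral zero_less_power)
  have x_double: "x (Suc k) (2 * i) = x k i" "x (Suc k) (2 * i + 1) = (x k i + x k (Suc i)) / 2"
    "x (Suc k) (Suc (2 * i + 1)) = x k (Suc i)" for k i
    by (simp_all add: x_def field_simps)
  have sub: "subalgebra M (F (x k i))" if "i < 2 ^ k" for k i
    using F(1)[of "x k i"] x_range[OF that] by auto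
  define Dk where "Dk k i = D (x k i) (x k (Suc i))" for k i
  define gk where "gk k i = g (x k i) (x k (Suc i))" for k i
  have D_sq: "sq_int M (D u v)" if uv: "0 \<le> u" "u < v" "v \<le> T" for u v
  proof -
    have "sq_int M (\<lambda>w. A u ((u + v) / 2) w + A ((u + v) / 2) v w - A u v w)"
      using uv by (intro sq_int_diff sq_int_add A) auto
    moreover have "D u v = (\<lambda>w. A u ((u + v) / 2) w + A ((u + v) / 2) v w - A u v w)"
      using D[OF uv] by auto
    ultimately show ?thesis by simp
  qed
  have Dk_sq: "sq_int M (Dk k i)" and gk_sq: "sq_int M (gk k i)"
    and gk_ce: "has_cond_exp M (F (x k i)) (Dk k i) (gk k i)" if "i < 2 ^ k" for k i
    unfolding Dk_def gk_def using x_range[OF that] by (auto intro: D_sq g)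
  have Dk_l2: "l2 M (Dk k i) \<le> a * (h / 2 ^ k) powr \<kappa>" and gk_l2: "l2 M (gk k i) \<le> c * (h / 2 ^ k) powr \<theta>"
    if "i < 2 ^ k" for k i
    unfolding Dk_def gk_def using D_bound[OF x_range(1-3)[OF that]] g(3)[OF x_range(1-3)[OF that]]
    by (simp_all add: x_diff)
  have step: "S (Suc k) w - S k w = (\<Sum>i<2 ^ k. Dk k i w)" for k w
  proof -
    have "S (Suc k) w = (\<Sum>i<2 * 2 ^ k. A (x (Suc k) i) (x (Suc k) (Suc i)) w)" by (simp add: S_def)
    also have "\<dots> = (\<Sum>i<2 ^ k. A (x k i) ((x k i + x k (Suc i)) / 2) w + A ((x k i + x k (Suc i)) / 2) (x k (Suc i)) w)"
      unfolding sum_lessThan_double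
      by (intro sum.cong refl) (simp only: x_double x_double(2)[unfolded Suc_eq_plus1[symmetric]])
    finally have "S (Suc k) w - S k w = (\<Sum>i<2 ^ k. A (x k i) ((x k i + x k (Suc i)) / 2) w
        + A ((x k i + x k (Suc i)) / 2) (x k (Suc i)) w - A (x k i) (x k (Suc i)) w)"
      by (simp add: S_def sum_subtractf)
    also have "\<dots> = (\<Sum>i<2 ^ k. Dk k i w)"
      unfolding Dk_def using x_range by (intro sum.cong refl D[symmetric]) auto
    finally show ?thesis .
  qed
  have ce_zero: "(\<integral>w. \<xi> w * (Dk k i w - gk k i w) \<partial>M) = 0"
    if i: "i < 2 ^ k" and \<xi>: "\<xi> \<in> borel_measurable (F (x k i))" "sq_int M \<xi>" for k i \<xi>
  proof -
    interpret finite_measure_subalgebra M "F (x k i)" by unfold_locales (rule sub[OF i])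
    have 1: "integrable M (\<lambda>w. \<xi> w * Dk k i w)" by (rule sq_int_inner(1)[OF \<xi>(2) Dk_sq[OF i]])
    note r = has_cond_exp_mult[OF gk_ce[OF i] \<xi>(1) 1]
    show ?thesis unfolding right_diff_distrib using 1 r by simp
  qed
  have e_l2: "(l2 M (\<lambda>w. Dk k i w - gk k i w))\<^sup>2 \<le> (a * (h / 2 ^ k) powr \<kappa>)\<^sup>2" if i: "i < 2 ^ k" for k i
  proof -
    let ?D = "Dk k i" and ?g = "gk k i"
    have gm: "?g \<in> borel_measurable (F (x k i))" using gk_ce[OF i] by (simp add: has_cond_exp_def)
    have "(l2 M (\<lambda>w. ?D w - ?g w))\<^sup>2 = (\<integral>w. (?D w)\<^sup>2 - (?g w)\<^sup>2 - 2 * (?g w * (?D w - ?g w)) \<partial>M)"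
      unfolding l2_square
      by (intro Bochner_Integration.integral_cong refl) (simp add: power2_eq_square algebra_simps)
    also have "\<dots> = (l2 M ?D)\<^sup>2 - (l2 M ?g)\<^sup>2 - 2 * (\<integral>w. ?g w * (?D w - ?g w) \<partial>M)"
      using Dk_sq[OF i] gk_sq[OF i] sq_int_inner(1)[OF gk_sq[OF i] sq_int_diff(1)[OF Dk_sq[OF i] gk_sq[OF i]]]
      unfolding l2_square by (simp add: sq_int_def)
    also have "\<dots> \<le> (l2 M ?D)\<^sup>2" using ce_zero[OF i gm gk_sq[OF i]] by simp
    also have "\<dots> \<le> (a * (h / 2 ^ k) powr \<kappa>)\<^sup>2" by (rule power_mono[OF Dk_l2[OF i] l2_nonneg])
    finally show ?thesis .
  qed
  have e_meas: "(\<lambda>w. Dk k i w - gk k i w) \<in> borel_measurable (F (x k j))" if ij: "i < j" "j < 2 ^ k" for k i j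
  proof -
    have i: "i < 2 ^ k" using ij by simp
    have r: "0 \<le> x k i" "x k i \<le> x k (Suc i)" "x k (Suc i) \<le> x k j" "x k j \<le> T"
      using x_range[OF i] x_range[OF ij(2)] x_mono[of "Suc i" j k] ij by auto
    have s1: "subalgebra (F (x k j)) (F (x k (Suc i)))" "subalgebra (F (x k j)) (F (x k i))"
      using F(2)[of "x k (Suc i)" "x k j"] F(2)[of "x k i" "x k j"] F(1)[of "x k j"] F(1)[of "x k i"] F(1)[of "x k (Suc i)"] r
      by (auto simp: subalgebra_def)
    have "Dk k i \<in> borel_measurable (F (x k j))"
      unfolding Dk_def using x_range[OF i] by (intro measurable_from_subalg[OF s1(1)] D_meas) auto
    moreover have "gk k i \<in> borel_measurable (F (x k j))"
      using gk_ce[OF i] by (intro measurable_from_subalg[OF s1(2)]) (auto simp: has_cond_exp_def)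
    ultimately show ?thesis by measurable
  qed
  have pw1: "sqrt (2 ^ k) * (h / 2 ^ k) powr \<kappa> = h powr \<kappa> * q1 ^ k" for k
  proof -
    have "sqrt (2 ^ k) = 2 powr (real k / 2)" by (simp add: powr_half_sqrt[symmetric] powr_realpow[symmetric] powr_powr)
    moreover have "(h / 2 ^ k) powr \<kappa> = h powr \<kappa> * 2 powr (- (real k * \<kappa>))"
    proof -
      have "(2 ^ k :: real) powr \<kappa> = 2 powr (real k * \<kappa>)"
        by (simp add: powr_realpow[symmetric] powr_powr)
      then show ?thesis using h by (simp add: powr_divide powr_minus_divide)
    qed
    moreover have "q1 ^ k = 2 powr (real k / 2) * 2 powr (- (real k * \<kappa>))"
      by (simp add: q1_def powr_realpow[symmetric] powr_powr powr_add[symmetric] algebra_simps)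
    ultimately show ?thesis by simp
  qed
  have pw2: "2 ^ k * (h / 2 ^ k) powr \<theta> = h powr \<theta> * q2 ^ k" for k
  proof -
    have "(2::real) ^ k = 2 powr (real k)" by (simp add: powr_realpow)
    moreover have "(h / 2 ^ k) powr \<theta> = h powr \<theta> * 2 powr (- (real k * \<theta>))"
    proof -
      have "(2 ^ k :: real) powr \<theta> = 2 powr (real k * \<theta>)"
        by (simp add: powr_realpow[symmetric] powr_powr)
      then show ?thesis using h by (simp add: powr_divide powr_minus_divide)
    qed
    moreover have "q2 ^ k = 2 powr (real k) * 2 powr (- (real k * \<theta>))"
      by (simp add: q2_def powr_realpow[symmetric] powr_powr powr_add[symmetric] algebra_simps)
    ultimately show ?thesis by simp
  qed
  have S_sq: "sq_int M (S k)" for k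
    unfolding S_def[abs_def] using x_range by (intro sq_int_sum A) auto
  have gsum: "(\<Sum>i<2 ^ k. l2 M (gk k i)) \<le> c * h powr \<theta> * q2 ^ k" for k
  proof -
    have "(\<Sum>i<2 ^ k. l2 M (gk k i)) \<le> (\<Sum>i<(2::nat) ^ k. c * (h / 2 ^ k) powr \<theta>)"
      by (intro sum_mono gk_l2) auto
    also have "\<dots> = c * (2 ^ k * (h / 2 ^ k) powr \<theta>)" by simp
    finally show ?thesis unfolding pw2 by (simp add: mult.assoc)
  qed
  have level: "l2 M (\<lambda>w. S (Suc k) w - S k w) \<le> a * h powr \<kappa> * q1 ^ k + c * h powr \<theta> * q2 ^ k" for k
  proof -
    let ?e = "\<lambda>i w. Dk k i w - gk k i w"
    have e_sq: "sq_int M (?e i)" if "i < 2 ^ k" for i using that by (intro sq_int_diff Dk_sq gk_sq)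
    have "(l2 M (\<lambda>w. \<Sum>i<2 ^ k. ?e i w))\<^sup>2 = (\<Sum>i<2 ^ k. (l2 M (?e i))\<^sup>2)"
      by (rule l2_orthogonal_sum) (auto intro!: e_sq ce_zero e_meas)
    also have "\<dots> \<le> (\<Sum>i<(2::nat) ^ k. (a * (h / 2 ^ k) powr \<kappa>)\<^sup>2)" by (intro sum_mono e_l2) auto
    also have "\<dots> = (sqrt (2 ^ k) * (a * (h / 2 ^ k) powr \<kappa>))\<^sup>2" by (simp add: power_mult_distrib)
    finally have "l2 M (\<lambda>w. \<Sum>i<2 ^ k. ?e i w) \<le> sqrt (2 ^ k) * (a * (h / 2 ^ k) powr \<kappa>)"
      using exps by (intro power2_le_imp_le[OF _ mult_nonneg_nonneg]) auto
    also have "\<dots> = a * h powr \<kappa> * q1 ^ k" using pw1[of k] by (simp add: mult_ac)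
    finally have 1: "l2 M (\<lambda>w. \<Sum>i<2 ^ k. ?e i w) \<le> a * h powr \<kappa> * q1 ^ k" .
    have "l2 M (\<lambda>w. \<Sum>i<2 ^ k. gk k i w) \<le> (\<Sum>i<2 ^ k. l2 M (gk k i))"
      by (intro sq_int_sum gk_sq) auto
    then have 2: "l2 M (\<lambda>w. \<Sum>i<2 ^ k. gk k i w) \<le> c * h powr \<theta> * q2 ^ k" using gsum[of k] by simp
    have "l2 M (\<lambda>w. (\<Sum>i<2 ^ k. ?e i w) + (\<Sum>i<2 ^ k. gk k i w))
        \<le> l2 M (\<lambda>w. \<Sum>i<2 ^ k. ?e i w) + l2 M (\<lambda>w. \<Sum>i<2 ^ k. gk k i w)"
      by (intro sq_int_add(2) sq_int_sum(1) e_sq gk_sq) auto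
    moreover have "(\<lambda>w. S (Suc k) w - S k w) = (\<lambda>w. (\<Sum>i<2 ^ k. ?e i w) + (\<Sum>i<2 ^ k. gk k i w))"
      unfolding step by (simp add: sum_subtractf)
    ultimately show ?thesis using 1 2 by simp
  qed
  have S0: "S 0 = A s t" by (simp add: S_def[abs_def] x_def h_def)
  have tel: "(\<Sum>j<k. S (Suc j) w - S j w) = S k w - A s t w" for k w
    using sum_lessThan_telescope[of "\<lambda>j. S j w" k] S0 by simp
  have geo: "(\<Sum>j<k. r ^ j) \<le> 1 / (1 - r)" if "0 < r" "r < 1" for r :: real and k
  proof -
    have "(\<Sum>j<k. r ^ j) = (1 - r ^ k) / (1 - r)" using that geometric_sum[of r k] by (simp add: field_simps)
    also have "\<dots> \<le> 1 / (1 - r)" using that by (intro divide_right_mono) auto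
    finally show ?thesis .
  qed
  have sum_levels: "l2 M (\<lambda>w. S k w - A s t w)
      \<le> a * h powr \<kappa> * (\<Sum>j<k. q1 ^ j) + c * h powr \<theta> * (\<Sum>j<k. q2 ^ j)" for k
  proof -
    have eq: "(\<lambda>w. S k w - A s t w) = (\<lambda>w. \<Sum>j<k. S (Suc j) w - S j w)"
      by (simp only: tel)
    have "l2 M (\<lambda>w. S k w - A s t w) \<le> (\<Sum>j<k. l2 M (\<lambda>w. S (Suc j) w - S j w))"
      unfolding eq by (intro sq_int_sum(2) sq_int_diff(1) S_sq)
    also have "\<dots> \<le> (\<Sum>j<k. a * h powr \<kappa> * q1 ^ j + c * h powr \<theta> * q2 ^ j)" by (intro sum_mono level)
    also have "\<dots> = a * h powr \<kappa> * (\<Sum>j<k. q1 ^ j) + c * h powr \<theta> * (\<Sum>j<k. q2 ^ j)"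
      by (simp add: sum.distrib sum_distrib_left)
    finally show ?thesis .
  qed
  define K where "K = a / (1 - q1) * h powr \<kappa> + c / (1 - q2) * h powr \<theta>"
  have bound: "l2 M (\<lambda>w. S k w - A s t w) \<le> K" for k
  proof -
    have "a * h powr \<kappa> * (\<Sum>j<k. q1 ^ j) \<le> a * h powr \<kappa> * (1 / (1 - q1))"
      "c * h powr \<theta> * (\<Sum>j<k. q2 ^ j) \<le> c * h powr \<theta> * (1 / (1 - q2))"
      by (intro mult_left_mono geo mult_nonneg_nonneg powr_ge_zero q exps)+
    then show ?thesis using sum_levels[of k] by (simp add: K_def)
  qed
  have Asq: "sq_int M (A s t)" by (rule A[OF st])
  note [measurable] = sq_int_measurable[OF Asq] Z(1)
  have "tends_in_prob M S Z"
    using Z(2) unfolding S_def[abs_def] x_def h_def by simp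
  then obtain r where r: "strict_mono r" "AE w in M. (\<lambda>k. S (r k) w) \<longlonglongrightarrow> Z w"
    by (rule tends_in_prob_AE_subseq)
  have lim: "AE w in M. (\<lambda>k. S (r k) w - A s t w) \<longlonglongrightarrow> Z w - A s t w"
    using r(2) by eventually_elim (intro tendsto_diff tendsto_const)
  have Zm: "(\<lambda>w. Z w - A s t w) \<in> borel_measurable M" by measurable
  note v = expectation_tendsto_of_bounded_second_moment[of "\<lambda>k w. S (r k) w - A s t w",
      OF sq_int_diff(1)[OF S_sq Asq] bound Zm lim]
  show Zsq: "sq_int M (\<lambda>w. Z w - A s t w)" by (rule v(1))
  show "l2 M (\<lambda>w. Z w - A s t w)
      \<le> a / (1 - 2 powr (1 / 2 - \<kappa>)) * (t - s) powr \<kappa> + c / (1 - 2 powr (1 - \<theta>)) * (t - s) powr \<theta>"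
    using v(2) by (simp add: K_def q1_def q2_def h_def)
  fix \<xi> :: "'a => real" and C assume \<xi>: "\<xi> \<in> borel_measurable (F s)" "\<And>w. \<bar>\<xi> w\<bar> \<le> C"
  have C: "0 \<le> C" using \<xi>(2)[of undefined] by linarith
  have Fs: "subalgebra M (F s)" using F(1)[of s] st by simp
  note [measurable] = measurable_from_subalg[OF Fs \<xi>(1)]
  have \<xi>m: "\<xi> \<in> borel_measurable M" by measurable
  have sq_\<xi>: "sq_int M (\<lambda>w. \<xi> w * f w)" "l2 M (\<lambda>w. \<xi> w * f w) \<le> C * l2 M f" if "sq_int M f" for f
    using sq_int_bounded_mult[OF that \<xi>m, of C] \<xi>(2) C by auto
  have level\<xi>: "\<bar>\<integral>w. \<xi> w * (S (Suc k) w - S k w) \<partial>M\<bar> \<le> C * (c * h powr \<theta> * q2 ^ k)" for k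
  proof -
    have one: "\<bar>\<integral>w. \<xi> w * Dk k i w \<partial>M\<bar> \<le> C * l2 M (gk k i)" and oneI: "integrable M (\<lambda>w. \<xi> w * Dk k i w)"
      if i: "i < 2 ^ k" for i
    proof -
      interpret finite_measure_subalgebra M "F (x k i)" by unfold_locales (rule sub[OF i])
      have "subalgebra (F (x k i)) (F s)"
        using F(2)[of s "x k i"] Fs sub[OF i] x_range[OF i] st by (auto simp: subalgebra_def)
      then have m: "\<xi> \<in> borel_measurable (F (x k i))" using \<xi>(1) by (rule measurable_from_subalg)
      show I: "integrable M (\<lambda>w. \<xi> w * Dk k i w)"
        by (rule sq_int_integrable(1)[OF sq_\<xi>(1)[OF Dk_sq[OF i]]])
      have "\<bar>\<integral>w. \<xi> w * Dk k i w \<partial>M\<bar> = \<bar>\<integral>w. \<xi> w * gk k i w \<partial>M\<bar>"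
        using has_cond_exp_mult(2)[OF gk_ce[OF i] m I] by simp
      also have "\<dots> \<le> (\<integral>w. \<bar>\<xi> w * gk k i w\<bar> \<partial>M)" by (rule integral_abs_bound)
      also have "\<dots> \<le> l2 M (\<lambda>w. \<xi> w * gk k i w)"
        using sq_int_integrable(2)[OF sq_\<xi>(1)[OF gk_sq[OF i]]] by simp
      also have "\<dots> \<le> C * l2 M (gk k i)" by (rule sq_\<xi>(2)[OF gk_sq[OF i]])
      finally show "\<bar>\<integral>w. \<xi> w * Dk k i w \<partial>M\<bar> \<le> C * l2 M (gk k i)" .
    qed
    have "(\<integral>w. \<xi> w * (S (Suc k) w - S k w) \<partial>M) = (\<integral>w. (\<Sum>i<2 ^ k. \<xi> w * Dk k i w) \<partial>M)"
      unfolding step by (simp add: sum_distrib_left)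
    also have "\<dots> = (\<Sum>i<2 ^ k. \<integral>w. \<xi> w * Dk k i w \<partial>M)"
      by (intro Bochner_Integration.integral_sum oneI) auto
    also have "\<bar>\<dots>\<bar> \<le> (\<Sum>i<2 ^ k. C * l2 M (gk k i))"
      by (intro order_trans[OF sum_abs] sum_mono one) auto
    also have "\<dots> = C * (\<Sum>i<2 ^ k. l2 M (gk k i))" by (simp add: sum_distrib_left)
    also have "\<dots> \<le> C * (c * h powr \<theta> * q2 ^ k)" by (intro mult_left_mono gsum C)
    finally show ?thesis .
  qed
  have bound\<xi>: "\<bar>\<integral>w. \<xi> w * (S k w - A s t w) \<partial>M\<bar> \<le> C * (c / (1 - q2) * h powr \<theta>)" for k
  proof -
    have "(\<integral>w. \<xi> w * (S k w - A s t w) \<partial>M) = (\<integral>w. (\<Sum>j<k. \<xi> w * (S (Suc j) w - S j w)) \<partial>M)"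
      unfolding sum_distrib_left[symmetric] tel ..
    also have "\<dots> = (\<Sum>j<k. \<integral>w. \<xi> w * (S (Suc j) w - S j w) \<partial>M)"
      by (intro Bochner_Integration.integral_sum sq_int_integrable(1) sq_\<xi>(1) sq_int_diff(1) S_sq)
    also have "\<bar>\<dots>\<bar> \<le> (\<Sum>j<k. C * (c * h powr \<theta> * q2 ^ j))"
      by (intro order_trans[OF sum_abs] sum_mono level\<xi>)
    also have "\<dots> = C * (c * h powr \<theta>) * (\<Sum>j<k. q2 ^ j)" by (simp add: sum_distrib_left mult.assoc)
    also have "\<dots> \<le> C * (c * h powr \<theta>) * (1 / (1 - q2))"
      by (intro mult_left_mono geo mult_nonneg_nonneg powr_ge_zero q exps C)
    finally show ?thesis by (simp add: mult_ac)
  qed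
  have m\<xi>: "(\<lambda>w. \<xi> w * (Z w - A s t w)) \<in> borel_measurable M" by measurable
  have b\<xi>: "l2 M (\<lambda>w. \<xi> w * (S (r k) w - A s t w)) \<le> C * K" for k
    by (rule order_trans[OF sq_\<xi>(2)[OF sq_int_diff(1)[OF S_sq Asq]] mult_left_mono[OF bound C]])
  have lim\<xi>: "AE w in M. (\<lambda>k. \<xi> w * (S (r k) w - A s t w)) \<longlonglongrightarrow> \<xi> w * (Z w - A s t w)"
    using lim by eventually_elim (intro tendsto_mult tendsto_const)
  have "(\<lambda>k. \<integral>w. \<xi> w * (S (r k) w - A s t w) \<partial>M) \<longlonglongrightarrow> (\<integral>w. \<xi> w * (Z w - A s t w) \<partial>M)"
    by (rule expectation_tendsto_of_bounded_second_moment(3)[OF sq_\<xi>(1)[OF sq_int_diff(1)[OF S_sq Asq]] b\<xi> m\<xi> lim\<xi>])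
  then have "(\<lambda>k. \<bar>\<integral>w. \<xi> w * (S (r k) w - A s t w) \<partial>M\<bar>) \<longlonglongrightarrow> \<bar>\<integral>w. \<xi> w * (Z w - A s t w) \<partial>M\<bar>"
    by (rule tendsto_rabs)
  then have "\<bar>\<integral>w. \<xi> w * (Z w - A s t w) \<partial>M\<bar> \<le> C * (c / (1 - q2) * h powr \<theta>)"
    using bound\<xi> by (intro LIMSEQ_le_const2) auto
  then show "\<bar>\<integral>w. \<xi> w * (Z w - A s t w) \<partial>M\<bar> \<le> C * (c / (1 - 2 powr (1 - \<theta>)) * (t - s) powr \<theta>)"
    by (simp add: q2_def h_def)
qed


section \<open>Brownian increments and discrete martingales\<close>

locale filtered_space = prob_space M for M :: "'o measure" +
  fixes F :: "real => 'o measure" and T :: real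
  assumes T_pos: "0 < T"
    and sub: "t \<in> {0..T} ==> subalgebra M (F t)"
    and mono: "0 \<le> s ==> s \<le> t ==> t \<le> T ==> sets (F s) \<subseteq> sets (F t)"
begin

lemma subalgebra_mono:
  assumes "0 \<le> s" "s \<le> t" "t \<le> T"
  shows "subalgebra (F t) (F s)"
  using assms mono[OF assms] sub[of s] sub[of t] by (auto simp: subalgebra_def)

lemma measurable_mono:
  assumes "0 \<le> s" "s \<le> t" "t \<le> T" "f \<in> measurable (F s) N"
  shows "f \<in> measurable (F t) N"
  by (rule measurable_from_subalg[OF subalgebra_mono[OF assms(1-3)] assms(4)])

lemma measurable_F_M:
  assumes "t \<in> {0..T}" "f \<in> measurable (F t) N"
  shows "f \<in> measurable M N"
  by (rule measurable_from_subalg[OF sub[OF assms(1)] assms(2)])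

end

text \<open>The squared Hilbert--Schmidt norm of a linear functional.\<close>

definition hs :: "('u::euclidean_space \<Rightarrow>\<^sub>L real) => real"
  where "hs H = (\<Sum>e\<in>Basis. (H e)\<^sup>2)"

lemma hs_nonneg: "0 \<le> hs H"
  by (simp add: hs_def sum_nonneg)

lemma hs_le: "hs (H :: 'u::euclidean_space \<Rightarrow>\<^sub>L real) \<le> real DIM('u) * (norm H)\<^sup>2"
proof -
  have "hs H \<le> (\<Sum>e\<in>(Basis::'u set). (norm H)\<^sup>2)"
    unfolding hs_def
  proof (rule sum_mono)
    fix e :: 'u assume "e \<in> Basis"
    then have "\<bar>H e\<bar> \<le> norm H" using norm_blinfun[of H e] by simp
    then show "(H e)\<^sup>2 \<le> (norm H)\<^sup>2" by (metis abs_ge_zero power2_abs power_mono)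
  qed
  then show ?thesis by simp
qed

lemma borel_measurable_hs [measurable]: "hs \<in> borel_measurable borel"
proof -
  have "continuous_on UNIV (\<lambda>H :: 'a::euclidean_space \<Rightarrow>\<^sub>L real. \<Sum>e\<in>Basis. (H e)\<^sup>2)"
    by (intro continuous_intros)
  then show ?thesis unfolding hs_def[abs_def] by (rule borel_measurable_continuous_onI)
qed

locale brownian_space = filtered_space M F T for M :: "'o measure" and F T +
  fixes B :: "real => 'o => 'u::euclidean_space"
  assumes BM: "standard_brownian_motion M F T B"
begin

lemma B_measurable: "t \<in> {0..T} ==> B t \<in> borel_measurable (F t)"
  using BM by (simp add: standard_brownian_motion_def adapted_def)

lemma B_measurable_M: "t \<in> {0..T} ==> B t \<in> borel_measurable M"
  by (rule measurable_F_M[OF _ B_measurable])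

lemma increment_independent:
  assumes st: "0 \<le> s" "s < t" "t \<le> T" and G: "G \<in> borel_measurable (F s)"
    and f: "f \<in> borel_measurable borel"
  shows "indep_var borel (G :: 'o => real) borel (\<lambda>w. f (B t w - B s w) :: real)"
proof -
  let ?d = "\<lambda>w. B t w - B s w"
  have ind: "indep_set (sets (F s)) (sets (vimage_algebra (space M) ?d borel))"
    using BM st by (auto simp: standard_brownian_motion_def time_pairs_def)
  have Gm: "G \<in> borel_measurable M" using G st by (intro measurable_F_M) auto
  have dm: "?d \<in> borel_measurable M"
    using B_measurable_M[of s] B_measurable_M[of t] st by auto
  have fdm: "(\<lambda>w. f (?d w)) \<in> borel_measurable M" by (rule measurable_compose[OF dm f])
  have sp: "space (F s) = space M" using sub[of s] st by (simp add: subalgebra_def)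
  have 1: "sigma_sets (space M) {G -` A \<inter> space M | A. A \<in> sets borel} \<subseteq> sets (F s)"
    using G unfolding sp[symmetric] by (intro sets.sigma_sets_subset) (auto simp: measurable_def)
  have 2: "sigma_sets (space M) {(\<lambda>w. f (?d w)) -` A \<inter> space M | A. A \<in> sets borel}
      \<subseteq> sets (vimage_algebra (space M) ?d borel)"
  proof -
    have sp': "space (vimage_algebra (space M) ?d borel) = space M" by simp
    have m: "(\<lambda>w. f (?d w)) \<in> borel_measurable (vimage_algebra (space M) ?d borel)"
      by (rule measurable_compose[OF measurable_vimage_algebra1 f]) auto
    show ?thesis
      using sets.sigma_sets_subset[of "{(\<lambda>w. f (?d w)) -` A \<inter> space M | A. A \<in> sets borel}"
          "vimage_algebra (space M) ?d borel"] m
      by (auto simp: measurable_def)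
  qed
  have a: "sets (F s) \<subseteq> events" "sets (vimage_algebra (space M) ?d borel) \<subseteq> events"
    and b: "\<And>a b. a \<in> sets (F s) ==> b \<in> sets (vimage_algebra (space M) ?d borel) ==> prob (a \<inter> b) = prob a * prob b"
    using ind unfolding indep_sets2_eq by auto
  show ?thesis
    unfolding indep_var_eq indep_sets2_eq using 1 2 Gm fdm a b by (blast intro: subset_trans)
qed

lemma increment_expectation:
  assumes st: "0 \<le> s" "s < t" "t \<le> T" and G: "G \<in> borel_measurable (F s)" "integrable M G"
    and f: "f \<in> borel_measurable borel" "integrable M (\<lambda>w. f (B t w - B s w) :: real)"
  shows "integrable M (\<lambda>w. G w * f (B t w - B s w))"
    "(\<integral>w. G w * f (B t w - B s w) \<partial>M) = (\<integral>w. G w \<partial>M) * (\<integral>w. f (B t w - B s w) \<partial>M)"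
  using indep_var_integrable[OF increment_independent[OF st G(1) f(1)] G(2) f(2)]
    indep_var_lebesgue_integral[OF increment_independent[OF st G(1) f(1)] G(2) f(2)] by auto

lemma increment_moments:
  assumes st: "0 \<le> s" "s < t" "t \<le> T" and e: "e \<in> Basis"
  shows "integrable M (\<lambda>w. ((B t w - B s w) \<bullet> e) ^ k)"
    "(\<integral>w. (B t w - B s w) \<bullet> e \<partial>M) = 0"
    "(\<integral>w. ((B t w - B s w) \<bullet> e)\<^sup>2 \<partial>M) = t - s"
    "(\<integral>w. ((B t w - B s w) \<bullet> e) ^ 4 \<partial>M) = 3 * (t - s)\<^sup>2"
proof -
  let ?X = "\<lambda>w. (B t w - B s w) \<bullet> e" and ?\<sigma> = "sqrt (t - s)"
  have D: "distributed M lborel ?X (\<lambda>x. ennreal (normal_density 0 ?\<sigma> x))"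
    using BM st e by (auto simp: standard_brownian_motion_def time_pairs_def)
  have \<sigma>: "0 < ?\<sigma>" using st by simp
  have m: "(\<integral>w. (?X w) ^ k \<partial>M) = (\<integral>x. normal_density 0 ?\<sigma> x * x ^ k \<partial>lborel)" for k
    by (rule distributed_integral[OF D, symmetric]) auto
  show "integrable M (\<lambda>w. (?X w) ^ k)"
    using distributed_integrable[OF D, of "\<lambda>x. x ^ k"] integrable_normal_moment[OF \<sigma>, of 0 k] by simp
  show "(\<integral>w. ?X w \<partial>M) = 0"
    using m[of 1] integral_normal_moment_odd[OF \<sigma>, of 0 0] by simp
  show "(\<integral>w. (?X w)\<^sup>2 \<partial>M) = t - s"
    using m[of 2] integral_normal_moment_even[OF \<sigma>, of 0 1] st by (simp add: fact_numeral)
  have "(sqrt (t - s)) ^ 4 = (t - s)\<^sup>2"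
    using st by (metis diff_ge_0_iff_ge less_imp_le numeral_eq_Suc power2_eq_square power4_eq_xxxx real_sqrt_pow2 mult.assoc)
  then show "(\<integral>w. (?X w) ^ 4 \<partial>M) = 3 * (t - s)\<^sup>2"
    using m[of 4] integral_normal_moment_even[OF \<sigma>, of 0 2] st
    by (simp add: fact_numeral power2_eq_square power4_eq_xxxx field_simps)
qed

lemma increment_cross:
  assumes st: "0 \<le> s" "s < t" "t \<le> T" and e: "e \<in> Basis" "e' \<in> Basis" "e \<noteq> e'"
  shows "(\<integral>w. ((B t w - B s w) \<bullet> e) * ((B t w - B s w) \<bullet> e') \<partial>M) = 0"
proof -
  let ?X = "\<lambda>e w. (B t w - B s w) \<bullet> e"
  have "indep_vars (\<lambda>_. borel) ?X Basis"
    using BM st by (auto simp: standard_brownian_motion_def time_pairs_def)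
  then have "indep_vars (\<lambda>_. borel) ?X {e, e'}" by (rule indep_vars_subset) (use e in auto)
  then have "(\<integral>w. (\<Prod>i\<in>{e, e'}. ?X i w) \<partial>M) = (\<Prod>i\<in>{e, e'}. \<integral>w. ?X i w \<partial>M)"
    using increment_moments(1)[OF st, of _ 1] e by (intro indep_vars_lebesgue_integral) auto
  then show ?thesis using e increment_moments(2)[OF st e(1)] by simp
qed

lemma increment_norm4:
  fixes s t :: real
  assumes st: "0 \<le> s" "s < t" "t \<le> T"
  shows "integrable M (\<lambda>w. norm (B t w - B s w) ^ 4)"
    "(\<integral>w. norm (B t w - B s w) ^ 4 \<partial>M) \<le> 3 * (real DIM('u))\<^sup>2 * (t - s)\<^sup>2"
proof -
  let ?X = "\<lambda>e w. (B t w - B s w) \<bullet> e"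
  have pw: "norm v ^ 4 \<le> real DIM('u) * (\<Sum>e\<in>Basis. (v \<bullet> e) ^ 4)" for v :: 'u
  proof -
    have "norm v ^ 4 = ((norm v)\<^sup>2)\<^sup>2" by simp
    also have "(norm v)\<^sup>2 = (\<Sum>e\<in>Basis. 1 * (v \<bullet> e)\<^sup>2)"
      unfolding power2_norm_eq_inner by (subst euclidean_inner) (simp add: power2_eq_square)
    also have "\<dots>\<^sup>2 \<le> (\<Sum>e\<in>(Basis::'u set). 1\<^sup>2) * (\<Sum>e\<in>Basis. ((v \<bullet> e)\<^sup>2)\<^sup>2)"
      by (rule Cauchy_Schwarz_ineq_sum)
    finally show ?thesis by simp
  qed
  have I: "integrable M (\<lambda>w. real DIM('u) * (\<Sum>e\<in>Basis. (?X e w) ^ 4))"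
    using increment_moments(1)[OF st] by (intro integrable_mult_right Bochner_Integration.integrable_sum) auto
  have m: "(\<lambda>w. norm (B t w - B s w) ^ 4) \<in> borel_measurable M"
    using B_measurable_M[of s] B_measurable_M[of t] st by auto
  show J: "integrable M (\<lambda>w. norm (B t w - B s w) ^ 4)"
    by (rule Bochner_Integration.integrable_bound[OF I m]) (use pw in \<open>auto intro!: AE_I2 intro: order_trans[OF _ abs_ge_self]\<close>)
  have "(\<integral>w. norm (B t w - B s w) ^ 4 \<partial>M) \<le> (\<integral>w. real DIM('u) * (\<Sum>e\<in>Basis. (?X e w) ^ 4) \<partial>M)"
    by (intro integral_mono J I pw)
  also have "\<dots> = real DIM('u) * (\<Sum>e\<in>(Basis::'u set). 3 * (t - s)\<^sup>2)"
    using increment_moments[OF st] by (simp add: Bochner_Integration.integral_sum)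
  also have "\<dots> = 3 * (real DIM('u))\<^sup>2 * (t - s)\<^sup>2" by (simp add: power2_eq_square)
  finally show "(\<integral>w. norm (B t w - B s w) ^ 4 \<partial>M) \<le> 3 * (real DIM('u))\<^sup>2 * (t - s)\<^sup>2" .
qed

context
  fixes s t C :: real and H :: "'o => 'u \<Rightarrow>\<^sub>L real"
  assumes st: "0 \<le> s" "s < t" "t \<le> T"
    and H: "H \<in> borel_measurable (F s)" "\<And>w. norm (H w) \<le> C"
begin

lemma step_expand:
  "H w (B t w - B s w) = (\<Sum>e\<in>Basis. H w e * ((B t w - B s w) \<bullet> e))"
proof -
  have "H w v = (\<Sum>e\<in>Basis. H w e * (v \<bullet> e))" for v
    by (subst euclidean_representation[of v, symmetric])
      (simp only: blinfun.sum_right blinfun.scaleR_right real_scaleR_def mult.commute)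
  then show ?thesis .
qed

lemma weight_integrable:
  assumes G: "G \<in> borel_measurable (F s)" "integrable M G" and e: "norm e \<le> 1" "norm e' \<le> 1"
  shows "(\<lambda>w. G w * H w e) \<in> borel_measurable (F s)"
    "integrable M (\<lambda>w. G w * H w e)"
    "(\<lambda>w. G w * (H w e * H w e')) \<in> borel_measurable (F s)"
    "integrable M (\<lambda>w. G w * (H w e * H w e'))"
proof -
  note [measurable] = G(1) H(1)
  have s: "s \<in> {0..T}" using st by auto
  have b: "\<bar>H w e\<bar> \<le> C" if "norm e \<le> 1" for w e
  proof -
    have "norm (H w) * norm e \<le> C * 1"
      using H(2)[of w] that order_trans[OF norm_ge_zero H(2)] by (intro mult_mono) auto
    then show ?thesis using norm_blinfun[of "H w" e] by simp
  qed
  show m1: "(\<lambda>w. G w * H w e) \<in> borel_measurable (F s)"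
    and m2: "(\<lambda>w. G w * (H w e * H w e')) \<in> borel_measurable (F s)"
    by measurable
  have CG: "integrable M (\<lambda>w. C * G w)" "integrable M (\<lambda>w. (C * C) * G w)" using G(2) by auto
  have C: "0 \<le> C" using order_trans[OF norm_ge_zero H(2)] by blast
  show "integrable M (\<lambda>w. G w * H w e)"
  proof (rule Bochner_Integration.integrable_bound[OF CG(1) measurable_F_M[OF s m1]], rule AE_I2)
    fix w
    have "\<bar>G w\<bar> * \<bar>H w e\<bar> \<le> \<bar>G w\<bar> * C" by (intro mult_left_mono b e) auto
    then show "norm (G w * H w e) \<le> norm (C * G w)" using C by (simp add: abs_mult mult.commute)
  qed
  show "integrable M (\<lambda>w. G w * (H w e * H w e'))"
  proof (rule Bochner_Integration.integrable_bound[OF CG(2) measurable_F_M[OF s m2]], rule AE_I2)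
    fix w
    have "\<bar>G w\<bar> * (\<bar>H w e\<bar> * \<bar>H w e'\<bar>) \<le> \<bar>G w\<bar> * (C * C)"
      using C by (intro mult_left_mono mult_mono b e) auto
    then show "norm (G w * (H w e * H w e')) \<le> norm (C * C * G w)"
      using C by (simp add: abs_mult mult.commute)
  qed
qed

lemma step_first:
  assumes G: "G \<in> borel_measurable (F s)" "integrable M G"
  shows "integrable M (\<lambda>w. G w * H w (B t w - B s w))"
    "(\<integral>w. G w * H w (B t w - B s w) \<partial>M) = 0"
proof -
  have w: "(\<lambda>w. G w * H w e) \<in> borel_measurable (F s)"
    "integrable M (\<lambda>w. G w * H w e)" if "e \<in> Basis" for e
    using weight_integrable[OF G, of e e] that by auto
  have one: "integrable M (\<lambda>w. (G w * H w e) * ((B t w - B s w) \<bullet> e))"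
    "(\<integral>w. (G w * H w e) * ((B t w - B s w) \<bullet> e) \<partial>M) = 0" if e: "e \<in> Basis" for e
    using increment_expectation[OF st w[OF e], of "\<lambda>v. v \<bullet> e"] increment_moments(1)[OF st e, of 1]
      increment_moments(2)[OF st e] by auto
  have eq: "G w * H w (B t w - B s w)
      = (\<Sum>e\<in>Basis. (G w * H w e) * ((B t w - B s w) \<bullet> e))" for w
    unfolding step_expand by (simp add: sum_distrib_left mult.assoc)
  show "integrable M (\<lambda>w. G w * H w (B t w - B s w))"
    unfolding eq by (intro Bochner_Integration.integrable_sum one(1))
  show "(\<integral>w. G w * H w (B t w - B s w) \<partial>M) = 0"
    unfolding eq by (subst Bochner_Integration.integral_sum) (auto simp: one)
qed

lemma step_second:
  assumes G: "G \<in> borel_measurable (F s)" "integrable M G"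
  shows "integrable M (\<lambda>w. G w * (H w (B t w - B s w))\<^sup>2)"
    "(\<integral>w. G w * (H w (B t w - B s w))\<^sup>2 \<partial>M) = (t - s) * (\<integral>w. G w * hs (H w) \<partial>M)"
    "integrable M (\<lambda>w. G w * hs (H w))"
proof -
  let ?X = "\<lambda>e w. (B t w - B s w) \<bullet> e" and ?W = "\<lambda>e e' w. G w * (H w e * H w e')"
  have w: "?W e e' \<in> borel_measurable (F s)" "integrable M (?W e e')" if "e \<in> Basis" "e' \<in> Basis" for e e'
    using weight_integrable[OF G, of e e'] that by auto
  have sq: "sq_int M (?X e)" if e: "e \<in> Basis" for e
    using increment_moments(1)[OF st e, of 2] increment_moments(1)[OF st e, of 1] by (auto simp: sq_int_def)
  have XI: "integrable M (\<lambda>w. ?X e w * ?X e' w)" if "e \<in> Basis" "e' \<in> Basis" for e e'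
    by (rule sq_int_inner(1)[OF sq sq]) (use that in auto)
  have XE: "(\<integral>w. ?X e w * ?X e' w \<partial>M) = (if e = e' then t - s else 0)" if "e \<in> Basis" "e' \<in> Basis" for e e'
    using increment_cross[OF st, of e e'] increment_moments(3)[OF st, of e] that by (auto simp: power2_eq_square)
  have one: "integrable M (\<lambda>w. ?W e e' w * (?X e w * ?X e' w))"
    "(\<integral>w. ?W e e' w * (?X e w * ?X e' w) \<partial>M) = (\<integral>w. ?W e e' w \<partial>M) * (if e = e' then t - s else 0)"
    if e: "e \<in> Basis" "e' \<in> Basis" for e e'
    using increment_expectation[OF st w[OF e], of "\<lambda>v. (v \<bullet> e) * (v \<bullet> e')"] XI[OF e] XE[OF e] by auto
  have eq: "G w * (H w (B t w - B s w))\<^sup>2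
      = (\<Sum>e\<in>Basis. \<Sum>e'\<in>Basis. ?W e e' w * (?X e w * ?X e' w))" for w
    unfolding step_expand power2_eq_square sum_product
    by (simp add: sum_distrib_left mult_ac)
  show "integrable M (\<lambda>w. G w * (H w (B t w - B s w))\<^sup>2)"
    unfolding eq by (intro Bochner_Integration.integrable_sum one(1))
  have hsG: "(\<lambda>w. G w * hs (H w)) = (\<lambda>w. \<Sum>e\<in>Basis. ?W e e w)"
    by (auto simp: hs_def sum_distrib_left power2_eq_square)
  show "integrable M (\<lambda>w. G w * hs (H w))"
    unfolding hsG by (intro Bochner_Integration.integrable_sum w(2))
  have "(\<integral>w. G w * (H w (B t w - B s w))\<^sup>2 \<partial>M)
      = (\<integral>w. (\<Sum>e\<in>Basis. \<Sum>e'\<in>Basis. ?W e e' w * (?X e w * ?X e' w)) \<partial>M)"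
    by (simp only: eq)
  also have "\<dots> = (\<Sum>e\<in>Basis. \<Sum>e'\<in>Basis. (\<integral>w. ?W e e' w * (?X e w * ?X e' w) \<partial>M))"
    by (subst Bochner_Integration.integral_sum, intro Bochner_Integration.integrable_sum one(1), assumption, assumption,
        intro sum.cong refl Bochner_Integration.integral_sum one(1))
  also have "\<dots> = (\<Sum>e\<in>Basis. \<Sum>e'\<in>Basis. (\<integral>w. ?W e e' w \<partial>M) * (if e = e' then t - s else 0))"
    by (intro sum.cong refl one(2))
  also have "\<dots> = (\<Sum>e\<in>Basis. (\<integral>w. ?W e e w \<partial>M) * (t - s))"
    by (intro sum.cong refl) (simp add: if_distrib[of "(*) _"] sum.delta cong: if_cong)
  also have "\<dots> = (t - s) * (\<Sum>e\<in>Basis. \<integral>w. ?W e e w \<partial>M)"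
    by (simp add: sum_distrib_left mult.commute)
  also have "(\<Sum>e\<in>Basis. \<integral>w. ?W e e w \<partial>M) = (\<integral>w. (\<Sum>e\<in>Basis. ?W e e w) \<partial>M)"
    by (intro Bochner_Integration.integral_sum[symmetric] w(2))
  finally show "(\<integral>w. G w * (H w (B t w - B s w))\<^sup>2 \<partial>M) = (t - s) * (\<integral>w. G w * hs (H w) \<partial>M)"
    unfolding hsG .
qed

lemma step_measurable: "(\<lambda>w. H w (B t w - B s w)) \<in> borel_measurable (F t)"
proof -
  have [measurable]: "H \<in> borel_measurable (F t)" "B t \<in> borel_measurable (F t)" "B s \<in> borel_measurable (F t)"
    using measurable_mono[of s t] st H(1) B_measurable[of s] B_measurable[of t] by auto
  show ?thesis by measurable
qed

lemma step_fourth: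
  "integrable M (\<lambda>w. (H w (B t w - B s w)) ^ 4)"
  "(\<integral>w. (H w (B t w - B s w)) ^ 4 \<partial>M) \<le> 3 * (real DIM('u))\<^sup>2 * C ^ 4 * (t - s)\<^sup>2"
proof -
  have t: "t \<in> {0..T}" using st by auto
  have pw: "(H w (B t w - B s w)) ^ 4 \<le> C ^ 4 * norm (B t w - B s w) ^ 4" for w
  proof -
    have "\<bar>H w (B t w - B s w)\<bar> \<le> C * norm (B t w - B s w)"
      using order_trans[OF norm_blinfun mult_right_mono[OF H(2)]] by simp
    then have "\<bar>H w (B t w - B s w)\<bar> ^ 4 \<le> (C * norm (B t w - B s w)) ^ 4"
      by (intro power_mono) auto
    then show ?thesis by (simp add: power_mult_distrib)
  qed
  have I: "integrable M (\<lambda>w. C ^ 4 * norm (B t w - B s w) ^ 4)"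
    using increment_norm4(1)[OF st] by simp
  have m: "(\<lambda>w. (H w (B t w - B s w)) ^ 4) \<in> borel_measurable M"
    using measurable_F_M[OF t step_measurable] by measurable
  show J: "integrable M (\<lambda>w. (H w (B t w - B s w)) ^ 4)"
    by (rule Bochner_Integration.integrable_bound[OF I m]) (use pw in \<open>auto intro!: AE_I2 intro: order_trans[OF _ abs_ge_self]\<close>)
  have "(\<integral>w. (H w (B t w - B s w)) ^ 4 \<partial>M) \<le> (\<integral>w. C ^ 4 * norm (B t w - B s w) ^ 4 \<partial>M)"
    by (intro integral_mono J I pw)
  also have "\<dots> \<le> C ^ 4 * (3 * (real DIM('u))\<^sup>2 * (t - s)\<^sup>2)"
    using increment_norm4(2)[OF st] by (simp add: mult_left_mono)
  finally show "(\<integral>w. (H w (B t w - B s w)) ^ 4 \<partial>M) \<le> 3 * (real DIM('u))\<^sup>2 * C ^ 4 * (t - s)\<^sup>2"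
    by (simp add: mult_ac)
qed

end

end


context brownian_space
begin

text \<open>The fourth moment is controlled by expanding \<open>(S + d)\<^sup>4\<close>: the cubic term is
  a martingale difference and the others are bounded through \<open>S\<^sup>2 d\<^sup>2\<close> and \<open>d\<^sup>4\<close>.\<close>

lemma discrete_martingale:
  fixes \<tau> :: "nat => real" and H :: "nat => 'o => 'u \<Rightarrow>\<^sub>L real" and C :: real
  defines "S \<equiv> \<lambda>j w. \<Sum>i<j. H i w (B (\<tau> (Suc i)) w - B (\<tau> i) w)"
  assumes \<tau>: "\<And>i. i < m ==> \<tau> i \<le> \<tau> (Suc i)" "0 \<le> \<tau> 0" "\<And>i. i \<le> m ==> \<tau> i \<le> T"
    and H: "\<And>i. i < m ==> \<tau> i < \<tau> (Suc i) ==> H i \<in> borel_measurable (F (\<tau> i))"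
      "\<And>i w. norm (H i w) \<le> C"
  shows "j \<le> m ==> S j \<in> borel_measurable (F (\<tau> j)) \<and> integrable M (\<lambda>w. (S j w) ^ 4) \<and> sq_int M (S j) \<and>
      (\<integral>w. (S j w)\<^sup>2 \<partial>M) \<le> real DIM('u) * C\<^sup>2 * (\<tau> j - \<tau> 0) \<and>
      (\<integral>w. (S j w) ^ 4 \<partial>M) \<le> 9 * (real DIM('u))\<^sup>2 * C ^ 4 * (\<tau> j - \<tau> 0)\<^sup>2"
    and "\<And>\<xi> K. j \<le> m ==> \<xi> \<in> borel_measurable (F (\<tau> 0)) ==> (\<And>w. \<bar>\<xi> w\<bar> \<le> K) ==>
      (\<integral>w. \<xi> w * S j w \<partial>M) = 0 \<and>
      integrable M (\<lambda>w. \<xi> w * (\<Sum>i<j. (\<tau> (Suc i) - \<tau> i) * hs (H i w))) \<and>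
      (\<integral>w. \<xi> w * (S j w)\<^sup>2 \<partial>M) = (\<integral>w. \<xi> w * (\<Sum>i<j. (\<tau> (Suc i) - \<tau> i) * hs (H i w)) \<partial>M)"
proof -
  let ?D = "real DIM('u)"
  have C: "0 \<le> C" using order_trans[OF norm_ge_zero H(2)] by blast
  have mono: "\<tau> 0 \<le> \<tau> j" if "j \<le> m" for j using that
    by (induction j) (use \<tau>(1) in \<open>auto intro: order_trans\<close>)
  have hsH: "hs (H i w) \<le> ?D * C\<^sup>2" for i w
  proof -
    have "(norm (H i w))\<^sup>2 \<le> C\<^sup>2" using H(2) by (intro power_mono) auto
    then have "?D * (norm (H i w))\<^sup>2 \<le> ?D * C\<^sup>2" by (intro mult_left_mono) auto
    then show ?thesis using hs_le[of "H i w"] by linarith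
  qed
  have S_Suc: "S (Suc j) w = S j w + H j w (B (\<tau> (Suc j)) w - B (\<tau> j) w)" for j w
    by (simp add: S_def)
  have sq_of_fourth: "sq_int M f" if "f \<in> borel_measurable M" "integrable M (\<lambda>w. (f w) ^ 4)" for f :: "'o => real"
  proof -
    have "sq_int M (\<lambda>w. (f w)\<^sup>2)" using that by (simp add: sq_int_def power_mult[symmetric])
    then have "integrable M (\<lambda>w. (f w)\<^sup>2)" by (rule sq_int_integrable(1))
    then show ?thesis using that by (simp add: sq_int_def)
  qed
  have main: "S j \<in> borel_measurable (F (\<tau> j)) \<and> integrable M (\<lambda>w. (S j w) ^ 4) \<and> sq_int M (S j) \<and>
      (\<integral>w. (S j w)\<^sup>2 \<partial>M) \<le> ?D * C\<^sup>2 * (\<tau> j - \<tau> 0) \<and>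
      (\<integral>w. (S j w) ^ 4 \<partial>M) \<le> 9 * ?D\<^sup>2 * C ^ 4 * (\<tau> j - \<tau> 0)\<^sup>2 \<and>
      (\<forall>\<xi> K. \<xi> \<in> borel_measurable (F (\<tau> 0)) \<longrightarrow> (\<forall>w. \<bar>\<xi> w\<bar> \<le> K) \<longrightarrow>
      (\<integral>w. \<xi> w * S j w \<partial>M) = 0 \<and>
      integrable M (\<lambda>w. \<xi> w * (\<Sum>i<j. (\<tau> (Suc i) - \<tau> i) * hs (H i w))) \<and>
      (\<integral>w. \<xi> w * (S j w)\<^sup>2 \<partial>M) = (\<integral>w. \<xi> w * (\<Sum>i<j. (\<tau> (Suc i) - \<tau> i) * hs (H i w)) \<partial>M))"
    if "j \<le> m" for j
    using that
  proof (induction j)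
    case 0
    have "S 0 = (\<lambda>w. 0)" by (simp add: S_def)
    then show ?case using sq_int_zero by auto
  next
    case (Suc j)
    have jm: "j < m" using Suc.prems by simp
    note IH = Suc.IH[OF less_imp_le[OF jm]]
    show ?case
    proof (cases "\<tau> j = \<tau> (Suc j)")
      case True
      then have "S (Suc j) = S j" by (auto simp: S_Suc fun_eq_iff)
      then show ?thesis using IH True by simp
    next
      case False
      define u v where "u = \<tau> j" and "v = \<tau> (Suc j)"
      have uv: "0 \<le> u" "u < v" "v \<le> T" and ujT: "u \<in> {0..T}" and t0: "\<tau> 0 \<le> u"
        using False \<tau>(1)[OF jm] \<tau>(2) \<tau>(3)[of "Suc j"] mono[of j] jm by (auto simp: u_def v_def)
      have Hj: "H j \<in> borel_measurable (F u)" using H(1)[OF jm] uv by (simp add: u_def v_def)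
      let ?S = "S j" and ?d = "\<lambda>w. H j w (B v w - B u w)"
      have SS: "S (Suc j) w = ?S w + ?d w" for w by (simp add: S_Suc u_def v_def)
      note Hb = H(2)[of j]
      note st1 = step_first[OF uv Hj Hb] and st2 = step_second[OF uv Hj Hb]
        and st4 = step_fourth[OF uv Hj Hb] and stm = step_measurable[OF uv Hj Hb]
      from IH have Sm: "?S \<in> borel_measurable (F u)" and S4: "integrable M (\<lambda>w. (?S w) ^ 4)" and Ssq: "sq_int M ?S"
        and S2b: "(\<integral>w. (?S w)\<^sup>2 \<partial>M) \<le> ?D * C\<^sup>2 * (u - \<tau> 0)"
        and S4b: "(\<integral>w. (?S w) ^ 4 \<partial>M) \<le> 9 * ?D\<^sup>2 * C ^ 4 * (u - \<tau> 0)\<^sup>2" by (simp_all add: u_def)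
      have [measurable]: "?S \<in> borel_measurable M" using Sm ujT by (rule measurable_F_M[rotated])
      have dm[measurable]: "?d \<in> borel_measurable M" using stm uv by (intro measurable_F_M[of v]) auto
      have dsq: "sq_int M ?d" by (rule sq_of_fourth[OF dm st4(1)])
      have I2: "integrable M (\<lambda>w. (?S w)\<^sup>2)" using Ssq by (simp add: sq_int_def)
      have I3: "integrable M (\<lambda>w. (?S w) ^ 3)"
      proof (rule Bochner_Integration.integrable_bound)
        show "integrable M (\<lambda>w. 1 + (?S w) ^ 4)" using S4 by simp
        have "\<bar>x ^ 3\<bar> \<le> 1 + x ^ 4" for x :: real
        proof (cases "\<bar>x\<bar> \<le> 1")
          case True
          then have "\<bar>x\<bar> ^ 3 \<le> 1" by (intro power_le_one) auto
          then show ?thesis by (simp add: power_abs add_increasing2)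
        next
          case False
          then have "\<bar>x\<bar> ^ 3 \<le> \<bar>x\<bar> ^ 4" by (intro power_increasing) auto
          then show ?thesis by (simp add: power_abs)
        qed
        then show "AE w in M. norm ((?S w) ^ 3) \<le> norm (1 + (?S w) ^ 4)"
          by (intro AE_I2) (auto intro: order_trans[OF _ abs_ge_self])
      qed measurable
      have m3: "(\<lambda>w. (?S w) ^ 3) \<in> borel_measurable (F u)" and m2: "(\<lambda>w. (?S w)\<^sup>2) \<in> borel_measurable (F u)"
        using Sm by measurable
      note c3 = st1[OF m3 I3] and c2 = st2[OF m2 I2]
      have SSm: "S (Suc j) \<in> borel_measurable (F v)"
      proof -
        have "?S \<in> borel_measurable (F v)" using uv Sm by (intro measurable_mono[of u v]) auto
        then show ?thesis unfolding SS[abs_def] using stm by measurable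
      qed
      have SSmM: "S (Suc j) \<in> borel_measurable M" using SSm uv by (intro measurable_F_M[of v]) auto
      have pw4: "(x + y) ^ 4 \<le> x ^ 4 + 4 * (x ^ 3 * y) + 8 * (x\<^sup>2 * y\<^sup>2) + 3 * y ^ 4" for x y :: real
      proof -
        have "0 \<le> 2 * (y\<^sup>2 * (x - y)\<^sup>2)" by simp
        then show ?thesis by (simp add: power2_eq_square power3_eq_cube power4_eq_xxxx algebra_simps)
      qed
      have Ib: "integrable M (\<lambda>w. (?S w) ^ 4 + 4 * ((?S w) ^ 3 * ?d w) + 8 * ((?S w)\<^sup>2 * (?d w)\<^sup>2) + 3 * (?d w) ^ 4)"
        using S4 c3(1) c2(1) st4(1) by simp
      have J4: "integrable M (\<lambda>w. (S (Suc j) w) ^ 4)"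
      proof (rule Bochner_Integration.integrable_bound[OF Ib])
        show "(\<lambda>w. (S (Suc j) w) ^ 4) \<in> borel_measurable M" using SSmM by measurable
        show "AE w in M. norm ((S (Suc j) w) ^ 4) \<le>
            norm ((?S w) ^ 4 + 4 * ((?S w) ^ 3 * ?d w) + 8 * ((?S w)\<^sup>2 * (?d w)\<^sup>2) + 3 * (?d w) ^ 4)"
        proof (rule AE_I2)
          fix w
          have "norm ((S (Suc j) w) ^ 4) = (?S w + ?d w) ^ 4" by (simp add: SS)
          also have "\<dots> \<le> (?S w) ^ 4 + 4 * ((?S w) ^ 3 * ?d w) + 8 * ((?S w)\<^sup>2 * (?d w)\<^sup>2) + 3 * (?d w) ^ 4"
            by (rule pw4)
          finally show "norm ((S (Suc j) w) ^ 4) \<le>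
            norm ((?S w) ^ 4 + 4 * ((?S w) ^ 3 * ?d w) + 8 * ((?S w)\<^sup>2 * (?d w)\<^sup>2) + 3 * (?d w) ^ 4)"
            by (rule order_trans) (simp only: real_norm_def abs_ge_self)
        qed
      qed
      define L \<Delta> where "L = u - \<tau> 0" and "\<Delta> = v - u"
      have L: "0 \<le> L" "0 < \<Delta>" "v - \<tau> 0 = L + \<Delta>" using t0 uv by (auto simp: L_def \<Delta>_def)
      have c2b: "(\<integral>w. (?S w)\<^sup>2 * (?d w)\<^sup>2 \<partial>M) \<le> \<Delta> * (?D * C\<^sup>2 * (?D * C\<^sup>2 * L))"
      proof -
        have "(\<integral>w. (?S w)\<^sup>2 * hs (H j w) \<partial>M) \<le> (\<integral>w. (?D * C\<^sup>2) * (?S w)\<^sup>2 \<partial>M)"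
        proof (rule integral_mono[OF c2(3)])
          show "(?S w)\<^sup>2 * hs (H j w) \<le> (?D * C\<^sup>2) * (?S w)\<^sup>2" for w
            using mult_left_mono[OF hsH[of j w], of "(?S w)\<^sup>2"] by (simp add: mult.commute)
        qed (use I2 in simp)
        also have "\<dots> \<le> (?D * C\<^sup>2) * (?D * C\<^sup>2 * L)"
          using S2b by (simp add: L_def mult_left_mono)
        finally show ?thesis unfolding c2(2) \<Delta>_def[symmetric] using L by (intro mult_left_mono) auto
      qed
      have J4b: "(\<integral>w. (S (Suc j) w) ^ 4 \<partial>M) \<le> 9 * ?D\<^sup>2 * C ^ 4 * (v - \<tau> 0)\<^sup>2"
      proof -
        have "(\<integral>w. (S (Suc j) w) ^ 4 \<partial>M)
          \<le> (\<integral>w. (?S w) ^ 4 + 4 * ((?S w) ^ 3 * ?d w) + 8 * ((?S w)\<^sup>2 * (?d w)\<^sup>2) + 3 * (?d w) ^ 4 \<partial>M)"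
          by (intro integral_mono J4 Ib) (simp only: SS pw4)
        also have "\<dots> = (\<integral>w. (?S w) ^ 4 \<partial>M) + 4 * (\<integral>w. (?S w) ^ 3 * ?d w \<partial>M)
            + 8 * (\<integral>w. (?S w)\<^sup>2 * (?d w)\<^sup>2 \<partial>M) + 3 * (\<integral>w. (?d w) ^ 4 \<partial>M)"
          using S4 c3(1) c2(1) st4(1) by simp
        also have "\<dots> \<le> 9 * ?D\<^sup>2 * C ^ 4 * L\<^sup>2 + 8 * (\<Delta> * (?D * C\<^sup>2 * (?D * C\<^sup>2 * L))) + 3 * (3 * ?D\<^sup>2 * C ^ 4 * \<Delta>\<^sup>2)"
          using S4b c3(2) c2b st4(2) by (simp add: L_def \<Delta>_def)
        also have "\<dots> = ?D\<^sup>2 * C ^ 4 * (9 * L\<^sup>2 + 8 * L * \<Delta> + 9 * \<Delta>\<^sup>2)"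
          by (simp add: power2_eq_square power4_eq_xxxx algebra_simps)
        also have "\<dots> \<le> ?D\<^sup>2 * C ^ 4 * (9 * (L + \<Delta>)\<^sup>2)"
        proof (intro mult_left_mono)
          have "0 \<le> L * \<Delta>" using L by simp
          then show "9 * L\<^sup>2 + 8 * L * \<Delta> + 9 * \<Delta>\<^sup>2 \<le> 9 * (L + \<Delta>)\<^sup>2" by (simp add: power2_eq_square algebra_simps)
        qed simp
        finally show ?thesis unfolding L(3) by (simp add: mult_ac)
      qed
      have w: "(\<integral>w. \<xi> w * S (Suc j) w \<partial>M) = 0 \<and>
          integrable M (\<lambda>w. \<xi> w * (\<Sum>i<Suc j. (\<tau> (Suc i) - \<tau> i) * hs (H i w))) \<and>
          (\<integral>w. \<xi> w * (S (Suc j) w)\<^sup>2 \<partial>M) = (\<integral>w. \<xi> w * (\<Sum>i<Suc j. (\<tau> (Suc i) - \<tau> i) * hs (H i w)) \<partial>M)"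
        if \<xi>: "\<xi> \<in> borel_measurable (F (\<tau> 0))" "\<And>w. \<bar>\<xi> w\<bar> \<le> K" for \<xi> K
      proof -
        have \<xi>u: "\<xi> \<in> borel_measurable (F u)" using \<xi>(1) uv t0 \<tau>(2) by (intro measurable_mono[of "\<tau> 0" u]) auto
        have \<xi>M: "\<xi> \<in> borel_measurable M" by (rule measurable_F_M[OF ujT \<xi>u])
        have K: "0 \<le> K" using \<xi>(2)[of undefined] by linarith
        have \<xi>I: "integrable M \<xi>" using \<xi>M \<xi>(2) by (intro integrable_const_bound[of _ K]) auto
        have S1m: "(\<lambda>w. \<xi> w * ?S w) \<in> borel_measurable (F u)" using \<xi>u Sm by measurable
        have S1sq: "sq_int M (\<lambda>w. \<xi> w * ?S w)" using \<xi>(2) by (intro sq_int_bounded_mult(1)[OF Ssq \<xi>M, of K]) auto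
        note S1I = sq_int_integrable(1)[OF S1sq]
        note a = st1[OF \<xi>u \<xi>I] and b = st1[OF S1m S1I] and c = st2[OF \<xi>u \<xi>I]
        have IHx: "(\<integral>w. \<xi> w * ?S w \<partial>M) = 0"
          "integrable M (\<lambda>w. \<xi> w * (\<Sum>i<j. (\<tau> (Suc i) - \<tau> i) * hs (H i w)))"
          "(\<integral>w. \<xi> w * (?S w)\<^sup>2 \<partial>M) = (\<integral>w. \<xi> w * (\<Sum>i<j. (\<tau> (Suc i) - \<tau> i) * hs (H i w)) \<partial>M)"
          using IH \<xi> by blast+
        have S2I: "integrable M (\<lambda>w. \<xi> w * (?S w)\<^sup>2)"
          using sq_int_inner(1)[OF S1sq Ssq] by (simp add: power2_eq_square mult.assoc)
        have e1: "(\<lambda>w. \<xi> w * S (Suc j) w) = (\<lambda>w. \<xi> w * ?S w + \<xi> w * ?d w)"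
          unfolding SS by (simp add: distrib_left)
        have e2: "(\<lambda>w. \<xi> w * (S (Suc j) w)\<^sup>2) = (\<lambda>w. \<xi> w * (?S w)\<^sup>2 + 2 * (\<xi> w * ?S w * ?d w) + \<xi> w * (?d w)\<^sup>2)"
          unfolding SS by (simp add: power2_sum algebra_simps)
        have e3: "(\<lambda>w. \<xi> w * (\<Sum>i<Suc j. (\<tau> (Suc i) - \<tau> i) * hs (H i w)))
          = (\<lambda>w. \<xi> w * (\<Sum>i<j. (\<tau> (Suc i) - \<tau> i) * hs (H i w)) + (v - u) * (\<xi> w * hs (H j w)))"
          by (auto simp: u_def v_def algebra_simps)
        show ?thesis
          unfolding e1 e2 e3 using IHx S1I S2I a b c by simp
      qed
      have S2I: "sq_int M (S (Suc j))" by (rule sq_of_fourth[OF SSmM J4])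
      have J2: "(\<integral>w. (S (Suc j) w)\<^sup>2 \<partial>M) \<le> ?D * C\<^sup>2 * (v - \<tau> 0)"
      proof -
        have one: "(\<lambda>_. 1 :: real) \<in> borel_measurable (F u)" "integrable M (\<lambda>_. 1 :: real)" by auto
        note c = step_second[OF uv Hj Hb one]
        note a = step_first[OF uv Hj Hb Sm sq_int_integrable(1)[OF Ssq]]
        have "(\<integral>w. (S (Suc j) w)\<^sup>2 \<partial>M) = (\<integral>w. (?S w)\<^sup>2 + 2 * (?S w * ?d w) + (?d w)\<^sup>2 \<partial>M)"
          by (intro Bochner_Integration.integral_cong refl) (simp add: SS power2_sum)
        also have "\<dots> = (\<integral>w. (?S w)\<^sup>2 \<partial>M) + (v - u) * (\<integral>w. hs (H j w) \<partial>M)"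
          using I2 a c by simp
        finally have eq: "(\<integral>w. (S (Suc j) w)\<^sup>2 \<partial>M) = (\<integral>w. (?S w)\<^sup>2 \<partial>M) + (v - u) * (\<integral>w. hs (H j w) \<partial>M)" .
        have "(\<integral>w. hs (H j w) \<partial>M) \<le> ?D * C\<^sup>2"
          using integral_mono[of M "\<lambda>w. hs (H j w)" "\<lambda>_. ?D * C\<^sup>2"] c(3) hsH[of j] by (simp add: prob_space)
        then have "(v - u) * (\<integral>w. hs (H j w) \<partial>M) \<le> (v - u) * (?D * C\<^sup>2)"
          using uv by (intro mult_left_mono) auto
        then show ?thesis using S2b unfolding eq by (simp add: algebra_simps)
      qed
      show ?thesis using SSm J4 S2I J2 J4b w unfolding v_def by blast
    qed
  qed
  show "j \<le> m ==> S j \<in> borel_measurable (F (\<tau> j)) \<and> integrable M (\<lambda>w. (S j w) ^ 4) \<and> sq_int M (S j) \<and>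
      (\<integral>w. (S j w)\<^sup>2 \<partial>M) \<le> ?D * C\<^sup>2 * (\<tau> j - \<tau> 0) \<and>
      (\<integral>w. (S j w) ^ 4 \<partial>M) \<le> 9 * (real DIM('u))\<^sup>2 * C ^ 4 * (\<tau> j - \<tau> 0)\<^sup>2"
    using main[of j] by simp
  show "\<And>\<xi> K. j \<le> m ==> \<xi> \<in> borel_measurable (F (\<tau> 0)) ==> (\<And>w. \<bar>\<xi> w\<bar> \<le> K) ==>
      (\<integral>w. \<xi> w * S j w \<partial>M) = 0 \<and>
      integrable M (\<lambda>w. \<xi> w * (\<Sum>i<j. (\<tau> (Suc i) - \<tau> i) * hs (H i w))) \<and>
      (\<integral>w. \<xi> w * (S j w)\<^sup>2 \<partial>M) = (\<integral>w. \<xi> w * (\<Sum>i<j. (\<tau> (Suc i) - \<tau> i) * hs (H i w)) \<partial>M)"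
    using main[of j] by blast
qed

end


section \<open>Ito integrals as limits of elementary integrals\<close>

text \<open>At each time at most one of the intervals is active, and where none is, \<open>f 0 = 0\<close> is the right value.\<close>

lemma elementary_process_map:
  fixes h :: "real => 'o => 'e::real_vector" and f :: "'e => 'f::real_vector"
  assumes f0: "f 0 = 0" and P: "finite P"
  shows "f (elementary_process P h r w) = elementary_process P (\<lambda>u w. f (h u w)) r w"
proof (cases "\<exists>u v. (u, v) \<in> steps P \<and> r \<in> {u<..v}")
  case True
  then obtain u v where uv: "(u, v) \<in> steps P" "u < r" "r \<le> v" by auto
  have uniq: "(u', v') = (u, v)" if "(u', v') \<in> steps P" "r \<in> {u'<..v'}" for u' v'
  proof -
    have "u \<notin> {u'<..<v'}" "v \<notin> {u'<..<v'}" "u' \<notin> {u<..<v}" "v' \<notin> {u<..<v}"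
      using that uv by (auto simp: steps_def)
    then show ?thesis using that uv by force
  qed
  have val: "elementary_process P k r w = k u w" for k :: "real => 'o => 'x::real_vector"
  proof -
    have "elementary_process P k r w = (\<Sum>x\<in>steps P. if x = (u, v) then k u w else 0)"
      unfolding elementary_process_def
    proof (rule sum.cong[OF refl])
      fix x assume x: "x \<in> steps P"
      obtain u' v' where x': "x = (u', v')" by (cases x)
      show "(case x of (u, v) => indicator {u<..v} r *\<^sub>R k u w) = (if x = (u, v) then k u w else 0)"
      proof (cases "r \<in> {u'<..v'}")
        case True
        then show ?thesis using uniq x x' by simp
      next
        case False
        then show ?thesis using uv x' by auto
      qed
    qed
    then show ?thesis using uv(1) finite_steps[OF P] by simp
  qed
  show ?thesis by (simp only: val)
next
  case False
  then have zero: "elementary_process P k r w = 0" for k :: "real => 'o => 'x::real_vector"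
    unfolding elementary_process_def by (intro sum.neutral) (auto simp: indicator_def)
  show ?thesis by (simp only: zero f0)
qed

lemma set_integral_elementary_process:
  fixes h :: "real => 'o => real" and p :: "nat => real"
  assumes p: "\<And>i j. i < j ==> j \<le> m ==> p i < p j" and st: "s \<le> t"
  shows "(LINT r:{s..t}|lborel. elementary_process (p ` {..m}) h r w)
    = (\<Sum>i<m. (max s (min t (p (Suc i))) - max s (min t (p i))) * h (p i) w)"
proof -
  have m: "measure lborel ({s..t} \<inter> {a<..b}) = max s (min t b) - max s (min t a)" if "a < b" for a b
  proof -
    consider "t < s" | "b < s" | "t \<le> a" | "s \<le> t" "s \<le> b" "a < s" | "s \<le> t" "s \<le> a" "a < t" by linarith
    then show ?thesis
    proof cases
      case 2
      then have "{s..t} \<inter> {a<..b} = {}" by auto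
      then show ?thesis using 2 that st by simp
    next
      case 3
      then have "{s..t} \<inter> {a<..b} = {}" by auto
      then show ?thesis using 3 that st by simp
    next
      case 4
      then have "{s..t} \<inter> {a<..b} = {s..min t b}" by auto
      then show ?thesis using 4 that by simp
    next
      case 5
      then have "{s..t} \<inter> {a<..b} = {a<..min t b}" by auto
      then show ?thesis using 5 that by simp
    qed (use st in simp)
  qed
  have ep: "elementary_process (p ` {..m}) h r w = (\<Sum>i<m. indicator {p i<..p (Suc i)} r * h (p i) w)" for r
    unfolding elementary_process_def
    using sum_steps_image[where m=m and p=p and f="\<lambda>u v. indicator {u<..v} r *\<^sub>R h u w", OF p] by simp
  have "(LINT r:{s..t}|lborel. elementary_process (p ` {..m}) h r w)
      = (\<integral>r. (\<Sum>i<m. indicator ({s..t} \<inter> {p i<..p (Suc i)}) r * h (p i) w) \<partial>lborel)"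
    unfolding set_lebesgue_integral_def ep
    by (simp only: real_scaleR_def sum_distrib_left indicator_inter_arith mult.assoc)
  also have "\<dots> = (\<Sum>i<m. \<integral>r. indicator ({s..t} \<inter> {p i<..p (Suc i)}) r * h (p i) w \<partial>lborel)"
  proof (rule Bochner_Integration.integral_sum)
    fix i
    have "emeasure lborel ({s..t} \<inter> {p i<..p (Suc i)}) \<le> emeasure lborel {s..t}" by (intro emeasure_mono) auto
    also have "\<dots> < \<infinity>" using st by simp
    finally show "integrable lborel (\<lambda>r. indicator ({s..t} \<inter> {p i<..p (Suc i)}) r * h (p i) w)"
      by (intro integrable_mult_left integrable_real_indicator) auto
  qed
  also have "\<dots> = (\<Sum>i<m. (max s (min t (p (Suc i))) - max s (min t (p i))) * h (p i) w)"
    by (intro sum.cong refl) (use m p in auto)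
  finally show ?thesis .
qed

lemma elementary_integral_increment:
  fixes p :: "nat => real"
  assumes p: "\<And>i j. i < j ==> j \<le> m ==> p i < p j" and st: "s \<le> t"
  shows "elementary_integral (p ` {..m}) h B t w - elementary_integral (p ` {..m}) h B s w
    = (\<Sum>i<m. blinfun_apply (h (p i) w)
        (B (max s (min t (p (Suc i)))) w - B (max s (min t (p i))) w))"
proof -
  have B: "B (min x t) w - B (min x s) w = B (max s (min t x)) w - B s w" for x
    using st by (cases "s = t"; cases "x \<le> s"; cases "x \<le> t") (auto simp: min_def max_def)
  have "B (min v t) w - B (min u t) w - (B (min v s) w - B (min u s) w)
      = B (max s (min t v)) w - B (max s (min t u)) w" for u v
  proof -
    have "B (min v t) w - B (min u t) w - (B (min v s) w - B (min u s) w)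
        = (B (min v t) w - B (min v s) w) - (B (min u t) w - B (min u s) w)" by simp
    then show ?thesis unfolding B by simp
  qed
  moreover have "elementary_integral (p ` {..m}) h B x w
      = (\<Sum>i<m. h (p i) w (B (min (p (Suc i)) x) w - B (min (p i) x) w))" for x
    unfolding elementary_integral_def
    using sum_steps_image[where m=m and p=p and
        f="\<lambda>u v. h u w (B (min v x) w - B (min u x) w)", OF p] by simp
  ultimately show ?thesis
    by (simp only: sum_subtractf[symmetric] blinfun.diff_right[symmetric])
qed

text \<open>The radial retraction onto the ball of radius \<open>C\<close> moves a point no further than its
  distance to any point of the ball.\<close>

definition retract_ball :: "real => 'a::real_normed_vector => 'a"
  where "retract_ball C x = (if norm x \<le> C then x else (C / norm x) *\<^sub>R x)"

lemma retract_ball: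
  assumes C: "0 \<le> C"
  shows "norm (retract_ball C x) \<le> C" "retract_ball C 0 = 0"
    and "norm y \<le> C ==> norm (x - retract_ball C x) \<le> norm (x - y)"
proof -
  show "norm (retract_ball C x) \<le> C" "retract_ball C 0 = 0" using C by (auto simp: retract_ball_def)
  assume y: "norm y \<le> C"
  show "norm (x - retract_ball C x) \<le> norm (x - y)"
  proof (cases "norm x \<le> C")
    case False
    then have x: "norm x > 0" using C by linarith
    have "x - retract_ball C x = (1 - C / norm x) *\<^sub>R x"
      using False by (simp add: retract_ball_def scaleR_diff_left)
    then have "norm (x - retract_ball C x) = \<bar>1 - C / norm x\<bar> * norm x" by simp
    also have "\<dots> = (1 - C / norm x) * norm x" using False x by simp
    also have "\<dots> = norm x - C" using x by (simp add: left_diff_distrib)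
    also have "\<dots> \<le> norm (x - y)" using norm_triangle_ineq2[of x y] y by linarith
    finally show ?thesis .
  qed (simp add: retract_ball_def)
qed

lemma borel_measurable_retract_ball [measurable]:
  "retract_ball C \<in> borel_measurable (borel :: 'a::{real_normed_vector,second_countable_topology} measure)"
  unfolding retract_ball_def[abs_def] by measurable

lemma hs_diff_le:
  fixes x y :: "'u::euclidean_space \<Rightarrow>\<^sub>L real"
  assumes "norm x \<le> C" "norm y \<le> C"
  shows "\<bar>hs x - hs y\<bar> \<le> 2 * real DIM('u) * C * norm (x - y)"
proof -
  have one: "\<bar>(x e)\<^sup>2 - (y e)\<^sup>2\<bar> \<le> 2 * C * norm (x - y)" if e: "e \<in> Basis" for e
  proof -
    have b: "\<bar>z e\<bar> \<le> norm z" for z :: "'u \<Rightarrow>\<^sub>L real" using norm_blinfun[of z e] e by simp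
    have "\<bar>(x e)\<^sup>2 - (y e)\<^sup>2\<bar>
        = \<bar>x e + y e\<bar> * \<bar>(x - y) e\<bar>"
      by (simp add: abs_mult[symmetric] blinfun.diff_left power2_eq_square algebra_simps)
    also have "\<dots> \<le> (2 * C) * norm (x - y)"
      using b[of x] b[of y] b[of "x - y"] assms by (intro mult_mono) auto
    finally show ?thesis .
  qed
  have "\<bar>hs x - hs y\<bar> = \<bar>\<Sum>e\<in>Basis. (x e)\<^sup>2 - (y e)\<^sup>2\<bar>"
    by (simp add: hs_def sum_subtractf)
  also have "\<dots> \<le> (\<Sum>e\<in>(Basis::'u set). 2 * C * norm (x - y))"
    by (intro order_trans[OF sum_abs] sum_mono one)
  finally show ?thesis by (simp add: mult_ac)
qed

context filtered_space
begin

text \<open>Composition with \<open>clamp\<close> extends a process on \<open>[0,T]\<close> to all times, so that joint measurability refers to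
  the Borel sets of the whole line.\<close>

definition clamp :: "real => real" where "clamp s = max 0 (min T s)"

lemma clamp_eq: "s \<in> {0..T} ==> clamp s = s"
  by (auto simp: clamp_def)

lemma clamp_in: "clamp s \<in> {0..T}"
  using T_pos by (auto simp: clamp_def)

lemma progressive_joint:
  assumes "progressive F T Z"
  shows "(\<lambda>x. Z (clamp (snd x)) (fst x)) \<in> borel_measurable (M \<Otimes>\<^sub>M borel)"
proof -
  have Z: "(\<lambda>(s, w). Z s w) \<in> borel_measurable (restrict_space borel {0..T} \<Otimes>\<^sub>M F T)"
    using assms T_pos by (auto simp: progressive_def)
  have c: "clamp \<in> borel \<rightarrow>\<^sub>M restrict_space borel {0..T}"
    by (intro measurable_restrict_space2) (use clamp_in in \<open>auto simp: clamp_def[abs_def]\<close>)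
  have i: "(\<lambda>x. x) \<in> M \<rightarrow>\<^sub>M F T"
    using measurable_from_subalg[OF sub[of T], of "\<lambda>x. x" "F T"] T_pos by auto
  have "(\<lambda>x. (clamp (snd x), fst x)) \<in> (M \<Otimes>\<^sub>M borel) \<rightarrow>\<^sub>M (restrict_space borel {0..T} \<Otimes>\<^sub>M F T)"
    using measurable_compose[OF measurable_snd c, of M] measurable_compose[OF measurable_fst i, of borel]
    by (intro measurable_Pair) auto
  from measurable_compose[OF this Z] show ?thesis by simp
qed

lemma progressive_adapted:
  assumes Z: "progressive F T Z" and t: "t \<in> {0..T}"
  shows "Z t \<in> borel_measurable (F t)"
proof -
  have Z: "(\<lambda>(s, w). Z s w) \<in> borel_measurable (restrict_space borel {0..t} \<Otimes>\<^sub>M F t)"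
    using assms by (auto simp: progressive_def)
  have "(\<lambda>w. (t, w)) \<in> F t \<rightarrow>\<^sub>M (restrict_space borel {0..t} \<Otimes>\<^sub>M F t)"
    using t by (intro measurable_Pair measurable_const) (auto simp: space_restrict_space)
  from measurable_compose[OF this Z] show ?thesis by simp
qed

end

context brownian_space
begin

text \<open>Clipping the nodes to \<open>[s,t]\<close> writes the increment as a discrete martingale that starts at time \<open>s\<close>; the
  steps outside \<open>[s,t]\<close> shrink to length zero.\<close>

lemma elementary_ito:
  fixes h :: "real => 'o => 'u \<Rightarrow>\<^sub>L 'w::fin_dim_banach" and l :: "'w \<Rightarrow>\<^sub>L real"
  assumes h: "elementary_integrand M F T P h" and C: "\<And>u w. u \<in> P ==> w \<in> space M ==> norm (h u w) \<le> C" "0 \<le> C"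
    and st: "0 \<le> s" "s < t" "t \<le> T"
  defines "N \<equiv> \<lambda>w. l (elementary_integral P h B t w - elementary_integral P h B s w)"
  shows "sq_int M N" "integrable M (\<lambda>w. (N w) ^ 4)"
    "(\<integral>w. (N w) ^ 4 \<partial>M) \<le> 9 * (real DIM('u))\<^sup>2 * (norm l * C) ^ 4 * (t - s)\<^sup>2"
    "\<And>\<xi> K. \<xi> \<in> borel_measurable (F s) ==> (\<And>w. \<bar>\<xi> w\<bar> \<le> K) ==> (\<integral>w. \<xi> w * N w \<partial>M) = 0"
    "\<And>\<xi> K. \<xi> \<in> borel_measurable (F s) ==> (\<And>w. \<bar>\<xi> w\<bar> \<le> K) ==>
      (\<integral>w. \<xi> w * (N w)\<^sup>2 \<partial>M) = (\<integral>w. \<xi> w * (LINT r:{s..t}|lborel. hs (l o\<^sub>L elementary_process P h r w)) \<partial>M)"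
proof -
  have PT: "P \<in> partitions T" and hm: "\<And>u. u \<in> P ==> h u \<in> borel_measurable (F u)"
    using h by (auto simp: elementary_integrand_def)
  then have fin: "finite P" and ne: "P \<noteq> {}" and P0: "0 \<in> P" "T \<in> P" and PsT: "P \<subseteq> {0..T}"
    by (auto simp: partitions_def)
  obtain p and m :: nat where p: "\<And>i j. i < j ==> j \<le> m ==> p i < p j" and Pp: "P = p ` {..m}"
    by (rule partition_enumeration[OF fin ne]) (rule that)
  have ple: "p i \<le> p j" if "i \<le> j" "j \<le> m" for i j using p[of i j] that by (cases "i = j") auto
  obtain i0 iT where i0: "i0 \<le> m" "p i0 = 0" "iT \<le> m" "p iT = T" using P0 Pp by auto
  have pin: "p i \<in> P" if "i \<le> m" for i using that Pp by auto
  have p0: "p 0 = 0" and pm: "p m = T"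
    using ple[of 0 i0] ple[of iT m] i0 PsT pin[of 0] pin[of m] by (auto intro: antisym)
  define \<tau> where "\<tau> i = max s (min t (p i))" for i
  define H where "H i w = (if w \<in> space M then l o\<^sub>L h (p i) w else 0)" for i w
  define H' where "H' i w = (if i < m then H i w else 0)" for i w
  have \<tau>0: "\<tau> 0 = s" and \<tau>m: "\<tau> m = t" using p0 pm st by (auto simp: \<tau>_def)
  have t1: "\<tau> i \<le> \<tau> (Suc i)" if "i < m" for i using ple[of i "Suc i"] that by (auto simp: \<tau>_def)
  have t2: "0 \<le> \<tau> 0" using \<tau>0 st by simp
  have t3: "\<tau> i \<le> T" for i using st by (auto simp: \<tau>_def)
  have H1: "H' i \<in> borel_measurable (F (\<tau> i))" if i: "i < m" "\<tau> i < \<tau> (Suc i)" for i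
  proof -
    have pi: "p i \<in> P" "0 \<le> p i" using pin[of i] i PsT by auto
    have le: "p i \<le> \<tau> i" using i by (auto simp: \<tau>_def split: if_splits)
    have sp: "space (F (\<tau> i)) = space M" using sub[of "\<tau> i"] t3[of i] le pi by (auto simp: subalgebra_def)
    have hF: "h (p i) \<in> borel_measurable (F (\<tau> i))"
      using measurable_mono[OF pi(2) le t3 hm[OF pi(1)]] .
    have "(\<lambda>w. l o\<^sub>L h (p i) w) \<in> borel_measurable (F (\<tau> i))"
      by (rule borel_measurable_bounded_linear[OF bounded_bilinear.bounded_linear_right[OF bounded_bilinear_blinfun_compose] hF])
    then show ?thesis
      by (rule measurable_cong[THEN iffD1, rotated]) (use sp i in \<open>auto simp: H'_def H_def\<close>)
  qed
  have H2: "norm (H' i w) \<le> norm l * C" for i w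
  proof -
    have "norm (l o\<^sub>L h (p i) w) \<le> norm l * C" if "i < m" "w \<in> space M"
      using norm_blinfun_compose[of l "h (p i) w"] mult_left_mono[OF C(1)[OF pin that(2)], of i "norm l"] that by simp
    then show ?thesis using C(2) by (auto simp: H'_def H_def)
  qed
  let ?S = "\<lambda>w. \<Sum>i<m. H' i w (B (\<tau> (Suc i)) w - B (\<tau> i) w)"
  have NS: "N w = ?S w" if "w \<in> space M" for w
    using that elementary_integral_increment[where m=m and p=p and s=s and t=t and h=h and B=B and w=w, OF p] st
    by (simp add: N_def Pp H'_def H_def \<tau>_def blinfun.sum_right)
  note dm = discrete_martingale[where m=m and \<tau>=\<tau> and H=H' and C="norm l * C", OF t1 t2 t3 H1 H2]
  from dm(1)[OF _ _ _ order_refl] have S: "integrable M (\<lambda>w. (?S w) ^ 4)" "sq_int M ?S"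
    "(\<integral>w. (?S w) ^ 4 \<partial>M) \<le> 9 * (real DIM('u))\<^sup>2 * (norm l * C) ^ 4 * (t - s)\<^sup>2"
    by (simp_all add: \<tau>0 \<tau>m)
  have Nm: "N \<in> borel_measurable M"
    by (rule measurable_cong[THEN iffD1, rotated, OF sq_int_measurable[OF S(2)]]) (simp add: NS)
  show N4: "integrable M (\<lambda>w. (N w) ^ 4)"
    using S(1) by (rule Bochner_Integration.integrable_cong[THEN iffD1, rotated 2]) (auto simp: NS)
  have "integrable M (\<lambda>w. (norm (N w))\<^sup>2) = integrable M (\<lambda>w. (norm (?S w))\<^sup>2)"
    by (rule Bochner_Integration.integrable_cong) (auto simp: NS)
  then show "sq_int M N" using S(2) Nm by (simp add: sq_int_def)
  have "(\<integral>w. (N w) ^ 4 \<partial>M) = (\<integral>w. (?S w) ^ 4 \<partial>M)" by (rule Bochner_Integration.integral_cong) (auto simp: NS)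
  then show "(\<integral>w. (N w) ^ 4 \<partial>M) \<le> 9 * (real DIM('u))\<^sup>2 * (norm l * C) ^ 4 * (t - s)\<^sup>2" using S(3) by simp
  fix \<xi> :: "'o => real" and K assume \<xi>: "\<xi> \<in> borel_measurable (F s)" "\<And>w. \<bar>\<xi> w\<bar> \<le> K"
  note d2 = dm(2)[OF _ _ _ order_refl, of \<xi> K]
  have d2': "(\<integral>w. \<xi> w * ?S w \<partial>M) = 0"
    "(\<integral>w. \<xi> w * (?S w)\<^sup>2 \<partial>M) = (\<integral>w. \<xi> w * (\<Sum>i<m. (\<tau> (Suc i) - \<tau> i) * hs (H' i w)) \<partial>M)"
    using d2 \<xi> by (simp_all add: \<tau>0)
  have "(\<integral>w. \<xi> w * N w \<partial>M) = (\<integral>w. \<xi> w * ?S w \<partial>M)" by (rule Bochner_Integration.integral_cong) (auto simp: NS)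
  then show "(\<integral>w. \<xi> w * N w \<partial>M) = 0" using d2'(1) by simp
  have "(\<integral>w. \<xi> w * (N w)\<^sup>2 \<partial>M) = (\<integral>w. \<xi> w * (?S w)\<^sup>2 \<partial>M)" by (rule Bochner_Integration.integral_cong) (auto simp: NS)
  also have "\<dots> = (\<integral>w. \<xi> w * (LINT r:{s..t}|lborel. hs (l o\<^sub>L elementary_process P h r w)) \<partial>M)"
    unfolding d2'(2)
  proof (rule Bochner_Integration.integral_cong[OF refl])
    fix w assume w: "w \<in> space M"
    have "hs (l o\<^sub>L elementary_process P h r w) = elementary_process P (\<lambda>u w. hs (l o\<^sub>L h u w)) r w" for r
      by (rule elementary_process_map[OF _ fin, of "\<lambda>x. hs (l o\<^sub>L x)"]) (simp add: hs_def)
    then have "(LINT r:{s..t}|lborel. hs (l o\<^sub>L elementary_process P h r w))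
        = (\<Sum>i<m. (\<tau> (Suc i) - \<tau> i) * hs (l o\<^sub>L h (p i) w))"
      using set_integral_elementary_process[where m=m and p=p and s=s and t=t and
        h="\<lambda>u w. hs (l o\<^sub>L h u w)" and w=w, OF p] st
      by (simp add: Pp \<tau>_def)
    then show "\<xi> w * (\<Sum>i<m. (\<tau> (Suc i) - \<tau> i) * hs (H' i w))
        = \<xi> w * (LINT r:{s..t}|lborel. hs (l o\<^sub>L elementary_process P h r w))"
      using w by (simp add: H'_def H_def)
  qed
  finally show "(\<integral>w. \<xi> w * (N w)\<^sup>2 \<partial>M)
      = (\<integral>w. \<xi> w * (LINT r:{s..t}|lborel. hs (l o\<^sub>L elementary_process P h r w)) \<partial>M)" .
qed

end


lemma ennreal_integral_le_nn_integral:
  assumes "\<And>x. 0 \<le> f x"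
  shows "ennreal (\<integral>x. f x \<partial>M) \<le> (\<integral>\<^sup>+x. ennreal (f x) \<partial>M)"
proof (cases "integrable M f")
  case True
  then show ?thesis using nn_integral_eq_integral[OF True] assms by simp
next
  case False
  then show ?thesis by (simp add: not_integrable_integral_eq)
qed

lemma ennreal_double_integral_le:
  fixes g :: "'o => real => real"
  assumes g: "\<And>w r. 0 \<le> g w r" and sub: "A \<subseteq> A'"
  shows "ennreal (\<integral>w. (LINT r:A|lborel. g w r) \<partial>M) \<le> (\<integral>\<^sup>+w. (\<integral>\<^sup>+r\<in>A'. ennreal (g w r) \<partial>lborel) \<partial>M)"
proof -
  have "ennreal (\<integral>w. (LINT r:A|lborel. g w r) \<partial>M) \<le> (\<integral>\<^sup>+w. ennreal (LINT r:A|lborel. g w r) \<partial>M)"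
    unfolding set_lebesgue_integral_def using g
    by (intro ennreal_integral_le_nn_integral integral_nonneg_AE AE_I2) auto
  also have "\<dots> \<le> (\<integral>\<^sup>+w. (\<integral>\<^sup>+r\<in>A'. ennreal (g w r) \<partial>lborel) \<partial>M)"
  proof (rule nn_integral_mono)
    fix w
    have "ennreal (LINT r:A|lborel. g w r) \<le> (\<integral>\<^sup>+r. ennreal (indicator A r *\<^sub>R g w r) \<partial>lborel)"
      unfolding set_lebesgue_integral_def using g by (intro ennreal_integral_le_nn_integral) auto
    also have "\<dots> \<le> (\<integral>\<^sup>+r\<in>A'. ennreal (g w r) \<partial>lborel)"
      using sub g by (intro nn_integral_mono) (auto simp: indicator_def)
    finally show "ennreal (LINT r:A|lborel. g w r) \<le> (\<integral>\<^sup>+r\<in>A'. ennreal (g w r) \<partial>lborel)" .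
  qed
  finally show ?thesis .
qed

context brownian_space
begin

lemma elementary_process_joint:
  fixes h :: "real => 'o => 'e::{real_normed_vector,second_countable_topology}"
  assumes h: "elementary_integrand M F T P h"
  shows "(\<lambda>x. elementary_process P h (snd x) (fst x)) \<in> borel_measurable (M \<Otimes>\<^sub>M borel)"
proof -
  have PT: "P \<subseteq> {0..T}" using h by (auto simp: elementary_integrand_def partitions_def)
  have hm: "h u \<in> borel_measurable M" if "u \<in> P" for u
    using h that PT by (intro measurable_F_M[of u]) (auto simp: elementary_integrand_def)
  have "(\<lambda>x. \<Sum>y\<in>steps P. indicator {fst y<..snd y} (snd x) *\<^sub>R h (fst y) (fst x)) \<in> borel_measurable (M \<Otimes>\<^sub>M borel)"
  proof (rule borel_measurable_sum)
    fix y assume "y \<in> steps P"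
    then have [measurable]: "h (fst y) \<in> borel_measurable M" by (intro hm) (auto simp: steps_def)
    show "(\<lambda>x. indicator {fst y<..snd y} (snd x) *\<^sub>R h (fst y) (fst x)) \<in> borel_measurable (M \<Otimes>\<^sub>M borel)"
      by measurable
  qed
  then show ?thesis by (simp add: elementary_process_def[abs_def] case_prod_unfold)
qed

text \<open>The approximating elementary integrands are bounded, but not uniformly in the index. Retracting them
  to the ball of radius \<open>C\<close>, which contains the values of \<open>\<sigma>\<close>, moves them no further than their distance
  to \<open>\<sigma>\<close>. The retracted integrals therefore have the same limit, and by \<open>discrete_martingale\<close> their
  fourth moments are bounded uniformly. Along an almost surely convergent subsequence this bound passes
  to the limit by Fatou's lemma, and it makes the squares uniformly integrable, so that means and second
  moments converge as well.\<close>

lemma ito_increment: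
  fixes \<sigma> :: "real => 'o => 'u \<Rightarrow>\<^sub>L 'w::fin_dim_banach" and l :: "'w \<Rightarrow>\<^sub>L real"
  assumes \<sigma>C: "\<And>t w. t \<in> {0..T} ==> w \<in> space M ==> norm (\<sigma> t w) \<le> C" "0 \<le> C"
    and \<sigma>p: "progressive F T \<sigma>"
    and ito: "has_ito_integral M F T B \<sigma> I"
    and st: "0 \<le> s" "s < t" "t \<le> T"
  defines "N \<equiv> \<lambda>w. l (I t w - I s w)"
  shows "integrable M (\<lambda>w. (N w) ^ 4)"
    "(\<integral>w. (N w) ^ 4 \<partial>M) \<le> 9 * (real DIM('u))\<^sup>2 * (norm l * C) ^ 4 * (t - s)\<^sup>2"
    "\<And>\<xi> K. \<xi> \<in> borel_measurable (F s) ==> (\<And>w. \<bar>\<xi> w\<bar> \<le> K) ==> (\<integral>w. \<xi> w * N w \<partial>M) = 0"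
    "\<And>\<xi> K. \<xi> \<in> borel_measurable (F s) ==> (\<And>w. \<bar>\<xi> w\<bar> \<le> K) ==>
      (\<integral>w. \<xi> w * (N w)\<^sup>2 \<partial>M) = (\<integral>w. \<xi> w * (LINT r:{s..t}|lborel. hs (l o\<^sub>L \<sigma> r w)) \<partial>M)"
proof -
  let ?D = "real DIM('u)"
  from ito obtain P h where Ph: "\<And>k. elementary_integrand M F T (P k) (h k)"
    and \<rho>0: "(\<lambda>k. \<integral>\<^sup>+w. (\<integral>\<^sup>+s\<in>{0..T}.
            ennreal ((norm (elementary_process (P k) (h k) s w - \<sigma> s w))\<^sup>2) \<partial>lborel) \<partial>M) \<longlonglongrightarrow> 0"
    and ucp: "ucp_tendsto M T (\<lambda>k. elementary_integral (P k) (h k) B) I sequentially"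
    and Iad: "adapted F T I"
    unfolding has_ito_integral_def by blast
  define proc where "proc k r w = elementary_process (P k) (h k) r w" for k r w
  define \<rho> where "\<rho> k = (\<integral>\<^sup>+w. (\<integral>\<^sup>+s\<in>{0..T}. ennreal ((norm (proc k s w - \<sigma> s w))\<^sup>2) \<partial>lborel) \<partial>M)" for k
  have \<rho>: "\<rho> \<longlonglongrightarrow> 0" using \<rho>0 unfolding \<rho>_def[abs_def] proc_def .
  define h' where "h' k u w = retract_ball C (h k u w)" for k u w
  define hd where "hd k u w = h k u w - h' k u w" for k u w
  have fin: "finite (P k)" for k using Ph[of k] by (auto simp: elementary_integrand_def partitions_def)
  have hm: "h k u \<in> borel_measurable (F u)" if "u \<in> P k" for k u
    using Ph[of k] that by (auto simp: elementary_integrand_def)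
  have h'm: "h' k u \<in> borel_measurable (F u)" if "u \<in> P k" for k u
    unfolding h'_def[abs_def] using hm[OF that] by measurable
  have h'C: "norm (h' k u w) \<le> C" for k u w
    unfolding h'_def by (rule retract_ball(1)[OF \<sigma>C(2)])
  have Ph': "elementary_integrand M F T (P k) (h' k)" for k
    using Ph[of k] h'm h'C by (auto simp: elementary_integrand_def intro!: exI[of _ C])
  have Phd: "elementary_integrand M F T (P k) (hd k)" for k
  proof -
    have "\<exists>c. \<forall>w\<in>space M. norm (hd k u w) \<le> c" if u: "u \<in> P k" for u
    proof -
      obtain c where c: "\<forall>w\<in>space M. norm (h k u w) \<le> c" using Ph[of k] u by (auto simp: elementary_integrand_def)
      have "norm (hd k u w) \<le> c + C" if "w \<in> space M" for w
        using norm_triangle_ineq4[of "h k u w" "h' k u w"] h'C[of k u w] c that by (fastforce simp: hd_def)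
      then show ?thesis by blast
    qed
    moreover have "hd k u \<in> borel_measurable (F u)" if "u \<in> P k" for u
      unfolding hd_def[abs_def] using hm[OF that] h'm[OF that] by measurable
    ultimately show ?thesis using Ph[of k] by (auto simp: elementary_integrand_def)
  qed
  have "\<exists>c\<ge>0. \<forall>u\<in>P k. \<forall>w\<in>space M. norm (hd k u w) \<le> c" for k
  proof -
    have "\<forall>u\<in>P k. \<exists>c. \<forall>w\<in>space M. norm (hd k u w) \<le> c"
      using Phd[of k] by (simp add: elementary_integrand_def)
    then obtain c where c: "\<forall>u\<in>P k. \<forall>w\<in>space M. norm (hd k u w) \<le> c u" by metis
    have "norm (hd k u w) \<le> (\<Sum>u\<in>P k. \<bar>c u\<bar>)" if "u \<in> P k" "w \<in> space M" for u w
      using member_le_sum[of u "P k" "\<lambda>u. \<bar>c u\<bar>"] fin[of k] c that by fastforce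
    then show ?thesis by (intro exI[of _ "\<Sum>u\<in>P k. \<bar>c u\<bar>"]) (auto simp: sum_nonneg)
  qed
  then obtain Cd where Cd: "\<And>k. 0 \<le> Cd k" "\<And>k u w. u \<in> P k ==> w \<in> space M ==> norm (hd k u w) \<le> Cd k"
    by metis
  define E where "E g k w = l (elementary_integral (P k) (g k) B t w - elementary_integral (P k) (g k) B s w)"
    for g :: "nat => real => 'o => 'u \<Rightarrow>\<^sub>L 'w" and k w
  note e' = elementary_ito[OF Ph' h'C \<sigma>C(2) st, where l=l, folded E_def]
  note ed = elementary_ito[OF Phd Cd(2,1) st, where l=l, folded E_def]
  have E_diff: "E h k w - E hd k w = E h' k w" for k w
    unfolding E_def elementary_integral_def hd_def blinfun.diff_left blinfun.diff_right
    by (simp add: case_prod_unfold sum_subtractf blinfun.diff_right)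
  define \<sigma>c where "\<sigma>c r w = \<sigma> (clamp r) w" for r w
  have [measurable]: "(\<lambda>x. \<sigma>c (snd x) (fst x)) \<in> borel_measurable (M \<Otimes>\<^sub>M borel)"
    unfolding \<sigma>c_def by (rule progressive_joint[OF \<sigma>p])
  have [measurable]: "(\<lambda>x. proc k (snd x) (fst x)) \<in> borel_measurable (M \<Otimes>\<^sub>M borel)" for k
    unfolding proc_def by (rule elementary_process_joint[OF Ph])
  have \<sigma>cC: "norm (\<sigma>c r w) \<le> C" if "w \<in> space M" for r w
    unfolding \<sigma>c_def using \<sigma>C(1)[OF clamp_in that] .
  have \<sigma>c_eq: "\<sigma>c r w = \<sigma> r w" if "r \<in> {0..T}" for r w
    using clamp_eq[OF that] by (simp add: \<sigma>c_def)
  define dd where "dd k w r = ennreal ((norm (proc k r w - \<sigma>c r w))\<^sup>2) * indicator {0..T} r" for k w r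
  have [measurable]: "(\<lambda>x. dd k (fst x) (snd x)) \<in> borel_measurable (M \<Otimes>\<^sub>M borel)" for k
    unfolding dd_def by measurable
  have dd_meas: "dd k w \<in> borel_measurable lborel" if "w \<in> space M" for k w
    using measurable_compose[OF measurable_Pair1'[OF that] \<open>(\<lambda>x. dd k (fst x) (snd x)) \<in> borel_measurable (M \<Otimes>\<^sub>M borel)\<close>]
    by simp
  have dd_meas': "(\<lambda>w. \<integral>\<^sup>+r. dd k w r \<partial>lborel) \<in> borel_measurable M" for k
    by (rule sigma_finite_measure.borel_measurable_nn_integral[OF sigma_finite_lborel])
      (simp add: case_prod_unfold, measurable)
  have \<rho>_eq: "\<rho> k = (\<integral>\<^sup>+w. (\<integral>\<^sup>+r. dd k w r \<partial>lborel) \<partial>M)" for k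
    unfolding \<rho>_def dd_def by (intro nn_integral_cong) (auto simp: \<sigma>c_eq indicator_def)
  have dd_scale: "(\<integral>\<^sup>+w. (\<integral>\<^sup>+r. ennreal c * dd k w r \<partial>lborel) \<partial>M) = ennreal c * \<rho> k" for c k
  proof -
    have "(\<integral>\<^sup>+w. (\<integral>\<^sup>+r. ennreal c * dd k w r \<partial>lborel) \<partial>M) = (\<integral>\<^sup>+w. ennreal c * (\<integral>\<^sup>+r. dd k w r \<partial>lborel) \<partial>M)"
      by (intro nn_integral_cong nn_integral_cmult dd_meas)
    also have "\<dots> = ennreal c * \<rho> k" unfolding \<rho>_eq by (rule nn_integral_cmult[OF dd_meas'])
    finally show ?thesis .
  qed
  have proc': "elementary_process (P k) (h' k) r w = retract_ball C (proc k r w)" for k r w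
    unfolding proc_def h'_def
    by (rule elementary_process_map[of "retract_ball C", OF retract_ball(2)[OF \<sigma>C(2)] fin, symmetric])
  have procd: "elementary_process (P k) (hd k) r w = proc k r w - retract_ball C (proc k r w)" for k r w
    unfolding proc_def hd_def h'_def
    by (rule elementary_process_map[of "\<lambda>x. x - retract_ball C x", OF _ fin, symmetric]) (simp add: retract_ball(2)[OF \<sigma>C(2)])
  have retr: "norm (proc k r w - retract_ball C (proc k r w)) \<le> norm (proc k r w - \<sigma>c r w)" if "w \<in> space M" for k r w
    by (rule retract_ball(3)[OF \<sigma>C(2) \<sigma>cC[OF that]])
  \<comment> \<open>by the isometry the cut-off part of the integrand contributes at most its distance to \<open>\<sigma>\<close>\<close>
  have trunc: "ennreal ((l2 M (E hd k))\<^sup>2) \<le> ennreal (?D * (norm l)\<^sup>2) * \<rho> k" for k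
  proof -
    have one: "(\<lambda>_. 1 :: real) \<in> borel_measurable (F s)" "\<And>w. \<bar>1 :: real\<bar> \<le> 1" by auto
    have "(l2 M (E hd k))\<^sup>2 = (\<integral>w. (LINT r:{s..t}|lborel. hs (l o\<^sub>L (proc k r w - retract_ball C (proc k r w)))) \<partial>M)"
      using ed(5)[OF _ _ one, of k] by (simp add: l2_square procd)
    also have "ennreal \<dots> \<le> (\<integral>\<^sup>+w. (\<integral>\<^sup>+r\<in>{0..T}. ennreal (hs (l o\<^sub>L (proc k r w - retract_ball C (proc k r w)))) \<partial>lborel) \<partial>M)"
      by (rule ennreal_double_integral_le) (use st in \<open>auto simp: hs_nonneg\<close>)
    also have "\<dots> \<le> (\<integral>\<^sup>+w. (\<integral>\<^sup>+r. ennreal (?D * (norm l)\<^sup>2) * dd k w r \<partial>lborel) \<partial>M)"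
    proof (intro nn_integral_mono)
      fix w r assume w: "w \<in> space M"
      let ?y = "proc k r w - retract_ball C (proc k r w)"
      have "norm (l o\<^sub>L ?y) \<le> norm l * norm (proc k r w - \<sigma>c r w)"
        by (rule order_trans[OF norm_blinfun_compose mult_left_mono[OF retr[OF w]]]) simp
      from power_mono[OF this norm_ge_zero, of 2]
      have "(norm (l o\<^sub>L ?y))\<^sup>2 \<le> (norm l)\<^sup>2 * (norm (proc k r w - \<sigma>c r w))\<^sup>2"
        by (simp only: power_mult_distrib)
      then have "hs (l o\<^sub>L ?y) \<le> ?D * ((norm l)\<^sup>2 * (norm (proc k r w - \<sigma>c r w))\<^sup>2)"
        by (rule order_trans[OF hs_le mult_left_mono]) simp
      then have "ennreal (hs (l o\<^sub>L ?y)) \<le> ennreal (?D * (norm l)\<^sup>2) * ennreal ((norm (proc k r w - \<sigma>c r w))\<^sup>2)"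
        by (simp add: ennreal_mult[symmetric] ennreal_leI mult.assoc)
      then show "ennreal (hs (l o\<^sub>L ?y)) * indicator {0..T} r \<le> ennreal (?D * (norm l)\<^sup>2) * dd k w r"
        by (auto simp: dd_def indicator_def)
    qed
    also have "\<dots> = ennreal (?D * (norm l)\<^sup>2) * \<rho> k" by (rule dd_scale)
    finally show ?thesis .
  qed
  have scale_lim: "(\<lambda>k. ennreal c * \<rho> k) \<longlonglongrightarrow> 0" for c
    using ennreal_tendsto_cmult[OF _ \<rho>, of "ennreal c"] by simp
  have "(\<lambda>k. ennreal ((l2 M (E hd k))\<^sup>2)) \<longlonglongrightarrow> 0"
    by (rule tendsto_sandwich[OF _ _ tendsto_const scale_lim[of "?D * (norm l)\<^sup>2"]]) (use trunc in auto)
  then have "(\<lambda>k. (l2 M (E hd k))\<^sup>2) \<longlonglongrightarrow> 0" by (subst (asm) ennreal_tendsto_0_iff) auto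
  then have "(\<lambda>k. sqrt ((l2 M (E hd k))\<^sup>2)) \<longlonglongrightarrow> sqrt 0" by (rule tendsto_real_sqrt)
  then have l2d: "(\<lambda>k. l2 M (E hd k)) \<longlonglongrightarrow> 0" by (simp add: l2_nonneg)
  have "tends_in_prob M (\<lambda>k w. - E hd k w) (\<lambda>w. 0)"
    by (rule tends_in_prob_of_l2) (use l2d ed(1) in \<open>auto simp: sq_int_minus\<close>)
  moreover have "tends_in_prob M (E h) N"
  proof -
    have pt: "tends_in_prob M (\<lambda>k. elementary_integral (P k) (h k) B x) (I x)" if "x \<in> {0..T}" for x
      using ucp_tendsto_imp_tends_in_prob[OF ucp filterlim_ident that] .
    have "tends_in_prob M (\<lambda>k w. elementary_integral (P k) (h k) B t w + - elementary_integral (P k) (h k) B s w)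
        (\<lambda>w. I t w + - I s w)"
      by (rule tends_in_prob_add[OF pt tends_in_prob_bounded_linear[OF pt bounded_linear_minus[OF bounded_linear_ident]]])
        (use st in auto)
    from tends_in_prob_bounded_linear[OF this blinfun.bounded_linear_right[of l]]
    show ?thesis unfolding E_def[abs_def] N_def by simp
  qed
  ultimately have "tends_in_prob M (\<lambda>k w. E h k w + - E hd k w) (\<lambda>w. N w + 0)"
    by (rule tends_in_prob_add[rotated])
  then have "tends_in_prob M (E h') N" using E_diff by (simp add: fun_eq_iff)
  then obtain r where r: "strict_mono r" "AE w in M. (\<lambda>k. E h' (r k) w) \<longlonglongrightarrow> N w"
    by (rule tends_in_prob_AE_subseq)
  have Nm: "N \<in> borel_measurable M"
  proof -
    have [measurable]: "I t \<in> borel_measurable M" "I s \<in> borel_measurable M"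
      using Iad st measurable_F_M[of t "I t"] measurable_F_M[of s "I s"] by (auto simp: adapted_def)
    show ?thesis unfolding N_def by measurable
  qed
  define Q where "Q = 3 * ?D * (norm l * C)\<^sup>2 * (t - s)"
  have Q0: "0 \<le> Q" unfolding Q_def using st by simp
  have Q2: "Q\<^sup>2 = 9 * ?D\<^sup>2 * (norm l * C) ^ 4 * (t - s)\<^sup>2"
    unfolding Q_def by (simp add: power_mult_distrib power_mult[symmetric])
  have E'm: "E h' k \<in> borel_measurable M" for k by (rule sq_int_measurable[OF e'(1)])
  have sq4: "sq_int M (\<lambda>w. (E h' k w)\<^sup>2)" "l2 M (\<lambda>w. (E h' k w)\<^sup>2) \<le> Q" for k
  proof -
    show "sq_int M (\<lambda>w. (E h' k w)\<^sup>2)"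
      using e'(2)[of k] E'm[of k] by (simp add: sq_int_def power_mult[symmetric])
    have "(\<integral>w. (norm ((E h' k w)\<^sup>2))\<^sup>2 \<partial>M) \<le> Q\<^sup>2"
      unfolding Q2 using e'(3)[of k] by (simp add: power_mult[symmetric])
    then show "l2 M (\<lambda>w. (E h' k w)\<^sup>2) \<le> Q" using Q0 by (rule l2_leI)
  qed
  have l2E: "l2 M (E h' k) \<le> sqrt Q" for k
  proof -
    have "(\<integral>w. (norm (E h' k w))\<^sup>2 \<partial>M) \<le> Q"
      using sq_int_integrable(2)[OF sq4(1)[of k]] sq4(2)[of k] by simp
    then show ?thesis using Q0 by (intro l2_leI) auto
  qed
  have N2m: "(\<lambda>w. (N w)\<^sup>2) \<in> borel_measurable M" using Nm by measurable
  have lim2: "AE w in M. (\<lambda>k. (E h' (r k) w)\<^sup>2) \<longlonglongrightarrow> (N w)\<^sup>2"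
    using r(2) by eventually_elim (rule tendsto_power)
  note v4 = expectation_tendsto_of_bounded_second_moment[OF sq4 N2m lim2]
  show "integrable M (\<lambda>w. (N w) ^ 4)" using v4(1) by (simp add: sq_int_def power_mult[symmetric])
  have "(l2 M (\<lambda>w. (N w)\<^sup>2))\<^sup>2 \<le> Q\<^sup>2" by (rule power_mono[OF v4(2) l2_nonneg])
  then show "(\<integral>w. (N w) ^ 4 \<partial>M) \<le> 9 * (real DIM('u))\<^sup>2 * (norm l * C) ^ 4 * (t - s)\<^sup>2"
    unfolding Q2 l2_square by (simp add: power_mult[symmetric])
  fix \<xi> :: "'o => real" and K assume \<xi>: "\<xi> \<in> borel_measurable (F s)" "\<And>w. \<bar>\<xi> w\<bar> \<le> K"
  have K: "0 \<le> K" using \<xi>(2)[of undefined] by linarith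
  have \<xi>m[measurable]: "\<xi> \<in> borel_measurable M" using \<xi>(1) st by (intro measurable_F_M[of s]) auto
  have sq\<xi>: "sq_int M (\<lambda>w. \<xi> w * f w)" "l2 M (\<lambda>w. \<xi> w * f w) \<le> K * l2 M f" if "sq_int M f" for f
    using sq_int_bounded_mult[OF that \<xi>m, of K] \<xi>(2) K by auto
  note [measurable] = Nm
  have m1: "(\<lambda>w. \<xi> w * N w) \<in> borel_measurable M" and m2: "(\<lambda>w. \<xi> w * (N w)\<^sup>2) \<in> borel_measurable M"
    by measurable
  have lim\<xi>1: "AE w in M. (\<lambda>k. \<xi> w * E h' (r k) w) \<longlonglongrightarrow> \<xi> w * N w"
    using r(2) by eventually_elim (rule tendsto_mult[OF tendsto_const])
  have lim\<xi>2: "AE w in M. (\<lambda>k. \<xi> w * (E h' (r k) w)\<^sup>2) \<longlonglongrightarrow> \<xi> w * (N w)\<^sup>2"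
    using lim2 by eventually_elim (rule tendsto_mult[OF tendsto_const])
  have b1: "l2 M (\<lambda>w. \<xi> w * E h' (r k) w) \<le> K * sqrt Q" for k
    by (rule order_trans[OF sq\<xi>(2)[OF e'(1)] mult_left_mono[OF l2E K]])
  have b2: "l2 M (\<lambda>w. \<xi> w * (E h' (r k) w)\<^sup>2) \<le> K * Q" for k
    by (rule order_trans[OF sq\<xi>(2)[OF sq4(1)] mult_left_mono[OF sq4(2) K]])
  have "(\<lambda>k. \<integral>w. \<xi> w * E h' (r k) w \<partial>M) \<longlonglongrightarrow> (\<integral>w. \<xi> w * N w \<partial>M)"
    by (rule expectation_tendsto_of_bounded_second_moment(3)[OF sq\<xi>(1)[OF e'(1)] b1 m1 lim\<xi>1])
  then show "(\<integral>w. \<xi> w * N w \<partial>M) = 0"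
    using e'(4)[OF \<xi>] by (simp add: LIMSEQ_const_iff)
  have left: "(\<lambda>k. \<integral>w. \<xi> w * (E h' (r k) w)\<^sup>2 \<partial>M) \<longlonglongrightarrow> (\<integral>w. \<xi> w * (N w)\<^sup>2 \<partial>M)"
    by (rule expectation_tendsto_of_bounded_second_moment(3)[OF sq\<xi>(1)[OF sq4(1)] b2 m2 lim\<xi>2])
  define a where "a k r w = hs (l o\<^sub>L retract_ball C (proc k r w))" for k r w
  define a' where "a' r w = hs (l o\<^sub>L \<sigma>c r w)" for r w
  have comp[measurable]: "(\<lambda>x. l o\<^sub>L f x) \<in> borel_measurable M'"
    if "f \<in> borel_measurable M'" for f :: "'z => 'u \<Rightarrow>\<^sub>L 'w" and M'
    by (rule borel_measurable_bounded_linear[OF bounded_bilinear.bounded_linear_right[OF bounded_bilinear_blinfun_compose] that])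
  have ma[measurable]: "(\<lambda>x. a k (snd x) (fst x)) \<in> borel_measurable (M \<Otimes>\<^sub>M borel)" for k
    unfolding a_def by measurable
  have ma'[measurable]: "(\<lambda>x. a' (snd x) (fst x)) \<in> borel_measurable (M \<Otimes>\<^sub>M borel)"
    unfolding a'_def by measurable
  define ca where "ca = ?D * (norm l * C)\<^sup>2"
  have lC: "norm (l o\<^sub>L x) \<le> norm l * C" if "norm x \<le> C" for x :: "'u \<Rightarrow>\<^sub>L 'w"
    by (rule order_trans[OF norm_blinfun_compose mult_left_mono[OF that]]) simp
  have hsb: "hs (l o\<^sub>L x) \<le> ca" if "norm x \<le> C" for x :: "'u \<Rightarrow>\<^sub>L 'w"
    unfolding ca_def by (rule order_trans[OF hs_le mult_left_mono[OF power_mono[OF lC[OF that]]]]) auto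
  have ab: "0 \<le> a k r w" "a k r w \<le> ca" for k r w
    unfolding a_def by (auto intro!: hs_nonneg hsb retract_ball(1)[OF \<sigma>C(2)])
  have a'b: "0 \<le> a' r w" "w \<in> space M ==> a' r w \<le> ca" for r w
    unfolding a'_def by (auto intro!: hs_nonneg hsb \<sigma>cC)
  have Lint: "integrable lborel (\<lambda>r. indicator {s..t} r *\<^sub>R b r w)"
    "(\<lambda>w. LINT r:{s..t}|lborel. b r w) \<in> borel_measurable M"
    if b: "(\<lambda>x. b (snd x) (fst x)) \<in> borel_measurable (M \<Otimes>\<^sub>M borel)" "\<And>r w. 0 \<le> b r w"
      "\<And>r w. w \<in> space M ==> b r w \<le> ca" "w \<in> space M" for b :: "real => 'o => real" and w
  proof -
    have sec: "(\<lambda>r. b r w) \<in> borel_measurable borel"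
      using measurable_compose[OF measurable_Pair1'[OF b(4)] b(1)] by simp
    have i: "integrable lborel (\<lambda>r. indicator {s..t} r *\<^sub>R ca)" using st by simp
    show "integrable lborel (\<lambda>r. indicator {s..t} r *\<^sub>R b r w)"
    proof (rule Bochner_Integration.integrable_bound[OF i])
      show "(\<lambda>r. indicator {s..t} r *\<^sub>R b r w) \<in> borel_measurable lborel" using sec by simp
      have "\<bar>b r w\<bar> \<le> \<bar>ca\<bar>" for r using b(2)[of r w] b(3)[OF b(4), of r] by linarith
      then show "AE r in lborel. norm (indicator {s..t} r *\<^sub>R b r w) \<le> norm (indicator {s..t} r *\<^sub>R ca)"
        by (intro AE_I2) (simp add: indicator_def)
    qed
    note [measurable] = b(1)
    show "(\<lambda>w. LINT r:{s..t}|lborel. b r w) \<in> borel_measurable M"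
      unfolding set_lebesgue_integral_def
      by (rule sigma_finite_measure.borel_measurable_lebesgue_integral[OF sigma_finite_lborel])
        (simp add: case_prod_unfold, measurable)
  qed
  note La = Lint[OF ma ab(1) ab(2)]
  have La': "integrable lborel (\<lambda>r. indicator {s..t} r *\<^sub>R a' r w)"
    "(\<lambda>w. LINT r:{s..t}|lborel. a' r w) \<in> borel_measurable M" if "w \<in> space M" for w
    using Lint[of a' w, OF ma' a'b(1) _ that] a'b(2) by blast+
  define L where "L k w = (LINT r:{s..t}|lborel. a k r w)" for k w
  define L' where "L' w = (LINT r:{s..t}|lborel. a' r w)" for w
  have ne: "space M \<noteq> {}" by (rule not_empty)
  have Lm[measurable]: "L k \<in> borel_measurable M" "L' \<in> borel_measurable M" for k
    unfolding L_def[abs_def] L'_def[abs_def] using La(2) La'(2) ne by auto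
  have Lb: "\<bar>LINT r:{s..t}|lborel. b r w\<bar> \<le> ca * (t - s)"
    if "integrable lborel (\<lambda>r. indicator {s..t} r *\<^sub>R b r w)" "\<And>r. 0 \<le> b r w" "\<And>r. b r w \<le> ca"
    for b :: "real => 'o => real" and w
  proof -
    have "0 \<le> (LINT r:{s..t}|lborel. b r w)"
      unfolding set_lebesgue_integral_def using that(2) by (intro integral_nonneg_AE) auto
    moreover have "(LINT r:{s..t}|lborel. b r w) \<le> (\<integral>r. indicator {s..t} r *\<^sub>R ca \<partial>lborel)"
      unfolding set_lebesgue_integral_def
    proof (rule integral_mono[OF that(1)])
      show "integrable lborel (\<lambda>r. indicator {s..t} r *\<^sub>R ca)" using st by simp
      show "indicator {s..t} r *\<^sub>R b r w \<le> indicator {s..t} r *\<^sub>R ca" for r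
        using that(3)[of r] by (simp add: indicator_def)
    qed
    ultimately show ?thesis using st by (simp add: mult.commute)
  qed
  have LbL: "\<bar>L k w\<bar> \<le> ca * (t - s)" "\<bar>L' w\<bar> \<le> ca * (t - s)" if "w \<in> space M" for k w
    unfolding L_def L'_def using La(1) La'(1) ab a'b that by (auto intro!: Lb)
  have LI: "integrable M (L k)" "integrable M L'" for k
    using LbL by (auto intro!: integrable_const_bound[of _ "ca * (t - s)"])
  have \<xi>LI: "integrable M (\<lambda>w. \<xi> w * L k w)" "integrable M (\<lambda>w. \<xi> w * L' w)" for k
    by (rule integrable_const_bound[of _ "K * (ca * (t - s))"], rule AE_I2,
        simp only: real_norm_def abs_mult, intro mult_mono \<xi>(2) LbL K abs_ge_zero, assumption, measurable)+
  define c2 where "c2 = 2 * ?D * (norm l * C) * norm l"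
  have c20: "0 \<le> c2" using \<sigma>C(2) by (simp add: c2_def)
  have Ediff: "ennreal (\<integral>w. \<bar>L k w - L' w\<bar> \<partial>M) \<le> ennreal (c2 * \<eta> * T) + ennreal (c2 / \<eta>) * \<rho> k" if \<eta>: "\<eta> > 0" for k \<eta>
  proof -
    have "\<bar>L k w - L' w\<bar> \<le> (LINT r:{s..t}|lborel. \<bar>a k r w - a' r w\<bar>)" if w: "w \<in> space M" for w
    proof -
      have "L k w - L' w = (LINT r:{s..t}|lborel. a k r w - a' r w)"
        unfolding L_def L'_def using La(1)[OF w] La'(1)[OF w]
        by (intro set_integral_diff(2)[symmetric]) (auto simp: set_integrable_def)
      also have "\<bar>\<dots>\<bar> \<le> (LINT r:{s..t}|lborel. \<bar>a k r w - a' r w\<bar>)"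
        using integral_abs_bound[of lborel "\<lambda>r. indicator {s..t} r *\<^sub>R (a k r w - a' r w)"]
        unfolding set_lebesgue_integral_def by (simp add: abs_mult)
      finally show ?thesis .
    qed
    then have "ennreal (\<integral>w. \<bar>L k w - L' w\<bar> \<partial>M) \<le> (\<integral>\<^sup>+w. ennreal (LINT r:{s..t}|lborel. \<bar>a k r w - a' r w\<bar>) \<partial>M)"
      by (intro order_trans[OF ennreal_integral_le_nn_integral] nn_integral_mono ennreal_leI) auto
    also have "\<dots> \<le> (\<integral>\<^sup>+w. (\<integral>\<^sup>+r. ennreal (c2 * \<eta>) * indicator {0..T} r + ennreal (c2 / \<eta>) * dd k w r \<partial>lborel) \<partial>M)"
    proof (rule nn_integral_mono)
      fix w assume w: "w \<in> space M"
      have pw: "\<bar>a k r w - a' r w\<bar> \<le> c2 * \<eta> + (c2 / \<eta>) * (norm (proc k r w - \<sigma>c r w))\<^sup>2" for r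
      proof -
        let ?x = "retract_ball C (proc k r w)" and ?y = "\<sigma>c r w" and ?z = "norm (proc k r w - \<sigma>c r w)"
        have "\<bar>a k r w - a' r w\<bar> \<le> 2 * ?D * (norm l * C) * norm ((l o\<^sub>L ?x) - (l o\<^sub>L ?y))"
          unfolding a_def a'_def
          using hs_diff_le[OF lC[OF retract_ball(1)[OF \<sigma>C(2)]] lC[OF \<sigma>cC[OF w]]] by simp
        also have "(l o\<^sub>L ?x) - (l o\<^sub>L ?y) = l o\<^sub>L (?x - ?y)"
          by (simp add: bounded_bilinear.diff_right[OF bounded_bilinear_blinfun_compose])
        also have "2 * ?D * (norm l * C) * norm (l o\<^sub>L (?x - ?y)) \<le> 2 * ?D * (norm l * C) * (norm l * norm (?x - ?y))"
          using \<sigma>C(2) by (intro mult_left_mono norm_blinfun_compose) auto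
        also have "\<dots> = c2 * norm (?x - ?y)" by (simp add: c2_def)
        also have "\<dots> \<le> c2 * (2 * ?z)"
        proof (intro mult_left_mono c20)
          have "norm (?x - ?y) \<le> norm (?x - proc k r w) + ?z"
            using norm_triangle_ineq[of "?x - proc k r w" "proc k r w - ?y"] by simp
          then show "norm (?x - ?y) \<le> 2 * ?z" using retr[OF w, of k r] by (simp add: norm_minus_commute)
        qed
        also have "\<dots> \<le> c2 * (\<eta> + ?z\<^sup>2 / \<eta>)"
        proof (intro mult_left_mono c20)
          have "2 * ?z * \<eta> \<le> ?z\<^sup>2 + \<eta>\<^sup>2" by (rule sum_squares_bound)
          then show "2 * ?z \<le> \<eta> + ?z\<^sup>2 / \<eta>" using \<eta> by (simp add: field_simps power2_eq_square)
        qed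
        finally show ?thesis by (simp add: distrib_left)
      qed
      have "ennreal (LINT r:{s..t}|lborel. \<bar>a k r w - a' r w\<bar>)
          \<le> (\<integral>\<^sup>+r. ennreal (indicator {s..t} r *\<^sub>R \<bar>a k r w - a' r w\<bar>) \<partial>lborel)"
        unfolding set_lebesgue_integral_def by (intro ennreal_integral_le_nn_integral) auto
      also have "\<dots> \<le> (\<integral>\<^sup>+r. ennreal (c2 * \<eta>) * indicator {0..T} r + ennreal (c2 / \<eta>) * dd k w r \<partial>lborel)"
      proof (rule nn_integral_mono)
        fix r
        have "ennreal \<bar>a k r w - a' r w\<bar> \<le> ennreal (c2 * \<eta> + (c2 / \<eta>) * (norm (proc k r w - \<sigma>c r w))\<^sup>2)"
          using pw by (rule ennreal_leI)
        also have "\<dots> = ennreal (c2 * \<eta>) + ennreal (c2 / \<eta>) * ennreal ((norm (proc k r w - \<sigma>c r w))\<^sup>2)"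
          using c20 \<eta> by (simp add: ennreal_mult[symmetric])
        finally show "ennreal (indicator {s..t} r *\<^sub>R \<bar>a k r w - a' r w\<bar>)
            \<le> ennreal (c2 * \<eta>) * indicator {0..T} r + ennreal (c2 / \<eta>) * dd k w r"
          using st by (auto simp: dd_def indicator_def)
      qed
      finally show "ennreal (LINT r:{s..t}|lborel. \<bar>a k r w - a' r w\<bar>)
          \<le> (\<integral>\<^sup>+r. ennreal (c2 * \<eta>) * indicator {0..T} r + ennreal (c2 / \<eta>) * dd k w r \<partial>lborel)" .
    qed
    also have "\<dots> = (\<integral>\<^sup>+w. ennreal (c2 * \<eta> * T) + (\<integral>\<^sup>+r. ennreal (c2 / \<eta>) * dd k w r \<partial>lborel) \<partial>M)"
    proof (intro nn_integral_cong)
      fix w assume w: "w \<in> space M"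
      have "(\<integral>\<^sup>+r. ennreal (c2 * \<eta>) * indicator {0..T} r \<partial>lborel) = ennreal (c2 * \<eta> * T)"
        using T_pos c20 \<eta> by (simp add: nn_integral_cmult ennreal_mult)
      then show "(\<integral>\<^sup>+r. ennreal (c2 * \<eta>) * indicator {0..T} r + ennreal (c2 / \<eta>) * dd k w r \<partial>lborel)
          = ennreal (c2 * \<eta> * T) + (\<integral>\<^sup>+r. ennreal (c2 / \<eta>) * dd k w r \<partial>lborel)"
        using dd_meas[OF w, of k] by (subst nn_integral_add) auto
    qed
    also have "\<dots> = ennreal (c2 * \<eta> * T) + ennreal (c2 / \<eta>) * \<rho> k"
    proof (subst nn_integral_add)
      show "(\<lambda>w. \<integral>\<^sup>+r. ennreal (c2 / \<eta>) * dd k w r \<partial>lborel) \<in> borel_measurable M"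
        by (rule sigma_finite_measure.borel_measurable_nn_integral[OF sigma_finite_lborel])
          (simp add: case_prod_unfold, measurable)
    qed (auto simp: dd_scale emeasure_space_1)
    finally show ?thesis .
  qed
  have L1: "(\<lambda>k. \<integral>w. \<bar>L k w - L' w\<bar> \<partial>M) \<longlonglongrightarrow> 0"
  proof (rule tendstoI)
    fix e :: real assume e: "e > 0"
    define \<eta> where "\<eta> = e / (2 * (c2 * T + 1))"
    have cT: "c2 * T + 1 > 0" using c20 T_pos by (simp add: add_nonneg_pos)
    have \<eta>: "\<eta> > 0" using e cT by (simp add: \<eta>_def)
    have "c2 * (e / (2 * c)) * T = (c2 * T / c) * (e / 2)" for c by (simp add: ac_simps)
    then have "c2 * \<eta> * T = (c2 * T / (c2 * T + 1)) * (e / 2)" unfolding \<eta>_def .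
    also have "\<dots> \<le> 1 * (e / 2)" using cT e by (intro mult_right_mono) auto
    finally have small: "c2 * \<eta> * T \<le> e / 2" by simp
    have "\<forall>\<^sub>F k in sequentially. ennreal (c2 / \<eta>) * \<rho> k < ennreal (e / 2)"
      using scale_lim[of "c2 / \<eta>"] e by (intro order_tendstoD(2)) auto
    then show "\<forall>\<^sub>F k in sequentially. dist (\<integral>w. \<bar>L k w - L' w\<bar> \<partial>M) 0 < e"
    proof eventually_elim
      case (elim k)
      have "ennreal (\<integral>w. \<bar>L k w - L' w\<bar> \<partial>M) \<le> ennreal (c2 * \<eta> * T) + ennreal (c2 / \<eta>) * \<rho> k" by (rule Ediff[OF \<eta>])
      also have "\<dots> \<le> ennreal (e / 2) + ennreal (c2 / \<eta>) * \<rho> k"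
        by (intro add_right_mono ennreal_leI small)
      also have "\<dots> < ennreal (e / 2) + ennreal (e / 2)"
        using elim by (simp add: ennreal_add_left_cancel_less)
      also have "\<dots> = ennreal e" using e by (simp add: ennreal_plus[symmetric] del: ennreal_plus)
      finally show ?case using e by (simp add: dist_real_def ennreal_less_iff)
    qed
  qed
  have right: "(\<lambda>k. \<integral>w. \<xi> w * L k w \<partial>M) \<longlonglongrightarrow> (\<integral>w. \<xi> w * L' w \<partial>M)"
  proof -
    have "\<bar>(\<integral>w. \<xi> w * L k w \<partial>M) - (\<integral>w. \<xi> w * L' w \<partial>M)\<bar> \<le> K * (\<integral>w. \<bar>L k w - L' w\<bar> \<partial>M)" for k
    proof -
      have "(\<integral>w. \<xi> w * L k w \<partial>M) - (\<integral>w. \<xi> w * L' w \<partial>M) = (\<integral>w. \<xi> w * (L k w - L' w) \<partial>M)"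
        using \<xi>LI by (simp add: right_diff_distrib)
      also have "\<bar>\<dots>\<bar> \<le> (\<integral>w. K * \<bar>L k w - L' w\<bar> \<partial>M)"
      proof (rule order_trans[OF integral_abs_bound], rule integral_mono)
        show "integrable M (\<lambda>w. \<bar>\<xi> w * (L k w - L' w)\<bar>)"
          using Bochner_Integration.integrable_diff[OF \<xi>LI(1)[of k] \<xi>LI(2)] by (simp add: right_diff_distrib)
        show "integrable M (\<lambda>w. K * \<bar>L k w - L' w\<bar>)" using LI by simp
        show "\<bar>\<xi> w * (L k w - L' w)\<bar> \<le> K * \<bar>L k w - L' w\<bar>" for w
          using \<xi>(2)[of w] by (simp add: abs_mult mult_right_mono)
      qed
      finally show ?thesis by simp
    qed
    then have bd: "\<forall>k. norm ((\<integral>w. \<xi> w * L k w \<partial>M) - (\<integral>w. \<xi> w * L' w \<partial>M)) \<le> K * (\<integral>w. \<bar>L k w - L' w\<bar> \<partial>M)"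
      by simp
    have "(\<lambda>k. K * (\<integral>w. \<bar>L k w - L' w\<bar> \<partial>M)) \<longlonglongrightarrow> 0"
      using tendsto_mult_left[OF L1, of K] by simp
    from Lim_null_comparison[OF always_eventually[OF bd] this]
    have "(\<lambda>k. (\<integral>w. \<xi> w * L k w \<partial>M) - (\<integral>w. \<xi> w * L' w \<partial>M)) \<longlonglongrightarrow> 0" .
    then show ?thesis by (simp add: LIM_zero_iff)
  qed
  have "(\<integral>w. \<xi> w * (E h' k w)\<^sup>2 \<partial>M) = (\<integral>w. \<xi> w * L k w \<partial>M)" for k
    using e'(5)[OF \<xi>, of k] unfolding L_def a_def proc' by simp
  then have "(\<lambda>k. \<integral>w. \<xi> w * (E h' (r k) w)\<^sup>2 \<partial>M) \<longlonglongrightarrow> (\<integral>w. \<xi> w * L' w \<partial>M)"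
    using LIMSEQ_subseq_LIMSEQ[OF right r(1)] by (simp add: o_def)
  then have "(\<integral>w. \<xi> w * (N w)\<^sup>2 \<partial>M) = (\<integral>w. \<xi> w * L' w \<partial>M)" using left LIMSEQ_unique by blast
  also have "L' = (\<lambda>w. LINT r:{s..t}|lborel. hs (l o\<^sub>L \<sigma> r w))"
    unfolding L'_def[abs_def] a'_def set_lebesgue_integral_def
    by (intro ext Bochner_Integration.integral_cong refl) (use st in \<open>auto simp: indicator_def \<sigma>c_eq\<close>)
  finally show "(\<integral>w. \<xi> w * (N w)\<^sup>2 \<partial>M) = (\<integral>w. \<xi> w * (LINT r:{s..t}|lborel. hs (l o\<^sub>L \<sigma> r w)) \<partial>M)" .
qed

end


section \<open>Taylor expansion in expectation\<close>

lemma tensor_lift_eqI: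
  assumes "linear f" "\<And>u v. f (u \<otimes> v) = blinfun_apply (blinfun_apply K u) v"
  shows "tensor_lift K = f"
  using tensor_lift_unique[of K] linear_tensor_lift[of K] tensor_lift_tensor[of K] assms by blast

lemma tensor_lift_compose:
  assumes "bounded_linear L"
    and K: "\<And>u v. blinfun_apply (blinfun_apply K' u) v = L (blinfun_apply (blinfun_apply K u) v)"
  shows "tensor_lift K' A = L (tensor_lift K A)"
proof -
  have "linear (\<lambda>A. L (tensor_lift K A))"
    using linear_compose[OF linear_tensor_lift bounded_linear.linear[OF assms(1)]] by (simp add: o_def)
  then have "tensor_lift K' = (\<lambda>A. L (tensor_lift K A))"
    by (rule tensor_lift_eqI) (simp add: K tensor_lift_tensor)
  then show ?thesis by simp
qed

text \<open>The form \<open>D\<^sup>2\<phi>(y)(Y' _, Y' _)\<close> is symmetric, so its contraction with \<open>XX\<close> is half of its value at the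
  increment of \<open>X\<close>: the second order rough term absorbs the second order Taylor term in direction
  \<open>Y' \<delta>X\<close>.\<close>

lemma tensor_lift_transport_op':
  fixes \<phi> :: "'w::fin_dim_banach => real" and X :: "real => 'v::fin_dim_banach"
  assumes \<phi>: "\<phi> \<in> Cb \<gamma>" and X: "geometric_rough_path T \<alpha> X XX" and st: "0 \<le> s" "s < t" "t \<le> T"
  shows "tensor_lift (transport_op' Y' Y'' \<phi> y) (XX s t) =
    1 / 2 * Dfun (Dfun \<phi>) y (Y' (X t - X s)) (Y' (X t - X s))
    + Dfun \<phi> y (tensor_lift Y'' (XX s t))"
proof -
  have sum: "transport_op' Y' Y'' \<phi> y = transport_op' Y' 0 \<phi> y + transport_op' 0 Y'' \<phi> y"
    by (intro blinfun_eqI) (simp add: transport_op'_apply blinfun.add_left blinfun.zero_left blinfun.zero_right)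
  have "symmetric_form (transport_op' Y' 0 \<phi> y)"
    unfolding symmetric_form_def transport_op'_apply
    by (simp add: blinfun.zero_left blinfun.zero_right Cb_second_derivative_symmetric[OF \<phi>])
  from tensor_lift_geometric[OF X st this]
  have 1: "tensor_lift (transport_op' Y' 0 \<phi> y) (XX s t) =
    1 / 2 * Dfun (Dfun \<phi>) y (Y' (X t - X s)) (Y' (X t - X s))"
    by (simp add: transport_op'_apply blinfun.zero_left blinfun.zero_right)
  have 2: "tensor_lift (transport_op' 0 Y'' \<phi> y) (XX s t) = Dfun \<phi> y (tensor_lift Y'' (XX s t))"
    by (rule tensor_lift_compose[OF blinfun.bounded_linear_right])
      (simp add: transport_op'_apply blinfun.zero_left blinfun.zero_right)
  show ?thesis unfolding sum tensor_lift.add_left 1 2 ..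
qed

lemma tensor_lift_diffusion:
  "tensor_lift Q (diffusion \<sigma>) = (\<Sum>e\<in>Basis. Q (\<sigma> e) (\<sigma> e))"
  by (simp add: diffusion_eq linear_sum[OF linear_tensor_lift] tensor_lift_tensor)

text \<open>Interpolation of \<open>x\<^sup>\<gamma>\<close> between the powers \<open>2\<close> and \<open>4\<close> at scale \<open>\<rho>\<close>: only second and
  fourth moments are then needed.\<close>

lemma powr_le_interpolate:
  fixes x \<rho> \<gamma> :: real
  assumes "0 \<le> x" "0 < \<rho>" "2 \<le> \<gamma>" "\<gamma> \<le> 4"
  shows "x powr \<gamma> \<le> \<rho> powr (\<gamma> - 2) * x\<^sup>2 + \<rho> powr (\<gamma> - 4) * x ^ 4"
proof (cases "x = 0")
  case True
  then show ?thesis using assms by simp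
next
  case False
  then have x: "x > 0" using assms by simp
  show ?thesis
  proof (cases "x \<le> \<rho>")
    case True
    have "x powr \<gamma> = x powr (\<gamma> - 2) * x\<^sup>2" using x by (simp add: powr_diff)
    also have "\<dots> \<le> \<rho> powr (\<gamma> - 2) * x\<^sup>2"
      using x True assms by (intro mult_right_mono powr_mono2) auto
    finally show ?thesis by (simp add: add_increasing2)
  next
    case False
    have "x powr \<gamma> = x powr (\<gamma> - 4) * x ^ 4" using x by (simp add: powr_diff)
    also have "\<dots> \<le> \<rho> powr (\<gamma> - 4) * x ^ 4"
      using x False assms by (intro mult_right_mono powr_mono2') auto
    finally show ?thesis by (simp add: add_increasing)
  qed
qed

lemma powr_le_interpolate_linear:
  fixes x \<rho> a :: real
  assumes "0 \<le> x" "0 < \<rho>" "0 < a" "a \<le> 1"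
  shows "x powr a \<le> \<rho> powr a + \<rho> powr (a - 1) * x"
proof (cases "x \<le> \<rho>")
  case True
  then have "x powr a \<le> \<rho> powr a" using assms by (intro powr_mono2) auto
  then show ?thesis using assms by (simp add: add_increasing2)
next
  case False
  then have x: "x > 0" using assms by simp
  have "x powr a = x powr (a - 1) * x" using x by (simp add: powr_diff)
  also have "\<dots> \<le> \<rho> powr (a - 1) * x" using x False assms by (intro mult_right_mono powr_mono2') auto
  finally show ?thesis by (simp add: add_increasing)
qed

text \<open>Where \<open>p\<close> dominates use the bound of order \<open>\<gamma>\<close>, where \<open>q\<close> dominates the quadratic one; thus only \<open>p\<close> is
  raised to the power \<open>\<gamma> > 2\<close>.\<close>

lemma min_powr_add_le:
  fixes p q :: "'w::real_normed_vector"
  assumes "2 < \<gamma>" "\<gamma> \<le> 3" "R \<le> C * norm (p + q) ^ 2" "R \<le> C * norm (p + q) powr \<gamma>" "0 \<le> C"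
  shows "R \<le> C * (8 * norm p powr \<gamma> + 4 * norm q ^ 2)"
proof (cases "norm q \<le> norm p")
  case True
  then have "norm (p + q) \<le> 2 * norm p" using norm_triangle_ineq[of p q] by linarith
  then have "norm (p + q) powr \<gamma> \<le> (2 * norm p) powr \<gamma>" using assms by (intro powr_mono2) auto
  also have "\<dots> = 2 powr \<gamma> * norm p powr \<gamma>" by (simp add: powr_mult)
  also have "\<dots> \<le> 2 powr 3 * norm p powr \<gamma>" using assms by (intro mult_right_mono powr_mono) auto
  finally have "norm (p + q) powr \<gamma> \<le> 8 * norm p powr \<gamma> + 4 * norm q ^ 2" by (simp add: add_increasing2)
  then have "C * norm (p + q) powr \<gamma> \<le> C * (8 * norm p powr \<gamma> + 4 * norm q ^ 2)" using assms by (intro mult_left_mono) auto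
  then show ?thesis using assms by linarith
next
  case False
  then have "norm (p + q) \<le> 2 * norm q" using norm_triangle_ineq[of p q] by linarith
  then have "norm (p + q) ^ 2 \<le> (2 * norm q) ^ 2" by (intro power_mono) auto
  then have "norm (p + q) ^ 2 \<le> 8 * norm p powr \<gamma> + 4 * norm q ^ 2" by (simp add: power_mult_distrib add_increasing)
  then have "C * norm (p + q) ^ 2 \<le> C * (8 * norm p powr \<gamma> + 4 * norm q ^ 2)" using assms by (intro mult_left_mono) auto
  then show ?thesis using assms by linarith
qed

text \<open>In the application \<open>p\<close> has fourth moments while \<open>q\<close> is of higher order but merely square integrable.
  Only \<open>p\<close> may therefore appear in the quadratic Taylor term, and the remainder is expressed through
  the squares of \<open>p\<close> and \<open>q\<close> and the fourth power of \<open>p\<close>.\<close>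

lemma Cb_taylor_split:
  fixes \<phi> :: "'w::real_normed_vector => real"
  assumes \<phi>: "\<phi> \<in> Cb \<gamma>" and \<gamma>: "2 < \<gamma>" "\<gamma> \<le> 3"
  obtains C where "C > 0" "\<And>y p q \<rho>. 0 < \<rho> ==>
    \<bar>\<phi> (y + (p + q)) - \<phi> y - Dfun \<phi> y (p + q)
       - 1/2 * Dfun (Dfun \<phi>) y p p\<bar>
    \<le> C * (\<rho> powr (\<gamma> - 2) * norm p ^ 2 + \<rho> powr (\<gamma> - 4) * norm p ^ 4 + norm p * norm q + norm q ^ 2)"
proof -
  obtain C1 where C1: "C1 > 0"
    "\<And>y x. \<bar>\<phi> (y + x) - \<phi> y - Dfun \<phi> y x
       - 1/2 * Dfun (Dfun \<phi>) y x x\<bar> \<le> C1 * norm x ^ 2"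
    "\<And>y x. \<bar>\<phi> (y + x) - \<phi> y - Dfun \<phi> y x
       - 1/2 * Dfun (Dfun \<phi>) y x x\<bar> \<le> C1 * norm x powr \<gamma>"
    by (rule Cb_taylor[OF \<phi> \<gamma>(1)]) (rule that)
  obtain C2 where C2: "C2 > 0" "\<And>y. norm (Dfun (Dfun \<phi>) y) \<le> C2"
    by (rule Cb_bounds[OF \<phi>]) (rule that)
  define C where "C = 8 * C1 + C2"
  show thesis
  proof (rule that[of C])
    show "C > 0" using C1(1) C2(1) by (simp add: C_def)
    fix y p q :: 'w and \<rho> :: real assume \<rho>: "0 < \<rho>"
    let ?Q = "\<lambda>x z. Dfun (Dfun \<phi>) y x z"
    let ?R = "\<phi> (y + (p + q)) - \<phi> y - Dfun \<phi> y (p + q)"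
    let ?np = "norm p" and ?nq = "norm q"
    have Q: "\<bar>?Q x z\<bar> \<le> C2 * (norm x * norm z)" for x z
    proof -
      have "\<bar>?Q x z\<bar> \<le> (norm (Dfun (Dfun \<phi>) y) * norm x) * norm z"
        using norm_blinfun[of "Dfun (Dfun \<phi>) y x" z]
          mult_right_mono[OF norm_blinfun[of "Dfun (Dfun \<phi>) y" x] norm_ge_zero[of z]] by simp
      also have "\<dots> \<le> (C2 * norm x) * norm z" using C2(2) by (intro mult_right_mono) auto
      finally show ?thesis by (simp add: mult.assoc)
    qed
    have "\<bar>?R - 1/2 * ?Q (p + q) (p + q)\<bar> \<le> C1 * (8 * ?np powr \<gamma> + 4 * ?nq ^ 2)"
      using C1(2)[of y "p + q"] C1(3)[of y "p + q"] C1(1) by (intro min_powr_add_le[OF \<gamma>]) auto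
    moreover have "?np powr \<gamma> \<le> \<rho> powr (\<gamma> - 2) * ?np\<^sup>2 + \<rho> powr (\<gamma> - 4) * ?np ^ 4" (is "_ \<le> ?P")
      using \<rho> \<gamma> by (intro powr_le_interpolate) auto
    then have "C1 * (8 * ?np powr \<gamma> + 4 * ?nq ^ 2) \<le> C1 * (8 * ?P + 4 * ?nq ^ 2)"
      using C1(1) by (intro mult_left_mono) auto
    ultimately have a: "\<bar>?R - 1/2 * ?Q (p + q) (p + q)\<bar> \<le> C1 * (8 * ?P + 4 * ?nq ^ 2)" by linarith
    have "?Q (p + q) (p + q) - ?Q p p = ?Q p q + ?Q q p + ?Q q q"
      by (simp add: blinfun.add_left blinfun.add_right)
    then have b: "\<bar>?Q (p + q) (p + q) - ?Q p p\<bar> \<le> C2 * (2 * (?np * ?nq) + ?nq ^ 2)"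
      using Q[of p q] Q[of q p] Q[of q q] by (simp add: power2_eq_square algebra_simps)
    have "\<bar>?R - 1/2 * ?Q p p\<bar> \<le> C1 * (8 * ?P + 4 * ?nq ^ 2) + 1/2 * (C2 * (2 * (?np * ?nq) + ?nq ^ 2))"
      using a b by linarith
    also have "\<dots> \<le> C * (?P + ?np * ?nq + ?nq ^ 2)"
    proof -
      have nn: "0 \<le> C1 * ?P" "0 \<le> C1 * (?np * ?nq)" "0 \<le> C1 * ?nq ^ 2" "0 \<le> C2 * ?P" "0 \<le> C2 * (?np * ?nq)" "0 \<le> C2 * ?nq ^ 2"
        using C1(1) C2(1) \<rho> by (auto intro!: mult_nonneg_nonneg add_nonneg_nonneg)
      have "C * (?P + ?np * ?nq + ?nq ^ 2) = 8 * (C1 * ?P) + 8 * (C1 * (?np * ?nq)) + 8 * (C1 * ?nq ^ 2)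
          + (C2 * ?P + C2 * (?np * ?nq) + C2 * ?nq ^ 2)" unfolding C_def by (simp only: distrib_left distrib_right mult.assoc)
      moreover have "C1 * (8 * ?P + 4 * ?nq ^ 2) + 1/2 * (C2 * (2 * (?np * ?nq) + ?nq ^ 2))
          = 8 * (C1 * ?P) + 4 * (C1 * ?nq ^ 2) + (C2 * (?np * ?nq) + 1/2 * (C2 * ?nq ^ 2))"
        by (simp add: algebra_simps)
      ultimately show ?thesis using nn by linarith
    qed
    finally show "\<bar>?R - 1/2 * ?Q p p\<bar> \<le> C * (?P + ?np * ?nq + ?nq ^ 2)" .
  qed
qed

lemma (in prob_space) l2_of_l2_square:
  fixes p :: "'a => 'w::{real_normed_vector,second_countable_topology}"
  assumes p: "p \<in> borel_measurable M" "sq_int M (\<lambda>w. (norm (p w))\<^sup>2)" "l2 M (\<lambda>w. (norm (p w))\<^sup>2) \<le> c\<^sup>2" "0 \<le> c"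
  shows "sq_int M p" "l2 M p \<le> c" "integrable M (\<lambda>w. (norm (p w)) ^ 4)" "(\<integral>w. (norm (p w)) ^ 4 \<partial>M) \<le> c ^ 4"
proof -
  note i = sq_int_integrable[OF p(2)]
  show "sq_int M p" using i(1) p(1) by (simp add: sq_int_def)
  show "l2 M p \<le> c" using i(2) p(3,4) by (intro l2_leI) auto
  show "integrable M (\<lambda>w. (norm (p w)) ^ 4)" using p(2) by (simp add: sq_int_def power_mult[symmetric])
  have "(\<integral>w. (norm (p w)) ^ 4 \<partial>M) = (l2 M (\<lambda>w. (norm (p w))\<^sup>2))\<^sup>2"
    by (simp add: l2_square power_mult[symmetric])
  also have "\<dots> \<le> (c\<^sup>2)\<^sup>2" by (rule power_mono[OF p(3) l2_nonneg])
  finally show "(\<integral>w. (norm (p w)) ^ 4 \<partial>M) \<le> c ^ 4" by (simp add: power_mult[symmetric])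
qed

lemma (in prob_space) taylor_expectation:
  fixes \<phi> :: "'w::fin_dim_banach => real"
  assumes \<phi>: "\<phi> \<in> Cb \<gamma>" and \<gamma>: "2 < \<gamma>" "\<gamma> \<le> 3"
  obtains C where "C > 0" "\<And>y p q c \<rho> \<mu>. y \<in> borel_measurable M ==> p \<in> borel_measurable M ==>
      sq_int M (\<lambda>w. (norm (p w))\<^sup>2) ==> l2 M (\<lambda>w. (norm (p w))\<^sup>2) \<le> (c * \<rho>)\<^sup>2 ==> 0 < \<rho> ==> 0 \<le> c ==>
      sq_int M q ==> l2 M q \<le> \<mu> ==>
    integrable M (\<lambda>w. Dfun \<phi> (y w) (p w + q w)) \<and>
    integrable M (\<lambda>w. Dfun (Dfun \<phi>) (y w) (p w) (p w)) \<and>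
    \<bar>(\<integral>w. \<phi> (y w + (p w + q w)) \<partial>M) - (\<integral>w. \<phi> (y w) \<partial>M)
      - (\<integral>w. Dfun \<phi> (y w) (p w + q w) \<partial>M)
      - 1/2 * (\<integral>w. Dfun (Dfun \<phi>) (y w) (p w) (p w) \<partial>M)\<bar>
    \<le> C * ((c\<^sup>2 + c ^ 4) * \<rho> powr \<gamma> + c * \<rho> * \<mu> + \<mu>\<^sup>2)"
proof -
  obtain C where C: "C > 0" "\<And>y p q \<rho>. 0 < \<rho> ==>
    \<bar>\<phi> (y + (p + q)) - \<phi> y - Dfun \<phi> y (p + q)
       - 1/2 * Dfun (Dfun \<phi>) y p p\<bar>
    \<le> C * (\<rho> powr (\<gamma> - 2) * norm p ^ 2 + \<rho> powr (\<gamma> - 4) * norm p ^ 4 + norm p * norm q + norm q ^ 2)"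
    by (rule Cb_taylor_split[OF \<phi> \<gamma>]) (rule that)
  obtain C2 where C2: "C2 > 0" "\<And>y. \<bar>\<phi> y\<bar> \<le> C2" "\<And>y. norm (Dfun \<phi> y) \<le> C2" "\<And>y. norm (Dfun (Dfun \<phi>) y) \<le> C2"
    by (rule Cb_bounds[OF \<phi>]) (rule that)
  have cont: "\<phi> \<in> borel_measurable borel" "Dfun \<phi> \<in> borel_measurable borel" "Dfun (Dfun \<phi>) \<in> borel_measurable borel"
    using Cb_continuous[OF \<phi> \<gamma>(1)] by (auto intro: borel_measurable_continuous_onI)
  note [measurable] = cont
  show thesis
  proof (rule that[OF C(1)])
    fix y p q :: "'a => 'w" and c \<rho> \<mu> :: real
    assume y[measurable]: "y \<in> borel_measurable M" and p[measurable]: "p \<in> borel_measurable M"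
      and p2: "sq_int M (\<lambda>w. (norm (p w))\<^sup>2)" "l2 M (\<lambda>w. (norm (p w))\<^sup>2) \<le> (c * \<rho>)\<^sup>2"
      and \<rho>: "0 < \<rho>" and c: "0 \<le> c" and q: "sq_int M q" "l2 M q \<le> \<mu>"
    note [measurable] = sq_int_measurable[OF q(1)]
    have c\<rho>: "0 \<le> c * \<rho>" using \<rho> c by simp
    note pm = l2_of_l2_square[OF p p2 c\<rho>]
    have \<mu>: "0 \<le> \<mu>" using q(2) l2_nonneg[of M q] by linarith
    have pq: "sq_int M (\<lambda>w. p w + q w)" by (rule sq_int_add(1)[OF pm(1) q(1)])
    have I1: "integrable M (\<lambda>w. Dfun \<phi> (y w) (p w + q w))"
      by (rule integrable_blinfun_bounded[OF sq_int_integrable(1)[OF pq] _ C2(3)]) measurable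
    have p2I: "integrable M (\<lambda>w. (norm (p w))\<^sup>2)" and q2I: "integrable M (\<lambda>w. (norm (q w))\<^sup>2)"
      using pm(1) q(1) by (auto simp: sq_int_def)
    have I2: "integrable M (\<lambda>w. Dfun (Dfun \<phi>) (y w) (p w) (p w))"
    proof (rule Bochner_Integration.integrable_bound)
      show "integrable M (\<lambda>w. C2 * (norm (p w))\<^sup>2)" using p2I by simp
      show "AE w in M. norm (Dfun (Dfun \<phi>) (y w) (p w) (p w)) \<le> norm (C2 * (norm (p w))\<^sup>2)"
      proof (rule AE_I2)
        fix w
        have "norm (Dfun (Dfun \<phi>) (y w) (p w) (p w)) \<le> (C2 * norm (p w)) * norm (p w)"
          by (intro order_trans[OF norm_blinfun] mult_right_mono C2(4) norm_ge_zero)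
        then show "norm (Dfun (Dfun \<phi>) (y w) (p w) (p w)) \<le> norm (C2 * (norm (p w))\<^sup>2)"
          using C2(1) by (simp add: power2_eq_square)
      qed
    qed measurable
    have I0: "integrable M (\<lambda>w. \<phi> (z w))" if [measurable]: "z \<in> borel_measurable M" for z
      using C2(2) by (intro integrable_const_bound[of _ C2]) auto
    have zm: "(\<lambda>w. y w + (p w + q w)) \<in> borel_measurable M" by measurable
    let ?Q = "\<lambda>w. Dfun (Dfun \<phi>) (y w) (p w) (p w)"
    let ?L = "\<lambda>w. Dfun \<phi> (y w) (p w + q w)"
    let ?G = "\<lambda>w. C * (\<rho> powr (\<gamma> - 2) * norm (p w) ^ 2 + \<rho> powr (\<gamma> - 4) * norm (p w) ^ 4 + norm (p w) * norm (q w) + norm (q w) ^ 2)"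
    note pqm = sq_int_mult[OF pm(1) q(1)]
    let ?m2 = "\<integral>w. norm (p w) ^ 2 \<partial>M" and ?m4 = "\<integral>w. norm (p w) ^ 4 \<partial>M"
      and ?mpq = "\<integral>w. norm (p w) * norm (q w) \<partial>M" and ?mq = "\<integral>w. norm (q w) ^ 2 \<partial>M"
    have eq: "(\<integral>w. \<phi> (y w + (p w + q w)) \<partial>M) - (\<integral>w. \<phi> (y w) \<partial>M) - (\<integral>w. ?L w \<partial>M) - 1/2 * (\<integral>w. ?Q w \<partial>M)
        = (\<integral>w. \<phi> (y w + (p w + q w)) - \<phi> (y w) - ?L w - 1/2 * ?Q w \<partial>M)"
      using I0[OF zm] I0[OF y] I1 I2 by simp
    have b1: "\<bar>\<integral>w. \<phi> (y w + (p w + q w)) - \<phi> (y w) - ?L w - 1/2 * ?Q w \<partial>M\<bar> \<le> (\<integral>w. ?G w \<partial>M)"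
    proof (rule order_trans[OF integral_abs_bound], rule integral_mono)
      show "integrable M (\<lambda>w. \<bar>\<phi> (y w + (p w + q w)) - \<phi> (y w) - ?L w - 1/2 * ?Q w\<bar>)"
        using I0[OF zm] I0[OF y] I1 I2 by simp
      show "integrable M (\<lambda>w. ?G w)"
        by (intro integrable_mult_right Bochner_Integration.integrable_add pm(3) p2I q2I pqm(1))
    qed (rule C(2)[OF \<rho>])
    have b2: "(\<integral>w. ?G w \<partial>M) = C * (\<rho> powr (\<gamma> - 2) * ?m2 + \<rho> powr (\<gamma> - 4) * ?m4 + ?mpq + ?mq)"
      by (simp only: integral_mult_right_zero Bochner_Integration.integral_add pm(3) p2I q2I pqm(1)
          Bochner_Integration.integrable_add integrable_mult_right)
    have "?m2 \<le> (c * \<rho>)\<^sup>2" "?mpq \<le> c * \<rho> * \<mu>" "?mq \<le> \<mu>\<^sup>2"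
      using power_mono[OF pm(2) l2_nonneg, of 2] power_mono[OF q(2) l2_nonneg, of 2]
        order_trans[OF pqm(2) mult_mono[OF pm(2) q(2) c\<rho> l2_nonneg]] by (simp_all add: l2_square)
    then have b3: "C * (\<rho> powr (\<gamma> - 2) * ?m2 + \<rho> powr (\<gamma> - 4) * ?m4 + ?mpq + ?mq)
        \<le> C * (\<rho> powr (\<gamma> - 2) * (c * \<rho>)\<^sup>2 + \<rho> powr (\<gamma> - 4) * (c * \<rho>) ^ 4 + c * \<rho> * \<mu> + \<mu>\<^sup>2)"
      using pm(4) C(1) by (intro mult_left_mono add_mono) auto
    have b4: "\<rho> powr (\<gamma> - 2) * (c * \<rho>)\<^sup>2 = c\<^sup>2 * \<rho> powr \<gamma>" "\<rho> powr (\<gamma> - 4) * (c * \<rho>) ^ 4 = c ^ 4 * \<rho> powr \<gamma>"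
      using \<rho> by (simp_all add: power_mult_distrib powr_diff)
    have "\<bar>(\<integral>w. \<phi> (y w + (p w + q w)) \<partial>M) - (\<integral>w. \<phi> (y w) \<partial>M) - (\<integral>w. ?L w \<partial>M) - 1/2 * (\<integral>w. ?Q w \<partial>M)\<bar>
      \<le> C * ((c\<^sup>2 + c ^ 4) * \<rho> powr \<gamma> + c * \<rho> * \<mu> + \<mu>\<^sup>2)"
      unfolding eq using order_trans[OF b1[unfolded b2] b3] unfolding b4 distrib_right .
    then show "integrable M ?L \<and> integrable M ?Q \<and>
      \<bar>(\<integral>w. \<phi> (y w + (p w + q w)) \<partial>M) - (\<integral>w. \<phi> (y w) \<partial>M) - (\<integral>w. ?L w \<partial>M) - 1/2 * (\<integral>w. ?Q w \<partial>M)\<bar>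
      \<le> C * ((c\<^sup>2 + c ^ 4) * \<rho> powr \<gamma> + c * \<rho> * \<mu> + \<mu>\<^sup>2)"
      using I1 I2 by blast
  qed
qed


section \<open>The remainder of the rough stochastic integral\<close>

lemma sq_int_bounded_linear:
  fixes f :: "'o => 'a::{real_normed_vector,second_countable_topology}"
    and h :: "'a => 'b::{real_normed_vector,second_countable_topology}"
  assumes h: "bounded_linear h" and K: "\<And>x. norm (h x) \<le> K * norm x" "0 \<le> K" and f: "sq_int M f"
  shows "sq_int M (\<lambda>w. h (f w))" "l2 M (\<lambda>w. h (f w)) \<le> K * l2 M f"
proof -
  have m: "(\<lambda>w. h (f w)) \<in> borel_measurable M"
    by (rule borel_measurable_bounded_linear[OF h sq_int_measurable[OF f]])
  have ae: "AE w in M. norm (h (f w)) \<le> norm (K *\<^sub>R f w)" using K by (intro AE_I2) simp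
  show "sq_int M (\<lambda>w. h (f w))" "l2 M (\<lambda>w. h (f w)) \<le> K * l2 M f"
    using sq_int_mono[OF m sq_int_scaleR(1)[OF f] ae] sq_int_scaleR(2)[OF f, of K] K(2) by auto
qed

lemma sq_int_blinfun_at:
  fixes f :: "'o => 'a::fin_dim_banach \<Rightarrow>\<^sub>L 'b::fin_dim_banach"
  assumes f: "sq_int M f" "l2 M f \<le> c" and v: "norm v \<le> d" "0 \<le> d"
  shows "sq_int M (\<lambda>w. f w v)" "l2 M (\<lambda>w. f w v) \<le> c * d"
proof -
  have n: "norm (g v) \<le> norm v * norm g" for g :: "'a \<Rightarrow>\<^sub>L 'b"
    using norm_blinfun[of g v] by (simp add: mult.commute)
  note r = sq_int_bounded_linear[OF blinfun.bounded_linear_left n norm_ge_zero f(1)]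
  show "sq_int M (\<lambda>w. f w v)" by (rule r(1))
  have "norm v * l2 M f \<le> d * c" using f(2) v l2_nonneg[of M f] by (intro mult_mono) auto
  then show "l2 M (\<lambda>w. f w v) \<le> c * d" using r(2) by (simp add: mult.commute)
qed

lemma sq_int_tensor_lift_at:
  fixes f :: "'o => 'a::fin_dim_banach \<Rightarrow>\<^sub>L 'a \<Rightarrow>\<^sub>L 'b::fin_dim_banach"
  assumes KT: "\<And>(K :: 'a \<Rightarrow>\<^sub>L 'a \<Rightarrow>\<^sub>L 'b) A. norm (tensor_lift K A) \<le> norm K * norm A * KT" "0 \<le> KT"
    and f: "sq_int M f" "l2 M f \<le> c" and A: "norm A \<le> d" "0 \<le> d"
  shows "sq_int M (\<lambda>w. tensor_lift (f w) A)" "l2 M (\<lambda>w. tensor_lift (f w) A) \<le> c * d * KT"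
proof -
  have n: "norm (tensor_lift g A) \<le> (norm A * KT) * norm g" for g :: "'a \<Rightarrow>\<^sub>L 'a \<Rightarrow>\<^sub>L 'b"
    using KT(1)[of g A] by (simp add: mult_ac)
  have nn: "0 \<le> norm A * KT" using KT(2) by simp
  note r = sq_int_bounded_linear[OF tensor_lift.bounded_linear_left n nn f(1)]
  show "sq_int M (\<lambda>w. tensor_lift (f w) A)" by (rule r(1))
  have "(norm A * KT) * l2 M f \<le> (d * KT) * c"
    using f(2) A KT(2) l2_nonneg[of M f] by (intro mult_mono) (auto intro!: mult_right_mono)
  then show "l2 M (\<lambda>w. tensor_lift (f w) A) \<le> c * d * KT" using r(2) by (simp add: mult_ac)
qed

lemma tends_in_prob_AE_cong:
  assumes S: "tends_in_prob M S Z" and ae: "AE w in M. Z w = Z' w"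
  shows "tends_in_prob M S Z'"
  unfolding tends_in_prob_def
proof (intro allI impI)
  fix \<epsilon> \<eta> :: real assume e: "0 < \<epsilon>" "0 < \<eta>"
  obtain N where N: "N \<in> null_sets M" "{w \<in> space M. Z w \<noteq> Z' w} \<subseteq> N" using ae unfolding eventually_ae_filter by blast
  from S[unfolded tends_in_prob_def, rule_format, OF e]
  show "\<forall>\<^sub>F k in sequentially. \<exists>A\<in>sets M. measure M A < \<eta> \<and> (\<forall>w\<in>space M - A. norm (S k w - Z' w) \<le> \<epsilon>)"
  proof eventually_elim
    case (elim k)
    then obtain A where A: "A \<in> sets M" "measure M A < \<eta>" "\<And>w. w \<in> space M - A ==> norm (S k w - Z w) \<le> \<epsilon>" by blast
    have "measure M (A \<union> N) = measure M A"
      using A(1) N(1) by (simp add: measure_Un_null_set)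
    moreover have "norm (S k w - Z' w) \<le> \<epsilon>" if "w \<in> space M - (A \<union> N)" for w
    proof -
      have "Z w = Z' w" using that N(2) by blast
      then show ?thesis using A(3)[of w] that by auto
    qed
    ultimately show ?case using A N(1) by (intro bexI[of _ "A \<union> N"]) (auto simp: null_sets_def)
  qed
qed

lemma powr_le_scale:
  fixes h T :: real
  assumes "0 < h" "h \<le> T" "b \<le> a"
  shows "h powr a \<le> T powr (a - b) * h powr b"
proof -
  have "h powr a = h powr (a - b) * h powr b" using assms by (simp add: powr_add[symmetric])
  also have "\<dots> \<le> T powr (a - b) * h powr b" using assms by (intro mult_right_mono powr_mono2) auto
  finally show ?thesis .
qed

context filtered_space
begin

text \<open>The mixed norms enter only through moments: since \<open>n > 4\<close>, they dominate the fourth moments of \<open>Z\<close> and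
  the second moments of everything else.\<close>

lemma controlled_bounds:
  fixes Z :: "real => 'o => 'e::fin_dim_banach" and Z' :: "real => 'o => 'v::fin_dim_banach \<Rightarrow>\<^sub>L 'e"
  assumes n: "4 < n" and Z: "ext_stoch_controlled M F T X \<beta> \<beta>' 4 n Z Z'"
    and Zn: "(SUP t\<in>{0..T}. Lnorm M n (\<lambda>w. ennreal (norm (Z t w)))) < \<infinity>"
  obtains c R D where "c > 0"
    "\<And>t. t \<in> {0..T} ==> sq_int M (\<lambda>w. (norm (Z t w))\<^sup>2) \<and> l2 M (\<lambda>w. (norm (Z t w))\<^sup>2) \<le> c\<^sup>2"
    "\<And>t. t \<in> {0..T} ==> sq_int M (Z' t) \<and> l2 M (Z' t) \<le> c"
    "\<And>s t. 0 \<le> s ==> s < t ==> t \<le> T ==> l2 M (\<lambda>w. Z t w - Z s w) \<le> c * (t - s) powr \<beta>"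
    "\<And>s t. 0 \<le> s ==> s < t ==> t \<le> T ==>
      has_cond_exp M (F s) (\<lambda>w. Z t w - Z s w - Z' s w (X t - X s)) (R s t) \<and>
      sq_int M (R s t) \<and> l2 M (R s t) \<le> c * (t - s) powr (\<beta> + \<beta>')"
    "\<And>s t. 0 \<le> s ==> s < t ==> t \<le> T ==> has_cond_exp M (F s) (\<lambda>w. Z' t w - Z' s w) (D s t) \<and>
      sq_int M (D s t) \<and> l2 M (D s t) \<le> c * (t - s) powr \<beta>'"
proof -
  from Z have pr: "progressive F T Z" "progressive F T Z'"
    and h1: "holder_cond_Lnorm M F T \<beta> 4 n (\<lambda>s t w. Z t w - Z s w) < \<infinity>"
    and h2: "holder_Lnorm M T (\<beta> + \<beta>') n (\<lambda>s t. vcond_exp M (F s)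
        (\<lambda>w. Z t w - Z s w - Z' s w (X t - X s))) < \<infinity>"
    and h3: "(SUP t\<in>{0..T}. Lnorm M n (\<lambda>w. ennreal (norm (Z' t w)))) < \<infinity>"
    and h4: "holder_Lnorm M T \<beta>' n (\<lambda>s t. vcond_exp M (F s) (\<lambda>w. Z' t w - Z' s w)) < \<infinity>"
    unfolding ext_stoch_controlled_def by blast+
  obtain c0 where c0: "c0 > 0" "\<And>t. t \<in> {0..T} ==> Lnorm M n (\<lambda>w. ennreal (norm (Z t w))) \<le> ennreal c0"
    by (rule SUP_Lnorm_bound[OF Zn]) (rule that)
  obtain c1 where c1: "c1 > 0" "\<And>s t. (s, t) \<in> time_pairs T ==>
      Lnorm M n (cond_Lnorm M (F s) 4 (\<lambda>w. ennreal (norm (Z t w - Z s w)))) \<le> ennreal (c1 * (t - s) powr \<beta>)"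
    by (rule SUP_quotient_bound[OF h1[unfolded holder_cond_Lnorm_def]]) (rule that)
  define R where "R s t = vcond_exp M (F s) (\<lambda>w. Z t w - Z s w - Z' s w (X t - X s))" for s t
  define D where "D s t = vcond_exp M (F s) (\<lambda>w. Z' t w - Z' s w)" for s t
  obtain c2 where c2: "c2 > 0" "\<And>s t. (s, t) \<in> time_pairs T ==>
      Lnorm M n (\<lambda>w. ennreal (norm (R s t w))) \<le> ennreal (c2 * (t - s) powr (\<beta> + \<beta>'))"
    by (rule SUP_quotient_bound[OF h2[unfolded holder_Lnorm_def]]) (rule that, auto simp: R_def)
  obtain c3 where c3: "c3 > 0" "\<And>t. t \<in> {0..T} ==> Lnorm M n (\<lambda>w. ennreal (norm (Z' t w))) \<le> ennreal c3"
    by (rule SUP_Lnorm_bound[OF h3]) (rule that)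
  obtain c4 where c4: "c4 > 0" "\<And>s t. (s, t) \<in> time_pairs T ==>
      Lnorm M n (\<lambda>w. ennreal (norm (D s t w))) \<le> ennreal (c4 * (t - s) powr \<beta>')"
    by (rule SUP_quotient_bound[OF h4[unfolded holder_Lnorm_def]]) (rule that, auto simp: D_def)
  define c where "c = 2 * (c0 + c1 + c2 + c3 + c4)"
  have cc: "2 * c0 \<le> c" "2 * c1 \<le> c" "2 * c2 \<le> c" "2 * c3 \<le> c" "2 * c4 \<le> c" "c > 0"
    using c0(1) c1(1) c2(1) c3(1) c4(1) by (auto simp: c_def)
  have Zm: "Z t \<in> borel_measurable M" and Z'm: "Z' t \<in> borel_measurable M" if "t \<in> {0..T}" for t
    using that progressive_adapted[OF pr(1)] progressive_adapted[OF pr(2)] by (auto intro: measurable_F_M)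
  have Z4: "sq_int M (\<lambda>w. (norm (Z t w))\<^sup>2) \<and> l2 M (\<lambda>w. (norm (Z t w))\<^sup>2) \<le> c\<^sup>2" and Zsq: "sq_int M (Z t)"
    if t: "t \<in> {0..T}" for t
  proof -
    have [measurable]: "Z t \<in> borel_measurable M" by (rule Zm[OF t])
    note m = moments_of_Lnorm[OF Zm[OF t] c0(1) _ n c0(1) c0(2)[OF t]]
    have m': "integrable M (\<lambda>w. (norm (Z t w)) ^ 4)" "(\<integral>w. (norm (Z t w)) ^ 4 \<partial>M) \<le> 2 * c0 ^ 4"
      "sq_int M (Z t)" using m by auto
    show "sq_int M (Z t)" by (rule m'(3))
    have "2 * c0 ^ 4 \<le> (2 * c0) ^ 4" using c0(1) by (simp add: power_mult_distrib)
    also have "\<dots> \<le> c ^ 4" using cc c0(1) by (intro power_mono) auto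
    finally have "(\<integral>w. (norm ((norm (Z t w))\<^sup>2))\<^sup>2 \<partial>M) \<le> (c\<^sup>2)\<^sup>2"
      using m'(2) by (simp add: power_mult[symmetric])
    then show "sq_int M (\<lambda>w. (norm (Z t w))\<^sup>2) \<and> l2 M (\<lambda>w. (norm (Z t w))\<^sup>2) \<le> c\<^sup>2"
      using m'(1) by (auto simp: sq_int_def power_mult[symmetric] intro!: l2_leI)
  qed
  have Z'2: "sq_int M (Z' t)" "l2 M (Z' t) \<le> c" if t: "t \<in> {0..T}" for t
  proof -
    have [measurable]: "Z' t \<in> borel_measurable M" by (rule Z'm[OF t])
    have "(\<lambda>w. ennreal (norm (Z' t w))) \<in> borel_measurable M" by measurable
    note m = moments_of_Lnorm[OF Z'm[OF t] c3(1) this n c3(1) c3(2)[OF t]]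
    show "sq_int M (Z' t)" "l2 M (Z' t) \<le> c" using m(3,4) cc by auto
  qed
  have incr: "l2 M (\<lambda>w. Z t w - Z s w) \<le> c * (t - s) powr \<beta>" if st: "0 \<le> s" "s < t" "t \<le> T" for s t
  proof -
    have tp: "(s, t) \<in> time_pairs T" and s: "s \<in> {0..T}" "t \<in> {0..T}" using st by (auto simp: time_pairs_def)
    have [measurable]: "Z t \<in> borel_measurable M" "Z s \<in> borel_measurable M" using Zm s by auto
    have pos: "0 < c1 * (t - s) powr \<beta>" using c1(1) st by simp
    have m1: "(\<lambda>w. Z t w - Z s w) \<in> borel_measurable M" by measurable
    have "(\<integral>\<^sup>+w. ennreal (norm (Z t w - Z s w)) ^ 4 \<partial>M) \<le> ennreal (2 * (c1 * (t - s) powr \<beta>) ^ 4)"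
      by (rule fourth_moment_of_cond_Lnorm[OF sub[OF s(1)] _ n pos c1(2)[OF tp]]) measurable
    from moments_of_nn_fourth_moment(4)[OF m1 pos this]
    have "l2 M (\<lambda>w. Z t w - Z s w) \<le> (2 * c1) * (t - s) powr \<beta>" by (simp add: mult.assoc)
    also have "\<dots> \<le> c * (t - s) powr \<beta>" using cc by (intro mult_right_mono) auto
    finally show ?thesis .
  qed
  have Rb: "has_cond_exp M (F s) (\<lambda>w. Z t w - Z s w - Z' s w (X t - X s)) (R s t) \<and>
      sq_int M (R s t) \<and> l2 M (R s t) \<le> c * (t - s) powr (\<beta> + \<beta>')" if st: "0 \<le> s" "s < t" "t \<le> T" for s t
  proof -
    have tp: "(s, t) \<in> time_pairs T" and s: "s \<in> {0..T}" "t \<in> {0..T}" using st by (auto simp: time_pairs_def)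
    interpret finite_measure_subalgebra M "F s" by unfold_locales (rule sub[OF s(1)])
    have "sq_int M (\<lambda>w. Z t w - Z s w - Z' s w (X t - X s))"
      using s by (intro sq_int_diff(1) Zsq sq_int_blinfun_at(1)[OF Z'2]) auto
    then have ce: "has_cond_exp M (F s) (\<lambda>w. Z t w - Z s w - Z' s w (X t - X s)) (R s t)"
      unfolding R_def by (intro has_cond_exp_vcond_exp sq_int_integrable(1))
    have Rm[measurable]: "R s t \<in> borel_measurable M" using ce by (auto simp: has_cond_exp_def)
    have pos: "0 < c2 * (t - s) powr (\<beta> + \<beta>')" using c2(1) st by simp
    have "(\<lambda>w. ennreal (norm (R s t w))) \<in> borel_measurable M" by measurable
    note m = moments_of_Lnorm(3,4)[OF Rm pos this n pos c2(2)[OF tp]]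
    have "2 * (c2 * (t - s) powr (\<beta> + \<beta>')) \<le> c * (t - s) powr (\<beta> + \<beta>')"
      using mult_right_mono[OF cc(3), of "(t - s) powr (\<beta> + \<beta>')"] by (simp add: mult.assoc)
    then show ?thesis using ce m by auto
  qed
  have Db: "has_cond_exp M (F s) (\<lambda>w. Z' t w - Z' s w) (D s t) \<and>
      sq_int M (D s t) \<and> l2 M (D s t) \<le> c * (t - s) powr \<beta>'" if st: "0 \<le> s" "s < t" "t \<le> T" for s t
  proof -
    have tp: "(s, t) \<in> time_pairs T" and s: "s \<in> {0..T}" "t \<in> {0..T}" using st by (auto simp: time_pairs_def)
    interpret finite_measure_subalgebra M "F s" by unfold_locales (rule sub[OF s(1)])
    have "sq_int M (\<lambda>w. Z' t w - Z' s w)" using s by (intro sq_int_diff(1) Z'2) auto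
    then have ce: "has_cond_exp M (F s) (\<lambda>w. Z' t w - Z' s w) (D s t)"
      unfolding D_def by (intro has_cond_exp_vcond_exp sq_int_integrable(1))
    have Dm[measurable]: "D s t \<in> borel_measurable M" using ce by (auto simp: has_cond_exp_def)
    have pos: "0 < c4 * (t - s) powr \<beta>'" using c4(1) st by simp
    have "(\<lambda>w. ennreal (norm (D s t w))) \<in> borel_measurable M" by measurable
    note m = moments_of_Lnorm(3,4)[OF Dm pos this n pos c4(2)[OF tp]]
    have "2 * (c4 * (t - s) powr \<beta>') \<le> c * (t - s) powr \<beta>'"
      using mult_right_mono[OF cc(5), of "(t - s) powr \<beta>'"] by (simp add: mult.assoc)
    then show ?thesis using ce m by auto
  qed
  show thesis by (rule that[OF cc(6) Z4 _ incr Rb Db]) (use Z'2 in blast)+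
qed

end


context filtered_space
begin

text \<open>By Chen's relation the germ \<open>Z\<^sub>s \<delta>X + Z'\<^sub>s XX\<close> has the defect \<open>Dv\<close> at the midpoint of an interval, of
  order \<open>\<alpha> + \<beta> > 1/2\<close>, and the conditional expectation \<open>gv\<close> of the defect is of order
  \<open>\<alpha> + \<beta> + \<beta>' > 1\<close>. Stochastic sewing yields the two bounds for the remainder of the integral. It
  is applied to coordinates, since it is a statement about real processes. \<open>V\<close> stands for a measurable
  version of the increment of \<open>J\<close>.\<close>

lemma rough_remainder:
  fixes Z :: "real => 'o => 'v::fin_dim_banach \<Rightarrow>\<^sub>L 'w::fin_dim_banach"
    and Z' :: "real => 'o => 'v \<Rightarrow>\<^sub>L 'v \<Rightarrow>\<^sub>L 'w"
    and X :: "real => 'v" and c CX \<alpha> \<beta> \<beta>' :: real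
  assumes X: "\<And>s t. 0 \<le> s ==> s < t ==> t \<le> T ==> norm (X t - X s) \<le> CX * (t - s) powr \<alpha>"
      "\<And>s t. 0 \<le> s ==> s < t ==> t \<le> T ==> norm (XX s t) \<le> CX * (t - s) powr (2 * \<alpha>)"
      "\<And>s u t. 0 \<le> s ==> s \<le> u ==> u \<le> t ==> t \<le> T ==> XX s t - XX s u - XX u t = (X u - X s) \<otimes> (X t - X u)"
      "0 < CX"
    and exps: "0 < \<beta>'" "\<beta>' \<le> \<beta>" "\<beta> \<le> \<alpha>" "1 / 2 < \<alpha> + \<beta>" "1 < \<alpha> + \<beta> + \<beta>'"
    and ad: "\<And>t. t \<in> {0..T} ==> Z t \<in> borel_measurable (F t)" "\<And>t. t \<in> {0..T} ==> Z' t \<in> borel_measurable (F t)"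
    and c: "0 < c"
    and Z: "\<And>t. t \<in> {0..T} ==> sq_int M (Z t)" "\<And>t. t \<in> {0..T} ==> sq_int M (Z' t) \<and> l2 M (Z' t) \<le> c"
      "\<And>s t. 0 \<le> s ==> s < t ==> t \<le> T ==> l2 M (\<lambda>w. Z t w - Z s w) \<le> c * (t - s) powr \<beta>"
      "\<And>s t. 0 \<le> s ==> s < t ==> t \<le> T ==>
        has_cond_exp M (F s) (\<lambda>w. Z t w - Z s w - Z' s w (X t - X s)) (R s t) \<and>
        sq_int M (R s t) \<and> l2 M (R s t) \<le> c * (t - s) powr (\<beta> + \<beta>')"
      "\<And>s t. 0 \<le> s ==> s < t ==> t \<le> T ==> has_cond_exp M (F s) (\<lambda>w. Z' t w - Z' s w) (D s t) \<and>
        sq_int M (D s t) \<and> l2 M (D s t) \<le> c * (t - s) powr \<beta>'"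
    and J: "has_stoch_rough_integral M T X XX Z Z' J"
  obtains C where "C > 0" "\<And>s t V. 0 \<le> s ==> s < t ==> t \<le> T ==> V \<in> borel_measurable M ==>
      AE w in M. J t w - J s w = V w ==>
      sq_int M (\<lambda>w. V w - (Z s w (X t - X s) + tensor_lift (Z' s w) (XX s t))) \<and>
      l2 M (\<lambda>w. V w - (Z s w (X t - X s) + tensor_lift (Z' s w) (XX s t))) \<le> C * (t - s) powr (\<alpha> + \<beta>)"
    "\<And>s t V \<Lambda> K. 0 \<le> s ==> s < t ==> t \<le> T ==> V \<in> borel_measurable M ==>
      AE w in M. J t w - J s w = V w ==> \<Lambda> \<in> borel_measurable (F s) ==> (\<And>w. norm (\<Lambda> w :: 'w \<Rightarrow>\<^sub>L real) \<le> K) ==>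
      \<bar>\<integral>w. \<Lambda> w (V w - (Z s w (X t - X s) + tensor_lift (Z' s w) (XX s t))) \<partial>M\<bar>
        \<le> K * (C * (t - s) powr (\<alpha> + \<beta> + \<beta>'))"
proof -
  obtain Bs :: "'w set" and co :: "'w => ('w \<Rightarrow>\<^sub>L real)" where fB: "finite Bs"
    and coord: "\<And>x. x = (\<Sum>b\<in>Bs. co b x *\<^sub>R b)"
    using finite_coordinates by blast
  obtain KT where KT: "0 < KT" "\<And>(K :: 'v \<Rightarrow>\<^sub>L 'v \<Rightarrow>\<^sub>L 'w) A. norm (tensor_lift K A) \<le> norm K * norm A * KT"
    using bounded_bilinear.pos_bounded[OF bounded_bilinear_tensor_lift] by blast
  define \<kappa> \<theta> where "\<kappa> = \<alpha> + \<beta>" and "\<theta> = \<alpha> + \<beta> + \<beta>'"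
  have \<kappa>\<theta>: "1 / 2 < \<kappa>" "1 < \<theta>" "\<kappa> \<le> \<theta>" using exps by (auto simp: \<kappa>_def \<theta>_def)
  define Av where "Av s t w = Z s w (X t - X s) + tensor_lift (Z' s w) (XX s t)" for s t w
  define mid where "mid s t = (s + t) / 2" for s t :: real
  define Dv where "Dv s t w =
      (Z (mid s t) w - Z s w - Z' s w (X (mid s t) - X s)) (X t - X (mid s t))
      + tensor_lift (Z' (mid s t) w - Z' s w) (XX (mid s t) t)" for s t w
  define gv where "gv s t w = R s (mid s t) w (X t - X (mid s t))
      + tensor_lift (D s (mid s t) w) (XX (mid s t) t)" for s t w
  have midr: "0 \<le> s" "s < mid s t" "mid s t < t" "mid s t \<le> T" "mid s t \<in> {0..T}" "s \<in> {0..T}" "t \<in> {0..T}"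
    "mid s t - s = (t - s) / 2" "t - mid s t = (t - s) / 2"
    if "0 \<le> s" "s < t" "t \<le> T" for s t using that by (auto simp: mid_def field_simps)
  have half: "((t - s) / 2) powr p \<le> (t - s) powr p" if "s < t" "0 \<le> p" for s t p :: real
    using that by (intro powr_mono2) auto
  have dZ: "sq_int M (\<lambda>w. Z u w - Z s w - Z' s w (X u - X s))"
    "sq_int M (\<lambda>w. Z' u w - Z' s w)" if "u \<in> {0..T}" "s \<in> {0..T}" for u s
    using that Z(1,2) by (auto intro!: sq_int_diff(1) sq_int_blinfun_at(1)[of M _ c])
  define e1 e2 where "e1 = T powr (\<alpha> - \<beta>)" and "e2 = c * CX"
  have e12: "0 \<le> e1" "0 < e2" using c X(4) by (auto simp: e1_def e2_def)
  have Xh: "norm (X t - X (mid s t)) \<le> CX * (t - s) powr \<alpha>" "norm (XX (mid s t) t) \<le> CX * (t - s) powr (2 * \<alpha>)"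
    "norm (X (mid s t) - X s) \<le> CX * (t - s) powr \<alpha>" if st: "0 \<le> s" "s < t" "t \<le> T" for s t
  proof -
    note m = midr[OF st]
    have a: "0 \<le> \<alpha>" using exps by linarith
    have h: "CX * ((t - s) / 2) powr p \<le> CX * (t - s) powr p" if "0 \<le> p" for p
      using half[OF st(2) that] X(4) by (intro mult_left_mono) auto
    have "0 \<le> mid s t" using m by linarith
    then show "norm (X t - X (mid s t)) \<le> CX * (t - s) powr \<alpha>" "norm (XX (mid s t) t) \<le> CX * (t - s) powr (2 * \<alpha>)"
      using X(1)[of "mid s t" t] X(2)[of "mid s t" t] m st h[of \<alpha>] h[of "2 * \<alpha>"] a by auto
    show "norm (X (mid s t) - X s) \<le> CX * (t - s) powr \<alpha>"
      using X(1)[of s "mid s t"] m st h[of \<alpha>] a by auto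
  qed
  have Dv_bound: "sq_int M (Dv s t)" "l2 M (Dv s t) \<le> (e2 + e2 * CX * e1 + 2 * e2 * KT * e1) * (t - s) powr \<kappa>"
    if st: "0 \<le> s" "s < t" "t \<le> T" for s t
  proof -
    note m = midr[OF st] and xh = Xh[OF st]
    let ?h = "t - s"
    have h: "0 < ?h" "?h \<le> T" using st by auto
    let ?P = "\<lambda>w. (Z (mid s t) w - Z s w) (X t - X (mid s t))"
    let ?Q = "\<lambda>w. Z' s w (X (mid s t) - X s) (X t - X (mid s t))"
    let ?U = "\<lambda>w. tensor_lift (Z' (mid s t) w - Z' s w) (XX (mid s t) t)"
    have eq: "Dv s t = (\<lambda>w. ?P w - ?Q w + ?U w)" by (auto simp: Dv_def blinfun.diff_left)
    have x0: "0 \<le> CX * ?h powr p" for p using X(4) by simp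
    have "l2 M (\<lambda>w. Z (mid s t) w - Z s w) \<le> c * (?h / 2) powr \<beta>" using Z(3)[of s "mid s t"] m by simp
    also have "\<dots> \<le> c * ?h powr \<beta>" using half[OF st(2), of \<beta>] exps c by (intro mult_left_mono) auto
    finally have z: "l2 M (\<lambda>w. Z (mid s t) w - Z s w) \<le> c * ?h powr \<beta>" .
    have zs: "sq_int M (\<lambda>w. Z (mid s t) w - Z s w)" using m Z(1) by (intro sq_int_diff(1)) auto
    note P = sq_int_blinfun_at[OF zs z xh(1) x0]
    have z's: "sq_int M (Z' s)" "l2 M (Z' s) \<le> c" using Z(2)[of s] m by auto
    note Q1 = sq_int_blinfun_at[OF z's xh(3) x0]
    note Q = sq_int_blinfun_at[OF Q1 xh(1) x0]
    have z'm: "sq_int M (Z' (mid s t))" "l2 M (Z' (mid s t)) \<le> c" using Z(2)[of "mid s t"] m by auto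
    have u: "sq_int M (\<lambda>w. Z' (mid s t) w - Z' s w)" "l2 M (\<lambda>w. Z' (mid s t) w - Z' s w) \<le> 2 * c"
      using sq_int_diff[OF z'm(1) z's(1)] z'm(2) z's(2) by auto
    note U = sq_int_tensor_lift_at[OF KT(2) less_imp_le[OF KT(1)] u xh(2) x0]
    note PQ = sq_int_diff[OF P(1) Q(1)]
    note tot = sq_int_add[OF PQ(1) U(1)]
    show "sq_int M (Dv s t)" unfolding eq by (rule tot(1))
    have "l2 M (Dv s t) \<le> c * ?h powr \<beta> * (CX * ?h powr \<alpha>) + c * (CX * ?h powr \<alpha>) * (CX * ?h powr \<alpha>)
        + 2 * c * (CX * ?h powr (2 * \<alpha>)) * KT"
      unfolding eq using tot(2) PQ(2) P(2) Q(2) U(2) by linarith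
    also have "\<dots> = e2 * ?h powr \<kappa> + e2 * CX * ?h powr (2 * \<alpha>) + 2 * e2 * KT * ?h powr (2 * \<alpha>)"
    proof -
      have "?h powr \<beta> * ?h powr \<alpha> = ?h powr \<kappa>" "?h powr \<alpha> * ?h powr \<alpha> = ?h powr (2 * \<alpha>)"
        by (simp_all add: \<kappa>_def powr_add[symmetric] add.commute)
      then show ?thesis by (simp add: e2_def mult_ac)
    qed
    also have "\<dots> \<le> e2 * ?h powr \<kappa> + e2 * CX * (e1 * ?h powr \<kappa>) + 2 * e2 * KT * (e1 * ?h powr \<kappa>)"
    proof -
      have "?h powr (2 * \<alpha>) \<le> e1 * ?h powr \<kappa>"
        using powr_le_scale[OF h, of \<kappa> "2 * \<alpha>"] exps by (simp add: \<kappa>_def e1_def)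
      then show ?thesis using e12 X(4) KT(1) by (intro add_mono mult_left_mono) auto
    qed
    also have "\<dots> = (e2 + e2 * CX * e1 + 2 * e2 * KT * e1) * ?h powr \<kappa>" by (simp add: algebra_simps)
    finally show "l2 M (Dv s t) \<le> (e2 + e2 * CX * e1 + 2 * e2 * KT * e1) * ?h powr \<kappa>" .
  qed
  have gv_bound: "sq_int M (gv s t)" "l2 M (gv s t) \<le> (e2 + e2 * KT * e1) * (t - s) powr \<theta>"
    if st: "0 \<le> s" "s < t" "t \<le> T" for s t
  proof -
    note m = midr[OF st] and xh = Xh[OF st]
    let ?h = "t - s"
    have h: "0 < ?h" "?h \<le> T" using st by auto
    have x0: "0 \<le> CX * ?h powr p" for p using X(4) by simp
    have hh: "c * (?h / 2) powr p \<le> c * ?h powr p" if "0 \<le> p" for p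
      using half[OF st(2) that] c by (intro mult_left_mono) auto
    have r: "sq_int M (R s (mid s t))" "l2 M (R s (mid s t)) \<le> c * ?h powr (\<beta> + \<beta>')"
      using Z(4)[OF m(1,2,4)] m hh[of "\<beta> + \<beta>'"] exps by auto
    have d: "sq_int M (D s (mid s t))" "l2 M (D s (mid s t)) \<le> c * ?h powr \<beta>'"
      using Z(5)[OF m(1,2,4)] m hh[of \<beta>'] exps by auto
    note P = sq_int_blinfun_at[OF r xh(1) x0]
    note U = sq_int_tensor_lift_at[OF KT(2) less_imp_le[OF KT(1)] d xh(2) x0]
    note tot = sq_int_add[OF P(1) U(1)]
    show "sq_int M (gv s t)" unfolding gv_def[abs_def] by (rule tot(1))
    have "l2 M (gv s t) \<le> c * ?h powr (\<beta> + \<beta>') * (CX * ?h powr \<alpha>) + c * ?h powr \<beta>' * (CX * ?h powr (2 * \<alpha>)) * KT"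
      unfolding gv_def[abs_def] using tot(2) P(2) U(2) by linarith
    also have "\<dots> = e2 * ?h powr \<theta> + e2 * KT * ?h powr (2 * \<alpha> + \<beta>')"
    proof -
      have "?h powr (\<beta> + \<beta>') * ?h powr \<alpha> = ?h powr \<theta>" "?h powr \<beta>' * ?h powr (2 * \<alpha>) = ?h powr (2 * \<alpha> + \<beta>')"
        by (simp_all add: \<theta>_def powr_add[symmetric] add_ac)
      then show ?thesis by (simp add: e2_def mult_ac)
    qed
    also have "\<dots> \<le> e2 * ?h powr \<theta> + e2 * KT * (e1 * ?h powr \<theta>)"
    proof -
      have "?h powr (2 * \<alpha> + \<beta>') \<le> e1 * ?h powr \<theta>"
        using powr_le_scale[OF h, of \<theta> "2 * \<alpha> + \<beta>'"] exps by (simp add: \<theta>_def e1_def)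
      then show ?thesis using e12 KT(1) by (intro add_mono mult_left_mono) auto
    qed
    also have "\<dots> = (e2 + e2 * KT * e1) * ?h powr \<theta>" by (simp add: algebra_simps)
    finally show "l2 M (gv s t) \<le> (e2 + e2 * KT * e1) * ?h powr \<theta>" .
  qed
  have Av_sq: "sq_int M (Av s t)" if "0 \<le> s" "s < t" "t \<le> T" for s t
  proof -
    have s: "s \<in> {0..T}" using that by auto
    have "sq_int M (\<lambda>w. Z s w (X t - X s))"
      by (rule sq_int_blinfun_at(1)[OF Z(1)[OF s] order_refl order_refl norm_ge_zero])
    moreover have "sq_int M (\<lambda>w. tensor_lift (Z' s w) (XX s t))"
      using Z(2)[OF s] by (intro sq_int_tensor_lift_at(1)[OF KT(2) less_imp_le[OF KT(1)] _ _ order_refl norm_ge_zero]) auto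
    ultimately show ?thesis unfolding Av_def[abs_def] by (rule sq_int_add(1))
  qed
  have Av_defect: "Dv s t w = Av s (mid s t) w + Av (mid s t) t w - Av s t w" if st: "0 \<le> s" "s < t" "t \<le> T" for s t w
  proof -
    note m = midr[OF st]
    have chen: "XX s t = XX s (mid s t) + XX (mid s t) t + (X (mid s t) - X s) \<otimes> (X t - X (mid s t))"
      using X(3)[of s "mid s t" t] m st by (simp add: algebra_simps)
    have inc: "X t - X s = (X (mid s t) - X s) + (X t - X (mid s t))" by simp
    show ?thesis unfolding Dv_def Av_def chen inc
      by (simp only: tensor_lift.add_right tensor_lift.diff_left tensor_lift_tensor blinfun.add_right blinfun.diff_left) simp
  qed
  have Dv_meas: "Dv s t \<in> borel_measurable (F t)" if st: "0 \<le> s" "s < t" "t \<le> T" for s t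
  proof -
    note m = midr[OF st]
    have m0: "0 \<le> mid s t" using m by linarith
    have [measurable]: "Z (mid s t) \<in> borel_measurable (F t)" "Z s \<in> borel_measurable (F t)"
      "Z' (mid s t) \<in> borel_measurable (F t)" "Z' s \<in> borel_measurable (F t)"
      using measurable_mono[of "mid s t" t] measurable_mono[of s t] ad[of "mid s t"] ad[of s] m m0 st by auto
    have "(\<lambda>w. tensor_lift (Z' (mid s t) w - Z' s w) (XX (mid s t) t)) \<in> borel_measurable (F t)"
      by (rule borel_measurable_bounded_linear[OF tensor_lift.bounded_linear_left]) measurable
    then show ?thesis unfolding Dv_def[abs_def] by measurable
  qed
  have ce: "has_cond_exp M (F s) (Dv s t) (gv s t)" if st: "0 \<le> s" "s < t" "t \<le> T" for s t
  proof -
    note m = midr[OF st]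
    have s: "subalgebra M (F s)" using sub m by auto
    have r: "has_cond_exp M (F s) (\<lambda>w. Z (mid s t) w - Z s w - Z' s w (X (mid s t) - X s)) (R s (mid s t))"
      using Z(4)[OF m(1,2,4)] by blast
    have d: "has_cond_exp M (F s) (\<lambda>w. Z' (mid s t) w - Z' s w) (D s (mid s t))" using Z(5)[OF m(1,2,4)] by blast
    show ?thesis unfolding Dv_def[abs_def] gv_def[abs_def]
      by (rule has_cond_exp_add[OF has_cond_exp_bounded_linear[OF blinfun.bounded_linear_left r s]
            has_cond_exp_bounded_linear[OF tensor_lift.bounded_linear_left d s] s])
  qed
  \<comment> \<open>the functionals \<open>l\<close> used below are the coordinates of the state space\<close>
  define a0 c0 where "a0 = e2 + e2 * CX * e1 + 2 * e2 * KT * e1" and "c0 = e2 + e2 * KT * e1"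
  have ac0: "0 \<le> a0" "0 \<le> c0" using e12 X(4) KT(1) by (auto simp: a0_def c0_def intro!: add_nonneg_nonneg mult_nonneg_nonneg)
  define C1 C2 where "C1 = 1 / (1 - (2::real) powr (1 / 2 - \<kappa>))" and "C2 = 1 / (1 - (2::real) powr (1 - \<theta>))"
  have C12: "0 \<le> C1" "0 \<le> C2"
    using \<kappa>\<theta> powr_less_mono[of "1/2 - \<kappa>" 0 "2::real"] powr_less_mono[of "1 - \<theta>" 0 "2::real"] by (auto simp: C1_def C2_def)
  define S where "S s t k w = (\<Sum>i<2 ^ k. Av (s + real i * (t - s) / 2 ^ k) (s + real (Suc i) * (t - s) / 2 ^ k) w)" for s t and k :: nat and w
  have prob: "tends_in_prob M (S s t) V"
    if st: "0 \<le> s" "s < t" "t \<le> T" and V: "AE w in M. J t w - J s w = V w" for s t V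
  proof -
    let ?P = "dyadic_partition T s t"
    have ucp: "ucp_tendsto M T (\<lambda>P t w. rough_sum X XX (\<lambda>s. Z s w) (\<lambda>s. Z' s w) P t) J (mesh_to_zero T)"
      using J unfolding has_stoch_rough_integral_def by blast
    have fl: "filterlim ?P (mesh_to_zero T) sequentially"
    proof (rule filterlim_mesh_to_zero[where m="\<lambda>k. T / 2 ^ k"])
      show "(\<lambda>k. T / 2 ^ k) \<longlonglongrightarrow> 0"
        using tendsto_mult_right_zero[OF LIMSEQ_power_zero[of "1/2::real"], of T] by (simp add: power_divide)
    qed (use dyadic_partition[OF st] in auto)
    have pt: "tends_in_prob M (\<lambda>k w. rough_sum X XX (\<lambda>s. Z s w) (\<lambda>s. Z' s w) (?P k) x) (J x)" if "x \<in> {0..T}" for x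
      using ucp_tendsto_imp_tends_in_prob[OF ucp fl that] .
    have "tends_in_prob M (\<lambda>k w. rough_sum X XX (\<lambda>s. Z s w) (\<lambda>s. Z' s w) (?P k) t
        + - rough_sum X XX (\<lambda>s. Z s w) (\<lambda>s. Z' s w) (?P k) s) (\<lambda>w. J t w + - J s w)"
      by (rule tends_in_prob_add[OF pt tends_in_prob_bounded_linear[OF pt bounded_linear_minus[OF bounded_linear_ident]]])
        (use st in auto)
    moreover have "rough_sum X XX (\<lambda>s. Z s w) (\<lambda>s. Z' s w) (?P k) t
        + - rough_sum X XX (\<lambda>s. Z s w) (\<lambda>s. Z' s w) (?P k) s = S s t k w" for k w
      using dyadic_sum_difference[OF st, of "\<lambda>u v. Av u v w" k] by (simp add: rough_sum_def S_def Av_def)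
    ultimately have "tends_in_prob M (\<lambda>k w. S s t k w) (\<lambda>w. J t w - J s w)" by simp
    then show ?thesis using V by (rule tends_in_prob_AE_cong)
  qed
  have scalar: "sq_int M (\<lambda>w. l (V w - Av s t w))"
    "l2 M (\<lambda>w. l (V w - Av s t w)) \<le> norm l * (a0 * C1 * (t - s) powr \<kappa> + c0 * C2 * (t - s) powr \<theta>)"
    "\<And>\<xi> K. \<xi> \<in> borel_measurable (F s) ==> (\<And>w. \<bar>\<xi> w\<bar> \<le> K) ==>
      \<bar>\<integral>w. \<xi> w * l (V w - Av s t w) \<partial>M\<bar> \<le> K * (norm l * c0 * C2 * (t - s) powr \<theta>)"
    if st: "0 \<le> s" "s < t" "t \<le> T" and V: "V \<in> borel_measurable M" "AE w in M. J t w - J s w = V w"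
    for s t V and l :: "'w \<Rightarrow>\<^sub>L real"
  proof -
    have bl: "bounded_linear (blinfun_apply l)" by (rule blinfun.bounded_linear_right)
    have nl: "norm (l x) \<le> norm l * norm x" for x by (rule norm_blinfun)
    note lin = sq_int_bounded_linear[OF bl nl norm_ge_zero]
    have Fs: "\<And>t. t \<in> {0..T} ==> subalgebra M (F t)" by (rule sub)
    have ml: "(\<lambda>w. l (f w)) \<in> borel_measurable M'" if "f \<in> borel_measurable M'" for f and M' :: "'o measure"
      by (rule borel_measurable_bounded_linear[OF bl that])
    have pr: "tends_in_prob M (\<lambda>k w. \<Sum>i<2 ^ k. l (Av (s + real i * (t - s) / 2 ^ k) (s + real (Suc i) * (t - s) / 2 ^ k) w))
        (\<lambda>w. l (V w))"
      using tends_in_prob_bounded_linear[OF prob[OF st V(2)] bl] by (simp add: S_def blinfun.sum_right)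
    note sew = stochastic_sewing_dyadic[where A="\<lambda>s t w. l (Av s t w)" and D="\<lambda>s t w. l (Dv s t w)"
        and g="\<lambda>s t w. l (gv s t w)" and F=F and T=T and \<kappa>=\<kappa> and \<theta>=\<theta> and a="norm l * a0" and c="norm l * c0"
        and Z="\<lambda>w. l (V w)" and s=s and t=t,
        OF sub mono \<kappa>\<theta>(1,2) mult_nonneg_nonneg[OF norm_ge_zero ac0(1)] mult_nonneg_nonneg[OF norm_ge_zero ac0(2)]
          lin(1)[OF Av_sq] _ ml[OF Dv_meas] _ has_cond_exp_bounded_linear[OF bl ce] lin(1)[OF gv_bound(1)] _ st ml[OF V(1)] pr]
    have h1: "l (Dv s t w) = l (Av s ((s + t) / 2) w) + l (Av ((s + t) / 2) t w) - l (Av s t w)"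
      if "0 \<le> s" "s < t" "t \<le> T" for s t w
      using Av_defect[OF that] by (simp add: mid_def blinfun.add_right blinfun.diff_right)
    have h2: "l2 M (\<lambda>w. l (Dv s t w)) \<le> norm l * a0 * (t - s) powr \<kappa>" if "0 \<le> s" "s < t" "t \<le> T" for s t
      using order_trans[OF lin(2)[OF Dv_bound(1)[OF that]] mult_left_mono[OF Dv_bound(2)[OF that] norm_ge_zero[of l]]]
      by (simp add: a0_def mult.assoc)
    have h3: "l2 M (\<lambda>w. l (gv s t w)) \<le> norm l * c0 * (t - s) powr \<theta>" if "0 \<le> s" "s < t" "t \<le> T" for s t
      using order_trans[OF lin(2)[OF gv_bound(1)[OF that]] mult_left_mono[OF gv_bound(2)[OF that] norm_ge_zero[of l]]]
      by (simp add: c0_def mult.assoc)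
    have sF: "subalgebra M (F s)" if "0 \<le> s" "s < t" "t \<le> T" for s t using that sub by auto
    have res: "sq_int M (\<lambda>w. l (V w) - l (Av s t w))"
      "l2 M (\<lambda>w. l (V w) - l (Av s t w))
        \<le> norm l * a0 / (1 - 2 powr (1 / 2 - \<kappa>)) * (t - s) powr \<kappa> + norm l * c0 / (1 - 2 powr (1 - \<theta>)) * (t - s) powr \<theta>"
      "\<And>\<xi> K. \<xi> \<in> borel_measurable (F s) ==> (\<And>w. \<bar>\<xi> w\<bar> \<le> K) ==>
        \<bar>\<integral>w. \<xi> w * (l (V w) - l (Av s t w)) \<partial>M\<bar>
        \<le> K * (norm l * c0 / (1 - 2 powr (1 - \<theta>)) * (t - s) powr \<theta>)"
      by (rule sew; (rule h1 h2 h3 sF; assumption)?; assumption?)+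
    show "sq_int M (\<lambda>w. l (V w - Av s t w))" using res(1) by (simp add: blinfun.diff_right)
    show "l2 M (\<lambda>w. l (V w - Av s t w)) \<le> norm l * (a0 * C1 * (t - s) powr \<kappa> + c0 * C2 * (t - s) powr \<theta>)"
      using res(2) by (simp add: blinfun.diff_right C1_def C2_def distrib_left mult.assoc)
    show "\<And>\<xi> K. \<xi> \<in> borel_measurable (F s) ==> (\<And>w. \<bar>\<xi> w\<bar> \<le> K) ==>
      \<bar>\<integral>w. \<xi> w * l (V w - Av s t w) \<partial>M\<bar> \<le> K * (norm l * c0 * C2 * (t - s) powr \<theta>)"
      using res(3) by (simp add: blinfun.diff_right C2_def mult.assoc)
  qed
  define C0 where "C0 = a0 * C1 + c0 * C2 * T powr (\<theta> - \<kappa>) + c0 * C2"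
  have C00: "0 \<le> C0" using ac0 C12 by (auto simp: C0_def intro!: add_nonneg_nonneg mult_nonneg_nonneg)
  define CB where "CB = (\<Sum>b\<in>Bs. norm (co b) * norm b)"
  have CB0: "0 \<le> CB" by (auto simp: CB_def intro!: sum_nonneg)
  define C where "C = C0 * CB + 1"
  have Cpos: "C > 0" using C00 CB0 by (simp add: C_def add_nonneg_pos)
  show thesis
  proof (rule that[OF Cpos])
    fix s t V assume st: "0 \<le> s" "s < t" "t \<le> T" and V: "V \<in> borel_measurable M" "AE w in M. J t w - J s w = V w"
    note sc = scalar[OF st V]
    let ?W = "\<lambda>w. V w - Av s t w"
    have ex: "?W = (\<lambda>w. \<Sum>b\<in>Bs. co b (?W w) *\<^sub>R b)" by (rule ext, rule coord)
    have one: "sq_int M (\<lambda>w. co b (?W w) *\<^sub>R b)"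
      "l2 M (\<lambda>w. co b (?W w) *\<^sub>R b) \<le> norm b * l2 M (\<lambda>w. co b (?W w))" for b
      using sq_int_bounded_linear[where K="norm b" and h="\<lambda>x. x *\<^sub>R b", OF bounded_linear_scaleR_left _ norm_ge_zero sc(1)]
      by (simp_all add: mult.commute)
    have sq: "sq_int M ?W" by (subst ex) (rule sq_int_sum(1)[OF one(1)])
    have "l2 M ?W \<le> (\<Sum>b\<in>Bs. l2 M (\<lambda>w. co b (?W w) *\<^sub>R b))"
      by (subst ex) (rule sq_int_sum(2)[OF one(1)])
    also have "\<dots> \<le> (\<Sum>b\<in>Bs. norm b * (norm (co b) * (a0 * C1 * (t - s) powr \<kappa> + c0 * C2 * (t - s) powr \<theta>)))"
      by (intro sum_mono order_trans[OF one(2)] mult_left_mono sc(2) norm_ge_zero)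
    also have "\<dots> = CB * (a0 * C1 * (t - s) powr \<kappa> + c0 * C2 * (t - s) powr \<theta>)"
      by (simp add: CB_def sum_distrib_right mult_ac)
    also have "\<dots> \<le> CB * (C0 * (t - s) powr \<kappa>)"
    proof (intro mult_left_mono CB0)
      have "c0 * C2 * (t - s) powr \<theta> \<le> c0 * C2 * (T powr (\<theta> - \<kappa>) * (t - s) powr \<kappa>)"
        using powr_le_scale[of "t - s" T \<kappa> \<theta>] st \<kappa>\<theta> ac0 C12 by (intro mult_left_mono) auto
      moreover have "0 \<le> c0 * C2 * (t - s) powr \<kappa>" using ac0 C12 by simp
      ultimately show "a0 * C1 * (t - s) powr \<kappa> + c0 * C2 * (t - s) powr \<theta> \<le> C0 * (t - s) powr \<kappa>"
        unfolding C0_def distrib_right by (simp add: mult.assoc)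
    qed
    also have "\<dots> \<le> C * (t - s) powr (\<alpha> + \<beta>)" by (simp add: C_def \<kappa>_def algebra_simps)
    finally show "sq_int M (\<lambda>w. V w - (Z s w (X t - X s) + tensor_lift (Z' s w) (XX s t))) \<and>
      l2 M (\<lambda>w. V w - (Z s w (X t - X s) + tensor_lift (Z' s w) (XX s t))) \<le> C * (t - s) powr (\<alpha> + \<beta>)"
      using sq by (simp add: Av_def)
  next
    fix s t V \<Lambda> K assume st: "0 \<le> s" "s < t" "t \<le> T" and V: "V \<in> borel_measurable M" "AE w in M. J t w - J s w = V w"
      and \<Lambda>: "\<Lambda> \<in> borel_measurable (F s)" "\<And>w. norm (\<Lambda> w :: 'w \<Rightarrow>\<^sub>L real) \<le> K"
    note sc = scalar[OF st V]
    have K: "0 \<le> K" using order_trans[OF norm_ge_zero \<Lambda>(2)] .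
    let ?W = "\<lambda>w. V w - Av s t w"
    have ex: "\<Lambda> w (?W w) = (\<Sum>b\<in>Bs. \<Lambda> w b * co b (?W w))" for w
      by (subst coord[of "?W w"]) (simp add: blinfun.sum_right blinfun.scaleR_right mult.commute)
    have \<Lambda>b: "\<bar>\<Lambda> w b\<bar> \<le> K * norm b" for b w
      using order_trans[OF norm_blinfun mult_right_mono[OF \<Lambda>(2) norm_ge_zero]] by simp
    have \<Lambda>m: "(\<lambda>w. \<Lambda> w b) \<in> borel_measurable (F s)" for b using \<Lambda>(1) by measurable
    have \<Lambda>mM: "(\<lambda>w. \<Lambda> w b) \<in> borel_measurable M" for b
      using \<Lambda>m st by (intro measurable_F_M[of s]) auto
    have I: "integrable M (\<lambda>w. \<Lambda> w b * co b (?W w))" for b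
      by (rule sq_int_integrable(1)[OF sq_int_bounded_mult(1)[OF sc(1) \<Lambda>mM AE_I2[OF \<Lambda>b]]])
    have "(\<integral>w. \<Lambda> w (?W w) \<partial>M) = (\<integral>w. (\<Sum>b\<in>Bs. \<Lambda> w b * co b (?W w)) \<partial>M)"
      by (intro Bochner_Integration.integral_cong refl ex)
    also have "\<dots> = (\<Sum>b\<in>Bs. \<integral>w. \<Lambda> w b * co b (?W w) \<partial>M)"
      by (intro Bochner_Integration.integral_sum I)
    finally have eq: "(\<integral>w. \<Lambda> w (?W w) \<partial>M) = (\<Sum>b\<in>Bs. \<integral>w. \<Lambda> w b * co b (?W w) \<partial>M)" .
    have "\<bar>\<integral>w. \<Lambda> w (?W w) \<partial>M\<bar> \<le> (\<Sum>b\<in>Bs. (K * norm b) * (norm (co b) * c0 * C2 * (t - s) powr \<theta>))"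
      unfolding eq by (intro order_trans[OF sum_abs] sum_mono sc(3) \<Lambda>m \<Lambda>b)
    also have "\<dots> = K * (CB * (c0 * C2) * (t - s) powr \<theta>)"
      by (simp add: CB_def sum_distrib_left sum_distrib_right mult_ac)
    also have "\<dots> \<le> K * (C * (t - s) powr \<theta>)"
    proof (intro mult_left_mono mult_right_mono K)
      have "c0 * C2 \<le> C0" using ac0 C12 by (auto simp: C0_def)
      then have "CB * (c0 * C2) \<le> CB * C0" using CB0 by (rule mult_left_mono)
      then show "CB * (c0 * C2) \<le> C" by (simp add: C_def mult.commute)
    qed simp
    finally show "\<bar>\<integral>w. \<Lambda> w (V w - (Z s w (X t - X s) + tensor_lift (Z' s w) (XX s t))) \<partial>M\<bar>
        \<le> K * (C * (t - s) powr (\<alpha> + \<beta> + \<beta>'))"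
      by (simp add: Av_def \<theta>_def)
  qed
qed

end


section \<open>Expectations of time integrals and of Ito increments\<close>

context filtered_space
begin

lemma fubini_bounded:
  fixes f :: "real => 'o => real"
  assumes f: "(\<lambda>x. f (clamp (snd x)) (fst x)) \<in> borel_measurable (M \<Otimes>\<^sub>M borel)"
    and C: "\<And>r w. r \<in> {0..T} ==> w \<in> space M ==> \<bar>f r w\<bar> \<le> C" "0 \<le> C"
    and st: "0 \<le> s" "s \<le> t" "t \<le> T"
  shows "\<And>w. w \<in> space M ==> set_integrable lborel {s..t} (\<lambda>r. f r w)"
    and "integrable M (\<lambda>w. LINT r:{s..t}|lborel. f r w)"
    and "set_integrable lborel {s..t} (\<lambda>r. \<integral>w. f r w \<partial>M)"
    and "(\<integral>w. (LINT r:{s..t}|lborel. f r w) \<partial>M) = (LINT r:{s..t}|lborel. (\<integral>w. f r w \<partial>M))"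
proof -
  define g where "g w r = indicator {s..t} r *\<^sub>R f (clamp r) w" for w and r :: real
  have eq: "g w r = indicator {s..t} r *\<^sub>R f r w" for w r
    using st clamp_eq[of r] by (auto simp: g_def indicator_def)
  note [measurable] = f
  have gm: "(\<lambda>x. g (fst x) (snd x)) \<in> borel_measurable (M \<Otimes>\<^sub>M lborel)"
    unfolding g_def by measurable
  have gb: "\<bar>g w r\<bar> \<le> indicator {s..t} r * C" if "w \<in> space M" for w r
    using C(1)[OF clamp_in[of r] that] C(2) by (auto simp: g_def indicator_def)
  interpret P: pair_sigma_finite M lborel ..
  have "integrable (M \<Otimes>\<^sub>M lborel) (\<lambda>x. indicator (space M \<times> {s..t}) x * C)"
  proof (intro integrable_mult_left integrable_real_indicator)
    show "emeasure (M \<Otimes>\<^sub>M lborel) (space M \<times> {s..t}) < \<infinity>"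
      using st by (simp add: lborel.emeasure_pair_measure_Times emeasure_space_1)
  qed auto
  then have gI: "integrable (M \<Otimes>\<^sub>M lborel) (\<lambda>x. g (fst x) (snd x))"
  proof (rule Bochner_Integration.integrable_bound[OF _ gm])
    show "AE x in M \<Otimes>\<^sub>M lborel. norm (g (fst x) (snd x)) \<le> norm (indicator (space M \<times> {s..t}) x * C)"
    proof (rule AE_I2)
      fix x :: "'o \<times> real" assume "x \<in> space (M \<Otimes>\<^sub>M lborel)"
      then have x: "fst x \<in> space M" by (auto simp: space_pair_measure)
      have "indicator (space M \<times> {s..t}) x = (indicator {s..t} (snd x) :: real)"
        using x by (cases x) (auto simp: indicator_def)
      then show "norm (g (fst x) (snd x)) \<le> norm (indicator (space M \<times> {s..t}) x * C)"
        using gb[OF x, of "snd x"] C(2) by (simp add: abs_mult)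
    qed
  qed
  then have gI': "integrable (M \<Otimes>\<^sub>M lborel) (case_prod g)" by (simp add: case_prod_unfold)
  show "set_integrable lborel {s..t} (\<lambda>r. f r w)" if w: "w \<in> space M" for w
    unfolding set_integrable_def eq[symmetric]
  proof (rule Bochner_Integration.integrable_bound)
    show "integrable lborel (\<lambda>r. indicator {s..t} r * C)" using st by simp
    show "g w \<in> borel_measurable lborel"
      using measurable_compose[OF measurable_Pair1'[OF w] gm] by simp
    show "AE r in lborel. norm (g w r) \<le> norm (indicator {s..t} r * C)"
      using gb[OF w] C(2) by (intro AE_I2) (simp add: abs_mult)
  qed
  show "integrable M (\<lambda>w. LINT r:{s..t}|lborel. f r w)"
    using P.integrable_fst[OF gI'] unfolding set_lebesgue_integral_def eq .
  show "set_integrable lborel {s..t} (\<lambda>r. \<integral>w. f r w \<partial>M)"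
    using P.integrable_snd[OF gI'] unfolding set_integrable_def eq by simp
  show "(\<integral>w. (LINT r:{s..t}|lborel. f r w) \<partial>M) = (LINT r:{s..t}|lborel. (\<integral>w. f r w \<partial>M))"
    using P.Fubini_integral[OF gI'] unfolding set_lebesgue_integral_def eq by simp
qed

text \<open>A continuous process is the limit of its values at dyadic times, which gives joint
  measurability only up to null sets; this is enough after taking expectations.\<close>

lemma measurable_expectation:
  fixes Y :: "real => 'o => 'w::fin_dim_banach" and G :: "'w => 'a::fin_dim_banach \<Rightarrow>\<^sub>L real" and u :: "real => 'o => 'a"
  assumes Y: "\<And>t. t \<in> {0..T} ==> Y t \<in> borel_measurable M" "continuous_process M T Y"
    and G: "continuous_on UNIV G" "\<And>y. norm (G y) \<le> CG"
    and u: "(\<lambda>x. u (clamp (snd x)) (fst x)) \<in> borel_measurable (M \<Otimes>\<^sub>M borel)"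
      "\<And>r w. r \<in> {0..T} ==> w \<in> space M ==> norm (u r w) \<le> Cu"
  shows "(\<lambda>r. \<integral>w. G (Y (clamp r) w) (u (clamp r) w) \<partial>M) \<in> borel_measurable borel"
proof -
  define d where "d k r = clamp (real_of_int \<lfloor>r * 2 ^ k\<rfloor> / 2 ^ k)" for k :: nat and r :: real
  define Yk where "Yk k w r = Y (d k r) w" for k w and r :: real
  have Ykm[measurable]: "(\<lambda>x. Yk k (fst x) (snd x)) \<in> borel_measurable (M \<Otimes>\<^sub>M borel)" for k
  proof -
    have 1: "(\<lambda>x. Y (clamp (real_of_int i / 2 ^ k)) (fst x)) \<in> borel_measurable (M \<Otimes>\<^sub>M borel)" for i :: int
      using Y(1)[OF clamp_in] by measurable
    have 2: "(\<lambda>x. \<lfloor>(snd x :: real) * 2 ^ k\<rfloor>) \<in> measurable (M \<Otimes>\<^sub>M borel) (count_space UNIV)"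
      by measurable
    from measurable_compose_countable[OF 1 2] show ?thesis by (simp add: Yk_def d_def)
  qed
  note [measurable] = u(1) borel_measurable_continuous_onI[OF G(1)]
  have CG: "0 \<le> CG" using order_trans[OF norm_ge_zero G(2)] .
  have Cu: "0 \<le> Cu" using u(2)[of 0] T_pos not_empty order_trans[OF norm_ge_zero] by fastforce
  have bd: "norm (G y (u (clamp r) w)) \<le> CG * Cu" if "w \<in> space M" for y r w
    by (rule order_trans[OF norm_blinfun mult_mono[OF G(2) u(2)[OF clamp_in that] CG norm_ge_zero]])
  have m: "(\<lambda>r. \<integral>w. G (Yk k w r) (u (clamp r) w) \<partial>M) \<in> borel_measurable borel" for k
  proof (rule borel_measurable_lebesgue_integral)
    have "(\<lambda>x. G (Yk k (fst x) (snd x)) (u (clamp (snd x)) (fst x))) \<in> borel_measurable (M \<Otimes>\<^sub>M borel)"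
      by measurable
    from measurable_compose[OF measurable_pair_swap' this]
    show "case_prod (\<lambda>r w. G (Yk k w r) (u (clamp r) w)) \<in> borel_measurable (borel \<Otimes>\<^sub>M M)"
      by (simp add: case_prod_unfold)
  qed
  show ?thesis
  proof (rule borel_measurable_LIMSEQ_real[OF _ m])
    fix r :: real
    have um: "u (clamp r) \<in> borel_measurable M"
      using measurable_compose[OF measurable_Pair2'[of r borel M] u(1)] by simp
    note [measurable] = um Y(1)[OF clamp_in]
    have Ykm': "(\<lambda>w. Yk k w r) \<in> borel_measurable M" for k
      unfolding Yk_def d_def by measurable
    note [measurable] = Ykm'
    have dlim: "(\<lambda>k. d k r) \<longlonglongrightarrow> clamp r"
    proof -
      have fl: "(\<lambda>k. real_of_int \<lfloor>r * 2 ^ k\<rfloor> / 2 ^ k) \<longlonglongrightarrow> r"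
      proof -
        have b: "norm (real_of_int \<lfloor>r * 2 ^ k\<rfloor> / 2 ^ k - r) \<le> (1 / 2) ^ k" for k :: nat
        proof -
          have "\<bar>real_of_int \<lfloor>r * 2 ^ k\<rfloor> - r * 2 ^ k\<bar> \<le> 1" by linarith
          then have "\<bar>real_of_int \<lfloor>r * 2 ^ k\<rfloor> - r * 2 ^ k\<bar> / 2 ^ k \<le> 1 / 2 ^ k" by (intro divide_right_mono) auto
          moreover have "real_of_int \<lfloor>r * 2 ^ k\<rfloor> / 2 ^ k - r = (real_of_int \<lfloor>r * 2 ^ k\<rfloor> - r * 2 ^ k) / 2 ^ k"
            by (simp add: field_simps)
          then have "\<bar>real_of_int \<lfloor>r * 2 ^ k\<rfloor> / 2 ^ k - r\<bar> = \<bar>real_of_int \<lfloor>r * 2 ^ k\<rfloor> - r * 2 ^ k\<bar> / 2 ^ k"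
            by (simp only: abs_divide) simp
          ultimately show ?thesis by (simp add: power_divide)
        qed
        have "(\<lambda>k. (1 / 2 :: real) ^ k) \<longlonglongrightarrow> 0" by (intro LIMSEQ_power_zero) auto
        then have "(\<lambda>k. real_of_int \<lfloor>r * 2 ^ k\<rfloor> / 2 ^ k - r) \<longlonglongrightarrow> 0"
          by (rule Lim_null_comparison[OF always_eventually[OF allI[OF b]]])
        then show ?thesis by (simp add: LIM_zero_iff)
      qed
      then show ?thesis unfolding d_def clamp_def by (intro tendsto_max tendsto_min tendsto_const)
    qed
    show "(\<lambda>k. \<integral>w. G (Yk k w r) (u (clamp r) w) \<partial>M)
      \<longlonglongrightarrow> (\<integral>w. G (Y (clamp r) w) (u (clamp r) w) \<partial>M)"
    proof (rule integral_dominated_convergence[where w="\<lambda>_. CG * Cu"])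
      show "AE w in M. (\<lambda>k. G (Yk k w r) (u (clamp r) w)) \<longlonglongrightarrow> G (Y (clamp r) w) (u (clamp r) w)"
        using Y(2) unfolding continuous_process_def
      proof eventually_elim
        case (elim w)
        have "(\<lambda>k. Y (d k r) w) \<longlonglongrightarrow> Y (clamp r) w"
          using continuous_on_tendsto_compose[OF elim dlim clamp_in] clamp_in by (simp add: d_def)
        then have "(\<lambda>k. G (Y (d k r) w)) \<longlonglongrightarrow> G (Y (clamp r) w)"
          by (rule continuous_on_tendsto_compose[OF G(1)]) auto
        then show ?case unfolding Yk_def by (intro blinfun.tendsto tendsto_const)
      qed
      show "AE w in M. norm (G (Yk k w r) (u (clamp r) w)) \<le> CG * Cu" for k
        using bd by (intro AE_I2)
    qed (simp, measurable)
  qed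
qed

end

context brownian_space
begin

text \<open>Truncation of \<open>\<xi>\<close> passes from bounded to square integrable weights. The weight in the mixed second
  order term, \<open>D\<^sup>2\<phi>(Y\<^sub>s)(Y'\<^sub>s \<delta>X)\<close>, is unbounded.\<close>

lemma ito_mean_zero_scalar:
  fixes N :: "'o => real"
  assumes s: "s \<in> {0..T}" and N: "sq_int M N"
    and zero: "\<And>\<xi> K. \<xi> \<in> borel_measurable (F s) ==> (\<And>w. \<bar>\<xi> w\<bar> \<le> K) ==> (\<integral>w. \<xi> w * N w \<partial>M) = 0"
    and \<xi>: "\<xi> \<in> borel_measurable (F s)" "sq_int M \<xi>"
  shows "(\<integral>w. \<xi> w * N w \<partial>M) = 0"
proof -
  define \<xi>k where "\<xi>k k w = max (- real k) (min (real k) (\<xi> w))" for k w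
  note [measurable] = sq_int_measurable[OF N] sq_int_measurable[OF \<xi>(2)]
  have km: "\<xi>k k \<in> borel_measurable (F s)" for k unfolding \<xi>k_def[abs_def] using \<xi>(1) by measurable
  have [measurable]: "\<xi>k k \<in> borel_measurable M" for k by (rule measurable_F_M[OF s km])
  have z: "(\<integral>w. \<xi>k k w * N w \<partial>M) = 0" for k
    by (rule zero[OF km, of _ "real k"]) (auto simp: \<xi>k_def)
  have "(\<lambda>k. \<integral>w. \<xi>k k w * N w \<partial>M) \<longlonglongrightarrow> (\<integral>w. \<xi> w * N w \<partial>M)"
  proof (rule integral_dominated_convergence[where w="\<lambda>w. norm (\<xi> w) * norm (N w)"])
    show "integrable M (\<lambda>w. norm (\<xi> w) * norm (N w))" by (rule sq_int_mult(1)[OF \<xi>(2) N])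
    show "AE w in M. (\<lambda>k. \<xi>k k w * N w) \<longlonglongrightarrow> \<xi> w * N w"
    proof (rule AE_I2)
      fix w
      obtain k0 :: nat where k0: "\<bar>\<xi> w\<bar> \<le> real k0" using real_arch_simple by blast
      have "\<forall>\<^sub>F k in sequentially. \<xi>k k w * N w = \<xi> w * N w"
        using eventually_ge_at_top[of k0] by eventually_elim (use k0 in \<open>auto simp: \<xi>k_def\<close>)
      then show "(\<lambda>k. \<xi>k k w * N w) \<longlonglongrightarrow> \<xi> w * N w" by (rule tendsto_eventually)
    qed
    show "AE w in M. norm (\<xi>k k w * N w) \<le> norm (\<xi> w) * norm (N w)" for k
      by (intro AE_I2) (auto simp: abs_mult \<xi>k_def intro!: mult_right_mono)
  qed measurable
  then show ?thesis unfolding z by (simp add: LIMSEQ_const_iff)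
qed

text \<open>Coordinates reduce the first two statements to scalar integrals; the quadratic form is recovered from
  the squares of linear functionals by polarisation.\<close>

lemma ito_increment_vector:
  fixes \<sigma> :: "real => 'o => 'u \<Rightarrow>\<^sub>L 'w::fin_dim_banach"
  assumes \<sigma>C: "\<And>t w. t \<in> {0..T} ==> w \<in> space M ==> norm (\<sigma> t w) \<le> C" "0 \<le> C"
    and \<sigma>p: "progressive F T \<sigma>" and ito: "has_ito_integral M F T B \<sigma> I"
  obtains cN where "cN > 0"
    "\<And>s t. 0 \<le> s ==> s < t ==> t \<le> T ==> sq_int M (\<lambda>w. (norm (I t w - I s w))\<^sup>2) \<and>
       l2 M (\<lambda>w. (norm (I t w - I s w))\<^sup>2) \<le> cN * (t - s)"
    "\<And>s t \<Lambda>. 0 \<le> s ==> s < t ==> t \<le> T ==> \<Lambda> \<in> borel_measurable (F s) ==> sq_int M (\<Lambda> :: 'o => 'w \<Rightarrow>\<^sub>L real) ==>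
       (\<integral>w. \<Lambda> w (I t w - I s w) \<partial>M) = 0"
    "\<And>s t Q. 0 \<le> s ==> s < t ==> t \<le> T ==> Q \<in> borel_measurable (F s) ==> (\<exists>K. \<forall>w. norm (Q w :: 'w \<Rightarrow>\<^sub>L 'w \<Rightarrow>\<^sub>L real) \<le> K) ==>
       (\<integral>w. Q w (I t w - I s w) (I t w - I s w) \<partial>M)
       = (\<integral>w. (LINT r:{s..t}|lborel. tensor_lift (Q w) (diffusion (\<sigma> r w))) \<partial>M)"
proof -
  obtain Bs :: "'w set" and co :: "'w => ('w \<Rightarrow>\<^sub>L real)" where fB: "finite Bs"
    and coord: "\<And>x. x = (\<Sum>b\<in>Bs. co b x *\<^sub>R b)"
    using finite_coordinates by blast
  let ?D = "real DIM('u)"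
  have Im: "I t \<in> borel_measurable M" if "t \<in> {0..T}" for t
    using ito that measurable_F_M[OF that] unfolding has_ito_integral_def adapted_def by blast
  define cN where "cN = real (card Bs) * (\<Sum>b\<in>Bs. (norm b)\<^sup>2 * (3 * ?D * (norm (co b) * C)\<^sup>2)) + 1"
  have cN: "cN > 0" unfolding cN_def by (intro add_nonneg_pos mult_nonneg_nonneg sum_nonneg) auto
  have sc4: "sq_int M (\<lambda>w. (l (I t w - I s w))\<^sup>2)"
    "l2 M (\<lambda>w. (l (I t w - I s w))\<^sup>2) \<le> 3 * ?D * (norm l * C)\<^sup>2 * (t - s)"
    "sq_int M (\<lambda>w. l (I t w - I s w))"
    if st: "0 \<le> s" "s < t" "t \<le> T" for s t and l :: "'w \<Rightarrow>\<^sub>L real"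
  proof -
    note ii = ito_increment[where l=l, OF \<sigma>C \<sigma>p ito st]
    have [measurable]: "I t \<in> borel_measurable M" "I s \<in> borel_measurable M" using Im st by auto
    have m: "(\<lambda>w. l (I t w - I s w)) \<in> borel_measurable M" by measurable
    show s4: "sq_int M (\<lambda>w. (l (I t w - I s w))\<^sup>2)"
      using ii(1) m by (simp add: sq_int_def power_mult[symmetric])
    have "(\<integral>w. (norm ((l (I t w - I s w))\<^sup>2))\<^sup>2 \<partial>M) \<le> (3 * ?D * (norm l * C)\<^sup>2 * (t - s))\<^sup>2"
      using ii(2) by (simp add: power_mult_distrib power_mult[symmetric])
    then show "l2 M (\<lambda>w. (l (I t w - I s w))\<^sup>2) \<le> 3 * ?D * (norm l * C)\<^sup>2 * (t - s)"
      using st by (intro l2_leI) auto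
    show "sq_int M (\<lambda>w. l (I t w - I s w))"
      using sq_int_integrable(1)[OF s4] m by (simp add: sq_int_def)
  qed
  have four: "sq_int M (\<lambda>w. (norm (I t w - I s w))\<^sup>2) \<and> l2 M (\<lambda>w. (norm (I t w - I s w))\<^sup>2) \<le> cN * (t - s)"
    if st: "0 \<le> s" "s < t" "t \<le> T" for s t
  proof -
    have [measurable]: "I t \<in> borel_measurable M" "I s \<in> borel_measurable M" using Im st by auto
    let ?G = "\<lambda>w. \<Sum>b\<in>Bs. (real (card Bs) * (norm b)\<^sup>2) *\<^sub>R (co b (I t w - I s w))\<^sup>2"
    have pw: "(norm x)\<^sup>2 \<le> (\<Sum>b\<in>Bs. (real (card Bs) * (norm b)\<^sup>2) *\<^sub>R (co b x)\<^sup>2)" for x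
    proof -
      have "norm x \<le> (\<Sum>b\<in>Bs. 1 * (\<bar>co b x\<bar> * norm b))"
        by (subst coord[of x]) (auto intro!: order_trans[OF norm_sum] sum_mono)
      then have "(norm x)\<^sup>2 \<le> (\<Sum>b\<in>Bs. 1 * (\<bar>co b x\<bar> * norm b))\<^sup>2" by (intro power_mono) auto
      also have "\<dots> \<le> (\<Sum>b\<in>Bs. 1\<^sup>2) * (\<Sum>b\<in>Bs. (\<bar>co b x\<bar> * norm b)\<^sup>2)" by (rule Cauchy_Schwarz_ineq_sum)
      also have "\<dots> = (\<Sum>b\<in>Bs. (real (card Bs) * (norm b)\<^sup>2) *\<^sub>R (co b x)\<^sup>2)"
        by (simp add: sum_distrib_left power_mult_distrib mult_ac)
      finally show ?thesis .
    qed
    have G: "sq_int M ?G" by (intro sq_int_sum(1) sq_int_scaleR(1) sc4(1)[OF st])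
    have m: "(\<lambda>w. (norm (I t w - I s w))\<^sup>2) \<in> borel_measurable M" by measurable
    have ae: "AE w in M. norm ((norm (I t w - I s w))\<^sup>2) \<le> norm (?G w)"
      using pw by (intro AE_I2) (auto intro: order_trans[OF _ abs_ge_self])
    have "l2 M ?G \<le> (\<Sum>b\<in>Bs. l2 M (\<lambda>w. (real (card Bs) * (norm b)\<^sup>2) *\<^sub>R (co b (I t w - I s w))\<^sup>2))"
      by (intro sq_int_sum(2) sq_int_scaleR(1) sc4(1)[OF st])
    also have "\<dots> \<le> (\<Sum>b\<in>Bs. (real (card Bs) * (norm b)\<^sup>2) * (3 * ?D * (norm (co b) * C)\<^sup>2 * (t - s)))"
      unfolding sq_int_scaleR(2)[OF sc4(1)[OF st]]
      by (intro sum_mono mult_mono sc4(2)[OF st] l2_nonneg) auto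
    also have "\<dots> = (cN - 1) * (t - s)" by (simp add: cN_def sum_distrib_left sum_distrib_right mult_ac)
    also have "\<dots> \<le> cN * (t - s)" using st by (intro mult_right_mono) auto
    finally show ?thesis using sq_int_mono[OF m G ae] by auto
  qed
  have zero: "(\<integral>w. \<Lambda> w (I t w - I s w) \<partial>M) = 0"
    if st: "0 \<le> s" "s < t" "t \<le> T" and \<Lambda>: "\<Lambda> \<in> borel_measurable (F s)" "sq_int M \<Lambda>" for s t and \<Lambda> :: "'o => 'w \<Rightarrow>\<^sub>L real"
  proof -
    have s: "s \<in> {0..T}" using st by auto
    have ex: "\<Lambda> w x = (\<Sum>b\<in>Bs. \<Lambda> w b * co b x)" for w x
      by (subst coord[of x]) (simp add: blinfun.sum_right blinfun.scaleR_right mult.commute)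
    have b: "(\<lambda>w. \<Lambda> w b) \<in> borel_measurable (F s)" "sq_int M (\<lambda>w. \<Lambda> w b)" for b
    proof -
      note [measurable] = \<Lambda>(1)
      show "(\<lambda>w. \<Lambda> w b) \<in> borel_measurable (F s)" by measurable
      show "sq_int M (\<lambda>w. \<Lambda> w b)"
        by (rule sq_int_blinfun_at(1)[OF \<Lambda>(2) order_refl order_refl norm_ge_zero])
    qed
    have "(\<integral>w. \<Lambda> w (I t w - I s w) \<partial>M)
        = (\<integral>w. (\<Sum>b\<in>Bs. \<Lambda> w b * co b (I t w - I s w)) \<partial>M)"
      by (intro Bochner_Integration.integral_cong refl ex)
    also have "\<dots> = (\<Sum>b\<in>Bs. \<integral>w. \<Lambda> w b * co b (I t w - I s w) \<partial>M)"
      by (intro Bochner_Integration.integral_sum sq_int_inner(1) b sc4(3)[OF st])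
    also have "\<dots> = 0"
      by (intro sum.neutral ballI ito_mean_zero_scalar[OF s sc4(3)[OF st] _ b])
        (rule ito_increment(3)[OF \<sigma>C \<sigma>p ito st])
    finally show ?thesis .
  qed
  \<comment> \<open>\<open>4 xy = (x + y)\<^sup>2 - (x - y)\<^sup>2\<close>, on the increments and on their quadratic variation\<close>
  have polar: "(\<integral>w. \<xi> w * (l (I t w - I s w) * l' (I t w - I s w)) \<partial>M)
      = (\<integral>w. \<xi> w * (LINT r:{s..t}|lborel. (\<Sum>e\<in>Basis. l (\<sigma> r w e) * l' (\<sigma> r w e))) \<partial>M)"
    and polar_int: "integrable M (\<lambda>w. \<xi> w * (l (I t w - I s w) * l' (I t w - I s w)))"
      "integrable M (\<lambda>w. \<xi> w * (LINT r:{s..t}|lborel. (\<Sum>e\<in>Basis. l (\<sigma> r w e) * l' (\<sigma> r w e))))"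
      "\<And>w. w \<in> space M ==> set_integrable lborel {s..t} (\<lambda>r. (\<Sum>e\<in>Basis. l (\<sigma> r w e) * l' (\<sigma> r w e)))"
    if st: "0 \<le> s" "s < t" "t \<le> T" and \<xi>: "\<xi> \<in> borel_measurable (F s)" "\<And>w. \<bar>\<xi> w\<bar> \<le> K"
    for s t \<xi> K and l l' :: "'w \<Rightarrow>\<^sub>L real"
  proof -
    let ?N = "\<lambda>w. I t w - I s w"
    have \<xi>M: "\<xi> \<in> borel_measurable M" using \<xi>(1) st by (intro measurable_F_M[of s]) auto
    have K: "0 \<le> K" using \<xi>(2)[of undefined] by linarith
    define f where "f m r w = hs (m o\<^sub>L \<sigma> r w)" for m :: "'w \<Rightarrow>\<^sub>L real" and r w
    have fm: "(\<lambda>x. f m (clamp (snd x)) (fst x)) \<in> borel_measurable (M \<Otimes>\<^sub>M borel)" for m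
      unfolding f_def
      by (rule measurable_compose[OF borel_measurable_bounded_linear[OF bounded_bilinear.bounded_linear_right[OF bounded_bilinear_blinfun_compose] progressive_joint[OF \<sigma>p]] borel_measurable_hs])
    have fb: "\<bar>f m r w\<bar> \<le> ?D * (norm m * C)\<^sup>2" if "r \<in> {0..T}" "w \<in> space M" for m r w
    proof -
      have "norm (m o\<^sub>L \<sigma> r w) \<le> norm m * C"
        by (rule order_trans[OF norm_blinfun_compose mult_left_mono[OF \<sigma>C(1)[OF that]]]) simp
      then have "?D * (norm (m o\<^sub>L \<sigma> r w))\<^sup>2 \<le> ?D * (norm m * C)\<^sup>2" by (intro mult_left_mono power_mono) auto
      then have "hs (m o\<^sub>L \<sigma> r w) \<le> ?D * (norm m * C)\<^sup>2" by (rule order_trans[OF hs_le])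
      then show ?thesis using hs_nonneg[of "m o\<^sub>L \<sigma> r w"] unfolding f_def by linarith
    qed
    have Cn: "0 \<le> ?D * (norm m * C)\<^sup>2" for m :: "'w \<Rightarrow>\<^sub>L real" by simp
    have fint: "set_integrable lborel {s..t} (\<lambda>r. f m r w)" if "w \<in> space M" for m w
      by (rule fubini_bounded(1)[OF fm fb Cn st(1) less_imp_le[OF st(2)] st(3) that])
    have fI: "integrable M (\<lambda>w. \<xi> w * (LINT r:{s..t}|lborel. f m r w))" for m
    proof -
      have i: "integrable M (\<lambda>w. LINT r:{s..t}|lborel. f m r w)" 
        by (rule fubini_bounded(2)[OF fm fb Cn st(1) less_imp_le[OF st(2)] st(3)])
      show ?thesis
      proof (rule Bochner_Integration.integrable_bound)
        show "integrable M (\<lambda>w. K * (LINT r:{s..t}|lborel. f m r w))" using i by simp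
        show "(\<lambda>w. \<xi> w * (LINT r:{s..t}|lborel. f m r w)) \<in> borel_measurable M"
          by (rule borel_measurable_times[OF \<xi>M borel_measurable_integrable[OF i]])
        show "AE w in M. norm (\<xi> w * (LINT r:{s..t}|lborel. f m r w)) \<le> norm (K * (LINT r:{s..t}|lborel. f m r w))"
          using \<xi>(2) K by (intro AE_I2) (auto simp: abs_mult intro!: mult_right_mono)
      qed
    qed
    have sum_eq: "(\<Sum>e\<in>Basis. l (\<sigma> r w e) * l' (\<sigma> r w e))
        = 1/4 * (f (l + l') r w - f (l - l') r w)" for r w
      unfolding f_def hs_def sum_subtractf[symmetric] sum_distrib_left
      by (intro sum.cong refl) (simp add: blinfun.add_left blinfun.diff_left power2_eq_square algebra_simps)
    have setI: "set_integrable lborel {s..t} (\<lambda>r. 1/4 * (f (l + l') r w - f (l - l') r w))" if "w \<in> space M" for w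
      using fint[OF that] by (intro set_integrable_mult_right set_integral_diff(1)) auto
    have Leq: "(LINT r:{s..t}|lborel. 1/4 * (f (l + l') r w - f (l - l') r w))
        = 1/4 * ((LINT r:{s..t}|lborel. f (l + l') r w) - (LINT r:{s..t}|lborel. f (l - l') r w))" if "w \<in> space M" for w
      using set_integral_diff(2)[OF fint[OF that, of "l + l'"] fint[OF that, of "l - l'"]] by simp
    show "set_integrable lborel {s..t} (\<lambda>r. (\<Sum>e\<in>Basis. l (\<sigma> r w e) * l' (\<sigma> r w e)))"
      if "w \<in> space M" for w unfolding sum_eq by (rule setI[OF that])
    have sq: "integrable M (\<lambda>w. \<xi> w * (m (?N w))\<^sup>2)" for m :: "'w \<Rightarrow>\<^sub>L real"
      by (rule sq_int_integrable(1)[OF sq_int_bounded_mult(1)[OF sc4(1)[OF st] \<xi>M AE_I2[OF \<xi>(2)]]])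
    have prod_eq: "\<xi> w * (l (?N w) * l' (?N w))
        = 1/4 * (\<xi> w * ((l + l') (?N w))\<^sup>2 - \<xi> w * ((l - l') (?N w))\<^sup>2)" for w
      by (simp add: blinfun.add_left blinfun.diff_left power2_eq_square algebra_simps)
    show "integrable M (\<lambda>w. \<xi> w * (l (?N w) * l' (?N w)))"
      unfolding prod_eq using sq by simp
    have e2: "\<xi> w * (LINT r:{s..t}|lborel. 1/4 * (f (l + l') r w - f (l - l') r w))
      = 1/4 * (\<xi> w * (LINT r:{s..t}|lborel. f (l + l') r w) - \<xi> w * (LINT r:{s..t}|lborel. f (l - l') r w))"
      if "w \<in> space M" for w unfolding Leq[OF that] by (simp add: algebra_simps)
    have I2: "integrable M (\<lambda>w. 1/4 * (\<xi> w * (LINT r:{s..t}|lborel. f (l + l') r w) - \<xi> w * (LINT r:{s..t}|lborel. f (l - l') r w)))"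
      using fI by simp
    show "integrable M (\<lambda>w. \<xi> w * (LINT r:{s..t}|lborel. (\<Sum>e\<in>Basis. l (\<sigma> r w e) * l' (\<sigma> r w e))))"
      unfolding sum_eq by (rule Bochner_Integration.integrable_cong[OF refl e2, THEN iffD2, OF _ I2])
    have "(\<integral>w. \<xi> w * (l (?N w) * l' (?N w)) \<partial>M)
        = 1/4 * ((\<integral>w. \<xi> w * ((l + l') (?N w))\<^sup>2 \<partial>M) - (\<integral>w. \<xi> w * ((l - l') (?N w))\<^sup>2 \<partial>M))"
      unfolding prod_eq using sq by simp
    also have "\<dots> = 1/4 * ((\<integral>w. \<xi> w * (LINT r:{s..t}|lborel. f (l + l') r w) \<partial>M) - (\<integral>w. \<xi> w * (LINT r:{s..t}|lborel. f (l - l') r w) \<partial>M))"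
      using ito_increment(4)[OF \<sigma>C \<sigma>p ito st \<xi>] by (simp only: f_def)
    also have "\<dots> = (\<integral>w. 1/4 * (\<xi> w * (LINT r:{s..t}|lborel. f (l + l') r w) - \<xi> w * (LINT r:{s..t}|lborel. f (l - l') r w)) \<partial>M)"
      using fI by simp
    also have "\<dots> = (\<integral>w. \<xi> w * (LINT r:{s..t}|lborel. (\<Sum>e\<in>Basis. l (\<sigma> r w e) * l' (\<sigma> r w e))) \<partial>M)"
      unfolding sum_eq by (rule Bochner_Integration.integral_cong[OF refl e2[symmetric]])
    finally show "(\<integral>w. \<xi> w * (l (?N w) * l' (?N w)) \<partial>M)
      = (\<integral>w. \<xi> w * (LINT r:{s..t}|lborel. (\<Sum>e\<in>Basis. l (\<sigma> r w e) * l' (\<sigma> r w e))) \<partial>M)" .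
  qed
  have quad: "(\<integral>w. Q w (I t w - I s w) (I t w - I s w) \<partial>M)
       = (\<integral>w. (LINT r:{s..t}|lborel. tensor_lift (Q w) (diffusion (\<sigma> r w))) \<partial>M)"
    if st: "0 \<le> s" "s < t" "t \<le> T" and Q: "Q \<in> borel_measurable (F s)" "\<And>w. norm (Q w) \<le> K"
    for s t K and Q :: "'o => 'w \<Rightarrow>\<^sub>L 'w \<Rightarrow>\<^sub>L real"
  proof -
    let ?N = "\<lambda>w. I t w - I s w"
    let ?q = "\<lambda>b b' w. Q w b b'"
    let ?S = "\<lambda>b b' r w. \<Sum>e\<in>Basis. co b (\<sigma> r w e) * co b' (\<sigma> r w e)"
    have ex: "Q w x x
        = (\<Sum>b\<in>Bs. \<Sum>b'\<in>Bs. ?q b b' w * (co b x * co b' x))" for w x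
    proof -
      have e1: "Q w x x = (\<Sum>b\<in>Bs. co b x * Q w b x)"
      proof -
        have "Q w x = (\<Sum>b\<in>Bs. co b x *\<^sub>R Q w b)"
          by (subst coord[of x]) (simp only: blinfun.sum_right blinfun.scaleR_right)
        from arg_cong[OF this, of "\<lambda>l. l x"] show ?thesis
          by (simp only: blinfun.sum_left blinfun.scaleR_left real_scaleR_def)
      qed
      have e2: "l x = (\<Sum>b\<in>Bs. co b x * l b)" for l :: "'w \<Rightarrow>\<^sub>L real"
        by (subst coord[of x]) (simp only: blinfun.sum_right blinfun.scaleR_right real_scaleR_def)
      have "Q w x x
          = (\<Sum>b\<in>Bs. \<Sum>b'\<in>Bs. ?q b b' w * (co b x * co b' x))"
        unfolding e1 by (intro sum.cong refl) (subst e2, simp only: sum_distrib_left mult_ac)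
      then show ?thesis .
    qed
    have qm: "?q b b' \<in> borel_measurable (F s)" for b b' using Q(1) by measurable
    have qb: "\<bar>?q b b' w\<bar> \<le> K * norm b * norm b'" for b b' w
      using order_trans[OF norm_blinfun[of "Q w b" b'] mult_right_mono[OF order_trans[OF norm_blinfun mult_right_mono[OF Q(2)]]]]
      by simp
    note po = polar[OF st qm qb] and pi = polar_int[OF st qm qb]
    have "(\<integral>w. Q w (?N w) (?N w) \<partial>M)
        = (\<integral>w. (\<Sum>b\<in>Bs. \<Sum>b'\<in>Bs. ?q b b' w * (co b (?N w) * co b' (?N w))) \<partial>M)"
      by (intro Bochner_Integration.integral_cong refl ex)
    also have "\<dots> = (\<Sum>b\<in>Bs. \<Sum>b'\<in>Bs. \<integral>w. ?q b b' w * (co b (?N w) * co b' (?N w)) \<partial>M)"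
      by (subst Bochner_Integration.integral_sum, intro Bochner_Integration.integrable_sum pi(1),
          intro sum.cong refl Bochner_Integration.integral_sum pi(1))
    also have "\<dots> = (\<Sum>b\<in>Bs. \<Sum>b'\<in>Bs. \<integral>w. ?q b b' w * (LINT r:{s..t}|lborel. ?S b b' r w) \<partial>M)"
      by (intro sum.cong refl po)
    also have "\<dots> = (\<integral>w. (\<Sum>b\<in>Bs. \<Sum>b'\<in>Bs. ?q b b' w * (LINT r:{s..t}|lborel. ?S b b' r w)) \<partial>M)"
      by (subst Bochner_Integration.integral_sum, intro Bochner_Integration.integrable_sum pi(2),
          intro sum.cong refl Bochner_Integration.integral_sum[symmetric] pi(2))
    also have "\<dots> = (\<integral>w. (LINT r:{s..t}|lborel. tensor_lift (Q w) (diffusion (\<sigma> r w))) \<partial>M)"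
    proof (rule Bochner_Integration.integral_cong[OF refl])
      fix w assume w: "w \<in> space M"
      have td: "tensor_lift (Q w) (diffusion (\<sigma> r w)) = (\<Sum>b\<in>Bs. \<Sum>b'\<in>Bs. ?q b b' w * ?S b b' r w)" for r
      proof -
        have "tensor_lift (Q w) (diffusion (\<sigma> r w))
            = (\<Sum>e\<in>Basis. \<Sum>b\<in>Bs. \<Sum>b'\<in>Bs. ?q b b' w * (co b (\<sigma> r w e) * co b' (\<sigma> r w e)))"
          unfolding tensor_lift_diffusion by (intro sum.cong refl ex)
        also have "\<dots> = (\<Sum>b\<in>Bs. \<Sum>e\<in>Basis. \<Sum>b'\<in>Bs. ?q b b' w * (co b (\<sigma> r w e) * co b' (\<sigma> r w e)))"
          by (rule sum.swap)
        also have "\<dots> = (\<Sum>b\<in>Bs. \<Sum>b'\<in>Bs. \<Sum>e\<in>Basis. ?q b b' w * (co b (\<sigma> r w e) * co b' (\<sigma> r w e)))"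
          by (intro sum.cong refl sum.swap)
        finally show ?thesis by (simp only: sum_distrib_left)
      qed
      have "(LINT r:{s..t}|lborel. tensor_lift (Q w) (diffusion (\<sigma> r w)))
          = (\<integral>r. (\<Sum>b\<in>Bs. \<Sum>b'\<in>Bs. ?q b b' w * (indicator {s..t} r *\<^sub>R ?S b b' r w)) \<partial>lborel)"
        unfolding td set_lebesgue_integral_def
        by (intro Bochner_Integration.integral_cong refl) (simp only: real_scaleR_def sum_distrib_left mult.left_commute)
      also have "\<dots> = (\<Sum>b\<in>Bs. \<Sum>b'\<in>Bs. \<integral>r. ?q b b' w * (indicator {s..t} r *\<^sub>R ?S b b' r w) \<partial>lborel)"
        using pi(3)[OF w, unfolded set_integrable_def]
        by (subst Bochner_Integration.integral_sum, intro Bochner_Integration.integrable_sum integrable_mult_right,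
            assumption, intro sum.cong refl Bochner_Integration.integral_sum integrable_mult_right)
      also have "\<dots> = (\<Sum>b\<in>Bs. \<Sum>b'\<in>Bs. ?q b b' w * (LINT r:{s..t}|lborel. ?S b b' r w))"
        unfolding set_lebesgue_integral_def by (intro sum.cong refl integral_mult_right_zero)
      finally show "(\<Sum>b\<in>Bs. \<Sum>b'\<in>Bs. ?q b b' w * (LINT r:{s..t}|lborel. ?S b b' r w))
          = (LINT r:{s..t}|lborel. tensor_lift (Q w) (diffusion (\<sigma> r w)))" by (rule sym)
    qed
    finally show ?thesis .
  qed
  show thesis by (rule that[OF cN four zero]) (auto intro: quad)
qed

end


section \<open>The local expansion of expectations along a rough Ito process\<close>

text \<open>As an operator, the contraction with \<open>D\<^sup>2\<phi>(Y\<^sub>r)\<close> acts on the diffusion coefficient in the same way as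
  \<open>D\<phi>(Y\<^sub>r)\<close> acts on the drift, so that one lemma covers both.\<close>

definition lift_blinfun :: "('a::fin_dim_banach \<Rightarrow>\<^sub>L 'a \<Rightarrow>\<^sub>L 'e::fin_dim_banach) => 'a tensor2 \<Rightarrow>\<^sub>L 'e"
  where "lift_blinfun K = Blinfun (tensor_lift K)"

lemma lift_blinfun_apply: "lift_blinfun K A = tensor_lift K A"
  unfolding lift_blinfun_def
  by (subst bounded_linear_Blinfun_apply[OF tensor_lift.bounded_linear_right]) simp

lemma bounded_linear_lift_blinfun: "bounded_linear lift_blinfun"
  by (intro bounded_linear_fin_dim linearI blinfun_eqI)
    (simp_all add: lift_blinfun_apply blinfun.add_left blinfun.scaleR_left tensor_lift.add_left tensor_lift.scaleR_left)

lemma borel_measurable_diffusion [measurable]: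
  fixes \<sigma> :: "'o => 'u::euclidean_space \<Rightarrow>\<^sub>L 'w::fin_dim_banach"
  assumes "\<sigma> \<in> borel_measurable M"
  shows "(\<lambda>w. diffusion (\<sigma> w)) \<in> borel_measurable M"
proof -
  note [measurable] = assms
  have m: "(\<lambda>w. \<sigma> w e) \<in> borel_measurable M" for e by measurable
  show ?thesis unfolding diffusion_eq
    by (intro borel_measurable_sum borel_measurable_bilinear[OF bounded_bilinear_tensor] m)
qed

lemma diffusion_bound:
  fixes c :: real
  obtains C where "C \<ge> 0" "\<And>\<sigma> :: 'u::euclidean_space \<Rightarrow>\<^sub>L 'w::fin_dim_banach. norm \<sigma> \<le> c ==> norm (diffusion \<sigma>) \<le> C"
proof -
  obtain K where K: "0 < K" "\<And>x y :: 'w. norm (x \<otimes> y) \<le> norm x * norm y * K"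
    using bounded_bilinear.pos_bounded[OF bounded_bilinear_tensor] by blast
  have "norm (diffusion \<sigma>) \<le> (\<Sum>e\<in>(Basis :: 'u set). \<bar>c\<bar> * \<bar>c\<bar> * K)" if "norm \<sigma> \<le> c" for \<sigma> :: "'u \<Rightarrow>\<^sub>L 'w"
    unfolding diffusion_eq
  proof (rule order_trans[OF norm_sum sum_mono])
    fix e :: 'u assume e: "e \<in> Basis"
    have "norm (\<sigma> e) \<le> \<bar>c\<bar>" using norm_blinfun[of \<sigma> e] e that by simp
    then have "norm (\<sigma> e) * norm (\<sigma> e) * K \<le> \<bar>c\<bar> * \<bar>c\<bar> * K"
      using K(1) by (intro mult_right_mono mult_mono) auto
    then show "norm (\<sigma> e \<otimes> \<sigma> e) \<le> \<bar>c\<bar> * \<bar>c\<bar> * K" by (rule order_trans[OF K(2)])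
  qed
  then show thesis using K(1) by (intro that[of "\<Sum>e\<in>(Basis :: 'u set). \<bar>c\<bar> * \<bar>c\<bar> * K"] sum_nonneg) auto
qed

context filtered_space
begin

lemma time_integral_bounded:
  fixes b :: "real => 'o => 'w::fin_dim_banach"
  assumes b: "(\<lambda>x. b (clamp (snd x)) (fst x)) \<in> borel_measurable (M \<Otimes>\<^sub>M borel)"
    and C: "\<And>r w. r \<in> {0..T} ==> w \<in> space M ==> norm (b r w) \<le> C" "0 \<le> C"
    and st: "0 \<le> s" "s \<le> t" "t \<le> T"
  shows "\<And>w. w \<in> space M ==> set_integrable lborel {s..t} (\<lambda>r. b r w)"
    and "(\<lambda>w. LINT r:{s..t}|lborel. b r w) \<in> borel_measurable M"
    and "\<And>w. w \<in> space M ==> norm (LINT r:{s..t}|lborel. b r w) \<le> C * (t - s)"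
proof -
  define g where "g w r = indicator {s..t} r *\<^sub>R b (clamp r) w" for w and r :: real
  have eq: "g w r = indicator {s..t} r *\<^sub>R b r w" for w r
    using st clamp_eq[of r] by (auto simp: g_def indicator_def)
  note [measurable] = b
  have gm: "(\<lambda>x. g (fst x) (snd x)) \<in> borel_measurable (M \<Otimes>\<^sub>M lborel)"
    unfolding g_def by measurable
  have gb: "norm (g w r) \<le> indicator {s..t} r * C" if "w \<in> space M" for w r
    using C(1)[OF clamp_in[of r] that] C(2) by (auto simp: g_def indicator_def)
  have bi: "integrable lborel (\<lambda>r. indicator {s..t} r * C)" using st by simp
  have gi: "integrable lborel (g w)" if w: "w \<in> space M" for w
  proof (rule Bochner_Integration.integrable_bound[OF bi])
    show "g w \<in> borel_measurable lborel"
      using measurable_compose[OF measurable_Pair1'[OF w] gm] by simp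
    show "AE r in lborel. norm (g w r) \<le> norm (indicator {s..t} r * C)"
      using gb[OF w] C(2) by (intro AE_I2) (simp add: abs_mult)
  qed
  show "set_integrable lborel {s..t} (\<lambda>r. b r w)" if "w \<in> space M" for w
    using gi[OF that] unfolding set_integrable_def eq .
  have "case_prod g \<in> borel_measurable (M \<Otimes>\<^sub>M lborel)" using gm by (simp add: case_prod_unfold)
  from lborel.borel_measurable_lebesgue_integral[OF this]
  show "(\<lambda>w. LINT r:{s..t}|lborel. b r w) \<in> borel_measurable M"
    unfolding set_lebesgue_integral_def eq .
  show "norm (LINT r:{s..t}|lborel. b r w) \<le> C * (t - s)" if w: "w \<in> space M" for w
  proof -
    have "norm (\<integral>r. g w r \<partial>lborel) \<le> (\<integral>r. norm (g w r) \<partial>lborel)" by (rule integral_norm_bound)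
    also have "(\<integral>r. norm (g w r) \<partial>lborel) \<le> (\<integral>r. indicator {s..t} r * C \<partial>lborel)"
      by (rule integral_mono[OF integrable_norm[OF gi[OF w]] bi gb[OF w]])
    finally show ?thesis using st unfolding set_lebesgue_integral_def eq by (simp add: mult.commute)
  qed
qed

text \<open>The function \<open>r \<mapsto> E G(Y\<^sub>r) u\<^sub>r\<close> is the time density of expectations of drift terms.\<close>

lemma expectation_density:
  fixes Y :: "real => 'o => 'w::fin_dim_banach" and G :: "'w => 'a::fin_dim_banach \<Rightarrow>\<^sub>L real" and u :: "real => 'o => 'a"
  assumes Y: "\<And>t. t \<in> {0..T} ==> Y t \<in> borel_measurable M" "continuous_process M T Y"
    and G: "continuous_on UNIV G" "\<And>y. norm (G y) \<le> CG"
    and u: "(\<lambda>x. u (clamp (snd x)) (fst x)) \<in> borel_measurable (M \<Otimes>\<^sub>M borel)"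
      "\<And>r w. r \<in> {0..T} ==> w \<in> space M ==> norm (u r w) \<le> Cu"
  shows "\<And>r y. r \<in> {0..T} ==> y \<in> borel_measurable M ==> integrable M (\<lambda>w. G (y w) (u r w))"
    and "set_integrable lborel {0..T} (\<lambda>r. \<integral>w. G (Y r w) (u r w) \<partial>M)"
    and "\<And>r y. r \<in> {0..T} ==> \<bar>\<integral>w. G (y w) (u r w) \<partial>M\<bar> \<le> CG * Cu"
proof -
  note [measurable] = u(1) borel_measurable_continuous_onI[OF G(1)]
  have CG: "0 \<le> CG" using order_trans[OF norm_ge_zero G(2)] .
  have Cu: "0 \<le> Cu" using u(2)[of 0] T_pos not_empty order_trans[OF norm_ge_zero] by fastforce
  have um: "u r \<in> borel_measurable M" if "r \<in> {0..T}" for r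
    using measurable_compose[OF measurable_Pair2'[of r borel M] u(1)] clamp_eq[OF that] by simp
  have bd: "norm (G y (u r w)) \<le> CG * Cu" if "w \<in> space M" "r \<in> {0..T}" for y r w
    by (rule order_trans[OF norm_blinfun mult_mono[OF G(2) u(2)[OF that(2,1)] CG norm_ge_zero]])
  show i: "integrable M (\<lambda>w. G (y w) (u r w))" if r: "r \<in> {0..T}" and [measurable]: "y \<in> borel_measurable M" for r y
  proof (rule integrable_const_bound[where B="CG * Cu"])
    show "AE w in M. norm (G (y w) (u r w)) \<le> CG * Cu" using bd[OF _ r] by (intro AE_I2)
    note [measurable] = um[OF r]
    show "(\<lambda>w. G (y w) (u r w)) \<in> borel_measurable M" by measurable
  qed
  show b: "\<bar>\<integral>w. G (y w) (u r w) \<partial>M\<bar> \<le> CG * Cu" if r: "r \<in> {0..T}" for r y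
  proof (cases "integrable M (\<lambda>w. G (y w) (u r w))")
    case True
    have "\<bar>\<integral>w. G (y w) (u r w) \<partial>M\<bar> \<le> (\<integral>w. norm (G (y w) (u r w)) \<partial>M)"
      using integral_norm_bound[of M "\<lambda>w. G (y w) (u r w)"] by simp
    also have "\<dots> \<le> (\<integral>w. CG * Cu \<partial>M)"
      by (rule integral_mono[OF integrable_norm[OF True] _ bd[OF _ r]]) auto
    finally show ?thesis by (simp add: prob_space)
  next
    case False
    then show ?thesis using CG Cu by (simp add: not_integrable_integral_eq)
  qed
  show "set_integrable lborel {0..T} (\<lambda>r. \<integral>w. G (Y r w) (u r w) \<partial>M)"
    unfolding set_integrable_def
  proof (rule Bochner_Integration.integrable_bound)
    show "integrable lborel (\<lambda>r. indicator {0..T} r * (CG * Cu))" using T_pos by simp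
    have e: "indicator {0..T} r *\<^sub>R (\<integral>w. G (Y r w) (u r w) \<partial>M)
        = indicator {0..T} r *\<^sub>R (\<integral>w. G (Y (clamp r) w) (u (clamp r) w) \<partial>M)" for r
      using clamp_eq[of r] by (auto simp: indicator_def)
    note [measurable] = measurable_expectation[OF Y G u]
    show "(\<lambda>r. indicator {0..T} r *\<^sub>R (\<integral>w. G (Y r w) (u r w) \<partial>M)) \<in> borel_measurable lborel"
      unfolding e by measurable
    show "AE r in lborel. norm (indicator {0..T} r *\<^sub>R (\<integral>w. G (Y r w) (u r w) \<partial>M)) \<le> norm (indicator {0..T} r * (CG * Cu))"
      using b CG Cu by (intro AE_I2) (auto simp: indicator_def)
  qed
qed

end

text \<open>The local data of a rough Ito process: over each interval the increment of \<open>Y\<close> is the Ito increment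
  plus \<open>Y'\<^sub>s \<delta>X\<close>, of order \<open>\<alpha>\<close>, plus terms of order \<open>\<alpha> + \<beta>\<close>, among them the remainder \<open>W\<close> of the rough
  integral, which is of order \<open>\<alpha> + \<beta> + \<beta>'\<close> after pairing with the past. A single constant \<open>c\<close> serves in
  all bounds.\<close>

locale rough_ito_expansion = brownian_space M F T B
  for M :: "'o measure" and F and T and B :: "real => 'o => 'u::euclidean_space" +
  fixes \<alpha> \<beta> \<beta>' c :: real
    and X :: "real => 'v::fin_dim_banach" and XX :: "real => real => 'v tensor2"
    and b :: "real => 'o => 'w::fin_dim_banach" and \<sigma> :: "real => 'o => ('u \<Rightarrow>\<^sub>L 'w)" and I :: "real => 'o => 'w"
    and Y :: "real => 'o => 'w" and Y' :: "real => 'o => ('v \<Rightarrow>\<^sub>L 'w)"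
    and Y'' :: "real => 'o => ('v \<Rightarrow>\<^sub>L ('v \<Rightarrow>\<^sub>L 'w))" and W :: "real => real => 'o => 'w"
  assumes exps: "1 / 3 < \<alpha>" "\<alpha> \<le> 1 / 2" "0 < \<beta>'" "\<beta>' \<le> \<beta>" "\<beta> \<le> \<alpha>" "1 < \<alpha> + \<beta> + \<beta>'"
    and c: "0 < c"
    and X: "geometric_rough_path T \<alpha> X XX"
      "\<And>s t. 0 \<le> s ==> s < t ==> t \<le> T ==> norm (X t - X s) \<le> c * (t - s) powr \<alpha>"
      "\<And>s t. 0 \<le> s ==> s < t ==> t \<le> T ==> norm (XX s t) \<le> c * (t - s) powr (2 * \<alpha>)"
    and b: "progressive F T b" "\<And>t w. t \<in> {0..T} ==> w \<in> space M ==> norm (b t w) \<le> c"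
    and \<sigma>: "progressive F T \<sigma>" "\<And>t w. t \<in> {0..T} ==> w \<in> space M ==> norm (\<sigma> t w) \<le> c"
    and I: "has_ito_integral M F T B \<sigma> I"
    and Y: "adapted F T Y" "continuous_process M T Y"
    and Y': "\<And>t. t \<in> {0..T} ==> Y' t \<in> borel_measurable (F t)"
      "\<And>t. t \<in> {0..T} ==> sq_int M (\<lambda>w. (norm (Y' t w))\<^sup>2) \<and> l2 M (\<lambda>w. (norm (Y' t w))\<^sup>2) \<le> c\<^sup>2"
    and Y'': "\<And>t. t \<in> {0..T} ==> sq_int M (Y'' t) \<and> l2 M (Y'' t) \<le> c"
    and Y_expansion: "\<And>s t w. 0 \<le> s ==> s < t ==> t \<le> T ==>
      Y t w = Y s w + ((I t w - I s w + Y' s w (X t - X s))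
        + ((LINT r:{s..t}|lborel. b r w) + tensor_lift (Y'' s w) (XX s t) + W s t w))"
    and W: "\<And>s t. 0 \<le> s ==> s < t ==> t \<le> T ==> sq_int M (W s t) \<and> l2 M (W s t) \<le> c * (t - s) powr (\<alpha> + \<beta>)"
      "\<And>s t \<Lambda> K. 0 \<le> s ==> s < t ==> t \<le> T ==> \<Lambda> \<in> borel_measurable (F s) ==> (\<And>w. norm (\<Lambda> w :: 'w \<Rightarrow>\<^sub>L real) \<le> K) ==>
        \<bar>\<integral>w. \<Lambda> w (W s t w) \<partial>M\<bar> \<le> K * (c * (t - s) powr (\<alpha> + \<beta> + \<beta>'))"
begin

lemma Y_measurable: "t \<in> {0..T} ==> Y t \<in> borel_measurable (F t)" "t \<in> {0..T} ==> Y t \<in> borel_measurable M"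
  using Y(1) measurable_F_M unfolding adapted_def by blast+

lemma I_measurable: "t \<in> {0..T} ==> I t \<in> borel_measurable M"
  using I measurable_F_M unfolding has_ito_integral_def adapted_def by blast

lemma Y'_sq: "t \<in> {0..T} ==> sq_int M (Y' t)" "t \<in> {0..T} ==> l2 M (Y' t) \<le> c"
  using l2_of_l2_square(1,2)[OF measurable_F_M[OF _ Y'(1)], of t c] Y'(2)[of t] c by auto

lemma first_order_bounds:
  obtains k where "k > 0"
    "\<And>s t. 0 \<le> s ==> s < t ==> t \<le> T ==>
      sq_int M (\<lambda>w. I t w - I s w) \<and> sq_int M (\<lambda>w. Y' s w (X t - X s)) \<and>
      sq_int M (\<lambda>w. LINT r:{s..t}|lborel. b r w) \<and> sq_int M (\<lambda>w. tensor_lift (Y'' s w) (XX s t))"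
    "\<And>s t. 0 \<le> s ==> s < t ==> t \<le> T ==>
      sq_int M (\<lambda>w. (norm (I t w - I s w + Y' s w (X t - X s)))\<^sup>2) \<and>
      l2 M (\<lambda>w. (norm (I t w - I s w + Y' s w (X t - X s)))\<^sup>2) \<le> (k * (t - s) powr \<alpha>)\<^sup>2"
    "\<And>s t. 0 \<le> s ==> s < t ==> t \<le> T ==>
      sq_int M (\<lambda>w. (LINT r:{s..t}|lborel. b r w) + tensor_lift (Y'' s w) (XX s t) + W s t w) \<and>
      l2 M (\<lambda>w. (LINT r:{s..t}|lborel. b r w) + tensor_lift (Y'' s w) (XX s t) + W s t w) \<le> k * (t - s) powr (\<alpha> + \<beta>)"
proof -
  obtain KT where KT: "0 < KT" "\<And>(K :: 'v \<Rightarrow>\<^sub>L 'v \<Rightarrow>\<^sub>L 'w) A. norm (tensor_lift K A) \<le> norm K * norm A * KT"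
    using bounded_bilinear.pos_bounded[OF bounded_bilinear_tensor_lift] by blast
  obtain cN where cN: "cN > 0"
    "\<And>s t. 0 \<le> s ==> s < t ==> t \<le> T ==> sq_int M (\<lambda>w. (norm (I t w - I s w))\<^sup>2) \<and>
       l2 M (\<lambda>w. (norm (I t w - I s w))\<^sup>2) \<le> cN * (t - s)"
    by (rule ito_increment_vector[OF \<sigma>(2) less_imp_le[OF c] \<sigma>(1) I]) (assumption, assumption, rule that)
  define kp where "kp = 2 * (cN * T powr (1 - 2 * \<alpha>)) + 2 * (c * c)\<^sup>2"
  define kq where "kq = c * T powr (1 - (\<alpha> + \<beta>)) + c * c * KT * T powr (\<alpha> - \<beta>) + c"
  define k where "k = sqrt kp + kq"
  have kp: "0 \<le> kp" and kq: "0 < kq" unfolding kp_def kq_def using c cN(1) KT(1) by (auto intro!: add_nonneg_pos)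
  have k: "0 < k" "kq \<le> k" "kp \<le> k\<^sup>2"
  proof -
    show "0 < k" "kq \<le> k" using kp kq by (auto simp: k_def add_nonneg_pos)
    have "(sqrt kp)\<^sup>2 \<le> k\<^sup>2" unfolding k_def using kp kq by (intro power_mono) auto
    then show "kp \<le> k\<^sup>2" using kp by simp
  qed
  have parts: "sq_int M (\<lambda>w. I t w - I s w)" "sq_int M (\<lambda>w. Y' s w (X t - X s))"
      "sq_int M (\<lambda>w. LINT r:{s..t}|lborel. b r w)" "sq_int M (\<lambda>w. tensor_lift (Y'' s w) (XX s t))"
      "sq_int M (\<lambda>w. (norm (I t w - I s w + Y' s w (X t - X s)))\<^sup>2)"
      "l2 M (\<lambda>w. (norm (I t w - I s w + Y' s w (X t - X s)))\<^sup>2) \<le> (k * (t - s) powr \<alpha>)\<^sup>2"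
      "l2 M (\<lambda>w. (LINT r:{s..t}|lborel. b r w) + tensor_lift (Y'' s w) (XX s t) + W s t w) \<le> k * (t - s) powr (\<alpha> + \<beta>)"
    if st: "0 \<le> s" "s < t" "t \<le> T" for s t
  proof -
    define h where "h = t - s"
    have h: "0 < h" "h \<le> T" using st by (auto simp: h_def)
    have s: "s \<in> {0..T}" "t \<in> {0..T}" using st by auto
    note [measurable] = I_measurable[OF s(1)] I_measurable[OF s(2)] measurable_F_M[OF s(1) Y'(1)[OF s(1)]]
    have Nm: "(\<lambda>w. I t w - I s w) \<in> borel_measurable M" by measurable
    have Am: "(\<lambda>w. Y' s w (X t - X s)) \<in> borel_measurable M" by measurable
    note N4 = cN(2)[OF st, THEN conjunct1] cN(2)[OF st, THEN conjunct2]
    show "sq_int M (\<lambda>w. I t w - I s w)"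
      using sq_int_integrable(1)[OF N4(1)] Nm by (simp add: sq_int_def)
    have dX: "norm (X t - X s) \<le> c * h powr \<alpha>" and dXX: "norm (XX s t) \<le> c * h powr (2 * \<alpha>)"
      using X(2,3)[OF st] by (auto simp: h_def)
    have cn: "0 \<le> c * h powr \<alpha>" "0 \<le> c * h powr (2 * \<alpha>)" using c by auto
    show "sq_int M (\<lambda>w. Y' s w (X t - X s))"
      by (rule sq_int_blinfun_at(1)[OF Y'_sq[OF s(1)] dX cn(1)])
    have bm: "(\<lambda>w. LINT r:{s..t}|lborel. b r w) \<in> borel_measurable M"
      by (rule time_integral_bounded(2)[OF progressive_joint[OF b(1)] b(2) less_imp_le[OF c] st(1) less_imp_le[OF st(2)] st(3)])
    have bb: "norm (LINT r:{s..t}|lborel. b r w) \<le> c * (t - s)" if "w \<in> space M" for w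
      by (rule time_integral_bounded(3)[OF progressive_joint[OF b(1)] b(2) less_imp_le[OF c] st(1) less_imp_le[OF st(2)] st(3) that])
    have one: "sq_int M (\<lambda>w. c * (t - s))" "l2 M (\<lambda>w. c * (t - s)) \<le> c * h"
      using c h by (auto simp: sq_int_def l2_def prob_space h_def)
    have bae: "AE w in M. norm (LINT r:{s..t}|lborel. b r w) \<le> norm (c * (t - s))"
      using bb c h by (intro AE_I2) (simp add: abs_mult h_def)
    note bs = sq_int_mono[OF bm one(1) bae]
    show bsq: "sq_int M (\<lambda>w. LINT r:{s..t}|lborel. b r w)" by (rule bs(1))
    note Y''s = Y''[OF s(1), THEN conjunct1] Y''[OF s(1), THEN conjunct2]
    note es = sq_int_tensor_lift_at[OF KT(2) less_imp_le[OF KT(1)] Y''s dXX cn(2)]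
    show esq: "sq_int M (\<lambda>w. tensor_lift (Y'' s w) (XX s t))" by (rule es(1))
    \<comment> \<open>\<open>\<alpha> \<le> 1/2\<close> makes the Ito increment, of order \<open>1/2\<close>, also of order \<open>\<alpha>\<close>\<close>
    have A4: "sq_int M (\<lambda>w. (norm (Y' s w (X t - X s)))\<^sup>2)"
      "l2 M (\<lambda>w. (norm (Y' s w (X t - X s)))\<^sup>2) \<le> (c * c)\<^sup>2 * (h powr \<alpha>)\<^sup>2"
    proof -
      note y4 = Y'(2)[OF s(1), THEN conjunct1] Y'(2)[OF s(1), THEN conjunct2]
      have m: "(\<lambda>w. (norm (Y' s w (X t - X s)))\<^sup>2) \<in> borel_measurable M" by measurable
      have pw: "(norm (Y' s w (X t - X s)))\<^sup>2 \<le> (c * h powr \<alpha>)\<^sup>2 * (norm (Y' s w))\<^sup>2" for w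
      proof -
        have "norm (Y' s w (X t - X s)) \<le> norm (Y' s w) * (c * h powr \<alpha>)"
          by (rule order_trans[OF norm_blinfun mult_left_mono[OF dX norm_ge_zero]])
        then have "(norm (Y' s w (X t - X s)))\<^sup>2 \<le> (norm (Y' s w) * (c * h powr \<alpha>))\<^sup>2" by (intro power_mono) auto
        then show ?thesis by (simp add: power_mult_distrib mult_ac)
      qed
      have ae: "AE w in M. norm ((norm (Y' s w (X t - X s)))\<^sup>2) \<le> norm ((c * h powr \<alpha>)\<^sup>2 *\<^sub>R (norm (Y' s w))\<^sup>2)"
        using pw by (intro AE_I2) (simp add: abs_mult)
      note mono = sq_int_mono[OF m sq_int_scaleR(1)[OF y4(1)] ae]
      show "sq_int M (\<lambda>w. (norm (Y' s w (X t - X s)))\<^sup>2)" by (rule mono(1))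
      have "l2 M (\<lambda>w. (c * h powr \<alpha>)\<^sup>2 *\<^sub>R (norm (Y' s w))\<^sup>2) \<le> (c * h powr \<alpha>)\<^sup>2 * c\<^sup>2"
        unfolding sq_int_scaleR(2)[OF y4(1)] using y4(2) by (simp add: mult_left_mono)
      also have "\<dots> = (c * c)\<^sup>2 * (h powr \<alpha>)\<^sup>2" by (simp add: power_mult_distrib mult_ac)
      finally show "l2 M (\<lambda>w. (norm (Y' s w (X t - X s)))\<^sup>2) \<le> (c * c)\<^sup>2 * (h powr \<alpha>)\<^sup>2"
        by (rule order_trans[OF mono(2)])
    qed
    let ?S = "\<lambda>w. 2 *\<^sub>R (norm (I t w - I s w))\<^sup>2 + 2 *\<^sub>R (norm (Y' s w (X t - X s)))\<^sup>2"
    note s1 = sq_int_scaleR[OF N4(1), of 2] and s2 = sq_int_scaleR[OF A4(1), of 2]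
    note sS = sq_int_add[OF s1(1) s2(1)]
    have pm: "(\<lambda>w. (norm (I t w - I s w + Y' s w (X t - X s)))\<^sup>2) \<in> borel_measurable M" by measurable
    have sq2: "(norm (x + y))\<^sup>2 \<le> 2 * (norm x)\<^sup>2 + 2 * (norm y)\<^sup>2" for x y :: 'w
    proof -
      have "(norm (x + y))\<^sup>2 \<le> (norm x + norm y)\<^sup>2" by (intro power_mono norm_triangle_ineq) auto
      also have "\<dots> \<le> 2 * (norm x)\<^sup>2 + 2 * (norm y)\<^sup>2" using sum_squares_bound[of "norm x" "norm y"] by (simp add: power2_sum)
      finally show ?thesis .
    qed
    have pae: "AE w in M. norm ((norm (I t w - I s w + Y' s w (X t - X s)))\<^sup>2) \<le> norm (?S w)"
      using sq2 by (intro AE_I2) simp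
    note pb = sq_int_mono[OF pm sS(1) pae]
    show "sq_int M (\<lambda>w. (norm (I t w - I s w + Y' s w (X t - X s)))\<^sup>2)" by (rule pb(1))
    have h1: "h \<le> T powr (1 - 2 * \<alpha>) * (h powr \<alpha>)\<^sup>2"
    proof -
      have "(h powr \<alpha>)\<^sup>2 = h powr (2 * \<alpha>)" by (simp only: power2_eq_square powr_add[symmetric] mult_2)
      then show ?thesis using powr_le_scale[OF h, of "2 * \<alpha>" 1] exps(2) h by simp
    qed
    have "l2 M ?S \<le> 2 * (cN * h) + 2 * ((c * c)\<^sup>2 * (h powr \<alpha>)\<^sup>2)"
      using sS(2) N4(2) A4(2) unfolding s1(2) s2(2) by (simp add: h_def)
    also have "\<dots> \<le> 2 * (cN * (T powr (1 - 2 * \<alpha>) * (h powr \<alpha>)\<^sup>2)) + 2 * ((c * c)\<^sup>2 * (h powr \<alpha>)\<^sup>2)"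
      using h1 cN(1) by simp
    also have "\<dots> = kp * (h powr \<alpha>)\<^sup>2" by (simp add: kp_def algebra_simps)
    also have "\<dots> \<le> k\<^sup>2 * (h powr \<alpha>)\<^sup>2" using k(3) by (intro mult_right_mono) auto
    finally have "l2 M ?S \<le> (k * (t - s) powr \<alpha>)\<^sup>2" by (simp add: power_mult_distrib h_def)
    then show "l2 M (\<lambda>w. (norm (I t w - I s w + Y' s w (X t - X s)))\<^sup>2) \<le> (k * (t - s) powr \<alpha>)\<^sup>2"
      by (rule order_trans[OF pb(2)])
    \<comment> \<open>the drift and \<open>XX\<close> are of orders \<open>1\<close> and \<open>2\<alpha>\<close>, both at least \<open>\<alpha> + \<beta>\<close>\<close>
    note Ws = W(1)[OF st, THEN conjunct1] W(1)[OF st, THEN conjunct2]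
    note q1 = sq_int_add[OF bsq esq]
    note q2 = sq_int_add[OF q1(1) Ws(1)]
    have i1: "h \<le> T powr (1 - (\<alpha> + \<beta>)) * h powr (\<alpha> + \<beta>)"
      using powr_le_scale[OF h, of "\<alpha> + \<beta>" 1] exps h by simp
    have i2: "h powr (2 * \<alpha>) \<le> T powr (\<alpha> - \<beta>) * h powr (\<alpha> + \<beta>)"
      using powr_le_scale[OF h, of "\<alpha> + \<beta>" "2 * \<alpha>"] exps by simp
    have "l2 M (\<lambda>w. (LINT r:{s..t}|lborel. b r w) + tensor_lift (Y'' s w) (XX s t) + W s t w)
        \<le> c * h + c * (c * h powr (2 * \<alpha>)) * KT + c * h powr (\<alpha> + \<beta>)"
      using q2(2) q1(2) bs(2) one(2) es(2) Ws(2) by (simp add: h_def)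
    also have "\<dots> \<le> c * (T powr (1 - (\<alpha> + \<beta>)) * h powr (\<alpha> + \<beta>)) + c * (c * (T powr (\<alpha> - \<beta>) * h powr (\<alpha> + \<beta>))) * KT + c * h powr (\<alpha> + \<beta>)"
      using c KT(1) i1 i2 by (intro add_mono mult_left_mono mult_right_mono) auto
    also have "\<dots> = kq * h powr (\<alpha> + \<beta>)" by (simp add: kq_def algebra_simps)
    also have "\<dots> \<le> k * h powr (\<alpha> + \<beta>)" using k(2) by (intro mult_right_mono) auto
    finally show "l2 M (\<lambda>w. (LINT r:{s..t}|lborel. b r w) + tensor_lift (Y'' s w) (XX s t) + W s t w) \<le> k * (t - s) powr (\<alpha> + \<beta>)"
      by (simp add: h_def)
  qed
  have qsq: "sq_int M (\<lambda>w. (LINT r:{s..t}|lborel. b r w) + tensor_lift (Y'' s w) (XX s t) + W s t w)"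
    if "0 \<le> s" "s < t" "t \<le> T" for s t
    using parts(3,4)[OF that] W(1)[OF that] by (intro sq_int_add(1)) auto
  show thesis by (rule that[OF k(1)]) (simp_all add: parts qsq)
qed

lemma Y_increment_mean:
  obtains k where "k > 0"
    "\<And>s t. 0 \<le> s ==> s < t ==> t \<le> T ==> integrable M (\<lambda>w. norm (Y t w - Y s w)) \<and>
       (\<integral>w. norm (Y t w - Y s w) \<partial>M) \<le> k * (t - s) powr \<alpha>"
proof -
  obtain k where k: "k > 0"
    "\<And>s t. 0 \<le> s ==> s < t ==> t \<le> T ==>
      sq_int M (\<lambda>w. (norm (I t w - I s w + Y' s w (X t - X s)))\<^sup>2) \<and>
      l2 M (\<lambda>w. (norm (I t w - I s w + Y' s w (X t - X s)))\<^sup>2) \<le> (k * (t - s) powr \<alpha>)\<^sup>2"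
    "\<And>s t. 0 \<le> s ==> s < t ==> t \<le> T ==>
      sq_int M (\<lambda>w. (LINT r:{s..t}|lborel. b r w) + tensor_lift (Y'' s w) (XX s t) + W s t w) \<and>
      l2 M (\<lambda>w. (LINT r:{s..t}|lborel. b r w) + tensor_lift (Y'' s w) (XX s t) + W s t w) \<le> k * (t - s) powr (\<alpha> + \<beta>)"
    by (rule first_order_bounds) (rule that)
  show thesis
  proof (rule that[of "k + k * T powr \<beta>"])
    show "0 < k + k * T powr \<beta>" using k(1) by (intro add_pos_nonneg) auto
    fix s t assume st: "0 \<le> s" "s < t" "t \<le> T"
    have s: "s \<in> {0..T}" "t \<in> {0..T}" using st by auto
    note [measurable] = I_measurable[OF s(1)] I_measurable[OF s(2)] measurable_F_M[OF s(1) Y'(1)[OF s(1)]]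
    note k2 = k(2)[OF st, THEN conjunct1] k(2)[OF st, THEN conjunct2]
    note k3 = k(3)[OF st, THEN conjunct1] k(3)[OF st, THEN conjunct2]
    have pm: "(\<lambda>w. I t w - I s w + Y' s w (X t - X s)) \<in> borel_measurable M" by measurable
    have kk: "0 \<le> k * (t - s) powr \<alpha>" using k(1) by simp
    note p = l2_of_l2_square(1,2)[OF pm k2 kk]
    note S = sq_int_add[OF p(1) k3(1)]
    have e: "Y t w - Y s w = (I t w - I s w + Y' s w (X t - X s)) +
       ((LINT r:{s..t}|lborel. b r w) + tensor_lift (Y'' s w) (XX s t) + W s t w)" for w
      using Y_expansion[OF st, of w] by simp
    note i = sq_int_integrable[OF S(1)]
    have "(t - s) powr (\<alpha> + \<beta>) \<le> T powr \<beta> * (t - s) powr \<alpha>"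
      using powr_le_scale[of "t - s" T \<alpha> "\<alpha> + \<beta>"] st exps by simp
    then have "k * (t - s) powr (\<alpha> + \<beta>) \<le> k * (T powr \<beta> * (t - s) powr \<alpha>)" using k(1) by simp
    then have "(\<integral>w. norm (Y t w - Y s w) \<partial>M) \<le> (k + k * T powr \<beta>) * (t - s) powr \<alpha>"
      using i(2) S(2) p(2) k3(2) unfolding e by (simp only: distrib_right mult.assoc)
    then show "integrable M (\<lambda>w. norm (Y t w - Y s w)) \<and> (\<integral>w. norm (Y t w - Y s w) \<partial>M) \<le> (k + k * T powr \<beta>) * (t - s) powr \<alpha>"
      using integrable_norm[OF i(1)] unfolding e by simp
  qed
qed

end


lemma bilinear_form_integrable:
  fixes f g :: "'o => 'w::fin_dim_banach" and Q :: "'o => 'w \<Rightarrow>\<^sub>L 'w \<Rightarrow>\<^sub>L real"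
  assumes f: "sq_int M f" and g: "sq_int M g" and Q: "Q \<in> borel_measurable M" "\<And>w. norm (Q w) \<le> K"
  shows "integrable M (\<lambda>w. Q w (f w) (g w))"
proof (rule Bochner_Integration.integrable_bound)
  note [measurable] = sq_int_measurable[OF f] sq_int_measurable[OF g] Q(1)
  show "integrable M (\<lambda>w. K * (norm (f w) * norm (g w)))"
    using sq_int_mult(1)[OF f g] by simp
  show "(\<lambda>w. Q w (f w) (g w)) \<in> borel_measurable M" by measurable
  show "AE w in M. norm (Q w (f w) (g w)) \<le> norm (K * (norm (f w) * norm (g w)))"
  proof (rule AE_I2)
    fix w
    have K: "0 \<le> K" using order_trans[OF norm_ge_zero Q(2)] .
    have "norm (Q w (f w) (g w)) \<le> norm (Q w (f w)) * norm (g w)"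
      by (rule norm_blinfun)
    also have "\<dots> \<le> (K * norm (f w)) * norm (g w)"
      by (intro mult_right_mono order_trans[OF norm_blinfun] Q(2) norm_ge_zero)
    finally show "norm (Q w (f w) (g w)) \<le> norm (K * (norm (f w) * norm (g w)))"
      using K by (simp add: abs_mult mult.assoc)
  qed
qed

context rough_ito_expansion
begin

text \<open>Freezing the argument of \<open>G\<close> at the left end point costs a factor \<open>(t - s)\<^bsup>\<alpha> a\<^esup>\<close>. The bound on
  \<open>E |Y\<^sub>r - Y\<^sub>s|\<close> controls \<open>E |Y\<^sub>r - Y\<^sub>s|\<^sup>a\<close> through interpolation at the scale \<open>(t - s)\<^bsup>\<alpha>\<^esup>\<close>.\<close>

lemma time_regularity:
  fixes G :: "'w => 'a::fin_dim_banach \<Rightarrow>\<^sub>L real" and u :: "real => 'o => 'a"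
  assumes G: "continuous_on UNIV G" "\<And>y. norm (G y) \<le> CG" "\<And>x y. norm (G x - G y) \<le> CG * norm (x - y) powr a"
    and a: "0 < a" "a \<le> 1"
    and u: "(\<lambda>x. u (clamp (snd x)) (fst x)) \<in> borel_measurable (M \<Otimes>\<^sub>M borel)"
      "\<And>r w. r \<in> {0..T} ==> w \<in> space M ==> norm (u r w) \<le> Cu"
  obtains C where "C \<ge> 0"
    "\<And>s t. 0 \<le> s ==> s < t ==> t \<le> T ==>
      (\<integral>w. (LINT r:{s..t}|lborel. G (Y s w) (u r w)) \<partial>M) =
        (LINT r:{s..t}|lborel. (\<integral>w. G (Y s w) (u r w) \<partial>M))"
    "\<And>s t. 0 \<le> s ==> s < t ==> t \<le> T ==>
      \<bar>(LINT r:{s..t}|lborel. (\<integral>w. G (Y s w) (u r w) \<partial>M))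
        - (LINT r:{s..t}|lborel. (\<integral>w. G (Y r w) (u r w) \<partial>M))\<bar> \<le> C * (t - s) powr (1 + \<alpha> * a)"
proof -
  obtain k where k: "k > 0"
    "\<And>s t. 0 \<le> s ==> s < t ==> t \<le> T ==> integrable M (\<lambda>w. norm (Y t w - Y s w)) \<and>
       (\<integral>w. norm (Y t w - Y s w) \<partial>M) \<le> k * (t - s) powr \<alpha>"
    by (rule Y_increment_mean) (rule that)
  note [measurable] = u(1) borel_measurable_continuous_onI[OF G(1)]
  have CG: "0 \<le> CG" using order_trans[OF norm_ge_zero G(2)] .
  have Cu: "0 \<le> Cu" using u(2)[of 0] T_pos not_empty order_trans[OF norm_ge_zero] by fastforce
  have GI: "integrable M (\<lambda>w. G (y w) (u r w))" if "r \<in> {0..T}" "y \<in> borel_measurable M" for r y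
    by (rule expectation_density(1)[OF Y_measurable(2) Y(2) G(1,2) u that])
  have dens: "set_integrable lborel {0..T} (\<lambda>r. \<integral>w. G (Y r w) (u r w) \<partial>M)"
    by (rule expectation_density(2)[OF Y_measurable(2) Y(2) G(1,2) u])
  define C where "C = CG * Cu * (1 + k)"
  have C: "0 \<le> C" unfolding C_def using CG Cu k(1) by simp
  have froz: "set_integrable lborel {s..t} (\<lambda>r. \<integral>w. G (Y s w) (u r w) \<partial>M)"
    "(\<integral>w. (LINT r:{s..t}|lborel. G (Y s w) (u r w)) \<partial>M) =
        (LINT r:{s..t}|lborel. (\<integral>w. G (Y s w) (u r w) \<partial>M))"
    if st: "0 \<le> s" "s < t" "t \<le> T" for s t
  proof -
    have [measurable]: "Y s \<in> borel_measurable M" using st by (intro Y_measurable) auto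
    define f where "f r w = G (Y s w) (u r w)" for r w
    have fm: "(\<lambda>x. f (clamp (snd x)) (fst x)) \<in> borel_measurable (M \<Otimes>\<^sub>M borel)" unfolding f_def by measurable
    have fb: "\<bar>f r w\<bar> \<le> CG * Cu" if "r \<in> {0..T}" "w \<in> space M" for r w
      using order_trans[OF norm_blinfun mult_mono[OF G(2) u(2)[OF that] CG norm_ge_zero], of "Y s w"] by (simp add: f_def)
    have n: "0 \<le> CG * Cu" using CG Cu by simp
    show "set_integrable lborel {s..t} (\<lambda>r. \<integral>w. G (Y s w) (u r w) \<partial>M)"
      unfolding f_def[symmetric] by (rule fubini_bounded(3)[OF fm fb n st(1) less_imp_le[OF st(2)] st(3)])
    show "(\<integral>w. (LINT r:{s..t}|lborel. G (Y s w) (u r w)) \<partial>M) =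
        (LINT r:{s..t}|lborel. (\<integral>w. G (Y s w) (u r w) \<partial>M))"
      unfolding f_def[symmetric] by (rule fubini_bounded(4)[OF fm fb n st(1) less_imp_le[OF st(2)] st(3)])
  qed
  have reg: "\<bar>(LINT r:{s..t}|lborel. (\<integral>w. G (Y s w) (u r w) \<partial>M))
        - (LINT r:{s..t}|lborel. (\<integral>w. G (Y r w) (u r w) \<partial>M))\<bar> \<le> C * (t - s) powr (1 + \<alpha> * a)"
    if st: "0 \<le> s" "s < t" "t \<le> T" for s t
  proof -
    define h where "h = t - s"
    define \<rho> where "\<rho> = h powr \<alpha>"
    have h: "0 < h" and \<rho>: "0 < \<rho>" using st by (auto simp: h_def \<rho>_def)
    have s: "s \<in> {0..T}" using st by auto
    have pt: "\<bar>(\<integral>w. G (Y s w) (u r w) \<partial>M) - (\<integral>w. G (Y r w) (u r w) \<partial>M)\<bar> \<le> C * \<rho> powr a"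
      if r: "r \<in> {s..t}" for r
    proof (cases "r = s")
      case True
      then show ?thesis using C by simp
    next
      case False
      then have sr: "0 \<le> s" "s < r" "r \<le> T" and r0: "r \<in> {0..T}" using r st by auto
      note kk = k(2)[OF sr, THEN conjunct1] k(2)[OF sr, THEN conjunct2]
      note i = GI[OF r0 Y_measurable(2)[OF s]] GI[OF r0 Y_measurable(2)[OF r0]]
      have pw: "norm (G (Y s w) (u r w) - G (Y r w) (u r w))
          \<le> CG * Cu * (\<rho> powr a + \<rho> powr (a - 1) * norm (Y r w - Y s w))" if w: "w \<in> space M" for w
      proof -
        let ?d = "norm (Y s w - Y r w)"
        have "norm ((G (Y s w) - G (Y r w)) (u r w)) \<le> (CG * ?d powr a) * Cu"
          by (rule order_trans[OF norm_blinfun mult_mono[OF G(3) u(2)[OF r0 w] _ norm_ge_zero]]) (use CG in simp)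
        also have "\<dots> = CG * Cu * ?d powr a" by simp
        also have "\<dots> \<le> CG * Cu * (\<rho> powr a + \<rho> powr (a - 1) * ?d)"
          using CG Cu powr_le_interpolate_linear[OF norm_ge_zero \<rho> a] by (intro mult_left_mono) auto
        finally show ?thesis by (simp add: blinfun.diff_left norm_minus_commute)
      qed
      have "\<bar>(\<integral>w. G (Y s w) (u r w) \<partial>M) - (\<integral>w. G (Y r w) (u r w) \<partial>M)\<bar>
          = norm (\<integral>w. G (Y s w) (u r w) - G (Y r w) (u r w) \<partial>M)"
        using i by simp
      also have "\<dots> \<le> (\<integral>w. norm (G (Y s w) (u r w) - G (Y r w) (u r w)) \<partial>M)"
        by (rule integral_norm_bound)
      also have "\<dots> \<le> (\<integral>w. CG * Cu * (\<rho> powr a + \<rho> powr (a - 1) * norm (Y r w - Y s w)) \<partial>M)"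
        by (rule integral_mono[OF integrable_norm[OF Bochner_Integration.integrable_diff[OF i]] _ pw]) (use kk(1) in simp)
      also have "\<dots> = CG * Cu * (\<rho> powr a + \<rho> powr (a - 1) * (\<integral>w. norm (Y r w - Y s w) \<partial>M))"
        using kk(1) by (simp add: prob_space)
      also have "\<dots> \<le> CG * Cu * (\<rho> powr a + \<rho> powr (a - 1) * (k * \<rho>))"
      proof -
        have "(r - s) powr \<alpha> \<le> \<rho>" unfolding \<rho>_def h_def using exps r sr by (intro powr_mono2) auto
        then have "k * (r - s) powr \<alpha> \<le> k * \<rho>" using k(1) by simp
        then have "(\<integral>w. norm (Y r w - Y s w) \<partial>M) \<le> k * \<rho>" using kk(2) by linarith
        then show ?thesis using CG Cu by (intro mult_left_mono add_left_mono) auto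
      qed
      also have "\<dots> = C * \<rho> powr a"
      proof -
        have "\<rho> powr (a - 1) * \<rho> = \<rho> powr a" using \<rho> by (simp add: powr_diff)
        then have "\<rho> powr (a - 1) * (k * \<rho>) = k * \<rho> powr a" by (simp add: mult.left_commute)
        then show ?thesis by (simp add: C_def algebra_simps)
      qed
      finally show ?thesis .
    qed
    have sub: "set_integrable lborel {s..t} (\<lambda>r. \<integral>w. G (Y r w) (u r w) \<partial>M)"
      by (rule set_integrable_subset[OF dens]) (use st in auto)
    let ?f = "\<lambda>r. (\<integral>w. G (Y s w) (u r w) \<partial>M) - (\<integral>w. G (Y r w) (u r w) \<partial>M)"
    note d = set_integral_diff[OF froz(1)[OF st] sub]
    have "\<bar>LINT r:{s..t}|lborel. ?f r\<bar> \<le> (\<integral>r. norm (indicator {s..t} r *\<^sub>R ?f r) \<partial>lborel)"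
      unfolding set_lebesgue_integral_def real_norm_def[symmetric] by (rule integral_norm_bound)
    also have "\<dots> \<le> (\<integral>r. indicator {s..t} r * (C * \<rho> powr a) \<partial>lborel)"
    proof (rule integral_mono)
      show "integrable lborel (\<lambda>r. norm (indicator {s..t} r *\<^sub>R ?f r))" using integrable_norm[OF d(1)[unfolded set_integrable_def]] .
      show "integrable lborel (\<lambda>r. indicator {s..t} r * (C * \<rho> powr a))" using st by simp
      show "norm (indicator {s..t} r *\<^sub>R ?f r) \<le> indicator {s..t} r * (C * \<rho> powr a)" for r
        using pt[of r] by (auto simp: indicator_def)
    qed
    also have "\<dots> = (C * \<rho> powr a) * h" using st by (simp add: h_def)
    also have "\<dots> = C * h powr (1 + \<alpha> * a)" using h by (simp add: \<rho>_def powr_powr powr_add)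
    finally show ?thesis unfolding d(2) h_def .
  qed
  show thesis by (rule that[OF C froz(2) reg])
qed


text \<open>This is the heart of the argument. After the Taylor expansion at \<open>Y\<^sub>s\<close> the expectations of the
  individual terms are computed: the Ito increment disappears from the first order term and from the
  mixed second order terms, its square produces the diffusion part of the generator, the drift produces
  the other part, and the terms in \<open>\<delta>X\<close> and \<open>XX\<close> are those of the rough integrand. What is left is the
  Taylor remainder of order \<open>\<alpha>\<gamma>\<close>, the remainder \<open>W\<close> of order \<open>\<alpha> + \<beta> + \<beta>'\<close> and the error
  of order \<open>1 + \<alpha>(\<gamma> - 2)\<close> from freezing \<open>Y\<close> in the generator; all three exponents exceed \<open>1\<close>.\<close>

lemma local_expansion:
  fixes \<phi> :: "'w => real"
  assumes \<phi>: "\<phi> \<in> Cb \<gamma>" and \<gamma>: "1 / \<alpha> < \<gamma>" "\<gamma> \<le> 3"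
    and int: "\<And>s. s \<in> {0..T} ==> integrable M (\<lambda>w. transport_op (Y' s w) \<phi> (Y s w))"
      "\<And>s. s \<in> {0..T} ==> integrable M (\<lambda>w. transport_op' (Y' s w) (Y'' s w) \<phi> (Y s w))"
  obtains C \<theta> where "C \<ge> 0" "\<theta> > 1"
    "set_integrable lborel {0..T} (\<lambda>r. \<integral>w. Dfun \<phi> (Y r w) (b r w) \<partial>M)"
    "set_integrable lborel {0..T} (\<lambda>r. \<integral>w. tensor_lift (Dfun (Dfun \<phi>) (Y r w)) (diffusion (\<sigma> r w)) \<partial>M)"
    "\<And>s t. 0 \<le> s ==> s < t ==> t \<le> T ==>
      \<bar>(\<integral>w. \<phi> (Y t w) \<partial>M) - (\<integral>w. \<phi> (Y s w) \<partial>M)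
        - (LINT r:{s..t}|lborel. (\<integral>w. Dfun \<phi> (Y r w) (b r w) \<partial>M))
        - 1/2 * (LINT r:{s..t}|lborel. (\<integral>w. tensor_lift (Dfun (Dfun \<phi>) (Y r w)) (diffusion (\<sigma> r w)) \<partial>M))
        - ((\<integral>w. transport_op (Y' s w) \<phi> (Y s w) \<partial>M) (X t - X s)
          + tensor_lift (\<integral>w. transport_op' (Y' s w) (Y'' s w) \<phi> (Y s w) \<partial>M) (XX s t))\<bar>
      \<le> C * (t - s) powr \<theta>"
proof -
  have "2 \<le> 1 / \<alpha>" using exps by (simp add: field_simps)
  then have \<gamma>2: "2 < \<gamma>" using \<gamma> by linarith
  have \<alpha>\<gamma>: "1 < \<alpha> * \<gamma>" using \<gamma>(1) exps by (simp add: field_simps)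
  define L where "L s w = Dfun \<phi> (Y s w)" for s w
  define Q where "Q s w = Dfun (Dfun \<phi>) (Y s w)" for s w
  obtain C\<phi> where C\<phi>: "C\<phi> > 0" "\<And>y. norm (Dfun \<phi> y) \<le> C\<phi>" "\<And>y. norm (Dfun (Dfun \<phi>) y) \<le> C\<phi>"
    "\<And>x y. norm (Dfun (Dfun \<phi>) x - Dfun (Dfun \<phi>) y) \<le> C\<phi> * norm (x - y) powr (\<gamma> - 2)"
    "\<And>x y. norm (Dfun \<phi> x - Dfun \<phi> y) \<le> C\<phi> * norm (x - y)"
    by (rule Cb_bounds[OF \<phi>]) (rule that)
  note cont = Cb_continuous(2,3)[OF \<phi> \<gamma>2]
  note [measurable] = cont[THEN borel_measurable_continuous_onI]
  \<comment> \<open>the second order part of the generator as a function of the diffusion coefficient\<close>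
  define H where "H y = lift_blinfun (Dfun (Dfun \<phi>) y)" for y
  have Happ: "H y A = tensor_lift (Dfun (Dfun \<phi>) y) A" for y A
    unfolding H_def by (rule lift_blinfun_apply)
  obtain KH where KH: "0 < KH" "\<And>K :: 'w \<Rightarrow>\<^sub>L 'w \<Rightarrow>\<^sub>L real. norm (lift_blinfun K) \<le> norm K * KH"
    using bounded_linear.pos_bounded[OF bounded_linear_lift_blinfun] by blast
  have Hcont: "continuous_on UNIV H"
    unfolding H_def by (rule bounded_linear.continuous_on[OF bounded_linear_lift_blinfun cont(2)])
  have Hb: "norm (H y) \<le> C\<phi> * KH" for y
    unfolding H_def by (rule order_trans[OF KH(2) mult_right_mono[OF C\<phi>(3)]]) (use KH in simp)
  have Hh: "norm (H x - H y) \<le> C\<phi> * KH * norm (x - y) powr (\<gamma> - 2)" for x y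
  proof -
    have "norm (H x - H y) = norm (lift_blinfun (Dfun (Dfun \<phi>) x - Dfun (Dfun \<phi>) y))"
      unfolding H_def by (simp add: linear_diff[OF bounded_linear.linear[OF bounded_linear_lift_blinfun]])
    also have "\<dots> \<le> (C\<phi> * norm (x - y) powr (\<gamma> - 2)) * KH"
      by (rule order_trans[OF KH(2) mult_right_mono[OF C\<phi>(4)]]) (use KH in simp)
    finally show ?thesis by (simp add: mult_ac)
  qed
  obtain Cd where Cd: "Cd \<ge> 0" "\<And>A :: 'u \<Rightarrow>\<^sub>L 'w. norm A \<le> c ==> norm (diffusion A) \<le> Cd"
    using diffusion_bound[of c] by blast
  note bjoint = progressive_joint[OF b(1)]
  note [measurable] = bjoint progressive_joint[OF \<sigma>(1)]
  have djoint: "(\<lambda>x. diffusion (\<sigma> (clamp (snd x)) (fst x))) \<in> borel_measurable (M \<Otimes>\<^sub>M borel)" by measurable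
  have dbound: "norm (diffusion (\<sigma> r w)) \<le> Cd" if "r \<in> {0..T}" "w \<in> space M" for r w
    by (rule Cd(2)[OF \<sigma>(2)[OF that]])
  have C5: "norm (Dfun \<phi> x - Dfun \<phi> y) \<le> C\<phi> * norm (x - y) powr 1" for x y using C\<phi>(5)[of x y] by simp
  have \<gamma>1: "0 < \<gamma> - 2" "\<gamma> - 2 \<le> 1" using \<gamma>2 \<gamma>(2) by auto
  obtain D1 where D1: "D1 \<ge> 0"
    "\<And>s t. 0 \<le> s ==> s < t ==> t \<le> T ==>
      (\<integral>w. (LINT r:{s..t}|lborel. Dfun \<phi> (Y s w) (b r w)) \<partial>M) =
        (LINT r:{s..t}|lborel. (\<integral>w. Dfun \<phi> (Y s w) (b r w) \<partial>M))"
    "\<And>s t. 0 \<le> s ==> s < t ==> t \<le> T ==>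
      \<bar>(LINT r:{s..t}|lborel. (\<integral>w. Dfun \<phi> (Y s w) (b r w) \<partial>M))
        - (LINT r:{s..t}|lborel. (\<integral>w. Dfun \<phi> (Y r w) (b r w) \<partial>M))\<bar> \<le> D1 * (t - s) powr (1 + \<alpha> * 1)"
    by (rule time_regularity[OF cont(1) C\<phi>(2) C5 zero_less_one order_refl bjoint b(2)]) (assumption, assumption, rule that)
  obtain D2 where D2: "D2 \<ge> 0"
    "\<And>s t. 0 \<le> s ==> s < t ==> t \<le> T ==>
      (\<integral>w. (LINT r:{s..t}|lborel. H (Y s w) (diffusion (\<sigma> r w))) \<partial>M) =
        (LINT r:{s..t}|lborel. (\<integral>w. H (Y s w) (diffusion (\<sigma> r w)) \<partial>M))"
    "\<And>s t. 0 \<le> s ==> s < t ==> t \<le> T ==>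
      \<bar>(LINT r:{s..t}|lborel. (\<integral>w. H (Y s w) (diffusion (\<sigma> r w)) \<partial>M))
        - (LINT r:{s..t}|lborel. (\<integral>w. H (Y r w) (diffusion (\<sigma> r w)) \<partial>M))\<bar> \<le> D2 * (t - s) powr (1 + \<alpha> * (\<gamma> - 2))"
    by (rule time_regularity[OF Hcont Hb Hh \<gamma>1 djoint dbound]) (assumption, assumption, rule that)
  have dens1: "set_integrable lborel {0..T} (\<lambda>r. \<integral>w. Dfun \<phi> (Y r w) (b r w) \<partial>M)"
    by (rule expectation_density(2)[OF Y_measurable(2) Y(2) cont(1) C\<phi>(2) bjoint b(2)])
  have dens2: "set_integrable lborel {0..T} (\<lambda>r. \<integral>w. H (Y r w) (diffusion (\<sigma> r w)) \<partial>M)"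
    by (rule expectation_density(2)[OF Y_measurable(2) Y(2) Hcont Hb djoint dbound])
  obtain k where k: "k > 0"
    "\<And>s t. 0 \<le> s ==> s < t ==> t \<le> T ==>
      sq_int M (\<lambda>w. I t w - I s w) \<and> sq_int M (\<lambda>w. Y' s w (X t - X s)) \<and>
      sq_int M (\<lambda>w. LINT r:{s..t}|lborel. b r w) \<and> sq_int M (\<lambda>w. tensor_lift (Y'' s w) (XX s t))"
    "\<And>s t. 0 \<le> s ==> s < t ==> t \<le> T ==>
      sq_int M (\<lambda>w. (norm (I t w - I s w + Y' s w (X t - X s)))\<^sup>2) \<and>
      l2 M (\<lambda>w. (norm (I t w - I s w + Y' s w (X t - X s)))\<^sup>2) \<le> (k * (t - s) powr \<alpha>)\<^sup>2"
    "\<And>s t. 0 \<le> s ==> s < t ==> t \<le> T ==>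
      sq_int M (\<lambda>w. (LINT r:{s..t}|lborel. b r w) + tensor_lift (Y'' s w) (XX s t) + W s t w) \<and>
      l2 M (\<lambda>w. (LINT r:{s..t}|lborel. b r w) + tensor_lift (Y'' s w) (XX s t) + W s t w) \<le> k * (t - s) powr (\<alpha> + \<beta>)"
    by (rule first_order_bounds) (rule that)
  obtain Ct where Ct: "Ct > 0" "\<And>y p q c \<rho> \<mu>. y \<in> borel_measurable M ==> p \<in> borel_measurable M ==>
      sq_int M (\<lambda>w. (norm (p w))\<^sup>2) ==> l2 M (\<lambda>w. (norm (p w))\<^sup>2) \<le> (c * \<rho>)\<^sup>2 ==> 0 < \<rho> ==> 0 \<le> c ==>
      sq_int M q ==> l2 M q \<le> \<mu> ==>
    integrable M (\<lambda>w. Dfun \<phi> (y w) (p w + q w)) \<and>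
    integrable M (\<lambda>w. Dfun (Dfun \<phi>) (y w) (p w) (p w)) \<and>
    \<bar>(\<integral>w. \<phi> (y w + (p w + q w)) \<partial>M) - (\<integral>w. \<phi> (y w) \<partial>M)
      - (\<integral>w. Dfun \<phi> (y w) (p w + q w) \<partial>M)
      - 1/2 * (\<integral>w. Dfun (Dfun \<phi>) (y w) (p w) (p w) \<partial>M)\<bar>
    \<le> Ct * ((c\<^sup>2 + c ^ 4) * \<rho> powr \<gamma> + c * \<rho> * \<mu> + \<mu>\<^sup>2)"
    by (rule taylor_expectation[OF \<phi> \<gamma>2 \<gamma>(2)]) (rule that)
  obtain cN where ito0:
    "\<And>s t \<Lambda>. 0 \<le> s ==> s < t ==> t \<le> T ==> \<Lambda> \<in> borel_measurable (F s) ==> sq_int M (\<Lambda> :: 'o => 'w \<Rightarrow>\<^sub>L real) ==>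
       (\<integral>w. \<Lambda> w (I t w - I s w) \<partial>M) = 0"
    and ito2: "\<And>s t Q. 0 \<le> s ==> s < t ==> t \<le> T ==> Q \<in> borel_measurable (F s) ==> (\<exists>K. \<forall>w. norm (Q w :: 'w \<Rightarrow>\<^sub>L 'w \<Rightarrow>\<^sub>L real) \<le> K) ==>
       (\<integral>w. Q w (I t w - I s w) (I t w - I s w) \<partial>M)
       = (\<integral>w. (LINT r:{s..t}|lborel. tensor_lift (Q w) (diffusion (\<sigma> r w))) \<partial>M)"
    by (rule ito_increment_vector[OF \<sigma>(2) less_imp_le[OF c] \<sigma>(1) I]) (assumption, assumption, rule that)
  define \<theta> where "\<theta> = min (\<alpha> * \<gamma>) (min (\<alpha> + \<beta> + \<beta>') (1 + \<alpha> * (\<gamma> - 2)))"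
  have \<theta>1: "1 < \<theta>" unfolding \<theta>_def using \<alpha>\<gamma> exps \<gamma>1 by simp
  have \<alpha>1: "\<alpha> * (\<gamma> - 2) \<le> \<alpha> * 1" using \<gamma>1 exps by (intro mult_left_mono) auto
  have le\<theta>: "\<theta> \<le> \<alpha> * \<gamma>" "\<theta> \<le> \<alpha> + \<beta> + \<beta>'" "\<theta> \<le> 1 + \<alpha> * (\<gamma> - 2)" "\<theta> \<le> 1 + \<alpha> * 1"
    "\<theta> \<le> \<alpha> + (\<alpha> + \<beta>)" "\<theta> \<le> (\<alpha> + \<beta>) + (\<alpha> + \<beta>)"
    using exps \<alpha>1 unfolding \<theta>_def by auto
  define S where "S x = T powr (x - \<theta>)" for x
  have Snn: "0 \<le> S x" for x by (simp add: S_def)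
  define C where "C = Ct * ((k\<^sup>2 + k ^ 4) * S (\<alpha> * \<gamma>) + k * k * S (\<alpha> + (\<alpha> + \<beta>)) + k\<^sup>2 * S ((\<alpha> + \<beta>) + (\<alpha> + \<beta>)))
    + C\<phi> * (c * S (\<alpha> + \<beta> + \<beta>')) + D1 * S (1 + \<alpha> * 1) + 1/2 * (D2 * S (1 + \<alpha> * (\<gamma> - 2)))"
  have Cnn: "0 \<le> C" unfolding C_def
    using Snn k(1) Ct(1) C\<phi>(1) c D1(1) D2(1) by (intro add_nonneg_nonneg mult_nonneg_nonneg) auto
  have main: "\<bar>(\<integral>w. \<phi> (Y t w) \<partial>M) - (\<integral>w. \<phi> (Y s w) \<partial>M)
        - (LINT r:{s..t}|lborel. (\<integral>w. Dfun \<phi> (Y r w) (b r w) \<partial>M))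
        - 1/2 * (LINT r:{s..t}|lborel. (\<integral>w. H (Y r w) (diffusion (\<sigma> r w)) \<partial>M))
        - ((\<integral>w. transport_op (Y' s w) \<phi> (Y s w) \<partial>M) (X t - X s)
          + tensor_lift (\<integral>w. transport_op' (Y' s w) (Y'' s w) \<phi> (Y s w) \<partial>M) (XX s t))\<bar>
      \<le> C * (t - s) powr \<theta>" if st: "0 \<le> s" "s < t" "t \<le> T" for s t
  proof -
    define h where "h = t - s"
    have h: "0 < h" "h \<le> T" using st by (auto simp: h_def)
    have s: "s \<in> {0..T}" "t \<in> {0..T}" using st by auto
    define N where "N w = I t w - I s w" for w
    define A where "A w = Y' s w (X t - X s)" for w
    define D where "D w = (LINT r:{s..t}|lborel. b r w)" for w
    define E where "E w = tensor_lift (Y'' s w) (XX s t)" for w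
    define rem where "rem = W s t"
    note LFm = measurable_compose[OF Y_measurable(1)[OF s(1)] cont(1)[THEN borel_measurable_continuous_onI], folded L_def]
    note QFm = measurable_compose[OF Y_measurable(1)[OF s(1)] cont(2)[THEN borel_measurable_continuous_onI], folded Q_def]
    note LMm = measurable_F_M[OF s(1) LFm] and QMm = measurable_F_M[OF s(1) QFm]
    have Lb: "norm (L s w) \<le> C\<phi>" and Qb: "norm (Q s w) \<le> C\<phi>" for w using C\<phi>(2,3) by (auto simp: L_def Q_def)
    have sqN: "sq_int M N" and sqA: "sq_int M A" and sqD: "sq_int M D" and sqE: "sq_int M E" and sqr: "sq_int M rem"
      using k(2)[OF st] W(1)[OF st] by (auto simp: N_def[abs_def] A_def[abs_def] D_def[abs_def] E_def[abs_def] rem_def)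
    have LI: "integrable M (\<lambda>w. L s w (f w))" if "sq_int M f" for f
      by (rule integrable_blinfun_bounded[OF sq_int_integrable(1)[OF that] LMm Lb])
    have QI: "integrable M (\<lambda>w. Q s w (f w) (g w))" if "sq_int M f" "sq_int M g" for f g
      by (rule bilinear_form_integrable[OF that QMm Qb])
    have pm: "(\<lambda>w. N w + A w) \<in> borel_measurable M"
      using sq_int_measurable[OF sqN] sq_int_measurable[OF sqA] by measurable
    have p2: "sq_int M (\<lambda>w. (norm (N w + A w))\<^sup>2)" "l2 M (\<lambda>w. (norm (N w + A w))\<^sup>2) \<le> (k * h powr \<alpha>)\<^sup>2"
      using k(3)[OF st] by (auto simp: N_def A_def h_def)
    have q2: "sq_int M (\<lambda>w. D w + E w + rem w)" "l2 M (\<lambda>w. D w + E w + rem w) \<le> k * h powr (\<alpha> + \<beta>)"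
      using k(4)[OF st] by (auto simp: D_def E_def rem_def h_def)
    have \<rho>: "0 < h powr \<alpha>" using h by simp
    define R where "R = (\<integral>w. \<phi> (Y t w) \<partial>M) - (\<integral>w. \<phi> (Y s w) \<partial>M)
      - (\<integral>w. L s w ((N w + A w) + (D w + E w + rem w)) \<partial>M)
      - 1/2 * (\<integral>w. Q s w (N w + A w) (N w + A w) \<partial>M)"
    have Yt: "Y t w = Y s w + ((N w + A w) + (D w + E w + rem w))" for w
      using Y_expansion[OF st, of w] by (simp only: N_def A_def D_def E_def rem_def)
    note tay = Ct(2)[OF Y_measurable(2)[OF s(1)] pm p2 \<rho> less_imp_le[OF k(1)] q2, THEN conjunct2, THEN conjunct2]
    have R: "\<bar>R\<bar> \<le> Ct * ((k\<^sup>2 + k ^ 4) * (h powr \<alpha>) powr \<gamma> + k * h powr \<alpha> * (k * h powr (\<alpha> + \<beta>)) + (k * h powr (\<alpha> + \<beta>))\<^sup>2)"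
      unfolding R_def L_def Q_def Yt by (rule tay)
    have EL: "(\<integral>w. L s w ((N w + A w) + (D w + E w + rem w)) \<partial>M)
       = (\<integral>w. L s w (N w) \<partial>M) + (\<integral>w. L s w (A w) \<partial>M) + (\<integral>w. L s w (D w) \<partial>M)
         + (\<integral>w. L s w (E w) \<partial>M) + (\<integral>w. L s w (rem w) \<partial>M)"
      using LI[OF sqN] LI[OF sqA] LI[OF sqD] LI[OF sqE] LI[OF sqr]
      by (simp add: blinfun.add_right)
    have Lsq: "sq_int M (L s)"
    proof -
      have "sq_int M (\<lambda>w. C\<phi>)" by (simp add: sq_int_def)
      then show ?thesis using sq_int_mono(1)[OF LMm, of "\<lambda>w. C\<phi>"] Lb C\<phi>(1) by simp
    qed
    have EN: "(\<integral>w. L s w (N w) \<partial>M) = 0"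
      unfolding N_def by (rule ito0[OF st LFm Lsq])
    have ED: "(\<integral>w. L s w (D w) \<partial>M) = (LINT r:{s..t}|lborel. (\<integral>w. Dfun \<phi> (Y s w) (b r w) \<partial>M))"
    proof -
      have "(\<integral>w. L s w (D w) \<partial>M) = (\<integral>w. (LINT r:{s..t}|lborel. Dfun \<phi> (Y s w) (b r w)) \<partial>M)"
      proof (rule Bochner_Integration.integral_cong[OF refl])
        fix w assume w: "w \<in> space M"
        have "set_integrable lborel {s..t} (\<lambda>r. b r w)"
          by (rule time_integral_bounded(1)[OF bjoint b(2) less_imp_le[OF c] st(1) less_imp_le[OF st(2)] st(3) w])
        then have "integrable lborel (\<lambda>r. indicator {s..t} r *\<^sub>R b r w)" unfolding set_integrable_def .
        from integral_bounded_linear[OF blinfun.bounded_linear_right this, of "L s w"]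
        show "L s w (D w) = (LINT r:{s..t}|lborel. Dfun \<phi> (Y s w) (b r w))"
          unfolding D_def set_lebesgue_integral_def L_def by (simp add: blinfun.scaleR_right)
      qed
      also have "\<dots> = (LINT r:{s..t}|lborel. (\<integral>w. Dfun \<phi> (Y s w) (b r w) \<partial>M))" by (rule D1(2)[OF st])
      finally show ?thesis .
    qed
    have Ew: "\<bar>\<integral>w. L s w (rem w) \<partial>M\<bar> \<le> C\<phi> * (c * h powr (\<alpha> + \<beta> + \<beta>'))"
      unfolding rem_def h_def by (rule W(2)[OF st LFm Lb])
    \<comment> \<open>the weight \<open>D\<^sup>2\<phi>(Y\<^sub>s)(A)\<close> belongs to the past, so the Ito increment averages out against it\<close>
    have cross: "(\<integral>w. Q s w (A w) (N w) \<partial>M) = 0"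
      unfolding N_def
    proof (rule ito0[OF st])
      note [measurable] = QFm Y'(1)[OF s(1)]
      have [measurable]: "A \<in> borel_measurable (F s)" unfolding A_def[abs_def] by measurable
      show "(\<lambda>w. Q s w (A w)) \<in> borel_measurable (F s)" by measurable
      then have m: "(\<lambda>w. Q s w (A w)) \<in> borel_measurable M" by (rule measurable_F_M[OF s(1)])
      have ae: "AE w in M. norm (Q s w (A w)) \<le> norm (C\<phi> *\<^sub>R A w)"
        using order_trans[OF norm_blinfun mult_right_mono[OF Qb norm_ge_zero]] C\<phi>(1) by (intro AE_I2) simp
      show "sq_int M (\<lambda>w. Q s w (A w))" by (rule sq_int_mono(1)[OF m sq_int_scaleR(1)[OF sqA] ae])
    qed
    have EQ: "(\<integral>w. Q s w (N w + A w) (N w + A w) \<partial>M)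
        = (\<integral>w. Q s w (N w) (N w) \<partial>M) + (\<integral>w. Q s w (A w) (A w) \<partial>M)"
    proof -
      have e: "Q s w (N w + A w) (N w + A w)
        = Q s w (N w) (N w) + Q s w (A w) (A w)
          + 2 * Q s w (A w) (N w)" for w
        using Cb_second_derivative_symmetric[OF \<phi>, of "Y s w" "N w" "A w"]
        by (simp add: Q_def blinfun.add_right blinfun.add_left)
      show ?thesis unfolding e
        using QI[OF sqN sqN] QI[OF sqA sqA] QI[OF sqA sqN] cross by simp
    qed
    have ENN: "(\<integral>w. Q s w (N w) (N w) \<partial>M)
        = (LINT r:{s..t}|lborel. (\<integral>w. H (Y s w) (diffusion (\<sigma> r w)) \<partial>M))"
      using ito2[OF st QFm] Qb D2(2)[OF st] by (auto simp: N_def Happ Q_def)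
    have gX: "(\<integral>w. transport_op (Y' s w) \<phi> (Y s w) \<partial>M) (X t - X s) = (\<integral>w. L s w (A w) \<partial>M)"
      using integral_bounded_linear[OF blinfun.bounded_linear_left int(1)[OF s(1)], of "X t - X s"]
      by (simp add: transport_op_def L_def A_def)
    have gXX: "tensor_lift (\<integral>w. transport_op' (Y' s w) (Y'' s w) \<phi> (Y s w) \<partial>M) (XX s t)
        = 1/2 * (\<integral>w. Q s w (A w) (A w) \<partial>M) + (\<integral>w. L s w (E w) \<partial>M)"
    proof -
      have "tensor_lift (\<integral>w. transport_op' (Y' s w) (Y'' s w) \<phi> (Y s w) \<partial>M) (XX s t)
          = (\<integral>w. tensor_lift (transport_op' (Y' s w) (Y'' s w) \<phi> (Y s w)) (XX s t) \<partial>M)"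
        by (rule integral_bounded_linear[OF tensor_lift.bounded_linear_left int(2)[OF s(1)], symmetric])
      also have "\<dots> = (\<integral>w. 1/2 * Q s w (A w) (A w) + L s w (E w) \<partial>M)"
        unfolding tensor_lift_transport_op'[OF \<phi> X(1) st] Q_def A_def L_def E_def ..
      also have "\<dots> = 1/2 * (\<integral>w. Q s w (A w) (A w) \<partial>M) + (\<integral>w. L s w (E w) \<partial>M)"
        using QI[OF sqA sqA] LI[OF sqE] by simp
      finally show ?thesis .
    qed
    define d1 where "d1 = (LINT r:{s..t}|lborel. (\<integral>w. Dfun \<phi> (Y s w) (b r w) \<partial>M))
        - (LINT r:{s..t}|lborel. (\<integral>w. Dfun \<phi> (Y r w) (b r w) \<partial>M))"
    define d2 where "d2 = (LINT r:{s..t}|lborel. (\<integral>w. H (Y s w) (diffusion (\<sigma> r w)) \<partial>M))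
        - (LINT r:{s..t}|lborel. (\<integral>w. H (Y r w) (diffusion (\<sigma> r w)) \<partial>M))"
    define ew where "ew = (\<integral>w. L s w (rem w) \<partial>M)"
    let ?lhs = "(\<integral>w. \<phi> (Y t w) \<partial>M) - (\<integral>w. \<phi> (Y s w) \<partial>M)
        - (LINT r:{s..t}|lborel. (\<integral>w. Dfun \<phi> (Y r w) (b r w) \<partial>M))
        - 1/2 * (LINT r:{s..t}|lborel. (\<integral>w. H (Y r w) (diffusion (\<sigma> r w)) \<partial>M))
        - ((\<integral>w. transport_op (Y' s w) \<phi> (Y s w) \<partial>M) (X t - X s)
          + tensor_lift (\<integral>w. transport_op' (Y' s w) (Y'' s w) \<phi> (Y s w) \<partial>M) (XX s t))"
    have split: "?lhs = R + ew + d1 + 1/2 * d2"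
      unfolding R_def EL EQ EN ED ENN gX gXX d1_def d2_def ew_def by algebra
    have sc: "h powr x \<le> S x * h powr \<theta>" if "\<theta> \<le> x" for x
      unfolding S_def by (rule powr_le_scale[OF h that])
    have "\<bar>R\<bar> \<le> Ct * ((k\<^sup>2 + k ^ 4) * h powr (\<alpha> * \<gamma>) + k * k * h powr (\<alpha> + (\<alpha> + \<beta>)) + k\<^sup>2 * h powr ((\<alpha> + \<beta>) + (\<alpha> + \<beta>)))"
      using R by (simp only: powr_powr powr_add power2_eq_square mult_ac)
    also have "\<dots> \<le> Ct * ((k\<^sup>2 + k ^ 4) * (S (\<alpha> * \<gamma>) * h powr \<theta>) + k * k * (S (\<alpha> + (\<alpha> + \<beta>)) * h powr \<theta>)
        + k\<^sup>2 * (S ((\<alpha> + \<beta>) + (\<alpha> + \<beta>)) * h powr \<theta>))"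
      using Ct(1) k(1) by (intro mult_left_mono add_mono sc le\<theta>) auto
    finally have b1: "\<bar>R\<bar> \<le> Ct * ((k\<^sup>2 + k ^ 4) * (S (\<alpha> * \<gamma>) * h powr \<theta>) + k * k * (S (\<alpha> + (\<alpha> + \<beta>)) * h powr \<theta>)
        + k\<^sup>2 * (S ((\<alpha> + \<beta>) + (\<alpha> + \<beta>)) * h powr \<theta>))" .
    have b2: "\<bar>ew\<bar> \<le> C\<phi> * (c * (S (\<alpha> + \<beta> + \<beta>') * h powr \<theta>))"
      unfolding ew_def using C\<phi>(1) c by (intro order_trans[OF Ew] mult_left_mono sc le\<theta>) auto
    have b3: "\<bar>d1\<bar> \<le> D1 * (S (1 + \<alpha> * 1) * h powr \<theta>)"
      unfolding d1_def using D1(1) by (intro order_trans[OF D1(3)[OF st, folded h_def]] mult_left_mono sc le\<theta>) auto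
    have b4: "\<bar>d2\<bar> \<le> D2 * (S (1 + \<alpha> * (\<gamma> - 2)) * h powr \<theta>)"
      unfolding d2_def using D2(1) by (intro order_trans[OF D2(3)[OF st, folded h_def]] mult_left_mono sc le\<theta>) auto
    have Ch: "C * h powr \<theta> = Ct * ((k\<^sup>2 + k ^ 4) * (S (\<alpha> * \<gamma>) * h powr \<theta>) + k * k * (S (\<alpha> + (\<alpha> + \<beta>)) * h powr \<theta>)
        + k\<^sup>2 * (S ((\<alpha> + \<beta>) + (\<alpha> + \<beta>)) * h powr \<theta>)) + C\<phi> * (c * (S (\<alpha> + \<beta> + \<beta>') * h powr \<theta>))
        + D1 * (S (1 + \<alpha> * 1) * h powr \<theta>) + 1/2 * (D2 * (S (1 + \<alpha> * (\<gamma> - 2)) * h powr \<theta>))"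
      unfolding C_def by algebra
    have "\<bar>R + ew + d1 + 1/2 * d2\<bar> \<le> \<bar>R\<bar> + \<bar>ew\<bar> + \<bar>d1\<bar> + 1/2 * \<bar>d2\<bar>" by linarith
    then have "\<bar>R + ew + d1 + 1/2 * d2\<bar> \<le> C * h powr \<theta>" unfolding Ch using b1 b2 b3 b4 by linarith
    then show ?thesis unfolding split h_def .
  qed
  show thesis by (rule that[OF Cnn \<theta>1 dens1 dens2[unfolded Happ] main[unfolded Happ]])
qed

end


section \<open>The forward equation\<close>

lemma set_integral_split:
  fixes f :: "real => 'a::{banach,second_countable_topology}"
  assumes f: "set_integrable lborel {r..t} f" and rst: "r \<le> s" "s \<le> t"
  shows "(LINT x:{r..t}|lborel. f x) = (LINT x:{r..s}|lborel. f x) + (LINT x:{s..t}|lborel. f x)"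
proof -
  have "{r..t} = {r..s} \<union> {s..t}" using rst by auto
  moreover have "(LINT x:{r..s} \<union> {s..t}|lborel. f x) = (LINT x:{r..s}|lborel. f x) + (LINT x:{s..t}|lborel. f x)"
  proof (rule set_integral_Un_AE)
    show "AE x in lborel. \<not> (x \<in> {r..s} \<and> x \<in> {s..t})"
      using AE_lborel_singleton[of s] by eventually_elim auto
    show "set_integrable lborel {r..s} f" "set_integrable lborel {s..t} f"
      using rst by (auto intro!: set_integrable_subset[OF f])
  qed auto
  ultimately show ?thesis by simp
qed

text \<open>\<open>G(\<eta>)\<close> is measurable with respect to \<open>\<eta>\<close>, so it may be taken out of the conditional expectation.\<close>

lemma (in prob_space) cond_exp_given_blinfun:
  fixes \<eta> :: "'a => 'w::fin_dim_banach" and \<xi> :: "'a => 'e::fin_dim_banach" and G :: "'w => 'e \<Rightarrow>\<^sub>L real"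
  assumes h: "cond_exp_given M \<xi> \<eta> h" and \<eta>: "\<eta> \<in> borel_measurable M"
    and G: "G \<in> borel_measurable borel" "\<And>y. norm (G y) \<le> C"
  shows "integrable (distr M borel \<eta>) (\<lambda>y. G y (h y))"
    and "(\<integral>y. G y (h y) \<partial>distr M borel \<eta>) = (\<integral>w. G (\<eta> w) (\<xi> w) \<partial>M)"
    and "integrable M (\<lambda>w. G (\<eta> w) (\<xi> w))"
proof -
  let ?V = "vimage_algebra (space M) \<eta> borel"
  have hm: "h \<in> borel_measurable borel" and he: "has_cond_exp M ?V \<xi> (\<lambda>w. h (\<eta> w))"
    using h by (auto simp: cond_exp_given_def)
  have "subalgebra M ?V"
    using \<eta> by (auto simp: subalgebra_def sets_vimage_algebra2 measurable_sets)
  then interpret finite_measure_subalgebra M ?V by unfold_locales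
  note [measurable] = hm \<eta> G(1)
  have GV: "(\<lambda>w. G (\<eta> w)) \<in> borel_measurable ?V"
    by (rule measurable_compose[OF measurable_vimage_algebra1 G(1)]) auto
  have GM: "(\<lambda>w. G (\<eta> w)) \<in> borel_measurable M" by measurable
  have ih: "integrable M (\<lambda>w. h (\<eta> w))" "integrable M \<xi>" using he by (auto simp: has_cond_exp_def)
  have i: "integrable M (\<lambda>w. G (\<eta> w) (h (\<eta> w)))"
    by (rule integrable_blinfun_bounded[OF ih(1) GM G(2)])
  have m: "(\<lambda>y. G y (h y)) \<in> borel_measurable borel" by measurable
  show "integrable (distr M borel \<eta>) (\<lambda>y. G y (h y))"
    using i integrable_distr_eq[OF \<eta> m] by simp
  show "integrable M (\<lambda>w. G (\<eta> w) (\<xi> w))"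
    by (rule integrable_blinfun_bounded[OF ih(2) GM G(2)])
  show "(\<integral>y. G y (h y) \<partial>distr M borel \<eta>) = (\<integral>w. G (\<eta> w) (\<xi> w) \<partial>M)"
    unfolding integral_distr[OF \<eta> m] by (rule has_cond_exp_blinfun[OF he GV G(2)])
qed

lemma (in prob_space) cond_exp_given_distr:
  fixes \<eta> :: "'a => 'w::fin_dim_banach" and \<xi> :: "'a => 'e::fin_dim_banach"
  assumes h: "cond_exp_given M \<xi> \<eta> h" and \<eta>: "\<eta> \<in> borel_measurable M"
  shows "integrable M \<xi>" "integrable (distr M borel \<eta>) h" "(\<integral>y. h y \<partial>distr M borel \<eta>) = (\<integral>w. \<xi> w \<partial>M)"
proof -
  let ?V = "vimage_algebra (space M) \<eta> borel"
  have hm: "h \<in> borel_measurable borel" and he: "has_cond_exp M ?V \<xi> (\<lambda>w. h (\<eta> w))"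
    using h by (auto simp: cond_exp_given_def)
  have i: "integrable M (\<lambda>w. h (\<eta> w))" and i2: "integrable M \<xi>" using he by (auto simp: has_cond_exp_def)
  show "integrable M \<xi>" by (rule i2)
  show "integrable (distr M borel \<eta>) h" using i integrable_distr_eq[OF \<eta> hm] by simp
  have "space M \<in> sets ?V" using sets.top[of ?V] by (simp add: space_vimage_algebra)
  then have "(LINT w:space M|M. \<xi> w) = (LINT w:space M|M. h (\<eta> w))"
    using he by (auto simp: has_cond_exp_def)
  then show "(\<integral>y. h y \<partial>distr M borel \<eta>) = (\<integral>w. \<xi> w \<partial>M)"
    unfolding integral_distr[OF \<eta> hm] set_integral_space[OF i] set_integral_space[OF i2] by simp
qed

context filtered_space
begin

lemma expectation_continuous:
  fixes Y :: "real => 'o => 'w::fin_dim_banach" and \<phi> :: "'w => real"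
  assumes Y: "\<And>t. t \<in> {0..T} ==> Y t \<in> borel_measurable M" "continuous_process M T Y"
    and \<phi>: "continuous_on UNIV \<phi>" "\<And>y. \<bar>\<phi> y\<bar> \<le> C"
  shows "continuous_on {0..T} (\<lambda>t. \<integral>w. \<phi> (Y t w) \<partial>M)"
  unfolding continuous_on_sequentially
proof (intro allI ballI impI, elim conjE)
  fix x :: "nat => real" and a assume a: "a \<in> {0..T}" and x: "\<forall>n. x n \<in> {0..T}" "x \<longlonglongrightarrow> a"
  note [measurable] = borel_measurable_continuous_onI[OF \<phi>(1)]
  have Ym[measurable]: "Y (x n) \<in> borel_measurable M" "Y a \<in> borel_measurable M" for n using Y(1) x a by auto
  have "(\<lambda>n. \<integral>w. \<phi> (Y (x n) w) \<partial>M) \<longlonglongrightarrow> (\<integral>w. \<phi> (Y a w) \<partial>M)"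
  proof (rule integral_dominated_convergence[where w="\<lambda>_. C"])
    show "AE w in M. (\<lambda>n. \<phi> (Y (x n) w)) \<longlonglongrightarrow> \<phi> (Y a w)"
      using Y(2) unfolding continuous_process_def
    proof eventually_elim
      case (elim w)
      have "(\<lambda>n. Y (x n) w) \<longlonglongrightarrow> Y a w"
        using continuous_on_tendsto_compose[OF elim x(2) a] x(1) by simp
      then show ?case by (rule continuous_on_tendsto_compose[OF \<phi>(1)]) auto
    qed
    show "AE w in M. norm (\<phi> (Y (x n) w)) \<le> C" for n using \<phi>(2) by simp
  qed (simp, measurable)
  then show "((\<lambda>t. \<integral>w. \<phi> (Y t w) \<partial>M) \<circ> x) \<longlonglongrightarrow> (\<integral>w. \<phi> (Y a w) \<partial>M)" by (simp add: o_def)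
qed

end

text \<open>The remainder \<open>W\<close> is defined through \<open>Y\<close>, \<open>b\<close> and \<open>I\<close>, which are measurable; it agrees almost surely
  with the remainder of the rough stochastic integral.\<close>

lemma (in brownian_space) rough_ito_process_expansion:
  fixes X :: "real => 'v::fin_dim_banach" and b :: "real => 'o => 'w::fin_dim_banach"
  assumes alpha: "1 / 3 < \<alpha>" "\<alpha> \<le> 1 / 2"
    and X: "geometric_rough_path T \<alpha> X XX"
    and b: "bounded_process M T b" "progressive F T b"
    and \<sigma>: "bounded_process M T \<sigma>" "progressive F T \<sigma>"
    and n: "4 < n"
    and beta: "0 < \<beta>'" "\<beta>' \<le> \<beta>" "\<beta> \<le> \<alpha>"
    and exponents: "\<alpha> + \<beta> > 1 / 2" "\<alpha> + \<beta> + \<beta>' > 1"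
    and Y'_moments: "(SUP t\<in>{0..T}. Lnorm M n (\<lambda>w. ennreal (norm (Y' t w)))) < \<infinity>"
    and Y'_controlled: "ext_stoch_controlled M F T X \<beta> \<beta>' 4 n Y' Y''"
    and Y: "rough_ito_process M F T B X XX b \<sigma> Y' Y'' Y"
  obtains c I W where "rough_ito_expansion M F T B \<alpha> \<beta> \<beta>' c X XX b \<sigma> I Y Y' Y'' W"
proof -
  obtain I J where IJ: "has_ito_integral M F T B \<sigma> I" "has_stoch_rough_integral M T X XX Y' Y'' J"
    and Yae: "AE w in M. \<forall>t\<in>{0..T}. Y t w = Y 0 w + (LINT s:{0..t}|lborel. b s w) + I t w + J t w"
    and Yc: "continuous_process M T Y" "adapted F T Y"
    using Y unfolding rough_ito_process_def by blast
  obtain c1 where c1: "\<And>t w. t \<in> {0..T} ==> w \<in> space M ==> norm (b t w) \<le> c1" using b(1) unfolding bounded_process_def by blast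
  obtain c2 where c2: "\<And>t w. t \<in> {0..T} ==> w \<in> space M ==> norm (\<sigma> t w) \<le> c2" using \<sigma>(1) unfolding bounded_process_def by blast
  have rp: "rough_path T \<alpha> X XX" using X by (simp add: geometric_rough_path_def)
  obtain c3 c4 where "\<forall>(s, t)\<in>time_pairs T. norm (X t - X s) \<le> c3 * (t - s) powr \<alpha>"
    "\<forall>(s, t)\<in>time_pairs T. norm (XX s t) \<le> c4 * (t - s) powr (2 * \<alpha>)"
    using rp unfolding rough_path_def by blast
  then have c3: "norm (X t - X s) \<le> c3 * (t - s) powr \<alpha>" and c4: "norm (XX s t) \<le> c4 * (t - s) powr (2 * \<alpha>)"
    if "0 \<le> s" "s < t" "t \<le> T" for s t
    using that by (auto simp: time_pairs_def)
  have chen: "\<And>s u t. 0 \<le> s ==> s \<le> u ==> u \<le> t ==> t \<le> T ==> XX s t - XX s u - XX u t = (X u - X s) \<otimes> (X t - X u)"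
    using rp unfolding rough_path_def by auto
  obtain c5 R D where c5: "c5 > 0"
    "\<And>t. t \<in> {0..T} ==> sq_int M (\<lambda>w. (norm (Y' t w))\<^sup>2) \<and> l2 M (\<lambda>w. (norm (Y' t w))\<^sup>2) \<le> c5\<^sup>2"
    "\<And>t. t \<in> {0..T} ==> sq_int M (Y'' t) \<and> l2 M (Y'' t) \<le> c5"
    "\<And>s t. 0 \<le> s ==> s < t ==> t \<le> T ==> l2 M (\<lambda>w. Y' t w - Y' s w) \<le> c5 * (t - s) powr \<beta>"
    "\<And>s t. 0 \<le> s ==> s < t ==> t \<le> T ==>
      has_cond_exp M (F s) (\<lambda>w. Y' t w - Y' s w - Y'' s w (X t - X s)) (R s t) \<and>
      sq_int M (R s t) \<and> l2 M (R s t) \<le> c5 * (t - s) powr (\<beta> + \<beta>')"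
    "\<And>s t. 0 \<le> s ==> s < t ==> t \<le> T ==> has_cond_exp M (F s) (\<lambda>w. Y'' t w - Y'' s w) (D s t) \<and>
      sq_int M (D s t) \<and> l2 M (D s t) \<le> c5 * (t - s) powr \<beta>'"
    by (rule controlled_bounds[OF n Y'_controlled Y'_moments]) (rule that)
  have pr: "progressive F T Y'" "progressive F T Y''" using Y'_controlled by (auto simp: ext_stoch_controlled_def)
  note ad = progressive_adapted[OF pr(1)] progressive_adapted[OF pr(2)]
  have Y'sq: "sq_int M (Y' t)" if "t \<in> {0..T}" for t
    using l2_of_l2_square(1)[OF measurable_F_M[OF that ad(1)[OF that]], of c5] c5(1,2) that by auto
  define cX where "cX = \<bar>c3\<bar> + \<bar>c4\<bar> + 1"
  have cX: "0 < cX" "c3 \<le> cX" "c4 \<le> cX" by (auto simp: cX_def)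
  have X1: "norm (X t - X s) \<le> cX * (t - s) powr \<alpha>" and X2: "norm (XX s t) \<le> cX * (t - s) powr (2 * \<alpha>)"
    if "0 \<le> s" "s < t" "t \<le> T" for s t
    using order_trans[OF c3[OF that] mult_right_mono[OF cX(2)]] order_trans[OF c4[OF that] mult_right_mono[OF cX(3)]] by auto
  obtain c6 where c6: "c6 > 0" "\<And>s t V. 0 \<le> s ==> s < t ==> t \<le> T ==> V \<in> borel_measurable M ==>
      AE w in M. J t w - J s w = V w ==>
      sq_int M (\<lambda>w. V w - (Y' s w (X t - X s) + tensor_lift (Y'' s w) (XX s t))) \<and>
      l2 M (\<lambda>w. V w - (Y' s w (X t - X s) + tensor_lift (Y'' s w) (XX s t))) \<le> c6 * (t - s) powr (\<alpha> + \<beta>)"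
    and c6': "\<And>s t V \<Lambda> K. 0 \<le> s ==> s < t ==> t \<le> T ==> V \<in> borel_measurable M ==>
      AE w in M. J t w - J s w = V w ==> \<Lambda> \<in> borel_measurable (F s) ==> (\<And>w. norm (\<Lambda> w :: 'w \<Rightarrow>\<^sub>L real) \<le> K) ==>
      \<bar>\<integral>w. \<Lambda> w (V w - (Y' s w (X t - X s) + tensor_lift (Y'' s w) (XX s t))) \<partial>M\<bar>
        \<le> K * (c6 * (t - s) powr (\<alpha> + \<beta> + \<beta>'))"
  proof (rule rough_remainder[where Z=Y' and Z'=Y'' and X=X and XX=XX and CX=cX and \<alpha>=\<alpha> and \<beta>=\<beta> and \<beta>'=\<beta>' and c=c5 and R=R and D=D and J=J])
    fix C assume a: "0 < C" "\<And>s t V. 0 \<le> s ==> s < t ==> t \<le> T ==> V \<in> borel_measurable M ==>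
      AE w in M. J t w - J s w = V w ==>
      sq_int M (\<lambda>w. V w - (Y' s w (X t - X s) + tensor_lift (Y'' s w) (XX s t))) \<and>
      l2 M (\<lambda>w. V w - (Y' s w (X t - X s) + tensor_lift (Y'' s w) (XX s t))) \<le> C * (t - s) powr (\<alpha> + \<beta>)"
      "\<And>s t V \<Lambda> K. 0 \<le> s ==> s < t ==> t \<le> T ==> V \<in> borel_measurable M ==>
      AE w in M. J t w - J s w = V w ==> \<Lambda> \<in> borel_measurable (F s) ==> (\<And>w. norm (\<Lambda> w :: 'w \<Rightarrow>\<^sub>L real) \<le> K) ==>
      \<bar>\<integral>w. \<Lambda> w (V w - (Y' s w (X t - X s) + tensor_lift (Y'' s w) (XX s t))) \<partial>M\<bar>
        \<le> K * (C * (t - s) powr (\<alpha> + \<beta> + \<beta>'))"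
    show thesis by (rule that[OF a])
  qed (rule X1 X2 chen cX(1) beta exponents ad c5 Y'sq IJ(2); assumption)+
  define c where "c = \<bar>c1\<bar> + \<bar>c2\<bar> + cX + c5 + c6"
  have cc: "0 < c" "c1 \<le> c" "c2 \<le> c" "cX \<le> c" "c5 \<le> c" "c6 \<le> c" using cX c5(1) c6(1) by (auto simp: c_def)
  define V where "V s t w = Y t w - Y s w - (LINT r:{s..t}|lborel. b r w) - (I t w - I s w)" for s t w
  define W where "W s t w = V s t w - (Y' s w (X t - X s) + tensor_lift (Y'' s w) (XX s t))" for s t w
  have bb: "norm (b t w) \<le> c" if "t \<in> {0..T}" "w \<in> space M" for t w using c1[OF that] cc by linarith
  have Ym: "Y t \<in> borel_measurable M" if "t \<in> {0..T}" for t
    using Yc(2) that measurable_F_M[OF that] unfolding adapted_def by blast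
  have Im: "I t \<in> borel_measurable M" if "t \<in> {0..T}" for t
    using IJ(1) that measurable_F_M[OF that] unfolding has_ito_integral_def adapted_def by blast
  have Vm: "V s t \<in> borel_measurable M" and Vae: "AE w in M. J t w - J s w = V s t w"
    if st: "0 \<le> s" "s < t" "t \<le> T" for s t
  proof -
    have s: "s \<in> {0..T}" "t \<in> {0..T}" using st by auto
    have [measurable]: "(\<lambda>w. LINT r:{s..t}|lborel. b r w) \<in> borel_measurable M"
      by (rule time_integral_bounded(2)[OF progressive_joint[OF b(2)] bb less_imp_le[OF cc(1)] st(1) less_imp_le[OF st(2)] st(3)])
    note [measurable] = Ym[OF s(1)] Ym[OF s(2)] Im[OF s(1)] Im[OF s(2)]
    show "V s t \<in> borel_measurable M" unfolding V_def[abs_def] by measurable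
    show "AE w in M. J t w - J s w = V s t w"
      using Yae AE_space
    proof eventually_elim
      case (elim w)
      have "set_integrable lborel {0..t} (\<lambda>r. b r w)"
        by (rule time_integral_bounded(1)[OF progressive_joint[OF b(2)] bb less_imp_le[OF cc(1)] order_refl _ st(3) elim(2)]) (use st in auto)
      from set_integral_split[OF this st(1) less_imp_le[OF st(2)]] show ?case
        using elim(1)[rule_format, OF s(1)] elim(1)[rule_format, OF s(2)] unfolding V_def by (simp add: algebra_simps)
    qed
  qed
  have up: "x \<le> c * p" if "x \<le> c' * p" "c' \<le> c" "0 \<le> p" for x c' p :: real
    using that mult_right_mono[of c' c p] by linarith
  have "rough_ito_expansion M F T B \<alpha> \<beta> \<beta>' c X XX b \<sigma> I Y Y' Y'' W"
  proof (unfold_locales)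
    fix s t assume st: "0 \<le> s" "s < t" "t \<le> T"
    show "norm (X t - X s) \<le> c * (t - s) powr \<alpha>" by (rule up[OF X1[OF st] cc(4)]) simp
    show "norm (XX s t) \<le> c * (t - s) powr (2 * \<alpha>)" by (rule up[OF X2[OF st] cc(4)]) simp
    note w = c6(2)[OF st Vm[OF st] Vae[OF st], folded W_def]
    show "sq_int M (W s t) \<and> l2 M (W s t) \<le> c * (t - s) powr (\<alpha> + \<beta>)"
      using w up[OF w[THEN conjunct2] cc(6)] by simp
    show "Y t w = Y s w + ((I t w - I s w + Y' s w (X t - X s))
        + ((LINT r:{s..t}|lborel. b r w) + tensor_lift (Y'' s w) (XX s t) + W s t w))" for w
      unfolding W_def V_def by simp
    show "\<bar>\<integral>w. \<Lambda> w (W s t w) \<partial>M\<bar> \<le> K * (c * (t - s) powr (\<alpha> + \<beta> + \<beta>'))"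
      if "\<Lambda> \<in> borel_measurable (F s)" "\<And>w. norm (\<Lambda> w :: 'w \<Rightarrow>\<^sub>L real) \<le> K" for \<Lambda> K
    proof -
      have K: "0 \<le> K" using order_trans[OF norm_ge_zero that(2)] .
      have "c6 * (t - s) powr (\<alpha> + \<beta> + \<beta>') \<le> c * (t - s) powr (\<alpha> + \<beta> + \<beta>')" using cc(6) by (intro mult_right_mono) auto
      then have "K * (c6 * (t - s) powr (\<alpha> + \<beta> + \<beta>')) \<le> K * (c * (t - s) powr (\<alpha> + \<beta> + \<beta>'))" using K by (rule mult_left_mono)
      with c6'[OF st Vm[OF st] Vae[OF st] that, folded W_def] show ?thesis by linarith
    qed
  next
    fix t assume t: "t \<in> {0..T}"
    show "norm (\<sigma> t w) \<le> c" if "w \<in> space M" for w using c2[OF t that] cc by linarith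
    have "c5\<^sup>2 \<le> c\<^sup>2" using cc(5) c5(1) by (intro power_mono) auto
    then show "sq_int M (\<lambda>w. (norm (Y' t w))\<^sup>2) \<and> l2 M (\<lambda>w. (norm (Y' t w))\<^sup>2) \<le> c\<^sup>2" using c5(2)[OF t] by linarith
    show "sq_int M (Y'' t) \<and> l2 M (Y'' t) \<le> c" using c5(3)[OF t] cc(5) by linarith
  qed (rule alpha beta exponents(2) X b(2) \<sigma>(2) IJ(1) Yc cc(1) bb ad(1); assumption)+
  then show thesis by (rule that)
qed

context rough_ito_expansion
begin

text \<open>The increments of \<open>E \<phi>(Y\<^sub>t)\<close> minus the integrated generator satisfy the bound of
  \<open>has_rough_integral_germ\<close>, and conditioning on \<open>Y\<^sub>t\<close> rewrites all expectations as integrals of the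
  effective coefficients against the law of \<open>Y\<^sub>t\<close>.\<close>

lemma weak_forward_equation:
  fixes bbar :: "real => 'w => 'w" and abar :: "real => 'w => 'w tensor2"
  assumes \<gamma>: "1 / \<alpha> < \<gamma>" "\<gamma> \<le> 3"
    and bbar: "\<forall>t\<in>{0..T}. cond_exp_given M (b t) (Y t) (bbar t)"
    and abar: "\<forall>t\<in>{0..T}. cond_exp_given M (\<lambda>w. diffusion (\<sigma> t w)) (Y t) (abar t)"
    and Tbar: "\<forall>t\<in>{0..T}. \<forall>\<phi>\<in>Cb \<gamma>.
      cond_exp_given M (\<lambda>w. transport_op (Y' t w) \<phi> (Y t w)) (Y t) (Tbar t \<phi>)"
    and Tbar': "\<forall>t\<in>{0..T}. \<forall>\<phi>\<in>Cb \<gamma>.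
      cond_exp_given M (\<lambda>w. transport_op' (Y' t w) (Y'' t w) \<phi> (Y t w)) (Y t) (Tbar' t \<phi>)"
  shows "weak_rough_forward_solution T \<gamma> X XX (generator bbar abar) Tbar Tbar'
    (\<lambda>t. distr M borel (Y t)) (distr M borel (Y 0))"
  unfolding weak_rough_forward_solution_def
proof (intro conjI ballI)
  show "distr M borel (Y 0) = distr M borel (Y 0)" ..
  show "prob_space (distr M borel (Y t))" if "t \<in> {0..T}" for t by (rule prob_space_distr[OF Y_measurable(2)[OF that]])
  show "sets (distr M borel (Y t)) = sets borel" for t by simp
  have "2 \<le> 1 / \<alpha>" using exps by (simp add: field_simps)
  then have \<gamma>2: "2 < \<gamma>" using \<gamma> by linarith
  fix \<phi> :: "'w => real" assume \<phi>: "\<phi> \<in> Cb \<gamma>"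
  let ?\<mu> = "\<lambda>t. distr M borel (Y t)"
  obtain C\<phi> where C\<phi>: "C\<phi> > 0" "\<And>y. \<bar>\<phi> y\<bar> \<le> C\<phi>" "\<And>y. norm (Dfun \<phi> y) \<le> C\<phi>" "\<And>y. norm (Dfun (Dfun \<phi>) y) \<le> C\<phi>"
    by (rule Cb_bounds[OF \<phi>]) (rule that)
  note cont = Cb_continuous[OF \<phi> \<gamma>2]
  note meas = cont[THEN borel_measurable_continuous_onI]
  obtain KH where KH: "0 < KH" "\<And>K :: 'w \<Rightarrow>\<^sub>L 'w \<Rightarrow>\<^sub>L real. norm (lift_blinfun K) \<le> norm K * KH"
    using bounded_linear.pos_bounded[OF bounded_linear_lift_blinfun] by blast
  define H where "H y = lift_blinfun (Dfun (Dfun \<phi>) y)" for y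
  have Happ: "H y A = tensor_lift (Dfun (Dfun \<phi>) y) A" for y A
    unfolding H_def by (rule lift_blinfun_apply)
  have Hm: "H \<in> borel_measurable borel"
    unfolding H_def[abs_def] by (rule borel_measurable_bounded_linear[OF bounded_linear_lift_blinfun meas(3)])
  have Hb: "norm (H y) \<le> C\<phi> * KH" for y
    unfolding H_def by (rule order_trans[OF KH(2) mult_right_mono[OF C\<phi>(4)]]) (use KH in simp)
  define drift1 where "drift1 r = (\<integral>w. Dfun \<phi> (Y r w) (b r w) \<partial>M)" for r
  define drift2 where "drift2 r = (\<integral>w. tensor_lift (Dfun (Dfun \<phi>) (Y r w)) (diffusion (\<sigma> r w)) \<partial>M)" for r
  define m where "m t = (\<integral>w. \<phi> (Y t w) \<partial>M)" for t
  note T1 = cond_exp_given_distr[OF Tbar[rule_format, OF _ \<phi>] Y_measurable(2)]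
  note T2 = cond_exp_given_distr[OF Tbar'[rule_format, OF _ \<phi>] Y_measurable(2)]
  have gen: "integrable (?\<mu> s) (generator bbar abar s \<phi>)"
      "(\<integral>y. generator bbar abar s \<phi> y \<partial>?\<mu> s) = drift1 s + 1/2 * drift2 s" if s: "s \<in> {0..T}" for s
  proof -
    note g1 = cond_exp_given_blinfun[OF bbar[rule_format, OF s] Y_measurable(2)[OF s] meas(2) C\<phi>(3)]
    note g2 = cond_exp_given_blinfun[OF abar[rule_format, OF s] Y_measurable(2)[OF s] Hm Hb, unfolded Happ]
    show "integrable (?\<mu> s) (generator bbar abar s \<phi>)"
      unfolding generator_def[abs_def] using g1(1) g2(1) by simp
    show "(\<integral>y. generator bbar abar s \<phi> y \<partial>?\<mu> s) = drift1 s + 1/2 * drift2 s"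
      unfolding generator_def[abs_def] using g1(1,2) g2(1,2) by (simp add: drift1_def drift2_def)
  qed
  have \<phi>I: "integrable M (\<lambda>w. \<phi> (Y s w))" if "s \<in> {0..T}" for s
    by (rule integrable_const_bound[where B=C\<phi>]) (use C\<phi>(2) measurable_compose[OF Y_measurable(2)[OF that] meas(1)] in auto)
  show "integrable (?\<mu> s) \<phi>" if "s \<in> {0..T}" for s
    using \<phi>I[OF that] integrable_distr_eq[OF Y_measurable(2)[OF that] meas(1)] by simp
  have m: "(\<integral>y. \<phi> y \<partial>?\<mu> t) = m t" if "t \<in> {0..T}" for t
    unfolding m_def by (rule integral_distr[OF Y_measurable(2)[OF that] meas(1)])
  show "integrable (?\<mu> s) (generator bbar abar s \<phi>)" if "s \<in> {0..T}" for s by (rule gen(1)[OF that])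
  show "integrable (?\<mu> s) (Tbar s \<phi>)" if "s \<in> {0..T}" for s by (rule T1(2)[OF that that])
  show "integrable (?\<mu> s) (Tbar' s \<phi>)" if "s \<in> {0..T}" for s by (rule T2(2)[OF that that])
  obtain C \<theta> where C: "C \<ge> 0" "\<theta> > 1"
    and dens: "set_integrable lborel {0..T} (\<lambda>r. \<integral>w. Dfun \<phi> (Y r w) (b r w) \<partial>M)"
    "set_integrable lborel {0..T} (\<lambda>r. \<integral>w. tensor_lift (Dfun (Dfun \<phi>) (Y r w)) (diffusion (\<sigma> r w)) \<partial>M)"
    and germ: "\<And>s t. 0 \<le> s ==> s < t ==> t \<le> T ==>
      \<bar>(\<integral>w. \<phi> (Y t w) \<partial>M) - (\<integral>w. \<phi> (Y s w) \<partial>M)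
        - (LINT r:{s..t}|lborel. (\<integral>w. Dfun \<phi> (Y r w) (b r w) \<partial>M))
        - 1/2 * (LINT r:{s..t}|lborel. (\<integral>w. tensor_lift (Dfun (Dfun \<phi>) (Y r w)) (diffusion (\<sigma> r w)) \<partial>M))
        - ((\<integral>w. transport_op (Y' s w) \<phi> (Y s w) \<partial>M) (X t - X s)
          + tensor_lift (\<integral>w. transport_op' (Y' s w) (Y'' s w) \<phi> (Y s w) \<partial>M) (XX s t))\<bar>
      \<le> C * (t - s) powr \<theta>"
  proof (rule local_expansion[OF \<phi> \<gamma>])
    show "integrable M (\<lambda>w. transport_op (Y' s w) \<phi> (Y s w))" if "s \<in> {0..T}" for s by (rule T1(1)[OF that that])
    show "integrable M (\<lambda>w. transport_op' (Y' s w) (Y'' s w) \<phi> (Y s w))" if "s \<in> {0..T}" for s by (rule T2(1)[OF that that])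
  qed (rule that)
  note dens = dens[folded drift1_def drift2_def]
  define drift where "drift r = drift1 r + 1/2 * drift2 r" for r
  have driftI: "set_integrable lborel {0..T} drift"
    unfolding drift_def using dens by (intro set_integral_add(1) set_integrable_mult_right) auto
  have driftI': "set_integrable lborel {s..t} drift" and drifts: "(LINT r:{s..t}|lborel. drift r) = (LINT r:{s..t}|lborel. drift1 r) + 1/2 * (LINT r:{s..t}|lborel. drift2 r)"
    if "0 \<le> s" "t \<le> T" for s t
  proof -
    have sub: "{s..t} \<subseteq> {0..T}" using that by auto
    show "set_integrable lborel {s..t} drift" by (rule set_integrable_subset[OF driftI _ sub]) simp
    have i: "set_integrable lborel {s..t} drift1" "set_integrable lborel {s..t} (\<lambda>r. 1/2 * drift2 r)"
      using set_integrable_subset[OF dens(1) _ sub] set_integrable_mult_right[OF set_integrable_subset[OF dens(2) _ sub], of "1/2"] by auto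
    show "(LINT r:{s..t}|lborel. drift r) = (LINT r:{s..t}|lborel. drift1 r) + 1/2 * (LINT r:{s..t}|lborel. drift2 r)"
      unfolding drift_def using set_integral_add(2)[OF i] by simp
  qed
  have drifteq: "(\<integral>y. generator bbar abar s \<phi> y \<partial>?\<mu> s) = drift s" if "s \<in> {0..T}" for s using gen(2)[OF that] by (simp add: drift_def)
  show "set_integrable lborel {0..T} (\<lambda>s. \<integral>y. generator bbar abar s \<phi> y \<partial>?\<mu> s)"
  proof -
    have e: "indicator {0..T} s *\<^sub>R (\<integral>y. generator bbar abar s \<phi> y \<partial>?\<mu> s) = indicator {0..T} s *\<^sub>R drift s" for s
      using drifteq[of s] by (auto simp: indicator_def)
    show ?thesis using driftI unfolding set_integrable_def e .
  qed
  define J where "J t = m t - m 0 - (LINT r:{0..t}|lborel. drift r)" for t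
  have Jc: "continuous_on {0..T} J"
  proof -
    have "continuous_on {0..T} m" unfolding m_def
      by (rule expectation_continuous[OF Y_measurable(2) Y(2) cont(1) C\<phi>(2)])
    moreover have "continuous_on {0..T} (\<lambda>t. LINT r:{0..t}|lborel. drift r)"
    proof -
      have eq: "(LINT r:{0..t}|lborel. drift r) = integral {0..t} drift" if "t \<in> {0..T}" for t
        by (rule set_borel_integral_eq_integral(2)[OF driftI']) (use that in auto)
      have "continuous_on {0..T} (\<lambda>t. integral {0..t} drift)"
        by (rule indefinite_integral_continuous_1[OF set_borel_integral_eq_integral(1)[OF driftI]])
      then show ?thesis by (rule continuous_on_eq) (simp only: eq)
    qed
    ultimately show ?thesis unfolding J_def by (intro continuous_intros)
  qed
  have J0: "J 0 = 0"
  proof -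
    have "AE r in lborel. indicator {0..0} r *\<^sub>R drift r = 0"
      using AE_lborel_singleton[of "0::real"] by eventually_elim (auto simp: indicator_def)
    then have "(LINT r:{0..0}|lborel. drift r) = 0" unfolding set_lebesgue_integral_def by (rule integral_eq_zero_AE)
    then show ?thesis by (simp add: J_def)
  qed
  have rough: "has_rough_integral T X XX (\<lambda>s. \<integral>y. Tbar s \<phi> y \<partial>?\<mu> s) (\<lambda>s. \<integral>y. Tbar' s \<phi> y \<partial>?\<mu> s) J"
  proof (rule has_rough_integral_germ[OF T_pos Jc J0 C(2,1)])
    fix u v assume uv: "0 \<le> u" "u < v" "v \<le> T"
    have u: "u \<in> {0..T}" using uv by auto
    have "(LINT r:{0..v}|lborel. drift r) = (LINT r:{0..u}|lborel. drift r) + (LINT r:{u..v}|lborel. drift r)"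
      by (rule set_integral_split[OF driftI']) (use uv in auto)
    then have "J v - J u = m v - m u - (LINT r:{u..v}|lborel. drift1 r) - 1/2 * (LINT r:{u..v}|lborel. drift2 r)"
      unfolding J_def using drifts[OF uv(1,3)] by simp
    then show "norm (J v - J u - ((\<integral>y. Tbar u \<phi> y \<partial>?\<mu> u) (X v - X u) + tensor_lift (\<integral>y. Tbar' u \<phi> y \<partial>?\<mu> u) (XX u v)))
        \<le> C * (v - u) powr \<theta>"
      unfolding T1(3)[OF u u] T2(3)[OF u u] using germ[OF uv] by (simp only: m_def drift1_def drift2_def real_norm_def)
  qed
  show "\<exists>J. has_rough_integral T X XX (\<lambda>s. \<integral>y. Tbar s \<phi> y \<partial>?\<mu> s) (\<lambda>s. \<integral>y. Tbar' s \<phi> y \<partial>?\<mu> s) J \<and>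
      (\<forall>t\<in>{0..T}. (\<integral>y. \<phi> y \<partial>?\<mu> t) =
         (\<integral>y. \<phi> y \<partial>?\<mu> 0) + (LINT s:{0..t}|lborel. (\<integral>y. generator bbar abar s \<phi> y \<partial>?\<mu> s)) + J t)"
  proof (intro exI[of _ J] conjI rough ballI)
    fix t assume t: "t \<in> {0..T}"
    have "(LINT s:{0..t}|lborel. (\<integral>y. generator bbar abar s \<phi> y \<partial>?\<mu> s)) = (LINT r:{0..t}|lborel. drift r)"
      by (rule set_lebesgue_integral_cong) (use t drifteq in auto)
    then show "(\<integral>y. \<phi> y \<partial>?\<mu> t) = (\<integral>y. \<phi> y \<partial>?\<mu> 0) + (LINT s:{0..t}|lborel. (\<integral>y. generator bbar abar s \<phi> y \<partial>?\<mu> s)) + J t"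
      using m[OF t] m[of 0] T_pos by (simp add: J_def)
  qed
qed

end

theorem theorem4p14:
  fixes M :: "'o measure" and F :: "real \<Rightarrow> 'o measure"
    and T \<alpha> \<beta> \<beta>' \<gamma> :: real and n :: ereal
    and B :: "real \<Rightarrow> 'o \<Rightarrow> 'u::euclidean_space"
    and X :: "real \<Rightarrow> 'v::fin_dim_banach" and XX :: "real \<Rightarrow> real \<Rightarrow> 'v tensor2"
    and b :: "real \<Rightarrow> 'o \<Rightarrow> 'w::fin_dim_banach" and \<sigma> :: "real \<Rightarrow> 'o \<Rightarrow> ('u \<Rightarrow>\<^sub>L 'w)"
    and Y :: "real \<Rightarrow> 'o \<Rightarrow> 'w" and Y' :: "real \<Rightarrow> 'o \<Rightarrow> ('v \<Rightarrow>\<^sub>L 'w)"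
    and Y'' :: "real \<Rightarrow> 'o \<Rightarrow> ('v \<Rightarrow>\<^sub>L ('v \<Rightarrow>\<^sub>L 'w))"
    and bbar :: "real \<Rightarrow> 'w \<Rightarrow> 'w" and abar :: "real \<Rightarrow> 'w \<Rightarrow> 'w tensor2"
    and Tbar :: "real \<Rightarrow> ('w \<Rightarrow> real) \<Rightarrow> 'w \<Rightarrow> ('v \<Rightarrow>\<^sub>L real)"
    and Tbar' :: "real \<Rightarrow> ('w \<Rightarrow> real) \<Rightarrow> 'w \<Rightarrow> ('v \<Rightarrow>\<^sub>L ('v \<Rightarrow>\<^sub>L real))"
  assumes T: "0 < T"
    and space: "filtered_prob_space M F T"
    and BM: "standard_brownian_motion M F T B"
    and alpha: "1 / 3 < \<alpha>" "\<alpha> \<le> 1 / 2"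
    and X: "geometric_rough_path T \<alpha> X XX"
    and b: "bounded_process M T b" "progressive F T b"
    and \<sigma>: "bounded_process M T \<sigma>" "progressive F T \<sigma>"
    and gamma: "1 / \<alpha> < \<gamma>" "\<gamma> \<le> 3"
    and n: "4 < n"
    and beta: "0 < \<beta>'" "\<beta>' \<le> \<beta>" "\<beta> \<le> \<alpha>"
    and exponents: "\<alpha> + \<beta> > 1 / 2"
      "ereal (\<alpha> + \<beta>) + Min {ereal (\<alpha> * (\<gamma> - 2)), ereal \<alpha> * (n / 4 - 1), ereal \<beta>'} > 1"
    and Y'_moments: "(SUP t\<in>{0..T}. Lnorm M n (\<lambda>w. ennreal (norm (Y' t w)))) < \<infinity>"
    and Y'_controlled: "ext_stoch_controlled M F T X \<beta> \<beta>' 4 n Y' Y''"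
    and Y: "rough_ito_process M F T B X XX b \<sigma> Y' Y'' Y"
    and bbar_measurable:
      "(\<lambda>(t, y). bbar t y) \<in> borel_measurable (restrict_space borel {0..T} \<Otimes>\<^sub>M borel)"
    and bbar: "\<forall>t\<in>{0..T}. cond_exp_given M (b t) (Y t) (bbar t)"
    and abar_measurable:
      "(\<lambda>(t, y). abar t y) \<in> borel_measurable (restrict_space borel {0..T} \<Otimes>\<^sub>M borel)"
    and abar: "\<forall>t\<in>{0..T}. cond_exp_given M (\<lambda>w. diffusion (\<sigma> t w)) (Y t) (abar t)"
    and Tbar: "\<forall>t\<in>{0..T}. \<forall>\<phi>\<in>Cb \<gamma>.
      cond_exp_given M (\<lambda>w. transport_op (Y' t w) \<phi> (Y t w)) (Y t) (Tbar t \<phi>)"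
    and Tbar': "\<forall>t\<in>{0..T}. \<forall>\<phi>\<in>Cb \<gamma>.
      cond_exp_given M (\<lambda>w. transport_op' (Y' t w) (Y'' t w) \<phi> (Y t w)) (Y t) (Tbar' t \<phi>)"
  shows "weak_rough_forward_solution T \<gamma> X XX (generator bbar abar) Tbar Tbar'
    (\<lambda>t. distr M borel (Y t)) (distr M borel (Y 0))"
proof -
  interpret prob_space M using space by (simp add: filtered_prob_space_def)
  interpret brownian_space M F T B
    by unfold_locales (use space BM T in \<open>auto simp: filtered_prob_space_def\<close>)
  have "Min {ereal (\<alpha> * (\<gamma> - 2)), ereal \<alpha> * (n / 4 - 1), ereal \<beta>'} \<le> ereal \<beta>'" by (rule Min_le) auto
  then have "ereal (\<alpha> + \<beta>) + Min {ereal (\<alpha> * (\<gamma> - 2)), ereal \<alpha> * (n / 4 - 1), ereal \<beta>'} \<le> ereal (\<alpha> + \<beta>) + ereal \<beta>'"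
    by (rule add_left_mono)
  with exponents(2) have "1 < ereal (\<alpha> + \<beta>) + ereal \<beta>'" by (rule less_le_trans)
  then have "1 < \<alpha> + \<beta> + \<beta>'" by (simp add: one_ereal_def)
  then obtain c I W where "rough_ito_expansion M F T B \<alpha> \<beta> \<beta>' c X XX b \<sigma> I Y Y' Y'' W"
    using rough_ito_process_expansion[OF alpha X b \<sigma> n beta exponents(1) _ Y'_moments Y'_controlled Y] by blast
  from rough_ito_expansion.weak_forward_equation[OF this gamma bbar abar Tbar Tbar'] show ?thesis .
qed

end
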